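(* Let $\sigma_\bullet$ be a numerical quasi-convergent path in $\mathrm{Stab}_\Lambda(\mathcal C)$ with set of limit semistable objects $\mathcal P$. For $E\in\mathcal P$ let $\sigma_E=(Z_E,\mathcal P_E)$ be the induced pre-stability condition on $\mathcal C_{\preceq E}/\mathcal C_{\prec E}$, and let $\Lambda_E$ be the torsion-free part of $v(\mathcal C_{\preceq E})/v(\mathcal C_{\prec E})$ (its quotient by torsion). Then: (1) for each $E\in\mathcal P$, the central charge $Z_E$ factors through $\Lambda_E$; and (2) $\sigma_\bullet$ satisfies the support property for paths if and only if, for every $E\in\mathcal P$, $\sigma_E$ satisfies the support property with respect to $\Lambda_E$.
   Context: Conventions. $\mathcal C$ is a pre-triangulated dg-category over a field $k$ (one may work with its homotopy category, a triangulated category); Hom, $K_0$, exact triangles and stability conditions refer to the homotopy category. Fix a surjective homomorphism $v:K_0(\mathcal C)\to\Lambda$ onto a free abelian group of finite rank. For a triangulated subcategory $\mathcal D\subset\mathcal C$, $v(\mathcal D)\subset\Lambda$ is the subgroup of classes $v(X)$, $X\in\mathcal D$. Stability conditions. A slicing $\mathcal Q$ on a triangulated category $\mathcal D$ is a family of full additive subcategories $\mathcal Q(\phi)$, $\phi\in\mathbb R$, with $\mathcal Q(\phi)[1]=\mathcal Q(\phi+1)$, $\operatorname{Hom}(\mathcal Q(\phi_1),\mathcal Q(\phi_2))=0$ for $\phi_1>\phi_2$, and such that every nonzero $E\in\mathcal D$ has a Harder–Narasimhan (HN) filtration $0=E_0\to E_1\to\cdots\to E_n=E$ with HN factors $0\neq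 F_i=\mathrm{Cone}(E_{i-1}\to E_i)\in\mathcal Q(\phi_i)$, $\phi_1>\cdots>\phi_n$. Nonzero objects of $\mathcal Q(\phi)$ are semistable of phase $\phi$. A pre-stability condition is a pair $(Z,\mathcal Q)$ with $\mathcal Q$ a slicing and $Z:K_0(\mathcal D)\to\mathbb C$ a homomorphism such that $Z(E)\in\mathbb R_{>0}e^{i\pi\phi}$ for $0\ne E\in\mathcal Q(\phi)$. If $Z$ factors through a homomorphism $w:K_0(\mathcal D)\to\Lambda'$ to a free abelian group of finite rank, $(Z,\mathcal Q)$ satisfies the support property with respect to $\Lambda'$ if there is $c>0$ with $|Z(E)|\ge c\|w(E)\|$ for all semistable $E$, for some (equivalently any) norm on $\Lambda'\otimes\mathbb R$. $\mathrm{Stab}_\Lambda(\mathcal C)$ is the space, with Bridgeland's topology, of pre-stability conditions on $\mathcal C$ with central charge factoring through $v$ and satisfying the support property with respect to $\Lambda$. For $\sigma=(Z,\mathcal Q)$ and $E\neq 0$ with HN factors $F_1,\dots,F_n$ of phases $\phi_1>\dots>\phi_n$: $\phi^+_\sigma(E)=\phi_1$, $\phi^-_\sigma(E)=\phi_n$, $m_\sigma(E)=\sum_i|Z(F_i)|$, $\phi_\sigma(E)=\frac1{m_\sigma(E)}\sum_i\phi_i|Z(F_i)|$, $\ell_\sigma(E)=\log m_\sigma(E)+i\pi\phi_\sigma(E)$, and $\ell_\sigma(E/F)=\ell_\sigma(E)-\ell_\sigma(F)$. Quasi-convergent paths. Let $\sigma_\bullet$ be a continuous path $[a,\infty)\to\mathrm{Stab}_\Lambda(\mathcal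 C)$, $\sigma_t=(Z_t,\mathcal P_t)$; a subscript $t$ replaces $\sigma_t$ in the functions above. A nonzero object $E$ is limit semistable if $\lim_{t\to\infty}\phi_t^+(E)-\phi_t^-(E)=0$; $\mathcal P$ is the collection of limit semistable objects. The path is quasi-convergent if (i) every $E\in\mathcal C$ has a limit HN filtration: $0=E_0\to\cdots\to E_n=E$ with $G_i=\mathrm{Cone}(E_{i-1}\to E_i)$ limit semistable and $\liminf_{t\to\infty}\phi_t(G_i)-\phi_t(G_{i+1})>0$ for all $i$ (the limit HN factors $G_i$ are unique up to isomorphism); and (ii) for all $E,F\in\mathcal P$, $\lim_{t\to\infty}\frac{\ell_t(E/F)}{1+|\ell_t(E/F)|}$ exists. Preorders. For $E,F\in\mathcal P$: $F\prec^{\mathrm i}E$ if $\lim_{t\to\infty}\phi_t(E)-\phi_t(F)=\infty$; $E\preceq^{\mathrm i}F$ is the negation of $F\prec^{\mathrm i}E$; $E\sim^{\mathrm i}F$ if $E\preceq^{\mathrm i}F$ and $F\preceq^{\mathrm i}E$; $F\prec E$ if either $F\prec^{\mathrm i}E$, or $E\sim^{\mathrm i}F$ and $\lim_{t\to\infty}\log\frac{m_t(E)}{m_t(F)}=\infty$; $E\preceq F$ is the negation of $F\prec E$; $E\sim F$ if $E\preceq F$ and $F\preceq E$. Subcategories. $\mathcal C_{\preceq E}$ (resp. $\mathcal C_{\prec E}$, $\mathcal C^E$) is the full subcategory of objects all of whose limit HN factors $A$ satisfy $A\preceq E$ (resp. $A\prec E$, $A\sim^{\mathrm i}E$). These are thick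 triangulated subcategories. Quotients are Drinfeld dg quotients (Verdier quotients on homotopy categories). Induced pre-stability conditions. For $E\in\mathcal P$, $\mathcal C_{\preceq E}/\mathcal C_{\prec E}$ carries a pre-stability condition $\sigma_E=(Z_E,\mathcal P_E)$, whose nonzero semistable objects of phase $\phi$ are the images of those $F\in\mathcal P$ with $F\sim E$ and $\lim_{t\to\infty}\phi_t(F)-\phi_t(E)=\phi$, and with $Z_E(F)=\lim_{t\to\infty}Z_t(F)/Z_t(E)$ for such $F$. Numerical paths. $\sigma_\bullet$ is numerical if for any $E_1,\dots,E_n\in\mathcal P$ pairwise non-equivalent under $\sim^{\mathrm i}$, the subgroups $v(\mathcal C^{E_i})\subset\Lambda$ are linearly independent over $\mathbb Q$. Support property for paths. A numerical quasi-convergent path $\sigma_\bullet$ satisfies the support property if for every $E\in\mathcal P$ and some (equivalently any) norm $\|\cdot\|_E$ on $\Lambda_E\otimes\mathbb R$ there is $\epsilon_E>0$ such that $\lim_{t\to\infty}\frac{|Z_t(F)|}{|Z_t(E)|}\ge\epsilon_E\|v(F)\|_E$ for all $F\in\mathcal P$ with $F\sim E$, where $v(F)$ also denotes its class in $\Lambda_E$. *)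

theory Defs
  imports "HOL-Analysis.Analysis" "HOL-Algebra.Free_Abelian_Groups"
    "HOL-Algebra.Generated_Groups"
begin

section \<open>Triangulated categories\<close>

text \<open>
  A small category whose arrows know their source and target. The order of composition is the
  usual one: in g \<cdot> f the arrow f comes first. The field tri is the set of distinguished
  triangles; a triple (f, g, h) stands for X \<rightarrow> Y \<rightarrow> Z \<rightarrow> X[1], the objects being recovered
  as sources and targets. All Hom groups carry an action of the field 'k.
\<close>

record ('k, 'o, 'm) tcat =
  obj :: "'o set"
  arr :: "'m set"
  src :: "'m \<Rightarrow> 'o"
  trg :: "'m \<Rightarrow> 'o"
  idt :: "'o \<Rightarrow> 'm"
  cmp :: "'m \<Rightarrow> 'm \<Rightarrow> 'm"  (infixl "\<cdot>\<index>" 70)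
  padd :: "'m \<Rightarrow> 'm \<Rightarrow> 'm"  (infixl "\<boxplus>\<index>" 65)
  null :: "'o \<Rightarrow> 'o \<Rightarrow> 'm"
  scal :: "'k \<Rightarrow> 'm \<Rightarrow> 'm"
  sho :: "'o \<Rightarrow> 'o"
  sha :: "'m \<Rightarrow> 'm"
  tri :: "('m \<times> 'm \<times> 'm) set"

definition homset :: "('k, 'o, 'm) tcat \<Rightarrow> 'o \<Rightarrow> 'o \<Rightarrow> 'm set" where
  "homset C X Y = {f \<in> arr C. src C f = X \<and> trg C f = Y}"

definition is_isom :: "('k, 'o, 'm) tcat \<Rightarrow> 'm \<Rightarrow> bool" where
  "is_isom C f \<longleftrightarrow> f \<in> arr C \<and>
     (\<exists>g \<in> homset C (trg C f) (src C f).
        g \<cdot>\<^bsub>C\<^esub> f = idt C (src C f) \<and> f \<cdot>\<^bsub>C\<^esub> g = idt C (trg C f))"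

definition isomorphic :: "('k, 'o, 'm) tcat \<Rightarrow> 'o \<Rightarrow> 'o \<Rightarrow> bool" where
  "isomorphic C X Y \<longleftrightarrow> (\<exists>f \<in> homset C X Y. is_isom C f)"

definition zero_obj :: "('k, 'o, 'm) tcat \<Rightarrow> 'o \<Rightarrow> bool" where
  "zero_obj C X \<longleftrightarrow> X \<in> obj C \<and> idt C X = null C X X"

definition biproduct :: "('k, 'o, 'm) tcat \<Rightarrow> 'o \<Rightarrow> 'o \<Rightarrow> 'o \<Rightarrow> bool" where
  "biproduct C X Y B \<longleftrightarrow> B \<in> obj C \<and>
     (\<exists>i\<^sub>1 \<in> homset C X B. \<exists>i\<^sub>2 \<in> homset C Y B. \<exists>p\<^sub>1 \<in> homset C B X. \<exists>p\<^sub>2 \<in> homset C B Y.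
        p\<^sub>1 \<cdot>\<^bsub>C\<^esub> i\<^sub>1 = idt C X \<and> p\<^sub>2 \<cdot>\<^bsub>C\<^esub> i\<^sub>2 = idt C Y \<and>
        p\<^sub>2 \<cdot>\<^bsub>C\<^esub> i\<^sub>1 = null C X Y \<and> p\<^sub>1 \<cdot>\<^bsub>C\<^esub> i\<^sub>2 = null C Y X \<and>
        (i\<^sub>1 \<cdot>\<^bsub>C\<^esub> p\<^sub>1) \<boxplus>\<^bsub>C\<^esub> (i\<^sub>2 \<cdot>\<^bsub>C\<^esub> p\<^sub>2) = idt C B)"

definition candidate_triangle :: "('k, 'o, 'm) tcat \<Rightarrow> 'm \<times> 'm \<times> 'm \<Rightarrow> bool" where
  "candidate_triangle C = (\<lambda>(f, g, h).
     f \<in> arr C \<and> g \<in> arr C \<and> h \<in> arr C \<and>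
     trg C f = src C g \<and> trg C g = src C h \<and> trg C h = sho C (src C f))"

definition triangle_isom :: "('k, 'o, 'm) tcat \<Rightarrow> 'm \<times> 'm \<times> 'm \<Rightarrow> 'm \<times> 'm \<times> 'm \<Rightarrow> bool" where
  "triangle_isom C = (\<lambda>(f, g, h) (f', g', h').
     \<exists>a \<in> homset C (src C f) (src C f'). \<exists>b \<in> homset C (src C g) (src C g').
     \<exists>c \<in> homset C (src C h) (src C h').
       is_isom C a \<and> is_isom C b \<and> is_isom C c \<and>
       b \<cdot>\<^bsub>C\<^esub> f = f' \<cdot>\<^bsub>C\<^esub> a \<and> c \<cdot>\<^bsub>C\<^esub> g = g' \<cdot>\<^bsub>C\<^esub> b \<and> sha C a \<cdot>\<^bsub>C\<^esub> h = h' \<cdot>\<^bsub>C\<^esub> c)"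

locale linear_category =
  fixes C :: "('k::field, 'o, 'm) tcat" (structure)
  assumes src_trg: "f \<in> arr C \<Longrightarrow> src C f \<in> obj C \<and> trg C f \<in> obj C"
    and idt_in: "X \<in> obj C \<Longrightarrow> idt C X \<in> homset C X X"
    and cmp_in: "\<lbrakk>f \<in> homset C X Y; g \<in> homset C Y Z\<rbrakk> \<Longrightarrow> g \<cdot> f \<in> homset C X Z"
    and cmp_assoc: "\<lbrakk>f \<in> homset C X Y; g \<in> homset C Y Z; h \<in> homset C Z W\<rbrakk>
        \<Longrightarrow> h \<cdot> (g \<cdot> f) = (h \<cdot> g) \<cdot> f"
    and cmp_idt: "f \<in> homset C X Y \<Longrightarrow> f \<cdot> idt C X = f \<and> idt C Y \<cdot> f = f"
    and padd_in: "\<lbrakk>f \<in> homset C X Y; g \<in> homset C X Y\<rbrakk> \<Longrightarrow> f \<boxplus> g \<in> homset C X Y"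
    and padd_assoc: "\<lbrakk>f \<in> homset C X Y; g \<in> homset C X Y; h \<in> homset C X Y\<rbrakk>
        \<Longrightarrow> (f \<boxplus> g) \<boxplus> h = f \<boxplus> (g \<boxplus> h)"
    and padd_comm: "\<lbrakk>f \<in> homset C X Y; g \<in> homset C X Y\<rbrakk> \<Longrightarrow> f \<boxplus> g = g \<boxplus> f"
    and null_in: "\<lbrakk>X \<in> obj C; Y \<in> obj C\<rbrakk> \<Longrightarrow> null C X Y \<in> homset C X Y"
    and padd_null: "f \<in> homset C X Y \<Longrightarrow> f \<boxplus> null C X Y = f"
    and padd_uminus: "f \<in> homset C X Y \<Longrightarrow> f \<boxplus> scal C (-1) f = null C X Y"
    and scal_in: "f \<in> homset C X Y \<Longrightarrow> scal C c f \<in> homset C X Y"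
    and scal_padd: "\<lbrakk>f \<in> homset C X Y; g \<in> homset C X Y\<rbrakk>
        \<Longrightarrow> scal C c (f \<boxplus> g) = scal C c f \<boxplus> scal C c g"
    and scal_add: "f \<in> homset C X Y \<Longrightarrow> scal C (c + d) f = scal C c f \<boxplus> scal C d f"
    and scal_mult: "f \<in> homset C X Y \<Longrightarrow> scal C (c * d) f = scal C c (scal C d f)"
    and scal_one: "f \<in> homset C X Y \<Longrightarrow> scal C 1 f = f"
    and cmp_padd_right: "\<lbrakk>f \<in> homset C X Y; f' \<in> homset C X Y; g \<in> homset C Y Z\<rbrakk>
        \<Longrightarrow> g \<cdot> (f \<boxplus> f') = (g \<cdot> f) \<boxplus> (g \<cdot> f')"
    and cmp_padd_left: "\<lbrakk>f \<in> homset C X Y; g \<in> homset C Y Z; g' \<in> homset C Y Z\<rbrakk>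
        \<Longrightarrow> (g \<boxplus> g') \<cdot> f = (g \<cdot> f) \<boxplus> (g' \<cdot> f)"
    and cmp_scal: "\<lbrakk>f \<in> homset C X Y; g \<in> homset C Y Z\<rbrakk>
        \<Longrightarrow> g \<cdot> scal C c f = scal C c (g \<cdot> f) \<and> scal C c g \<cdot> f = scal C c (g \<cdot> f)"

locale additive_category = linear_category +
  assumes ex_zero_obj: "\<exists>X. zero_obj C X"
    and ex_biproduct: "\<lbrakk>X \<in> obj C; Y \<in> obj C\<rbrakk> \<Longrightarrow> \<exists>B. biproduct C X Y B"

text \<open>
  The shift is only required to be an autoequivalence. The last axiom is the octahedral axiom.
\<close>

locale triangulated_category = additive_category +
  assumes sho_in: "X \<in> obj C \<Longrightarrow> sho C X \<in> obj C"
    and sha_bij: "\<lbrakk>X \<in> obj C; Y \<in> obj C\<rbrakk>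
        \<Longrightarrow> bij_betw (sha C) (homset C X Y) (homset C (sho C X) (sho C Y))"
    and sho_ess_surj: "Y \<in> obj C \<Longrightarrow> \<exists>X \<in> obj C. isomorphic C (sho C X) Y"
    and sha_idt: "X \<in> obj C \<Longrightarrow> sha C (idt C X) = idt C (sho C X)"
    and sha_cmp: "\<lbrakk>f \<in> homset C X Y; g \<in> homset C Y Z\<rbrakk> \<Longrightarrow> sha C (g \<cdot> f) = sha C g \<cdot> sha C f"
    and sha_padd: "\<lbrakk>f \<in> homset C X Y; g \<in> homset C X Y\<rbrakk>
        \<Longrightarrow> sha C (f \<boxplus> g) = sha C f \<boxplus> sha C g"
    and sha_scal: "f \<in> homset C X Y \<Longrightarrow> sha C (scal C c f) = scal C c (sha C f)"
    and tri_candidate: "t \<in> tri C \<Longrightarrow> candidate_triangle C t"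
    and tri_isom: "\<lbrakk>t \<in> tri C; candidate_triangle C t'; triangle_isom C t t'\<rbrakk> \<Longrightarrow> t' \<in> tri C"
    and tri_idt: "\<lbrakk>X \<in> obj C; zero_obj C Z\<rbrakk>
        \<Longrightarrow> (idt C X, null C X Z, null C Z (sho C X)) \<in> tri C"
    and tri_complete: "f \<in> arr C \<Longrightarrow> \<exists>g h. (f, g, h) \<in> tri C"
    and tri_rotate: "candidate_triangle C (f, g, h)
        \<Longrightarrow> (f, g, h) \<in> tri C \<longleftrightarrow> (g, h, scal C (-1) (sha C f)) \<in> tri C"
    and tri_morphism: "\<lbrakk>(f, g, h) \<in> tri C; (f', g', h') \<in> tri C;
          a \<in> homset C (src C f) (src C f'); b \<in> homset C (trg C f) (trg C f'); b \<cdot> f = f' \<cdot> a\<rbrakk>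
        \<Longrightarrow> \<exists>c \<in> homset C (trg C g) (trg C g'). c \<cdot> g = g' \<cdot> b \<and> sha C a \<cdot> h = h' \<cdot> c"
    and octahedral: "\<lbrakk>(f, i, i') \<in> tri C; (g, j, j') \<in> tri C; trg C f = src C g;
          (g \<cdot> f, l, l') \<in> tri C\<rbrakk>
        \<Longrightarrow> \<exists>a b. (a, b, sha C i \<cdot> j') \<in> tri C \<and> src C a = trg C i \<and> trg C a = trg C l \<and>
               trg C b = trg C j \<and>
               a \<cdot> i = l \<cdot> g \<and> l' \<cdot> a = i' \<and> b \<cdot> l = j \<and> j' \<cdot> b = sha C f \<cdot> l'"

definition full_subcategory :: "('k, 'o, 'm) tcat \<Rightarrow> 'o set \<Rightarrow> ('k, 'o, 'm) tcat" where
  "full_subcategory C S = C\<lparr>obj := obj C \<inter> S,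
     arr := {f \<in> arr C. src C f \<in> S \<and> trg C f \<in> S},
     tri := {(f, g, h) \<in> tri C. src C f \<in> S \<and> trg C f \<in> S \<and> trg C g \<in> S \<and> trg C h \<in> S}\<rparr>"

section \<open>Verdier quotients\<close>

text \<open>
  The quotient of D by the full subcategory on a set of objects N, by calculus of fractions.
  A roof (s, f) is X \<leftarrow> W \<rightarrow> Y with s : W \<rightarrow> X having its cone in N, and f : W \<rightarrow> Y. An arrow
  X \<rightarrow> Y of the quotient is a triple (X, Y, class of roofs).
\<close>

definition cone_in :: "('k, 'o, 'm) tcat \<Rightarrow> 'o set \<Rightarrow> 'm \<Rightarrow> bool" where
  "cone_in D N s \<longleftrightarrow> s \<in> arr D \<and> (\<exists>g h. (s, g, h) \<in> tri D \<and> trg D g \<in> N)"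

definition roofs :: "('k, 'o, 'm) tcat \<Rightarrow> 'o set \<Rightarrow> 'o \<Rightarrow> 'o \<Rightarrow> ('m \<times> 'm) set" where
  "roofs D N X Y = {(s, f). cone_in D N s \<and> trg D s = X \<and> f \<in> homset D (src D s) Y}"

definition roof_eq :: "('k, 'o, 'm) tcat \<Rightarrow> 'o set \<Rightarrow> 'm \<times> 'm \<Rightarrow> 'm \<times> 'm \<Rightarrow> bool" where
  "roof_eq D N = (\<lambda>(s, f) (s', f').
     \<exists>u u'. u \<in> arr D \<and> u' \<in> arr D \<and> src D u = src D u' \<and> trg D u = src D s \<and> trg D u' = src D s' \<and>
       s \<cdot>\<^bsub>D\<^esub> u = s' \<cdot>\<^bsub>D\<^esub> u' \<and> f \<cdot>\<^bsub>D\<^esub> u = f' \<cdot>\<^bsub>D\<^esub> u' \<and> cone_in D N (s \<cdot>\<^bsub>D\<^esub> u))"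

type_synonym ('o, 'm) fraction = "'o \<times> 'o \<times> ('m \<times> 'm) set"

definition fraction_of ::
  "('k, 'o, 'm) tcat \<Rightarrow> 'o set \<Rightarrow> 'o \<Rightarrow> 'o \<Rightarrow> 'm \<times> 'm \<Rightarrow> ('o, 'm) fraction" where
  "fraction_of D N X Y r = (X, Y, {r' \<in> roofs D N X Y. roof_eq D N r' r})"

definition localize :: "('k, 'o, 'm) tcat \<Rightarrow> 'o set \<Rightarrow> 'm \<Rightarrow> ('o, 'm) fraction" where
  "localize D N f = fraction_of D N (src D f) (trg D f) (idt D (src D f), f)"

text \<open>
  Each operation below collects all roofs equivalent to one computed from representatives, so
  that no representative has to be chosen: the square f \<cdot> u = t \<cdot> w is the Ore square used to compose
  (s, f) with (t, g), and fractions are added after bringing them to a common denominator s.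
\<close>

definition verdier_category ::
  "('k, 'o, 'm) tcat \<Rightarrow> 'o set \<Rightarrow> ('k, 'o, ('o, 'm) fraction) tcat" where
  "verdier_category D N =
    \<lparr>obj = obj D,
     arr = {fraction_of D N X Y r | X Y r. X \<in> obj D \<and> Y \<in> obj D \<and> r \<in> roofs D N X Y},
     src = (\<lambda>(X, Y, A). X),
     trg = (\<lambda>(X, Y, A). Y),
     idt = (\<lambda>X. localize D N (idt D X)),
     cmp = (\<lambda>(Y', Z, B) (X, Y, A). (X, Z, {r \<in> roofs D N X Z.
        \<exists>(s, f) \<in> A. \<exists>(t, g) \<in> B. \<exists>u w.
          cone_in D N u \<and> w \<in> arr D \<and> src D w = src D u \<and> trg D u = src D s \<and> trg D w = src D t \<and>
          f \<cdot>\<^bsub>D\<^esub> u = t \<cdot>\<^bsub>D\<^esub> w \<and> roof_eq D N r (s \<cdot>\<^bsub>D\<^esub> u, g \<cdot>\<^bsub>D\<^esub> w)})),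
     padd = (\<lambda>(X, Y, A) (X', Y', B). (X, Y, {r \<in> roofs D N X Y.
        \<exists>s f g. (s, f) \<in> A \<and> (s, g) \<in> B \<and> roof_eq D N r (s, f \<boxplus>\<^bsub>D\<^esub> g)})),
     null = (\<lambda>X Y. localize D N (null D X Y)),
     scal = (\<lambda>c (X, Y, A). (X, Y, {r \<in> roofs D N X Y.
        \<exists>(s, f) \<in> A. roof_eq D N r (s, scal D c f)})),
     sho = sho D,
     sha = (\<lambda>(X, Y, A). (sho D X, sho D Y, {r \<in> roofs D N (sho D X) (sho D Y).
        \<exists>(s, f) \<in> A. roof_eq D N r (sha D s, sha D f)})),
     tri = {}\<rparr>"

definition verdier_quotient ::
  "('k, 'o, 'm) tcat \<Rightarrow> 'o set \<Rightarrow> ('k, 'o, ('o, 'm) fraction) tcat" where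
  "verdier_quotient D N = (verdier_category D N)
     \<lparr>tri := {t. candidate_triangle (verdier_category D N) t \<and>
        (\<exists>(f, g, h) \<in> tri D. triangle_isom (verdier_category D N)
            (localize D N f, localize D N g, localize D N h) t)}\<rparr>"

section \<open>Abelian groups\<close>

definition complex_group :: "complex monoid" where
  "complex_group = \<lparr>carrier = UNIV, mult = (+), one = 0\<rparr>"

definition free_of_finite_rank :: "'a monoid \<Rightarrow> bool" where
  "free_of_finite_rank G \<longleftrightarrow> comm_group G \<and> (\<exists>n::nat. G \<cong> free_Abelian_group {..<n})"

definition presented_group :: "'a set \<Rightarrow> ('a \<Rightarrow>\<^sub>0 int) set \<Rightarrow> ('a \<Rightarrow>\<^sub>0 int) set monoid" where
  "presented_group S R = free_Abelian_group S Mod generate (free_Abelian_group S) R"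

definition presented_class :: "'a set \<Rightarrow> ('a \<Rightarrow>\<^sub>0 int) set \<Rightarrow> ('a \<Rightarrow>\<^sub>0 int) \<Rightarrow> ('a \<Rightarrow>\<^sub>0 int) set" where
  "presented_class S R x =
     generate (free_Abelian_group S) R #>\<^bsub>free_Abelian_group S\<^esub> x"

definition K0_relators :: "('k, 'o, 'm) tcat \<Rightarrow> ('o \<Rightarrow>\<^sub>0 int) set" where
  "K0_relators C = {frag_of (trg C f) - frag_of (src C f) - frag_of (trg C g) | f g h.
     (f, g, h) \<in> tri C}"

definition K0 :: "('k, 'o, 'm) tcat \<Rightarrow> ('o \<Rightarrow>\<^sub>0 int) set monoid" where
  "K0 C = presented_group (obj C) (K0_relators C)"

definition K0_class :: "('k, 'o, 'm) tcat \<Rightarrow> 'o \<Rightarrow> ('o \<Rightarrow>\<^sub>0 int) set" where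
  "K0_class C X = presented_class (obj C) (K0_relators C) (frag_of X)"

text \<open>
  The tensor product of an abelian group (written multiplicatively) with a ring 'r over the
  integers, generated by the symbols (x, r) = x \<otimes> r. It is used with 'r the reals and the rationals.
\<close>

definition tensor_relators :: "'a monoid \<Rightarrow> ('a \<times> 'r::comm_ring_1 \<Rightarrow>\<^sub>0 int) set" where
  "tensor_relators G =
     {frag_of (x \<otimes>\<^bsub>G\<^esub> y, r) - frag_of (x, r) - frag_of (y, r) | x y r. x \<in> carrier G \<and> y \<in> carrier G} \<union>
     {frag_of (x, r + s) - frag_of (x, r) - frag_of (x, s) | x r s. x \<in> carrier G}"

definition tensor :: "'a monoid \<Rightarrow> ('a \<times> 'r::comm_ring_1 \<Rightarrow>\<^sub>0 int) set monoid" where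
  "tensor G = presented_group (carrier G \<times> UNIV) (tensor_relators G)"

definition pure_tensor :: "'a monoid \<Rightarrow> 'a \<Rightarrow> 'r \<Rightarrow> ('a \<times> 'r::comm_ring_1 \<Rightarrow>\<^sub>0 int) set" where
  "pure_tensor G x r = presented_class (carrier G \<times> UNIV) (tensor_relators G) (frag_of (x, r))"

definition tensor_scale ::
  "'a monoid \<Rightarrow> 'r \<Rightarrow> ('a \<times> 'r::comm_ring_1 \<Rightarrow>\<^sub>0 int) set \<Rightarrow> ('a \<times> 'r \<Rightarrow>\<^sub>0 int) set" where
  "tensor_scale G c U = (\<Union>u\<in>U. presented_class (carrier G \<times> UNIV) (tensor_relators G)
     (frag_extend (\<lambda>(x, r). frag_of (x, c * r)) u))"

lemma tensor_scale_pure_tensor: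
  assumes "comm_group G" "x \<in> carrier G"
  shows "tensor_scale G c (pure_tensor G x r) = pure_tensor G x (c * r)"
proof -
  define F :: "('a \<times> 'b \<Rightarrow>\<^sub>0 int) monoid" where "F = free_Abelian_group (carrier G \<times> UNIV)"
  define N where "N = generate F (tensor_relators G)"
  define \<mu> where "\<mu> = frag_extend (\<lambda>(x, r). frag_of (x, c * r) :: 'a \<times> 'b \<Rightarrow>\<^sub>0 int)"
  interpret G: comm_group G by fact
  interpret F: comm_group F by (simp add: F_def abelian_free_Abelian_group)
  have F_mult: "u \<otimes>\<^bsub>F\<^esub> w = u + w" for u w by (simp add: F_def)
  have rel: "tensor_relators G \<subseteq> carrier F"
    unfolding F_def tensor_relators_def
    by (auto simp: keys_frag_of dest!: subsetD[OF keys_diff])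
  have N: "subgroup N F"
    unfolding N_def by (rule F.generate_is_subgroup[OF rel])
  have \<mu>_rel: "\<mu> u \<in> tensor_relators G" if "u \<in> tensor_relators G" for u
    using that unfolding tensor_relators_def \<mu>_def
    by (force simp: frag_extend_diff distrib_left)
  have \<mu>_N: "\<mu> u \<in> N" if "u \<in> N" for u
    using that unfolding N_def
  proof (induction rule: generate.induct)
    case one
    then show ?case
      by (simp add: \<mu>_def F_def) (metis generate.one one_free_Abelian_group)
  next
    case (incl h)
    then show ?case by (simp add: \<mu>_rel generate.incl)
  next
    case (inv h)
    have "inv\<^bsub>F\<^esub> w = - w" if "w \<in> tensor_relators G" for w
      using rel that unfolding F_def by auto
    then show ?case
      using inv \<mu>_rel[OF inv] by (metis \<mu>_def frag_extend_minus generate.inv)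
  next
    case (eng h1 h2)
    then show ?case
      by (metis F_mult \<mu>_def frag_extend_add generate.eng)
  qed
  have x: "frag_of (x, s) \<in> carrier F" for s
    using assms by (simp add: F_def)
  have *: "N #>\<^bsub>F\<^esub> \<mu> u = N #>\<^bsub>F\<^esub> frag_of (x, c * r)" if u: "u \<in> N #>\<^bsub>F\<^esub> frag_of (x, r)" for u
  proof -
    obtain n where n: "n \<in> N" "u = n + frag_of (x, r)"
      using u by (auto simp: r_coset_def F_mult)
    then have "\<mu> u = \<mu> n \<otimes>\<^bsub>F\<^esub> frag_of (x, c * r)"
      by (simp add: F_mult \<mu>_def frag_extend_add)
    then have "\<mu> u \<in> N #>\<^bsub>F\<^esub> frag_of (x, c * r)"
      using \<mu>_N[OF n(1)] by (auto simp: r_coset_def)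
    then show ?thesis
      using F.repr_independence[OF _ x N] by metis
  qed
  have "frag_of (x, r) \<in> N #>\<^bsub>F\<^esub> frag_of (x, r)"
    by (rule F.rcos_self[OF x N])
  then show ?thesis
    using * unfolding tensor_scale_def pure_tensor_def presented_class_def
    by (fold F_def) (fold N_def \<mu>_def, blast)
qed

definition norm_on_realification :: "'a monoid \<Rightarrow> (('a \<times> real \<Rightarrow>\<^sub>0 int) set \<Rightarrow> real) \<Rightarrow> bool" where
  "norm_on_realification G N \<longleftrightarrow>
     (\<forall>u \<in> carrier (tensor G). 0 \<le> N u \<and> (N u = 0 \<longleftrightarrow> u = \<one>\<^bsub>tensor G\<^esub>)) \<and>
     (\<forall>u \<in> carrier (tensor G). \<forall>w \<in> carrier (tensor G). N (u \<otimes>\<^bsub>tensor G\<^esub> w) \<le> N u + N w) \<and>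
     (\<forall>c. \<forall>u \<in> carrier (tensor G). N (tensor_scale G c u) = \<bar>c\<bar> * N u)"

definition rational_span :: "'a monoid \<Rightarrow> 'a set \<Rightarrow> ('a \<times> rat \<Rightarrow>\<^sub>0 int) set set" where
  "rational_span G H = generate (tensor G) {pure_tensor G x q | x q. x \<in> H}"

text \<open>
  Linear independence of subgroups means that the sum of their rational spans is direct.
\<close>

definition independent_over_rat :: "'a monoid \<Rightarrow> nat \<Rightarrow> (nat \<Rightarrow> 'a set) \<Rightarrow> bool" where
  "independent_over_rat G n H \<longleftrightarrow>
     (\<forall>u. (\<forall>i<n. u i \<in> rational_span G (H i)) \<and> finprod (tensor G) u {..<n} = \<one>\<^bsub>tensor G\<^esub>
        \<longrightarrow> (\<forall>i<n. u i = \<one>\<^bsub>tensor G\<^esub>))"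

definition torsion :: "'a monoid \<Rightarrow> 'a set" where
  "torsion G = {x \<in> carrier G. \<exists>n::nat. n > 0 \<and> x [^]\<^bsub>G\<^esub> n = \<one>\<^bsub>G\<^esub>}"

definition torsion_free_part :: "'a monoid \<Rightarrow> 'a set monoid" where
  "torsion_free_part G = G Mod torsion G"

section \<open>Stability conditions\<close>

text \<open>
  filtration C E Gs: there are maps 0 = E_0 \<rightarrow> E_1 \<rightarrow> ... \<rightarrow> E_n = E whose successive cones
  are the entries of the list Gs.
\<close>

definition filtration :: "('k, 'o, 'm) tcat \<Rightarrow> 'o \<Rightarrow> 'o list \<Rightarrow> bool" where
  "filtration C E Gs \<longleftrightarrow>
     (\<exists>Es f g h. zero_obj C (Es 0) \<and> Es (length Gs) = E \<and>
        (\<forall>i < length Gs. (f i, g i, h i) \<in> tri C \<and>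
           src C (f i) = Es i \<and> trg C (f i) = Es (Suc i) \<and> trg C (g i) = Gs ! i))"

definition hn_filtration ::
  "('k, 'o, 'm) tcat \<Rightarrow> (real \<Rightarrow> 'o set) \<Rightarrow> 'o \<Rightarrow> ('o \<times> real) list \<Rightarrow> bool" where
  "hn_filtration C Q E L \<longleftrightarrow> filtration C E (map fst L) \<and>
     (\<forall>(F, \<phi>) \<in> set L. F \<in> Q \<phi> \<and> \<not> zero_obj C F) \<and> sorted_wrt (>) (map snd L)"

text \<open>
  The subcategories of a slicing are taken to be closed under isomorphism, and the
  condition on the shift is accordingly an equality of essential images.
\<close>

definition full_additive_subcategory :: "('k, 'o, 'm) tcat \<Rightarrow> 'o set \<Rightarrow> bool" where
  "full_additive_subcategory C S \<longleftrightarrow> S \<subseteq> obj C \<and>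
     (\<forall>X. zero_obj C X \<longrightarrow> X \<in> S) \<and>
     (\<forall>X \<in> S. \<forall>Y \<in> S. \<forall>B. biproduct C X Y B \<longrightarrow> B \<in> S) \<and>
     (\<forall>X \<in> S. \<forall>Y. isomorphic C X Y \<longrightarrow> Y \<in> S)"

definition slicing :: "('k, 'o, 'm) tcat \<Rightarrow> (real \<Rightarrow> 'o set) \<Rightarrow> bool" where
  "slicing C Q \<longleftrightarrow>
     (\<forall>\<phi>. full_additive_subcategory C (Q \<phi>)) \<and>
     (\<forall>\<phi>. {Y \<in> obj C. \<exists>X \<in> Q \<phi>. isomorphic C (sho C X) Y} = Q (\<phi> + 1)) \<and>
     (\<forall>\<phi>\<^sub>1 \<phi>\<^sub>2. \<phi>\<^sub>1 > \<phi>\<^sub>2 \<longrightarrow> (\<forall>X \<in> Q \<phi>\<^sub>1. \<forall>Y \<in> Q \<phi>\<^sub>2. homset C X Y = {null C X Y})) \<and>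
     (\<forall>E \<in> obj C. \<not> zero_obj C E \<longrightarrow> (\<exists>L. hn_filtration C Q E L))"

text \<open>
  A pair (Z, Q) of a central charge on the Grothendieck group and a slicing. Central charges are
  extensional, so that equal pairs are equal pre-stability conditions.
\<close>

type_synonym 'o charge_slicing = "(('o \<Rightarrow>\<^sub>0 int) set \<Rightarrow> complex) \<times> (real \<Rightarrow> 'o set)"

definition charge :: "('k, 'o, 'm) tcat \<Rightarrow> 'o charge_slicing \<Rightarrow> 'o \<Rightarrow> complex" where
  "charge C \<sigma> X = fst \<sigma> (K0_class C X)"

definition pre_stability :: "('k, 'o, 'm) tcat \<Rightarrow> 'o charge_slicing \<Rightarrow> bool" where
  "pre_stability C \<sigma> \<longleftrightarrow> slicing C (snd \<sigma>) \<and>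
     fst \<sigma> \<in> hom (K0 C) complex_group \<inter> extensional (carrier (K0 C)) \<and>
     (\<forall>\<phi>. \<forall>E \<in> snd \<sigma> \<phi>. \<not> zero_obj C E \<longrightarrow> (\<exists>m>0. charge C \<sigma> E = of_real m * cis (pi * \<phi>)))"

definition factors_through ::
  "'a monoid \<Rightarrow> 'b monoid \<Rightarrow> ('a \<Rightarrow> 'b) \<Rightarrow> ('a \<Rightarrow> complex) \<Rightarrow> bool" where
  "factors_through G H w Z \<longleftrightarrow> w \<in> hom G H \<and>
     (\<exists>Z' \<in> hom H complex_group. \<forall>x \<in> carrier G. Z x = Z' (w x))"

definition support_property :: "('k, 'o, 'm) tcat \<Rightarrow> 'l monoid \<Rightarrow>
    (('o \<Rightarrow>\<^sub>0 int) set \<Rightarrow> 'l) \<Rightarrow> 'o charge_slicing \<Rightarrow> bool" where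
  "support_property C \<Lambda> w \<sigma> \<longleftrightarrow>
     (\<exists>N. norm_on_realification \<Lambda> N \<and>
        (\<exists>c>0. \<forall>\<phi>. \<forall>E \<in> snd \<sigma> \<phi>. \<not> zero_obj C E \<longrightarrow>
           cmod (charge C \<sigma> E) \<ge> c * N (pure_tensor \<Lambda> (w (K0_class C E)) 1)))"

definition Stab :: "('k, 'o, 'm) tcat \<Rightarrow> 'l monoid \<Rightarrow> (('o \<Rightarrow>\<^sub>0 int) set \<Rightarrow> 'l) \<Rightarrow>
    'o charge_slicing set" where
  "Stab C \<Lambda> v = {\<sigma>. pre_stability C \<sigma> \<and> factors_through (K0 C) \<Lambda> v (fst \<sigma>) \<and>
     support_property C \<Lambda> v \<sigma>}"

text \<open>
  The phases of an HN filtration are unique and its factors are unique up to isomorphism, so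
  the quantities below do not depend on the choice made here.
\<close>

definition hn_factors :: "('k, 'o, 'm) tcat \<Rightarrow> 'o charge_slicing \<Rightarrow> 'o \<Rightarrow> ('o \<times> real) list" where
  "hn_factors C \<sigma> E = (SOME L. hn_filtration C (snd \<sigma>) E L)"

definition phase_plus :: "('k, 'o, 'm) tcat \<Rightarrow> 'o charge_slicing \<Rightarrow> 'o \<Rightarrow> real" where
  "phase_plus C \<sigma> E = snd (hd (hn_factors C \<sigma> E))"

definition phase_minus :: "('k, 'o, 'm) tcat \<Rightarrow> 'o charge_slicing \<Rightarrow> 'o \<Rightarrow> real" where
  "phase_minus C \<sigma> E = snd (last (hn_factors C \<sigma> E))"

definition mass :: "('k, 'o, 'm) tcat \<Rightarrow> 'o charge_slicing \<Rightarrow> 'o \<Rightarrow> real" where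
  "mass C \<sigma> E = (\<Sum>(F, \<phi>) \<leftarrow> hn_factors C \<sigma> E. cmod (charge C \<sigma> F))"

definition phase :: "('k, 'o, 'm) tcat \<Rightarrow> 'o charge_slicing \<Rightarrow> 'o \<Rightarrow> real" where
  "phase C \<sigma> E = (\<Sum>(F, \<phi>) \<leftarrow> hn_factors C \<sigma> E. \<phi> * cmod (charge C \<sigma> F)) / mass C \<sigma> E"

definition log_charge :: "('k, 'o, 'm) tcat \<Rightarrow> 'o charge_slicing \<Rightarrow> 'o \<Rightarrow> complex" where
  "log_charge C \<sigma> E = Complex (ln (mass C \<sigma> E)) (pi * phase C \<sigma> E)"

definition log_charge_diff ::
  "('k, 'o, 'm) tcat \<Rightarrow> 'o charge_slicing \<Rightarrow> 'o \<Rightarrow> 'o \<Rightarrow> complex" where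
  "log_charge_diff C \<sigma> E F = log_charge C \<sigma> E - log_charge C \<sigma> F"

text \<open>Bridgeland's topology is the one induced by his generalized metric, with values in [0, \<infinity>].\<close>

definition stab_dist ::
  "('k, 'o, 'm) tcat \<Rightarrow> 'o charge_slicing \<Rightarrow> 'o charge_slicing \<Rightarrow> ennreal" where
  "stab_dist C \<sigma> \<tau> = (SUP E \<in> {E \<in> obj C. \<not> zero_obj C E}. ennreal (Max
     {\<bar>phase_plus C \<sigma> E - phase_plus C \<tau> E\<bar>,
      \<bar>phase_minus C \<sigma> E - phase_minus C \<tau> E\<bar>,
      \<bar>ln (mass C \<sigma> E / mass C \<tau> E)\<bar>}))"

definition stab_open :: "('k, 'o, 'm) tcat \<Rightarrow> 'l monoid \<Rightarrow> (('o \<Rightarrow>\<^sub>0 int) set \<Rightarrow> 'l) \<Rightarrow>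
    'o charge_slicing set \<Rightarrow> bool" where
  "stab_open C \<Lambda> v U \<longleftrightarrow> U \<subseteq> Stab C \<Lambda> v \<and>
     (\<forall>\<sigma> \<in> U. \<exists>\<epsilon>>0. \<forall>\<tau> \<in> Stab C \<Lambda> v. stab_dist C \<sigma> \<tau> < \<epsilon> \<longrightarrow> \<tau> \<in> U)"

lemma istopology_stab_open: "istopology (stab_open C \<Lambda> v)"
proof -
  have "stab_open C \<Lambda> v (S \<inter> T)" if S: "stab_open C \<Lambda> v S" and T: "stab_open C \<Lambda> v T" for S T
    unfolding stab_open_def
  proof (intro conjI ballI)
    show "S \<inter> T \<subseteq> Stab C \<Lambda> v"
      using that unfolding stab_open_def by blast
    fix \<sigma> assume \<sigma>: "\<sigma> \<in> S \<inter> T"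
    obtain d where "d > 0" and "\<forall>\<tau> \<in> Stab C \<Lambda> v. stab_dist C \<sigma> \<tau> < d \<longrightarrow> \<tau> \<in> S"
      using S \<sigma> unfolding stab_open_def by blast
    moreover obtain e where "e > 0" and "\<forall>\<tau> \<in> Stab C \<Lambda> v. stab_dist C \<sigma> \<tau> < e \<longrightarrow> \<tau> \<in> T"
      using T \<sigma> unfolding stab_open_def by blast
    ultimately show "\<exists>\<epsilon>>0. \<forall>\<tau> \<in> Stab C \<Lambda> v. stab_dist C \<sigma> \<tau> < \<epsilon> \<longrightarrow> \<tau> \<in> S \<inter> T"
      by (intro exI[of _ "min d e"]) auto
  qed
  moreover have "stab_open C \<Lambda> v (\<Union>\<K>)" if "\<forall>K\<in>\<K>. stab_open C \<Lambda> v K" for \<K>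
    using that unfolding stab_open_def by (meson Union_iff Union_least)
  ultimately show ?thesis
    unfolding istopology_def by blast
qed

definition stab_topology :: "('k, 'o, 'm) tcat \<Rightarrow> 'l monoid \<Rightarrow> (('o \<Rightarrow>\<^sub>0 int) set \<Rightarrow> 'l) \<Rightarrow>
    'o charge_slicing topology" where
  "stab_topology C \<Lambda> v = topology (stab_open C \<Lambda> v)"

section \<open>Quasi-convergent paths\<close>

definition limit_semistable ::
  "('k, 'o, 'm) tcat \<Rightarrow> (real \<Rightarrow> 'o charge_slicing) \<Rightarrow> 'o \<Rightarrow> bool" where
  "limit_semistable C \<sigma> E \<longleftrightarrow> E \<in> obj C \<and> \<not> zero_obj C E \<and>
     ((\<lambda>t. phase_plus C (\<sigma> t) E - phase_minus C (\<sigma> t) E) \<longlongrightarrow> 0) at_top"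

definition limit_hn_filtration ::
  "('k, 'o, 'm) tcat \<Rightarrow> (real \<Rightarrow> 'o charge_slicing) \<Rightarrow> 'o \<Rightarrow> 'o list \<Rightarrow> bool" where
  "limit_hn_filtration C \<sigma> E Gs \<longleftrightarrow> filtration C E Gs \<and>
     (\<forall>G \<in> set Gs. limit_semistable C \<sigma> G) \<and>
     (\<forall>i. Suc i < length Gs \<longrightarrow>
        Liminf at_top (\<lambda>t. ereal (phase C (\<sigma> t) (Gs ! i) - phase C (\<sigma> t) (Gs ! Suc i))) > 0)"

definition quasi_convergent :: "('k, 'o, 'm) tcat \<Rightarrow> 'l monoid \<Rightarrow> (('o \<Rightarrow>\<^sub>0 int) set \<Rightarrow> 'l) \<Rightarrow>
    real \<Rightarrow> (real \<Rightarrow> 'o charge_slicing) \<Rightarrow> bool" where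
  "quasi_convergent C \<Lambda> v a \<sigma> \<longleftrightarrow>
     continuous_map (top_of_set {a..}) (stab_topology C \<Lambda> v) \<sigma> \<and>
     (\<forall>E \<in> obj C. \<exists>Gs. limit_hn_filtration C \<sigma> E Gs) \<and>
     (\<forall>E F. limit_semistable C \<sigma> E \<and> limit_semistable C \<sigma> F \<longrightarrow>
        (\<exists>l::complex. ((\<lambda>t. log_charge_diff C (\<sigma> t) E F / (1 + cmod (log_charge_diff C (\<sigma> t) E F)))
            \<longlongrightarrow> l) at_top))"

text \<open>
  The relations on limit semistable objects: the suffix i marks the versions that only compare
  phases, the prefix lim those that also compare masses.
\<close>

definition prec_i :: "('k, 'o, 'm) tcat \<Rightarrow> (real \<Rightarrow> 'o charge_slicing) \<Rightarrow> 'o \<Rightarrow> 'o \<Rightarrow> bool" where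
  "prec_i C \<sigma> F E \<longleftrightarrow> filterlim (\<lambda>t. phase C (\<sigma> t) E - phase C (\<sigma> t) F) at_top at_top"

definition preceq_i :: "('k, 'o, 'm) tcat \<Rightarrow> (real \<Rightarrow> 'o charge_slicing) \<Rightarrow> 'o \<Rightarrow> 'o \<Rightarrow> bool" where
  "preceq_i C \<sigma> E F \<longleftrightarrow> \<not> prec_i C \<sigma> F E"

definition equiv_i :: "('k, 'o, 'm) tcat \<Rightarrow> (real \<Rightarrow> 'o charge_slicing) \<Rightarrow> 'o \<Rightarrow> 'o \<Rightarrow> bool" where
  "equiv_i C \<sigma> E F \<longleftrightarrow> preceq_i C \<sigma> E F \<and> preceq_i C \<sigma> F E"

definition lim_prec :: "('k, 'o, 'm) tcat \<Rightarrow> (real \<Rightarrow> 'o charge_slicing) \<Rightarrow> 'o \<Rightarrow> 'o \<Rightarrow> bool" where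
  "lim_prec C \<sigma> F E \<longleftrightarrow> prec_i C \<sigma> F E \<or>
     (equiv_i C \<sigma> E F \<and>
      filterlim (\<lambda>t. ln (mass C (\<sigma> t) E / mass C (\<sigma> t) F)) at_top at_top)"

definition lim_preceq :: "('k, 'o, 'm) tcat \<Rightarrow> (real \<Rightarrow> 'o charge_slicing) \<Rightarrow> 'o \<Rightarrow> 'o \<Rightarrow> bool" where
  "lim_preceq C \<sigma> E F \<longleftrightarrow> \<not> lim_prec C \<sigma> F E"

definition lim_equiv :: "('k, 'o, 'm) tcat \<Rightarrow> (real \<Rightarrow> 'o charge_slicing) \<Rightarrow> 'o \<Rightarrow> 'o \<Rightarrow> bool" where
  "lim_equiv C \<sigma> E F \<longleftrightarrow> lim_preceq C \<sigma> E F \<and> lim_preceq C \<sigma> F E"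

text \<open>
  Objects whose limit HN factors all satisfy a given condition. Limit HN factors are unique up
  to isomorphism, so it does not matter which limit HN filtration is used.
\<close>

definition objs_with_factors ::
  "('k, 'o, 'm) tcat \<Rightarrow> (real \<Rightarrow> 'o charge_slicing) \<Rightarrow> ('o \<Rightarrow> bool) \<Rightarrow> 'o set" where
  "objs_with_factors C \<sigma> P =
     {X \<in> obj C. \<exists>Gs. limit_hn_filtration C \<sigma> X Gs \<and> (\<forall>A \<in> set Gs. P A)}"

definition objs_preceq :: "('k, 'o, 'm) tcat \<Rightarrow> (real \<Rightarrow> 'o charge_slicing) \<Rightarrow> 'o \<Rightarrow> 'o set" where
  "objs_preceq C \<sigma> E = objs_with_factors C \<sigma> (\<lambda>A. lim_preceq C \<sigma> A E)"

definition objs_prec :: "('k, 'o, 'm) tcat \<Rightarrow> (real \<Rightarrow> 'o charge_slicing) \<Rightarrow> 'o \<Rightarrow> 'o set" where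
  "objs_prec C \<sigma> E = objs_with_factors C \<sigma> (\<lambda>A. lim_prec C \<sigma> A E)"

definition objs_equiv_i :: "('k, 'o, 'm) tcat \<Rightarrow> (real \<Rightarrow> 'o charge_slicing) \<Rightarrow> 'o \<Rightarrow> 'o set" where
  "objs_equiv_i C \<sigma> E = objs_with_factors C \<sigma> (\<lambda>A. equiv_i C \<sigma> A E)"

definition graded_quotient :: "('k, 'o, 'm) tcat \<Rightarrow> (real \<Rightarrow> 'o charge_slicing) \<Rightarrow> 'o \<Rightarrow>
    ('k, 'o, ('o, 'm) fraction) tcat" where
  "graded_quotient C \<sigma> E =
     verdier_quotient (full_subcategory C (objs_preceq C \<sigma> E)) (objs_prec C \<sigma> E)"

text \<open>
  The pre-stability condition induced on the quotient attached to E; it is determined by these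
  requirements. The quotient functor is the identity on objects.
\<close>

definition induced_pre_stability :: "('k, 'o, 'm) tcat \<Rightarrow> (real \<Rightarrow> 'o charge_slicing) \<Rightarrow> 'o \<Rightarrow>
    'o charge_slicing \<Rightarrow> bool" where
  "induced_pre_stability C \<sigma> E \<sigma>E \<longleftrightarrow>
     pre_stability (graded_quotient C \<sigma> E) \<sigma>E \<and>
     (\<forall>\<phi>. \<forall>X \<in> obj (graded_quotient C \<sigma> E). \<not> zero_obj (graded_quotient C \<sigma> E) X \<longrightarrow>
        (X \<in> snd \<sigma>E \<phi> \<longleftrightarrow>
          (\<exists>F. limit_semistable C \<sigma> F \<and> lim_equiv C \<sigma> F E \<and>
             ((\<lambda>t. phase C (\<sigma> t) F - phase C (\<sigma> t) E) \<longlongrightarrow> \<phi>) at_top \<and>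
             isomorphic (graded_quotient C \<sigma> E) X F))) \<and>
     (\<forall>F. limit_semistable C \<sigma> F \<and> lim_equiv C \<sigma> F E \<longrightarrow>
        ((\<lambda>t. charge C (\<sigma> t) F / charge C (\<sigma> t) E) \<longlongrightarrow> charge (graded_quotient C \<sigma> E) \<sigma>E F) at_top)"

section \<open>Numerical paths and the support property\<close>

text \<open>
  The classes of the objects of a triangulated subcategory already form a subgroup, so for these
  the closure taken here adds nothing.
\<close>

definition class_subgroup :: "('k, 'o, 'm) tcat \<Rightarrow> 'l monoid \<Rightarrow> (('o \<Rightarrow>\<^sub>0 int) set \<Rightarrow> 'l) \<Rightarrow>
    'o set \<Rightarrow> 'l set" where
  "class_subgroup C \<Lambda> v S = generate \<Lambda> ((\<lambda>X. v (K0_class C X)) ` S)"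

definition numerical :: "('k, 'o, 'm) tcat \<Rightarrow> 'l monoid \<Rightarrow> (('o \<Rightarrow>\<^sub>0 int) set \<Rightarrow> 'l) \<Rightarrow>
    (real \<Rightarrow> 'o charge_slicing) \<Rightarrow> bool" where
  "numerical C \<Lambda> v \<sigma> \<longleftrightarrow>
     (\<forall>n (E :: nat \<Rightarrow> 'o). (\<forall>i<n. limit_semistable C \<sigma> (E i)) \<and>
        (\<forall>i<n. \<forall>j<n. i \<noteq> j \<longrightarrow> \<not> equiv_i C \<sigma> (E i) (E j)) \<longrightarrow>
        independent_over_rat \<Lambda> n (\<lambda>i. class_subgroup C \<Lambda> v (objs_equiv_i C \<sigma> (E i))))"

definition graded_class_group :: "('k, 'o, 'm) tcat \<Rightarrow> 'l monoid \<Rightarrow> (('o \<Rightarrow>\<^sub>0 int) set \<Rightarrow> 'l) \<Rightarrow>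
    (real \<Rightarrow> 'o charge_slicing) \<Rightarrow> 'o \<Rightarrow> 'l set monoid" where
  "graded_class_group C \<Lambda> v \<sigma> E =
     \<Lambda>\<lparr>carrier := class_subgroup C \<Lambda> v (objs_preceq C \<sigma> E)\<rparr> Mod
       class_subgroup C \<Lambda> v (objs_prec C \<sigma> E)"

definition graded_lattice :: "('k, 'o, 'm) tcat \<Rightarrow> 'l monoid \<Rightarrow> (('o \<Rightarrow>\<^sub>0 int) set \<Rightarrow> 'l) \<Rightarrow>
    (real \<Rightarrow> 'o charge_slicing) \<Rightarrow> 'o \<Rightarrow> 'l set set monoid" where
  "graded_lattice C \<Lambda> v \<sigma> E = torsion_free_part (graded_class_group C \<Lambda> v \<sigma> E)"

definition graded_lattice_class :: "('k, 'o, 'm) tcat \<Rightarrow> 'l monoid \<Rightarrow> (('o \<Rightarrow>\<^sub>0 int) set \<Rightarrow> 'l) \<Rightarrow>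
    (real \<Rightarrow> 'o charge_slicing) \<Rightarrow> 'o \<Rightarrow> 'o \<Rightarrow> 'l set set" where
  "graded_lattice_class C \<Lambda> v \<sigma> E X =
     torsion (graded_class_group C \<Lambda> v \<sigma> E) #>\<^bsub>graded_class_group C \<Lambda> v \<sigma> E\<^esub>
       (class_subgroup C \<Lambda> v (objs_prec C \<sigma> E) #>\<^bsub>\<Lambda>\<^esub> v (K0_class C X))"

text \<open>
  The homomorphism from the Grothendieck group of the quotient induced by v; it is unique because
  the Grothendieck group is generated by the classes of objects.
\<close>

definition graded_lattice_map :: "('k, 'o, 'm) tcat \<Rightarrow> 'l monoid \<Rightarrow> (('o \<Rightarrow>\<^sub>0 int) set \<Rightarrow> 'l) \<Rightarrow>
    (real \<Rightarrow> 'o charge_slicing) \<Rightarrow> 'o \<Rightarrow> ('o \<Rightarrow>\<^sub>0 int) set \<Rightarrow> 'l set set" where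
  "graded_lattice_map C \<Lambda> v \<sigma> E =
     (THE w. w \<in> hom (K0 (graded_quotient C \<sigma> E)) (graded_lattice C \<Lambda> v \<sigma> E) \<inter>
               extensional (carrier (K0 (graded_quotient C \<sigma> E))) \<and>
             (\<forall>X \<in> obj (graded_quotient C \<sigma> E).
                w (K0_class (graded_quotient C \<sigma> E) X) = graded_lattice_class C \<Lambda> v \<sigma> E X))"

definition path_support_property :: "('k, 'o, 'm) tcat \<Rightarrow> 'l monoid \<Rightarrow>
    (('o \<Rightarrow>\<^sub>0 int) set \<Rightarrow> 'l) \<Rightarrow> (real \<Rightarrow> 'o charge_slicing) \<Rightarrow> bool" where
  "path_support_property C \<Lambda> v \<sigma> \<longleftrightarrow>
     (\<forall>E. limit_semistable C \<sigma> E \<longrightarrow>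
       (\<exists>N. norm_on_realification (graded_lattice C \<Lambda> v \<sigma> E) N \<and>
         (\<exists>\<epsilon>>0. \<forall>F. limit_semistable C \<sigma> F \<and> lim_equiv C \<sigma> F E \<longrightarrow>
           (\<exists>l. ((\<lambda>t. cmod (charge C (\<sigma> t) F) / cmod (charge C (\<sigma> t) E)) \<longlongrightarrow> l) at_top \<and>
              l \<ge> \<epsilon> * N (pure_tensor (graded_lattice C \<Lambda> v \<sigma> E)
                          (graded_lattice_class C \<Lambda> v \<sigma> E F) 1)))))"

end

theory Submission
  imports Defs
begin

text \<open>
  If the class of X in the lattice of E vanishes, a multiple of v(X) equals v(Y) for some Y all of
  whose limit HN factors precede E. Written out in limit HN factors, this relation may by the numerical
  condition be restricted to factors whose phases stay at bounded distance from that of E. Applying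
  Z_t / Z_t(E) and letting t tend to infinity gives Z_E(X) = 0. The two support properties then state
  the same inequality, since the semistable objects of the induced pre-stability condition are the images
  of the limit semistable F equivalent to E.

  For this the subcategories below E have to be thick, so that the quotient can be computed by
  fractions. The tool is a windowed mass: the sum of |Z(F)| sin(\<pi>(\<phi> - \<theta>)) over the HN factors F
  of phase \<phi> in the interval from \<theta> to \<theta> + 1. It is the rotated imaginary part of the charge of a
  cohomology object in a heart, hence subadditive on triangles and monotone under retracts, and it
  controls the mass of each limit HN factor with phases inside the window.
\<close>

section \<open>Triangulated categories\<close>

text \<open>The Grothendieck group of the quotient is presented by triangles that are only
  isomorphic, in the quotient, to images of triangles of C. Hence objects isomorphic in the quotient
  must be shown to have equal classes, and for this an isomorphism has to come from a roof both of
  whose legs have cones among the objects preceding E. That is a saturation statement resting on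
  closure under retracts. A window is used in place of the mass because it sees phases: an object
  whose phase falls far behind contributes nothing, however large its mass. A second obstacle is
  that the relations on limit semistable objects are negations of divergence statements. They become
  boundedness statements once phase differences are known not to oscillate. This uses continuity of
  the path and limit HN filtrations of direct sums; condition (ii) of quasi-convergence does the
  same for ratios of masses. The bound 1/4 on the phase spread makes the sine at least 1/2 on all HN
  factors, so that charge and mass of a limit semistable object eventually agree up to a factor
  2.\<close>

lemma homset_iff: "f \<in> homset C X Y \<longleftrightarrow> f \<in> arr C \<and> src C f = X \<and> trg C f = Y"
  by (simp add: homset_def)

context linear_category
begin

lemma homset_obj: "f \<in> homset C X Y \<Longrightarrow> X \<in> obj C \<and> Y \<in> obj C"
  using src_trg by (auto simp: homset_iff)

abbreviation neg :: "'m \<Rightarrow> 'm" where "neg f \<equiv> scal C (-1) f"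

lemma neg_in: "f \<in> homset C X Y \<Longrightarrow> neg f \<in> homset C X Y"
  by (rule scal_in)

lemma neg_neg: "f \<in> homset C X Y \<Longrightarrow> neg (neg f) = f"
  using scal_mult[of f X Y "-1" "-1"] scal_one[of f X Y] by simp

text \<open>Additive maps send a null arrow to an additive idempotent, so preservation of null
  arrows by composition, negation and the shift reduces to this cancellation.\<close>

lemma padd_idem_null:
  assumes "f \<in> homset C X Y" "f \<boxplus> f = f"
  shows "f = null C X Y"
proof -
  have "f = f \<boxplus> (f \<boxplus> neg f)"
    using assms by (metis padd_uminus padd_null)
  also have "\<dots> = (f \<boxplus> f) \<boxplus> neg f"
    using padd_assoc[OF assms(1) assms(1) neg_in[OF assms(1)]] by simp
  also have "\<dots> = null C X Y"
    using assms padd_uminus by metis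
  finally show ?thesis .
qed

lemma null_padd_null: "X \<in> obj C \<Longrightarrow> Y \<in> obj C \<Longrightarrow> null C X Y \<boxplus> null C X Y = null C X Y"
  using padd_null null_in by blast

lemma cmp_null_right:
  assumes g: "g \<in> homset C Y Z" and X: "X \<in> obj C"
  shows "g \<cdot> null C X Y = null C X Z"
proof -
  have n: "null C X Y \<in> homset C X Y"
    using homset_obj[OF g] X null_in by blast
  have "(g \<cdot> null C X Y) \<boxplus> (g \<cdot> null C X Y) = g \<cdot> null C X Y"
    using cmp_padd_right[OF n n g] padd_null[OF n] by simp
  then show ?thesis
    by (rule padd_idem_null[OF cmp_in[OF n g]])
qed

lemma cmp_null_left:
  assumes f: "f \<in> homset C X Y" and Z: "Z \<in> obj C"
  shows "null C Y Z \<cdot> f = null C X Z"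
proof -
  have n: "null C Y Z \<in> homset C Y Z"
    using homset_obj[OF f] Z null_in by blast
  have "(null C Y Z \<cdot> f) \<boxplus> (null C Y Z \<cdot> f) = null C Y Z \<cdot> f"
    using cmp_padd_left[OF f n n] padd_null[OF n] by simp
  then show ?thesis
    by (rule padd_idem_null[OF cmp_in[OF f n]])
qed

lemma neg_null:
  assumes "X \<in> obj C" "Y \<in> obj C"
  shows "neg (null C X Y) = null C X Y"
proof -
  have n: "null C X Y \<in> homset C X Y"
    using assms by (rule null_in)
  have "neg (null C X Y) \<boxplus> neg (null C X Y) = neg (null C X Y)"
    using scal_padd[OF n n, of "-1"] padd_null[OF n] by simp
  then show ?thesis
    by (rule padd_idem_null[OF neg_in[OF n]])
qed

lemma neg_eq_null:
  assumes f: "f \<in> homset C X Y" and "neg f = null C X Y"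
  shows "f = null C X Y"
  using neg_neg[OF f] neg_null[of X Y] homset_obj[OF f] assms(2) by simp

lemma diff_null_imp_eq:
  assumes "f \<in> homset C X Y" "g \<in> homset C X Y" "f \<boxplus> neg g = null C X Y"
  shows "f = g"
proof -
  have n: "null C X Y \<in> homset C X Y"
    using homset_obj[OF assms(1)] null_in by blast
  have "f = f \<boxplus> (neg g \<boxplus> g)"
    using padd_comm[OF assms(2) neg_in[OF assms(2)]] padd_uminus[OF assms(2)] padd_null[OF assms(1)] by simp
  also have "\<dots> = null C X Y \<boxplus> g"
    using padd_assoc[OF assms(1) neg_in[OF assms(2)] assms(2)] assms(3) by simp
  also have "\<dots> = g"
    using padd_comm[OF n assms(2)] padd_null[OF assms(2)] by simp
  finally show ?thesis .
qed

lemma cmp_diff_right: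
  assumes "f \<in> homset C X Y" "f' \<in> homset C X Y" "g \<in> homset C Y Z"
  shows "g \<cdot> (f \<boxplus> neg f') = (g \<cdot> f) \<boxplus> neg (g \<cdot> f')"
  using cmp_padd_right[OF assms(1) neg_in[OF assms(2)] assms(3)] cmp_scal[OF assms(2,3), of "-1"]
  by simp

lemma cmp_diff_left:
  assumes "f \<in> homset C X Y" "g \<in> homset C Y Z" "g' \<in> homset C Y Z"
  shows "(g \<boxplus> neg g') \<cdot> f = (g \<cdot> f) \<boxplus> neg (g' \<cdot> f)"
  using cmp_padd_left[OF assms(1,2) neg_in[OF assms(3)]] cmp_scal[OF assms(1,3), of "-1"]
  by simp

lemma zero_obj_to:
  assumes "zero_obj C Z" "f \<in> homset C X Z"
  shows "f = null C X Z"
  using cmp_idt[OF assms(2)] cmp_null_left[OF assms(2), of Z] assms(1) by (simp add: zero_obj_def)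

lemma zero_obj_from:
  assumes "zero_obj C Z" "f \<in> homset C Z X"
  shows "f = null C Z X"
  using cmp_idt[OF assms(2)] cmp_null_right[OF assms(2), of Z] assms(1) by (simp add: zero_obj_def)

text \<open>Membership in \<open>obj C\<close> is built in because Hom sets at elements outside
  \<open>obj C\<close> are empty and the vanishing would hold vacuously.\<close>

definition orth :: "'o \<Rightarrow> 'o \<Rightarrow> bool" where
  "orth X Y \<longleftrightarrow> X \<in> obj C \<and> Y \<in> obj C \<and> (\<forall>f \<in> homset C X Y. f = null C X Y)"

lemma zero_objD: "zero_obj C Z \<Longrightarrow> Z \<in> obj C"
  by (simp add: zero_obj_def)

lemma orthD: "orth X Y \<Longrightarrow> f \<in> homset C X Y \<Longrightarrow> f = null C X Y"
  unfolding orth_def by blast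

lemma orth_zero_left: "zero_obj C Z \<Longrightarrow> X \<in> obj C \<Longrightarrow> orth Z X"
  unfolding orth_def using zero_obj_from[of Z] zero_objD by blast

lemma orth_zero_right: "zero_obj C Z \<Longrightarrow> X \<in> obj C \<Longrightarrow> orth X Z"
  unfolding orth_def using zero_obj_to[of Z] zero_objD by blast

lemma orth_self: "orth X X \<Longrightarrow> zero_obj C X"
  unfolding orth_def zero_obj_def using idt_in by blast

text \<open>Only a splitting is asked for, no complement; the cone of the inclusion supplies one in
  \<open>retract_complement\<close>.\<close>

definition retract :: "'o \<Rightarrow> 'o \<Rightarrow> bool" where
  "retract X Y \<longleftrightarrow> (\<exists>i \<in> homset C X Y. \<exists>p \<in> homset C Y X. p \<cdot> i = idt C X)"

lemma retract_obj: "retract X Y \<Longrightarrow> X \<in> obj C \<and> Y \<in> obj C"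
  by (auto simp: retract_def dest: homset_obj)

lemma retract_orth_left:
  assumes "retract X Y" "orth Y W"
  shows "orth X W"
  unfolding orth_def
proof (intro conjI ballI)
  obtain i p where ip: "i \<in> homset C X Y" "p \<in> homset C Y X" "p \<cdot> i = idt C X"
    using assms(1) by (auto simp: retract_def)
  show X: "X \<in> obj C" and W: "W \<in> obj C"
    using assms retract_obj by (auto simp: orth_def)
  fix f assume f: "f \<in> homset C X W"
  have "f = (f \<cdot> p) \<cdot> i"
    using cmp_assoc[OF ip(1,2) f] ip(3) cmp_idt[OF f] by simp
  then show "f = null C X W"
    using orthD[OF assms(2) cmp_in[OF ip(2) f]] cmp_null_left[OF ip(1) W] by simp
qed

lemma retract_orth_right:
  assumes "retract X Y" "orth W Y"
  shows "orth W X"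
  unfolding orth_def
proof (intro conjI ballI)
  obtain i p where ip: "i \<in> homset C X Y" "p \<in> homset C Y X" "p \<cdot> i = idt C X"
    using assms(1) by (auto simp: retract_def)
  show X: "X \<in> obj C" and W: "W \<in> obj C"
    using assms retract_obj by (auto simp: orth_def)
  fix f assume f: "f \<in> homset C W X"
  have "f = p \<cdot> (i \<cdot> f)"
    using cmp_assoc[OF f ip(1,2)] ip(3) cmp_idt[OF f] by simp
  then show "f = null C W X"
    using orthD[OF assms(2) cmp_in[OF f ip(1)]] cmp_null_right[OF ip(2) W] by simp
qed

lemma retract_zero: "retract X Z \<Longrightarrow> zero_obj C Z \<Longrightarrow> zero_obj C X"
  using orth_self retract_orth_left[of X Z X] orth_zero_left[of Z X] retract_obj[of X Z] by blast

lemma is_isom_iff: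
  assumes "f \<in> homset C X Y"
  shows "is_isom C f \<longleftrightarrow> (\<exists>g \<in> homset C Y X. g \<cdot> f = idt C X \<and> f \<cdot> g = idt C Y)"
proof -
  have "f \<in> arr C" "src C f = X" "trg C f = Y"
    using assms by (simp_all add: homset_iff)
  then show ?thesis
    unfolding is_isom_def by simp
qed

lemma isomorphic_iff:
  "isomorphic C X Y \<longleftrightarrow>
    (\<exists>f \<in> homset C X Y. \<exists>g \<in> homset C Y X. g \<cdot> f = idt C X \<and> f \<cdot> g = idt C Y)"
  unfolding isomorphic_def using is_isom_iff[of _ X Y] by blast

lemma isomorphicD:
  assumes "isomorphic C X Y"
  obtains f g where "f \<in> homset C X Y" "g \<in> homset C Y X" "g \<cdot> f = idt C X" "f \<cdot> g = idt C Y"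
  using assms unfolding isomorphic_iff by blast

lemma isomorphicI:
  assumes "f \<in> homset C X Y" "g \<in> homset C Y X" "g \<cdot> f = idt C X" "f \<cdot> g = idt C Y"
  shows "isomorphic C X Y"
  using assms unfolding isomorphic_iff by blast

lemma isomI:
  assumes "f \<in> homset C X Y" "g \<in> homset C Y X" "g \<cdot> f = idt C X" "f \<cdot> g = idt C Y"
  shows "is_isom C f"
  using assms unfolding is_isom_iff[OF assms(1)] by blast

lemma isomorphic_sym: "isomorphic C X Y \<Longrightarrow> isomorphic C Y X"
  unfolding isomorphic_iff by blast

lemma isomorphic_refl: "X \<in> obj C \<Longrightarrow> isomorphic C X X"
  using isomorphicI[OF idt_in idt_in] cmp_idt[OF idt_in] by blast

lemma isom_idt: "X \<in> obj C \<Longrightarrow> is_isom C (idt C X)"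
  using isomI[OF idt_in idt_in] cmp_idt[OF idt_in] by blast

lemma isomorphic_retract: "isomorphic C X Y \<Longrightarrow> retract X Y"
  unfolding isomorphic_iff retract_def by blast

end

section \<open>Distinguished triangles with named objects\<close>

definition dt :: "('k, 'o, 'm) tcat \<Rightarrow> 'o \<Rightarrow> 'o \<Rightarrow> 'o \<Rightarrow> 'm \<Rightarrow> 'm \<Rightarrow> 'm \<Rightarrow> bool" where
  "dt C X Y Z f g h \<longleftrightarrow> (f, g, h) \<in> tri C \<and> f \<in> homset C X Y \<and> g \<in> homset C Y Z \<and>
     h \<in> homset C Z (sho C X)"

text \<open>Forgets the arrows: classes, charges, truncations and windows depend only on the three
  objects, and most octahedra below are used in this form.\<close>

definition Tr :: "('k, 'o, 'm) tcat \<Rightarrow> 'o \<Rightarrow> 'o \<Rightarrow> 'o \<Rightarrow> bool" where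
  "Tr C X Y Z \<longleftrightarrow> (\<exists>f g h. dt C X Y Z f g h)"

context triangulated_category
begin

lemma sha_in: "f \<in> homset C X Y \<Longrightarrow> sha C f \<in> homset C (sho C X) (sho C Y)"
  using sha_bij[of X Y] homset_obj[of f X Y] bij_betw_apply by metis

lemma sha_inj: "f \<in> homset C X Y \<Longrightarrow> g \<in> homset C X Y \<Longrightarrow> sha C f = sha C g \<Longrightarrow> f = g"
  using sha_bij[of X Y] homset_obj[of f X Y] bij_betw_imp_inj_on inj_onD by metis

lemma sha_surj:
  assumes "X \<in> obj C" "Y \<in> obj C" "f \<in> homset C (sho C X) (sho C Y)"
  obtains g where "g \<in> homset C X Y" "sha C g = f"
proof -
  have "f \<in> sha C ` homset C X Y"
    using bij_betw_imp_surj_on[OF sha_bij[OF assms(1,2)]] assms(3) by simp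
  then show ?thesis
    using that by blast
qed

lemma sha_null:
  assumes "X \<in> obj C" "Y \<in> obj C"
  shows "sha C (null C X Y) = null C (sho C X) (sho C Y)"
proof -
  have n: "null C X Y \<in> homset C X Y"
    using assms by (rule null_in)
  have "sha C (null C X Y) \<boxplus> sha C (null C X Y) = sha C (null C X Y)"
    using sha_padd[OF n n] null_padd_null[OF assms] by simp
  then show ?thesis
    using padd_idem_null[OF sha_in[OF n]] by blast
qed

lemma sha_eq_null:
  assumes f: "f \<in> homset C X Y" and "sha C f = null C (sho C X) (sho C Y)"
  shows "f = null C X Y"
proof -
  have "X \<in> obj C" "Y \<in> obj C"
    using homset_obj[OF f] by auto
  then show ?thesis
    using sha_inj[OF f null_in] sha_null assms(2) by simp
qed

lemma zero_obj_sho_iff: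
  assumes X: "X \<in> obj C"
  shows "zero_obj C (sho C X) \<longleftrightarrow> zero_obj C X"
proof
  assume "zero_obj C (sho C X)"
  then have "sha C (idt C X) = null C (sho C X) (sho C X)"
    using sha_idt[OF X] by (simp only: zero_obj_def)
  then show "zero_obj C X"
    using sha_eq_null[OF idt_in[OF X]] X by (simp only: zero_obj_def)
next
  assume "zero_obj C X"
  then have "sha C (idt C X) = null C (sho C X) (sho C X)"
    using sha_null[OF X X] by (simp only: zero_obj_def)
  then show "zero_obj C (sho C X)"
    using sha_idt[OF X] sho_in[OF X] by (simp only: zero_obj_def)
qed

lemma zero_obj_sho: "zero_obj C X \<Longrightarrow> zero_obj C (sho C X)"
  using zero_obj_sho_iff zero_objD by blast

lemma orth_sho:
  assumes X: "X \<in> obj C" and Y: "Y \<in> obj C"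
  shows "orth (sho C X) (sho C Y) \<longleftrightarrow> orth X Y"
proof
  assume o: "orth (sho C X) (sho C Y)"
  have "f = null C X Y" if f: "f \<in> homset C X Y" for f
    using sha_eq_null[OF f orthD[OF o sha_in[OF f]]] .
  then show "orth X Y"
    unfolding orth_def using X Y by blast
next
  assume o: "orth X Y"
  have "f = null C (sho C X) (sho C Y)" if f: "f \<in> homset C (sho C X) (sho C Y)" for f
  proof -
    obtain g where g: "g \<in> homset C X Y" "sha C g = f"
      using sha_surj[OF X Y f] .
    then show ?thesis
      using orthD[OF o g(1)] sha_null[OF X Y] by simp
  qed
  then show "orth (sho C X) (sho C Y)"
    unfolding orth_def using X Y sho_in by blast
qed

lemma dtD:
  assumes "dt C X Y Z f g h"
  shows "f \<in> homset C X Y" "g \<in> homset C Y Z" "h \<in> homset C Z (sho C X)"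
    "X \<in> obj C" "Y \<in> obj C" "Z \<in> obj C" "(f, g, h) \<in> tri C"
proof -
  show 1: "f \<in> homset C X Y" "g \<in> homset C Y Z" "h \<in> homset C Z (sho C X)" "(f, g, h) \<in> tri C"
    using assms unfolding dt_def by blast+
  show "X \<in> obj C" "Y \<in> obj C" "Z \<in> obj C"
    using homset_obj[OF 1(1)] homset_obj[OF 1(2)] by blast+
qed

lemma dtI: "(f, g, h) \<in> tri C \<Longrightarrow> dt C (src C f) (trg C f) (trg C g) f g h"
  using tri_candidate[of "(f, g, h)"] by (auto simp: dt_def candidate_triangle_def homset_iff)

lemma TrD: "Tr C X Y Z \<Longrightarrow> X \<in> obj C \<and> Y \<in> obj C \<and> Z \<in> obj C"
  unfolding Tr_def using dtD(4-6) by blast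

lemma dt_complete:
  assumes "f \<in> homset C X Y"
  obtains Z g h where "dt C X Y Z f g h"
proof -
  obtain g h where "(f, g, h) \<in> tri C"
    using tri_complete[of f] assms by (auto simp: homset_iff)
  then show ?thesis
    using dtI[of f g h] assms that by (auto simp: homset_iff)
qed

lemma dt_candidate:
  assumes "f \<in> homset C X Y" "g \<in> homset C Y Z" "h \<in> homset C Z (sho C X)"
  shows "candidate_triangle C (f, g, h)"
  using assms unfolding candidate_triangle_def homset_iff prod.case by metis

lemma dt_rot:
  assumes "dt C X Y Z f g h"
  shows "dt C Y Z (sho C X) g h (neg (sha C f))"
  unfolding dt_def
  using dtD[OF assms] tri_rotate[OF dt_candidate[OF dtD(1-3)[OF assms]]]
    neg_in[OF sha_in[OF dtD(1)[OF assms]]] by blast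

lemma dt_unrot:
  assumes "f \<in> homset C X Y" "g \<in> homset C Y Z" "h \<in> homset C Z (sho C X)"
    "(g, h, neg (sha C f)) \<in> tri C"
  shows "dt C X Y Z f g h"
  unfolding dt_def using tri_rotate[OF dt_candidate[OF assms(1-3)]] assms by blast

lemma Tr_rot: "Tr C X Y Z \<Longrightarrow> Tr C Y Z (sho C X)"
  unfolding Tr_def using dt_rot by blast

lemma dt_idt:
  "X \<in> obj C \<Longrightarrow> zero_obj C Z \<Longrightarrow> dt C X X Z (idt C X) (null C X Z) (null C Z (sho C X))"
  unfolding dt_def using idt_in null_in sho_in tri_idt zero_objD by blast

lemma dt_zero_left:
  assumes "X \<in> obj C" "zero_obj C Z"
  shows "dt C Z X X (null C Z X) (idt C X) (null C X (sho C Z))"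
proof (rule dt_unrot)
  show "null C Z X \<in> homset C Z X" "idt C X \<in> homset C X X"
    "null C X (sho C Z) \<in> homset C X (sho C Z)"
    using assms(1) zero_objD[OF assms(2)] null_in sho_in idt_in by blast+
  have "Z \<in> obj C"
    using zero_objD[OF assms(2)] .
  then have "neg (sha C (null C Z X)) = null C (sho C Z) (sho C X)"
    using assms(1) sho_in sha_null[of Z X] neg_null[of "sho C Z" "sho C X"] by simp
  then show "(idt C X, null C X (sho C Z), neg (sha C (null C Z X))) \<in> tri C"
    using tri_idt[OF assms(1) zero_obj_sho[OF assms(2)]] by simp
qed

lemma Tr_idt: "X \<in> obj C \<Longrightarrow> zero_obj C Z \<Longrightarrow> Tr C X X Z"
  unfolding Tr_def using dt_idt by blast

lemma Tr_zero_left: "X \<in> obj C \<Longrightarrow> zero_obj C Z \<Longrightarrow> Tr C Z X X"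
  unfolding Tr_def using dt_zero_left by blast

lemma dt_morphism:
  assumes "dt C X Y Z f g h" "dt C X' Y' Z' f' g' h'" "a \<in> homset C X X'" "b \<in> homset C Y Y'"
    "b \<cdot> f = f' \<cdot> a"
  obtains c where "c \<in> homset C Z Z'" "c \<cdot> g = g' \<cdot> b" "sha C a \<cdot> h = h' \<cdot> c"
proof -
  have e: "src C f = X" "src C f' = X'" "trg C f = Y" "trg C f' = Y'" "trg C g = Z" "trg C g' = Z'"
    using dtD[OF assms(1)] dtD[OF assms(2)] by (simp_all add: homset_iff)
  then have "\<exists>c \<in> homset C (trg C g) (trg C g'). c \<cdot> g = g' \<cdot> b \<and> sha C a \<cdot> h = h' \<cdot> c"
    using tri_morphism[of f g h f' g' h' a b] dtD(7)[OF assms(1)] dtD(7)[OF assms(2)] assms(3-5)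
    by simp
  then show ?thesis
    using that e by auto
qed

lemma dt_cmp_null:
  assumes "dt C X Y Z f g h"
  shows "g \<cdot> f = null C X Z"
proof -
  obtain K where K: "zero_obj C K"
    using ex_zero_obj by blast
  note d = dtD[OF assms]
  obtain c where "c \<in> homset C K Z" "c \<cdot> null C X K = g \<cdot> f"
    using dt_morphism[OF dt_idt[OF d(4) K] assms idt_in[OF d(4)] d(1)] by blast
  then show ?thesis
    using cmp_null_right[of c K Z X] d(4) by simp
qed

lemma dt_cmp_null2: "dt C X Y Z f g h \<Longrightarrow> h \<cdot> g = null C Y (sho C X)"
  using dt_cmp_null dt_rot by blast

lemma dt_cmp_null3:
  assumes "dt C X Y Z f g h"
  shows "sha C f \<cdot> h = null C Z (sho C Y)"
proof -
  note d = dtD[OF assms]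
  have "neg (sha C f) \<cdot> h = null C Z (sho C Y)"
    using dt_cmp_null2[OF dt_rot[OF assms]] .
  then have "neg (sha C f \<cdot> h) = null C Z (sho C Y)"
    using cmp_scal[OF d(3) sha_in[OF d(1)], of "-1"] by simp
  then show ?thesis
    by (rule neg_eq_null[OF cmp_in[OF d(3) sha_in[OF d(1)]]])
qed

text \<open>The second arrow of a triangle is a weak cokernel: \<open>u\<close> and the arrow to a
  zero object \<open>K\<close> form a morphism into the triangle K -> W = W, whose third component
  is the factorization.\<close>

lemma factor_cone:
  assumes "dt C X Y Z f g h" "u \<in> homset C Y W" "u \<cdot> f = null C X W"
  obtains w where "w \<in> homset C Z W" "w \<cdot> g = u"
proof -
  obtain K where K: "zero_obj C K"
    using ex_zero_obj by blast
  note d = dtD[OF assms(1)]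
  have W: "W \<in> obj C" and K': "K \<in> obj C"
    using homset_obj[OF assms(2)] zero_objD[OF K] by auto
  have "u \<cdot> f = null C K W \<cdot> null C X K"
    using assms cmp_null_right[OF null_in[OF K' W] d(4)] by simp
  then obtain c where "c \<in> homset C Z W" "c \<cdot> g = idt C W \<cdot> u"
    using dt_morphism[OF assms(1) dt_zero_left[OF W K] null_in[OF d(4) K'] assms(2)] by blast
  then show ?thesis
    using that cmp_idt[OF assms(2)] by auto
qed

text \<open>The first arrow is a weak kernel. \<open>tri_morphism\<close> only produces third
  components, so the triangles are rotated once, the wanted arrow appears shifted, and full
  faithfulness of the shift brings it back.\<close>

lemma factor_fibre:
  assumes "dt C X Y Z f g h" "u \<in> homset C W Y" "g \<cdot> u = null C W Z"
  obtains w where "w \<in> homset C W X" "f \<cdot> w = u"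
proof -
  obtain K where K: "zero_obj C K"
    using ex_zero_obj by blast
  note d = dtD[OF assms(1)]
  have W: "W \<in> obj C" and K': "K \<in> obj C"
    using homset_obj[OF assms(2)] zero_objD[OF K] by auto
  have sW: "sho C W \<in> obj C" and i: "idt C (sho C W) \<in> homset C (sho C W) (sho C W)"
    using sho_in[OF W] idt_in by auto
  have "null C K Z \<cdot> null C W K = g \<cdot> u"
    using assms cmp_null_right[OF null_in[OF K' d(6)] W] by simp
  then obtain c where c: "c \<in> homset C (sho C W) (sho C X)"
    and "sha C u \<cdot> neg (sha C (idt C W)) = neg (sha C f) \<cdot> c"
    using dt_morphism[OF dt_rot[OF dt_idt[OF W K]] dt_rot[OF assms(1)] assms(2) null_in[OF K' d(6)]]
    by blast
  then have "neg (sha C u \<cdot> idt C (sho C W)) = neg (sha C f \<cdot> c)"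
    using cmp_scal[OF c sha_in[OF d(1)], of "-1"] cmp_scal[OF i sha_in[OF assms(2)], of "-1"] sha_idt[OF W]
    by simp
  then have *: "sha C u = sha C f \<cdot> c"
    using neg_neg[OF sha_in[OF assms(2)]] neg_neg[OF cmp_in[OF c sha_in[OF d(1)]]]
      cmp_idt[OF sha_in[OF assms(2)]] by metis
  obtain w where w: "w \<in> homset C W X" "sha C w = c"
    using sha_surj[OF W d(4) c] .
  then have "sha C (f \<cdot> w) = sha C u"
    using * sha_cmp[OF w(1) d(1)] by simp
  then show ?thesis
    using that w sha_inj assms(2) cmp_in[OF w(1) d(1)] by blast
qed

lemma factor_shift:
  assumes "dt C X Y Z f g h" "u \<in> homset C W (sho C X)" "sha C f \<cdot> u = null C W (sho C Y)"
  obtains w where "w \<in> homset C W Z" "h \<cdot> w = u"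
proof -
  have "neg (sha C f) \<cdot> u = null C W (sho C Y)"
    using assms(3) cmp_scal[OF assms(2) sha_in[OF dtD(1)[OF assms(1)]], of "-1"]
      neg_null[of W "sho C Y"] homset_obj[OF assms(2)] sho_in[OF dtD(5)[OF assms(1)]]
    by simp
  then show ?thesis
    using factor_fibre[OF dt_rot[OF dt_rot[OF assms(1)]] assms(2)] that by blast
qed

lemma orth_middle:
  assumes "Tr C X Y Z"
  shows "orth W X \<Longrightarrow> orth W Z \<Longrightarrow> orth W Y" "orth X W \<Longrightarrow> orth Z W \<Longrightarrow> orth Y W"
proof -
  obtain f g h where d: "dt C X Y Z f g h"
    using assms unfolding Tr_def by blast
  note dD = dtD[OF d]
  show "orth W Y" if o: "orth W X" "orth W Z"
    unfolding orth_def
  proof (intro conjI ballI)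
    fix u assume u: "u \<in> homset C W Y"
    then obtain w where "w \<in> homset C W X" "f \<cdot> w = u"
      using factor_fibre[OF d u orthD[OF o(2) cmp_in[OF u dD(2)]]] by blast
    then show "u = null C W Y"
      using orthD[OF o(1)] cmp_null_right[OF dD(1), of W] homset_obj[OF u] by simp
  qed (use o dD in \<open>unfold orth_def, blast+\<close>)
  show "orth Y W" if o: "orth X W" "orth Z W"
    unfolding orth_def
  proof (intro conjI ballI)
    fix u assume u: "u \<in> homset C Y W"
    then obtain w where "w \<in> homset C Z W" "w \<cdot> g = u"
      using factor_cone[OF d u orthD[OF o(1) cmp_in[OF dD(1) u]]] by blast
    then show "u = null C Y W"
      using orthD[OF o(2)] cmp_null_left[OF dD(2), of W] homset_obj[OF u] by simp
  qed (use o dD in \<open>unfold orth_def, blast+\<close>)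
qed

lemma orth_fibre:
  assumes "Tr C X Y Z" "orth W Y" "orth (sho C W) Z"
  shows "orth W X"
proof -
  have "W \<in> obj C" "X \<in> obj C" "Y \<in> obj C"
    using assms TrD unfolding orth_def by blast+
  moreover from this assms have "orth (sho C W) (sho C X)"
    using orth_middle(1)[OF Tr_rot[OF Tr_rot[OF assms(1)]] assms(3)] orth_sho by blast
  ultimately show ?thesis
    using orth_sho by blast
qed

lemma octahedron:
  assumes "dt C X Y A f i i'" "dt C Y Z B g j j'" "dt C X Z D (g \<cdot> f) l l'"
  obtains a b where "dt C A D B a b (sha C i \<cdot> j')" "a \<cdot> i = l \<cdot> g" "l' \<cdot> a = i'"
    "b \<cdot> l = j" "j' \<cdot> b = sha C f \<cdot> l'"
proof -
  have e: "trg C f = Y" "src C g = Y" "trg C i = A" "trg C l = D" "trg C j = B"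
    using dtD[OF assms(1)] dtD[OF assms(2)] dtD[OF assms(3)] by (simp_all add: homset_iff)
  then obtain a b where ab: "(a, b, sha C i \<cdot> j') \<in> tri C" "src C a = trg C i" "trg C a = trg C l"
    "trg C b = trg C j" "a \<cdot> i = l \<cdot> g" "l' \<cdot> a = i'" "b \<cdot> l = j" "j' \<cdot> b = sha C f \<cdot> l'"
    using octahedral[of f i i' g j j' l l'] dtD(7)[OF assms(1)] dtD(7)[OF assms(2)] dtD(7)[OF assms(3)]
    by metis
  have "dt C A D B a b (sha C i \<cdot> j')"
    using dtI[OF ab(1)] unfolding ab(2-4) e .
  then show ?thesis
    using that ab by blast
qed

lemma dt_iso_third:
  assumes "dt C X Y Z f g h" "p \<in> homset C Z W" "q \<in> homset C W Z" "q \<cdot> p = idt C Z" "p \<cdot> q = idt C W"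
  shows "dt C X Y W f (p \<cdot> g) (h \<cdot> q)"
proof -
  note d = dtD[OF assms(1)]
  have in': "p \<cdot> g \<in> homset C Y W" "h \<cdot> q \<in> homset C W (sho C X)"
    using d assms cmp_in by blast+
  have hqp: "(h \<cdot> q) \<cdot> p = h"
    using cmp_assoc[OF assms(2,3) d(3)] assms(4) cmp_idt[OF d(3)] by simp
  have "triangle_isom C (f, g, h) (f, p \<cdot> g, h \<cdot> q)"
    unfolding triangle_isom_def prod.case
  proof (intro bexI conjI)
    show "is_isom C (idt C X)" "is_isom C (idt C Y)" "is_isom C p"
      using d assms isom_idt isomI by blast+
    show "idt C Y \<cdot> f = f \<cdot> idt C X" "p \<cdot> g = (p \<cdot> g) \<cdot> idt C Y"
      using cmp_idt[OF d(1)] cmp_idt[OF in'(1)] by auto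
    show "sha C (idt C X) \<cdot> h = h \<cdot> q \<cdot> p"
      using sha_idt[OF d(4)] hqp cmp_idt[OF d(3)] by simp
    show "idt C X \<in> homset C (src C f) (src C f)" "idt C Y \<in> homset C (src C g) (src C (p \<cdot> g))"
      "p \<in> homset C (src C h) (src C (h \<cdot> q))"
      using d in' assms(2) idt_in[OF d(4)] idt_in[OF d(5)] by (simp_all add: homset_iff)
  qed
  then show ?thesis
    unfolding dt_def using tri_isom[OF d(7) dt_candidate[OF d(1) in']] d(1) in' by blast
qed

text \<open>The isomorphism is -1 on the middle object and the identity on the outer ones; signs can
  thus be removed in pairs.\<close>

lemma dt_neg_neg:
  assumes "dt C X Y Z f g h"
  shows "dt C X Y Z (neg f) (neg g) h"
proof -
  note d = dtD[OF assms]
  have nn: "neg f \<in> homset C X Y" "neg g \<in> homset C Y Z"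
    using d neg_in by blast+
  let ?i = "idt C Y"
  have i: "?i \<in> homset C Y Y"
    using d idt_in by blast
  have mi: "neg ?i \<cdot> neg ?i = ?i"
    using cmp_scal[OF i neg_in[OF i], of "-1"] cmp_scal[OF i i, of "-1"] cmp_idt[OF i] neg_neg[OF i]
    by simp
  have 1: "neg ?i \<cdot> f = neg f"
    using cmp_scal[OF d(1) i, of "-1"] cmp_idt[OF d(1)] by simp
  have 2: "neg g \<cdot> neg ?i = g"
    using cmp_scal[OF i neg_in[OF d(2)], of "-1"] cmp_idt[OF nn(2)] neg_neg[OF d(2)] by simp
  have "triangle_isom C (f, g, h) (neg f, neg g, h)"
    unfolding triangle_isom_def prod.case
  proof (intro bexI conjI)
    show "is_isom C (idt C X)" "is_isom C (neg ?i)" "is_isom C (idt C Z)"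
      using d isom_idt isomI[OF neg_in[OF i] neg_in[OF i] mi mi] by blast+
    show "neg ?i \<cdot> f = neg f \<cdot> idt C X"
      using 1 cmp_idt[OF nn(1)] by simp
    show "idt C Z \<cdot> g = neg g \<cdot> neg ?i"
      using 2 cmp_idt[OF d(2)] by simp
    show "sha C (idt C X) \<cdot> h = h \<cdot> idt C Z"
      using sha_idt[OF d(4)] cmp_idt[OF d(3)] by simp
    show "idt C X \<in> homset C (src C f) (src C (neg f))" "neg ?i \<in> homset C (src C g) (src C (neg g))"
      "idt C Z \<in> homset C (src C h) (src C h)"
      using d nn neg_in[OF i] idt_in[OF d(4)] idt_in[OF d(6)] by (simp_all add: homset_iff)
  qed
  then show ?thesis
    unfolding dt_def using tri_isom[OF d(7) dt_candidate[OF nn d(3)]] nn d(3) by blast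
qed

lemma dt_unshift:
  assumes "dt C (sho C X) (sho C Y) (sho C Z) f g h" "X \<in> obj C" "Y \<in> obj C" "Z \<in> obj C"
  shows "Tr C X Y Z"
proof -
  note d = dtD[OF assms(1)]
  obtain f0 where f0: "f0 \<in> homset C X Y" "sha C f0 = f"
    using sha_surj[OF assms(2,3) d(1)] .
  obtain g0 where g0: "g0 \<in> homset C Y Z" "sha C g0 = g"
    using sha_surj[OF assms(3,4) d(2)] .
  \<comment> \<open>Three rotations of the lifted triangle give its shift with all three arrows
    negated. \<open>dt_neg_neg\<close> absorbs two of these signs, and the third is put into the
    choice of \<open>h0\<close>.\<close>
  obtain h0 where h0: "h0 \<in> homset C Z (sho C X)" "sha C h0 = neg h"
    using sha_surj[OF assms(4) sho_in[OF assms(2)] neg_in[OF d(3)]] .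
  note nn = neg_in[OF d(1)] neg_in[OF d(2)]
  have t: "(neg f, neg g, h) \<in> tri C"
    using dtD(7)[OF dt_neg_neg[OF assms(1)]] .
  have "neg (sha C h0) = h"
    using h0(2) neg_neg[OF d(3)] by simp
  then have "dt C Z (sho C X) (sho C Y) h0 (neg f) (neg g)"
    using dt_unrot[OF h0(1) nn] t by simp
  then have "dt C Y Z (sho C X) g0 h0 (neg f)"
    using dt_unrot[OF g0(1) h0(1) nn(1)] g0(2) by (simp add: dt_def)
  then have "dt C X Y Z f0 g0 h0"
    using dt_unrot[OF f0(1) g0(1) h0(1)] f0(2) by (simp add: dt_def)
  then show ?thesis
    unfolding Tr_def by blast
qed

text \<open>The shift is only essentially surjective, so an object before X is found by choosing a
  preimage of the cone up to isomorphism and rotating backwards.\<close>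

lemma dt_back:
  assumes "dt C X Y Z f g h" "W \<in> obj C" "isomorphic C (sho C W) Z"
  obtains e c where "dt C W X Y e f c"
proof -
  note d = dtD[OF assms(1)]
  obtain p q where pq: "p \<in> homset C (sho C W) Z" "q \<in> homset C Z (sho C W)"
    "q \<cdot> p = idt C (sho C W)" "p \<cdot> q = idt C Z"
    using isomorphicD[OF assms(3)] .
  have t: "dt C X Y (sho C W) f (q \<cdot> g) (h \<cdot> p)"
    by (rule dt_iso_third[OF assms(1) pq(2,1,4,3)])
  note t' = dtD[OF t]
  obtain e where e: "e \<in> homset C W X" "sha C e = neg (h \<cdot> p)"
    using sha_surj[OF assms(2) d(4) neg_in[OF t'(3)]] .
  have "dt C W X Y e f (q \<cdot> g)"
    using dt_unrot[OF e(1) t'(1,2)] t'(7) e(2) neg_neg[OF t'(3)] by simp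
  then show ?thesis
    using that by blast
qed

text \<open>The octahedron for P -> A -> G: the quotient of G by P is an extension of the quotients
  of the two steps.\<close>

lemma Tr_compose:
  assumes "Tr C P A R" "Tr C A G B"
  obtains D where "Tr C P G D" "Tr C R D B"
proof -
  obtain f i i' where 1: "dt C P A R f i i'"
    using assms unfolding Tr_def by blast
  obtain g j j' where 2: "dt C A G B g j j'"
    using assms unfolding Tr_def by blast
  obtain D l l' where 3: "dt C P G D (g \<cdot> f) l l'"
    using dt_complete[OF cmp_in[OF dtD(1)[OF 1] dtD(1)[OF 2]]] .
  obtain a b where "dt C R D B a b (sha C i \<cdot> j')"
    using octahedron[OF 1 2 3] .
  with 3 that show ?thesis
    unfolding Tr_def by blast
qed

text \<open>The dual octahedron, with \<open>D\<close> as the preimage of P under G -> B. It is the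
  octahedron for G -> B -> R, whose cones are shifts of \<open>D\<close>, A and P and have to be
  shifted back.\<close>

lemma Tr_cocompose:
  assumes "Tr C A G B" "Tr C P B R"
  obtains D where "Tr C D G R" "Tr C A D P"
proof -
  obtain f g h where 1: "dt C A G B f g h"
    using assms unfolding Tr_def by blast
  obtain i j k where 2: "dt C P B R i j k"
    using assms unfolding Tr_def by blast
  note r1 = dt_rot[OF 1] and r2 = dt_rot[OF 2]
  obtain Y l l' where 3: "dt C G R Y (j \<cdot> g) l l'"
    using dt_complete[OF cmp_in[OF dtD(1)[OF r1] dtD(1)[OF r2]]] .
  obtain a b where oct: "dt C (sho C A) Y (sho C P) a b (sha C h \<cdot> neg (sha C i))"
    using octahedron[OF r1 r2 3] .
  obtain D where D: "D \<in> obj C" "isomorphic C (sho C D) Y"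
    using sho_ess_surj dtD(6)[OF 3] by blast
  then obtain e c where "dt C D G R e (j \<cdot> g) c"
    using dt_back[OF 3] by blast
  then have "Tr C D G R"
    unfolding Tr_def by blast
  moreover have "Tr C A D P"
  proof -
    obtain p q where pq: "p \<in> homset C (sho C D) Y" "q \<in> homset C Y (sho C D)"
      "q \<cdot> p = idt C (sho C D)" "p \<cdot> q = idt C Y"
      using isomorphicD[OF D(2)] .
    have s: "sho C A \<in> obj C" "sho C P \<in> obj C" "A \<in> obj C" "P \<in> obj C"
      using dtD[OF oct] dtD[OF 1] dtD[OF 2] by auto
    obtain e c where "dt C P (sho C A) Y e a c"
      using dt_back[OF oct s(4) isomorphic_refl[OF s(2)]] .
    from dt_rot[OF dt_iso_third[OF this pq(2,1,4,3)]] show ?thesis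
      by (rule dt_unshift) (use s D in auto)
  qed
  ultimately show ?thesis
    using that by blast
qed

lemma dt_sho:
  assumes "dt C X Y Z f g h"
  shows "dt C (sho C X) (sho C Y) (sho C Z) (neg (sha C f)) (neg (sha C g)) (neg (sha C h))"
  using dt_rot[OF dt_rot[OF dt_rot[OF assms]]] .

lemma Tr_sho: "Tr C X Y Z \<Longrightarrow> Tr C (sho C X) (sho C Y) (sho C Z)"
  unfolding Tr_def using dt_sho by blast

text \<open>Orthogonality lifts P -> X through P'. The octahedron for P -> P' -> X then presents one
  object as cone of P -> P' and as fibre of R -> R', which is how two truncations of X are
  compared.\<close>

lemma Tr_lift:
  assumes "Tr C P X R" "Tr C P' X R'" "orth P R'"
  obtains V where "Tr C P P' V" "Tr C V R R'"
proof -
  obtain f g h where 1: "dt C P X R f g h"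
    using assms unfolding Tr_def by blast
  obtain f' g' h' where 2: "dt C P' X R' f' g' h'"
    using assms unfolding Tr_def by blast
  obtain u where u: "u \<in> homset C P P'" "f' \<cdot> u = f"
    using factor_fibre[OF 2 dtD(1)[OF 1] orthD[OF assms(3) cmp_in[OF dtD(1)[OF 1] dtD(2)[OF 2]]]] .
  obtain V i j where 3: "dt C P P' V u i j"
    using dt_complete[OF u(1)] .
  have "dt C P X R (f' \<cdot> u) g h"
    using 1 u by simp
  from octahedron[OF 3 2 this] obtain a b where "dt C V R R' a b (sha C i \<cdot> h')" .
  with 3 that show ?thesis
    unfolding Tr_def by blast
qed

text \<open>The octahedron for A -> J -> U, with the cone of J -> U rotated to V[1].\<close>

lemma Tr_quotient:
  assumes "Tr C A J B" "Tr C V J U"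
  obtains D where "Tr C B D (sho C V)" "Tr C A U D"
proof -
  obtain D where "Tr C A U D" "Tr C B D (sho C V)"
    using Tr_compose[OF assms(1) Tr_rot[OF assms(2)]] .
  then show ?thesis
    using that by blast
qed

text \<open>The cone of the null arrow serves as the direct sum of Y and X[1]. It is the test object
  for comparing phases, and it realises sums and differences of classes by single objects.\<close>

lemma Tr_zero_map:
  assumes "X \<in> obj C" "Y \<in> obj C"
  obtains G where "Tr C Y G (sho C X)" "retract Y G" "retract (sho C X) G"
proof -
  have n: "null C X Y \<in> homset C X Y"
    using null_in assms by blast
  obtain G g h where d: "dt C X Y G (null C X Y) g h"
    using dt_complete[OF n] .
  note D = dtD[OF d]
  have "idt C Y \<cdot> null C X Y = null C X Y"
    using cmp_idt[OF n] by blast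
  then obtain w where "w \<in> homset C G Y" "w \<cdot> g = idt C Y"
    using factor_cone[OF d idt_in[OF assms(2)]] by blast
  then have 1: "retract Y G"
    unfolding retract_def using D(2) by blast
  have i: "idt C (sho C X) \<in> homset C (sho C X) (sho C X)"
    using idt_in sho_in assms by blast
  have "sha C (null C X Y) \<cdot> idt C (sho C X) = null C (sho C X) (sho C Y)"
    using cmp_idt[OF sha_in[OF n]] sha_null[OF assms] by simp
  then obtain s where "s \<in> homset C (sho C X) G" "h \<cdot> s = idt C (sho C X)"
    using factor_shift[OF d i] by blast
  then have 2: "retract (sho C X) G"
    unfolding retract_def using D(3) by blast
  show ?thesis
    using that[of G] dt_rot[OF d] 1 2 unfolding Tr_def by blast
qed

text \<open>The shifted inclusion is split and kills the connecting arrow, so the connecting arrow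
  is null and the projection to the cone splits too.\<close>

lemma retract_complement:
  assumes "retract X Y"
  obtains Z where "Tr C X Y Z" "retract Z Y"
proof -
  obtain i p where ip: "i \<in> homset C X Y" "p \<in> homset C Y X" "p \<cdot> i = idt C X"
    using assms unfolding retract_def by blast
  obtain Z q h where d: "dt C X Y Z i q h"
    using dt_complete[OF ip(1)] .
  note D = dtD[OF d]
  have "h = (sha C p \<cdot> sha C i) \<cdot> h"
    using sha_cmp[OF ip(1,2)] ip(3) sha_idt[OF D(4)] cmp_idt[OF D(3)] by simp
  also have "\<dots> = sha C p \<cdot> null C Z (sho C Y)"
    using cmp_assoc[OF D(3) sha_in[OF ip(1)] sha_in[OF ip(2)]] dt_cmp_null3[OF d] by simp
  also have "\<dots> = null C Z (sho C X)"
    using cmp_null_right[OF sha_in[OF ip(2)] D(6)] .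
  finally have "h \<cdot> idt C Z = null C Z (sho C X)"
    using cmp_idt[OF D(3)] by simp
  then obtain s where "s \<in> homset C Z Y" "q \<cdot> s = idt C Z"
    using factor_fibre[OF dt_rot[OF d] idt_in[OF D(6)]] by blast
  then have "retract Z Y"
    unfolding retract_def using D(2) by blast
  then show ?thesis
    using that d unfolding Tr_def by blast
qed

text \<open>Functoriality of truncation on the sub-object side. Inclusion and projection lift to P
  and P'; the defect of their composite from the identity is killed by P -> X, so its shift factors
  through an arrow P[1] -> R, and all such arrows are null.\<close>

lemma retract_sub:
  assumes "Tr C P X R" "Tr C P' X' R'" "retract X X'" "orth P R'" "orth P' R" "orth (sho C P) R"
  shows "retract P P'"
proof -
  obtain f g h where 1: "dt C P X R f g h"
    using assms unfolding Tr_def by blast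
  obtain f' g' h' where 2: "dt C P' X' R' f' g' h'"
    using assms unfolding Tr_def by blast
  obtain i p where ip: "i \<in> homset C X X'" "p \<in> homset C X' X" "p \<cdot> i = idt C X"
    using assms unfolding retract_def by blast
  note d = dtD[OF 1] and d' = dtD[OF 2]
  have fi: "i \<cdot> f \<in> homset C P X'" and fp: "p \<cdot> f' \<in> homset C P' X"
    using cmp_in d d' ip by blast+
  obtain u where u: "u \<in> homset C P P'" "f' \<cdot> u = i \<cdot> f"
    using factor_fibre[OF 2 fi orthD[OF assms(4) cmp_in[OF fi d'(2)]]] .
  obtain w where w: "w \<in> homset C P' P" "f \<cdot> w = p \<cdot> f'"
    using factor_fibre[OF 1 fp orthD[OF assms(5) cmp_in[OF fp d(2)]]] .
  have wu: "w \<cdot> u \<in> homset C P P" and iP: "idt C P \<in> homset C P P"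
    using cmp_in u w idt_in d by blast+
  define e where "e = w \<cdot> u \<boxplus> neg (idt C P)"
  have e: "e \<in> homset C P P"
    unfolding e_def using padd_in[OF wu neg_in[OF iP]] .
  have "f \<cdot> (w \<cdot> u) = f"
    using cmp_assoc[OF u(1) w(1) d(1)] w(2) cmp_assoc[OF u(1) d'(1) ip(2)] u(2)
      cmp_assoc[OF d(1) ip(1,2)] ip(3) cmp_idt[OF d(1)] by simp
  then have "f \<cdot> e = null C P X"
    unfolding e_def using cmp_diff_right[OF wu iP d(1)] cmp_idt[OF d(1)] padd_uminus[OF d(1)] by simp
  then have "sha C f \<cdot> sha C e = null C (sho C P) (sho C X)"
    using sha_cmp[OF e d(1)] sha_null[OF d(4,5)] by simp
  then obtain y where y: "y \<in> homset C (sho C P) R" "h \<cdot> y = sha C e"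
    using factor_shift[OF 1 sha_in[OF e]] by blast
  have "sha C e = null C (sho C P) (sho C P)"
    using y orthD[OF assms(6) y(1)] cmp_null_right[OF d(3), of "sho C P"] sho_in[OF d(4)] by simp
  then have "e = null C P P"
    using sha_eq_null[OF e] by blast
  then have "w \<cdot> u = idt C P"
    unfolding e_def by (rule diff_null_imp_eq[OF wu iP])
  then show ?thesis
    unfolding retract_def using u(1) w(1) by blast
qed

text \<open>The quotient side of the same argument: here the defect factors through R -> P[1]
  followed by an arrow P[1] -> R.\<close>

lemma retract_quotient:
  assumes "Tr C P X R" "Tr C P' X' R'" "retract X X'" "orth P R'" "orth P' R" "orth (sho C P) R"
  shows "retract R R'"
proof -
  obtain f g h where 1: "dt C P X R f g h"
    using assms unfolding Tr_def by blast
  obtain f' g' h' where 2: "dt C P' X' R' f' g' h'"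
    using assms unfolding Tr_def by blast
  obtain i p where ip: "i \<in> homset C X X'" "p \<in> homset C X' X" "p \<cdot> i = idt C X"
    using assms unfolding retract_def by blast
  note d = dtD[OF 1] and d' = dtD[OF 2]
  have gi: "g' \<cdot> i \<in> homset C X R'" and gp: "g \<cdot> p \<in> homset C X' R"
    using cmp_in d d' ip by blast+
  obtain u where u: "u \<in> homset C R R'" "u \<cdot> g = g' \<cdot> i"
    using factor_cone[OF 1 gi orthD[OF assms(4) cmp_in[OF d(1) gi]]] .
  obtain w where w: "w \<in> homset C R' R" "w \<cdot> g' = g \<cdot> p"
    using factor_cone[OF 2 gp orthD[OF assms(5) cmp_in[OF d'(1) gp]]] .
  have wu: "w \<cdot> u \<in> homset C R R" and iR: "idt C R \<in> homset C R R"
    using cmp_in u w idt_in d by blast+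
  define e where "e = w \<cdot> u \<boxplus> neg (idt C R)"
  have e: "e \<in> homset C R R"
    unfolding e_def using padd_in[OF wu neg_in[OF iR]] .
  have "(w \<cdot> u) \<cdot> g = g"
    using cmp_assoc[OF d(2) u(1) w(1)] u(2) cmp_assoc[OF ip(1) d'(2) w(1)] w(2)
      cmp_assoc[OF ip(1,2) d(2)] ip(3) cmp_idt[OF d(2)] by simp
  then have "e \<cdot> g = null C X R"
    unfolding e_def using cmp_diff_left[OF d(2) wu iR] cmp_idt[OF d(2)] padd_uminus[OF d(2)] by simp
  then obtain y where y: "y \<in> homset C (sho C P) R" "y \<cdot> h = e"
    using factor_cone[OF dt_rot[OF 1] e] by blast
  have "e = null C R R"
    using y orthD[OF assms(6) y(1)] cmp_null_left[OF d(3), of R] d(6) by simp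
  then have "w \<cdot> u = idt C R"
    unfolding e_def by (rule diff_null_imp_eq[OF wu iR])
  then show ?thesis
    unfolding retract_def using u(1) w(1) by blast
qed

lemma zero_of_null_quotient:
  assumes "Tr C P X R" "orth X R" "orth (sho C P) R"
  shows "zero_obj C R"
  using orth_self[OF orth_middle(2)[OF Tr_rot[OF assms(1)] assms(2,3)]] .

end

section \<open>Presented groups and slicings\<close>

lemma hom_FactGroup:
  assumes "N \<lhd> G" "h \<in> hom G H" "group H" "\<And>n. n \<in> N \<Longrightarrow> h n = \<one>\<^bsub>H\<^esub>"
  obtains k where "k \<in> hom (G Mod N) H" "\<And>x. x \<in> carrier G \<Longrightarrow> k (N #>\<^bsub>G\<^esub> x) = h x"
proof -
  interpret N: normal N G by fact
  interpret H: group H by fact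
  define k where "k U = h (SOME x. x \<in> U)" for U
  have k: "k (N #>\<^bsub>G\<^esub> x) = h x" if x: "x \<in> carrier G" for x
  proof -
    have "(SOME y. y \<in> N #>\<^bsub>G\<^esub> x) \<in> N #>\<^bsub>G\<^esub> x"
      using N.rcos_self[OF x N.is_subgroup] by (rule someI)
    then obtain n where n: "n \<in> N" "(SOME y. y \<in> N #>\<^bsub>G\<^esub> x) = n \<otimes>\<^bsub>G\<^esub> x"
      unfolding r_coset_def by blast
    have "h (n \<otimes>\<^bsub>G\<^esub> x) = h x"
      using hom_mult[OF assms(2) N.mem_carrier[OF n(1)] x] assms(4)[OF n(1)]
        hom_in_carrier[OF assms(2) x] by simp
    then show ?thesis
      by (simp add: k_def n(2))
  qed
  have "k \<in> hom (G Mod N) H"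
  proof (rule homI)
    fix U assume "U \<in> carrier (G Mod N)"
    then show "k U \<in> carrier H"
      using k hom_in_carrier[OF assms(2)] unfolding carrier_FactGroup by force
  next
    fix U W assume "U \<in> carrier (G Mod N)" "W \<in> carrier (G Mod N)"
    then obtain x y where xy: "x \<in> carrier G" "y \<in> carrier G" "U = N #>\<^bsub>G\<^esub> x" "W = N #>\<^bsub>G\<^esub> y"
      unfolding carrier_FactGroup by blast
    then have "U \<otimes>\<^bsub>G Mod N\<^esub> W = N #>\<^bsub>G\<^esub> (x \<otimes>\<^bsub>G\<^esub> y)"
      using N.rcos_sum by simp
    then show "k (U \<otimes>\<^bsub>G Mod N\<^esub> W) = k U \<otimes>\<^bsub>H\<^esub> k W"
      using k xy hom_mult[OF assms(2)] by simp
  qed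
  with k that show ?thesis
    by blast
qed

context
  fixes S :: "'a set" and R :: "('a \<Rightarrow>\<^sub>0 int) set"
  assumes R: "R \<subseteq> carrier (free_Abelian_group S)"
begin

lemma generate_relators_normal: "generate (free_Abelian_group S) R \<lhd> free_Abelian_group S"
  using comm_group.subgroup_imp_normal[OF abelian_free_Abelian_group]
    group.generate_is_subgroup[OF group_free_Abelian_group R] by blast

lemma presented_group_comm: "comm_group (presented_group S R)"
  unfolding presented_group_def
  using comm_group.abelian_FactGroup[OF abelian_free_Abelian_group]
    group.generate_is_subgroup[OF group_free_Abelian_group R] by blast

lemma presented_class_hom: "presented_class S R \<in> hom (free_Abelian_group S) (presented_group S R)"
proof -
  have "presented_class S R = r_coset (free_Abelian_group S) (generate (free_Abelian_group S) R)"
    by (rule ext) (rule presented_class_def)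
  then show ?thesis
    unfolding presented_group_def using normal.r_coset_hom_Mod[OF generate_relators_normal] by simp
qed

lemma presented_class_add:
  assumes "Poly_Mapping.keys x \<subseteq> S" "Poly_Mapping.keys y \<subseteq> S"
  shows "presented_class S R (x + y) = presented_class S R x \<otimes>\<^bsub>presented_group S R\<^esub> presented_class S R y"
  using hom_mult[OF presented_class_hom, of x y] assms by simp

lemma presented_class_relator:
  assumes "r \<in> R"
  shows "presented_class S R r = \<one>\<^bsub>presented_group S R\<^esub>"
proof -
  have "r \<in> carrier (free_Abelian_group S)"
    using assms R by blast
  from group.coset_join2[OF group_free_Abelian_group this
      group.generate_is_subgroup[OF group_free_Abelian_group R] generate.incl[OF assms]]
  show ?thesis
    unfolding presented_class_def presented_group_def one_FactGroup .
qed

lemma presented_group_elem: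
  assumes "u \<in> carrier (presented_group S R)"
  obtains x where "Poly_Mapping.keys x \<subseteq> S" "u = presented_class S R x"
proof -
  obtain x where "x \<in> carrier (free_Abelian_group S)"
    "u = generate (free_Abelian_group S) R #>\<^bsub>free_Abelian_group S\<^esub> x"
    using assms unfolding presented_group_def carrier_FactGroup by blast
  then show ?thesis
    using that by (simp add: presented_class_def)
qed

lemma presented_group_universal:
  assumes "h \<in> hom (free_Abelian_group S) H" "comm_group H" "\<And>r. r \<in> R \<Longrightarrow> h r = \<one>\<^bsub>H\<^esub>"
  obtains k where "k \<in> hom (presented_group S R) H"
    "\<And>x. Poly_Mapping.keys x \<subseteq> S \<Longrightarrow> k (presented_class S R x) = h x"
proof -
  let ?F = "free_Abelian_group S"
  interpret H: comm_group H by fact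
  interpret h: group_hom ?F H h
    using assms by (simp add: group_hom_def group_hom_axioms_def H.is_group)
  have "generate ?F R \<subseteq> kernel ?F H h"
    using group.generate_subgroup_incl[OF group_free_Abelian_group _ h.subgroup_kernel] R assms(3)
    unfolding kernel_def by blast
  then have "h n = \<one>\<^bsub>H\<^esub>" if "n \<in> generate ?F R" for n
    using that unfolding kernel_def by blast
  from hom_FactGroup[OF generate_relators_normal assms(1) H.is_group this]
  obtain k where "k \<in> hom (?F Mod generate ?F R) H"
    "\<And>x. x \<in> carrier ?F \<Longrightarrow> k (generate ?F R #>\<^bsub>?F\<^esub> x) = h x"
    by blast
  then show ?thesis
    using that by (simp add: presented_group_def presented_class_def)
qed

end

lemma presented_class_relator_add:
  assumes R: "R \<subseteq> carrier (free_Abelian_group S)"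
    and k: "Poly_Mapping.keys x \<subseteq> S" "Poly_Mapping.keys y \<subseteq> S" and r: "z - x - y \<in> R"
  shows "presented_class S R z = presented_class S R x \<otimes>\<^bsub>presented_group S R\<^esub> presented_class S R y"
proof -
  interpret K: comm_group "presented_group S R"
    by (rule presented_group_comm[OF R])
  have kxy: "Poly_Mapping.keys (x + y) \<subseteq> S"
    using k keys_add[of x y] by auto
  have "z - x - y \<in> carrier (free_Abelian_group S)"
    using R r by blast
  then have "presented_class S R ((z - x - y) + (x + y)) =
      presented_class S R (z - x - y) \<otimes>\<^bsub>presented_group S R\<^esub> presented_class S R (x + y)"
    by (intro presented_class_add[OF R _ kxy]) simp
  also have "\<dots> = \<one>\<^bsub>presented_group S R\<^esub> \<otimes>\<^bsub>presented_group S R\<^esub> presented_class S R (x + y)"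
    unfolding presented_class_relator[OF R r] ..
  also have "\<dots> = presented_class S R (x + y)"
    using hom_in_carrier[OF presented_class_hom[OF R]] kxy by simp
  also have "\<dots> = presented_class S R x \<otimes>\<^bsub>presented_group S R\<^esub> presented_class S R y"
    by (rule presented_class_add[OF R k])
  finally show ?thesis
    by simp
qed

text \<open>Stated for any category whose relators lie in the free group on its objects, so that it
  applies to the Verdier quotient as well as to C.\<close>

lemma K0_class_relator:
  assumes "K0_relators C \<subseteq> carrier (free_Abelian_group (obj C))" "X \<in> obj C" "W \<in> obj C"
    and "frag_of Y - frag_of X - frag_of W \<in> K0_relators C"
  shows "K0_class C Y = K0_class C X \<otimes>\<^bsub>K0 C\<^esub> K0_class C W"
  unfolding K0_class_def K0_def using assms by (intro presented_class_relator_add) auto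

section \<open>Classes of triangles and induction along filtrations\<close>

context triangulated_category
begin

lemma K0_relators_carrier: "K0_relators C \<subseteq> carrier (free_Abelian_group (obj C))"
proof
  fix r assume "r \<in> K0_relators C"
  then obtain f g h where r: "(f, g, h) \<in> tri C" "r = frag_of (trg C f) - frag_of (src C f) - frag_of (trg C g)"
    unfolding K0_relators_def by blast
  then have "trg C f \<in> obj C" "src C f \<in> obj C" "trg C g \<in> obj C"
    using dtD[OF dtI] by auto
  then show "r \<in> carrier (free_Abelian_group (obj C))"
    using r(2) keys_diff[of "frag_of (trg C f) - frag_of (src C f)" "frag_of (trg C g)"]
      keys_diff[of "frag_of (trg C f)" "frag_of (src C f)"] by auto
qed

lemma K0_class_in: "X \<in> obj C \<Longrightarrow> K0_class C X \<in> carrier (K0 C)"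
  using hom_in_carrier[OF presented_class_hom[OF K0_relators_carrier]]
  unfolding K0_def K0_class_def by simp

lemma K0_class_Tr:
  assumes "Tr C X Y W"
  shows "K0_class C Y = K0_class C X \<otimes>\<^bsub>K0 C\<^esub> K0_class C W"
proof -
  obtain f g h where d: "dt C X Y W f g h"
    using assms unfolding Tr_def by blast
  note D = dtD[OF d]
  have e: "src C f = X" "trg C f = Y" "trg C g = W"
    using D by (simp_all add: homset_iff)
  have "frag_of Y - frag_of X - frag_of W \<in> K0_relators C"
    unfolding K0_relators_def using D(7) e by blast
  then show ?thesis
    using K0_class_relator[OF K0_relators_carrier] D by blast
qed

lemma filtration_Nil: "filtration C E [] \<longleftrightarrow> zero_obj C E"
  unfolding filtration_def by auto

text \<open>Replaces the indexed families of the definition by induction on the last step, the form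
  in which filtrations meet \<open>Tr\<close>.\<close>

lemma filtration_snoc:
  "filtration C E (Gs @ [G]) \<longleftrightarrow> (\<exists>E'. filtration C E' Gs \<and> Tr C E' E G)"
proof
  assume "filtration C E (Gs @ [G])"
  then obtain Es f g h where *: "zero_obj C (Es 0)" "Es (Suc (length Gs)) = E"
    "\<And>i. i < Suc (length Gs) \<Longrightarrow> (f i, g i, h i) \<in> tri C \<and>
           src C (f i) = Es i \<and> trg C (f i) = Es (Suc i) \<and> trg C (g i) = (Gs @ [G]) ! i"
    unfolding filtration_def by auto
  have "filtration C (Es (length Gs)) Gs"
    unfolding filtration_def
    by (rule exI[of _ Es], rule exI[of _ f], rule exI[of _ g], rule exI[of _ h])
      (use * in \<open>simp add: nth_append\<close>)
  moreover have "Tr C (Es (length Gs)) E G"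
    using *(3)[of "length Gs"] *(2) dtI[of "f (length Gs)" "g (length Gs)" "h (length Gs)"]
    unfolding Tr_def by auto
  ultimately show "\<exists>E'. filtration C E' Gs \<and> Tr C E' E G"
    by blast
next
  assume "\<exists>E'. filtration C E' Gs \<and> Tr C E' E G"
  then obtain E' u w x where E': "filtration C E' Gs" and d: "dt C E' E G u w x"
    unfolding Tr_def by blast
  obtain Es f g h where *: "zero_obj C (Es 0)" "Es (length Gs) = E'"
    "\<And>i. i < length Gs \<Longrightarrow> (f i, g i, h i) \<in> tri C \<and>
           src C (f i) = Es i \<and> trg C (f i) = Es (Suc i) \<and> trg C (g i) = Gs ! i"
    using E' unfolding filtration_def by blast
  let ?n = "length Gs"
  show "filtration C E (Gs @ [G])"
    unfolding filtration_def
  proof (rule exI[of _ "Es(Suc ?n := E)"], rule exI[of _ "f(?n := u)"], rule exI[of _ "g(?n := w)"],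
      rule exI[of _ "h(?n := x)"], intro conjI allI impI)
    fix i assume "i < length (Gs @ [G])"
    then consider "i < ?n" | "i = ?n"
      by force
    then have "((f(?n := u)) i, (g(?n := w)) i, (h(?n := x)) i) \<in> tri C \<and>
      src C ((f(?n := u)) i) = (Es(Suc ?n := E)) i \<and> trg C ((f(?n := u)) i) = (Es(Suc ?n := E)) (Suc i) \<and>
      trg C ((g(?n := w)) i) = (Gs @ [G]) ! i"
      using *(3)[of i] *(2) dtD[OF d] by cases (simp_all add: homset_iff nth_append)
    then show "((f(?n := u)) i, (g(?n := w)) i, (h(?n := x)) i) \<in> tri C"
      "src C ((f(?n := u)) i) = (Es(Suc ?n := E)) i" "trg C ((f(?n := u)) i) = (Es(Suc ?n := E)) (Suc i)"
      "trg C ((g(?n := w)) i) = (Gs @ [G]) ! i"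
      by blast+
  qed (use * in auto)
qed

lemma filtration_obj: "filtration C E Gs \<Longrightarrow> E \<in> obj C \<and> set Gs \<subseteq> obj C"
proof (induction Gs arbitrary: E rule: rev_induct)
  case Nil
  then show ?case
    using zero_objD by (auto simp: filtration_Nil)
next
  case (snoc G Gs)
  then show ?case
    using TrD by (fastforce simp: filtration_snoc)
qed

text \<open>The extension closure. Orthogonality and membership in aisles need to be checked only on
  \<open>S\<close>, by \<open>orth_middle\<close> and its analogues.\<close>

inductive_set ext_closure :: "'b set \<Rightarrow> 'b set" for S where
  zero: "zero_obj C X \<Longrightarrow> X \<in> ext_closure S"
| base: "X \<in> S \<Longrightarrow> X \<in> obj C \<Longrightarrow> X \<in> ext_closure S"
| tri: "Tr C X Y W \<Longrightarrow> X \<in> ext_closure S \<Longrightarrow> W \<in> ext_closure S \<Longrightarrow> Y \<in> ext_closure S"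

lemma ext_obj: "X \<in> ext_closure S \<Longrightarrow> X \<in> obj C"
  by (induction rule: ext_closure.induct) (use zero_objD TrD in blast)+

lemma ext_mono: "X \<in> ext_closure S \<Longrightarrow> S \<subseteq> T \<Longrightarrow> X \<in> ext_closure T"
  by (induction rule: ext_closure.induct) (use ext_closure.intros in blast)+

lemma ext_orth: "X \<in> ext_closure S \<Longrightarrow> Y \<in> obj C \<Longrightarrow> (\<And>F. F \<in> S \<Longrightarrow> F \<in> obj C \<Longrightarrow> orth F Y) \<Longrightarrow> orth X Y"
  by (induction rule: ext_closure.induct) (use orth_zero_left orth_middle(2) in blast)+

lemma filtration_ext: "filtration C E Gs \<Longrightarrow> E \<in> ext_closure (set Gs)"
proof (induction Gs arbitrary: E rule: rev_induct)
  case Nil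
  then show ?case
    using ext_closure.zero by (auto simp: filtration_Nil)
next
  case (snoc G Gs)
  then obtain E' where E': "filtration C E' Gs" "Tr C E' E G"
    by (auto simp: filtration_snoc)
  moreover have "G \<in> ext_closure (set (Gs @ [G]))"
    using TrD[OF E'(2)] by (intro ext_closure.base) auto
  moreover have "E' \<in> ext_closure (set (Gs @ [G]))"
    using ext_mono[OF snoc.IH[OF E'(1)]] by auto
  ultimately show ?case
    using ext_closure.tri by blast
qed

text \<open>\<open>P\<close> is the intermediate term where the filtration is cut; the octahedra of
  the later steps assemble the remaining factors into the cone of P -> E.\<close>

lemma filtration_split:
  "filtration C E (L1 @ L2) \<Longrightarrow> \<exists>P R. Tr C P E R \<and> filtration C P L1 \<and> R \<in> ext_closure (set L2)"
proof (induction L2 arbitrary: E rule: rev_induct)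
  case Nil
  obtain K where "zero_obj C K"
    using ex_zero_obj by blast
  then show ?case
    using Nil Tr_idt[of E K] filtration_obj ext_closure.zero by fastforce
next
  case (snoc G L2)
  then obtain E' where E': "filtration C E' (L1 @ L2)" "Tr C E' E G"
    using filtration_snoc[of E "L1 @ L2" G] by auto
  obtain P R where PR: "Tr C P E' R" "filtration C P L1" "R \<in> ext_closure (set L2)"
    using snoc.IH[OF E'(1)] by blast
  obtain D where D: "Tr C P E D" "Tr C R D G"
    using Tr_compose[OF PR(1) E'(2)] .
  have "G \<in> ext_closure (set (L2 @ [G]))"
    using TrD[OF D(2)] by (intro ext_closure.base) auto
  moreover have "R \<in> ext_closure (set (L2 @ [G]))"
    using ext_mono[OF PR(3)] by auto
  ultimately have "D \<in> ext_closure (set (L2 @ [G]))"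
    using ext_closure.tri[OF D(2)] by blast
  then show ?case
    using D(1) PR(2) by blast
qed

end

section \<open>Aisles and truncations of a slicing\<close>

locale pre_stable_category = triangulated_category +
  fixes \<sigma> :: "'b charge_slicing"
  assumes pre_stable: "pre_stability C \<sigma>"
begin

abbreviation Q :: "real \<Rightarrow> 'b set" where "Q \<equiv> snd \<sigma>"

abbreviation Z :: "'b \<Rightarrow> complex" where "Z \<equiv> charge C \<sigma>"

lemma slicing_Q: "slicing C Q"
  using pre_stable by (simp add: pre_stability_def)

lemma Z_Tr:
  assumes "Tr C X Y W"
  shows "Z Y = Z X + Z W"
proof -
  have "fst \<sigma> \<in> hom (K0 C) complex_group"
    using pre_stable by (simp add: pre_stability_def)
  from hom_mult[OF this K0_class_in K0_class_in, of X W] show ?thesis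
    using K0_class_Tr[OF assms] TrD[OF assms] by (simp add: charge_def complex_group_def)
qed

lemma Z_zero: "zero_obj C X \<Longrightarrow> Z X = 0"
  using Z_Tr[OF Tr_idt[of X X]] zero_objD by fastforce

lemma Z_sho:
  assumes "X \<in> obj C"
  shows "Z (sho C X) = - Z X"
proof -
  obtain K where K: "zero_obj C K"
    using ex_zero_obj by blast
  have "Z K = Z X + Z (sho C X)"
    using Z_Tr[OF Tr_rot[OF Tr_idt[OF assms K]]] .
  then show ?thesis
    using Z_zero[OF K] by (metis add_eq_0_iff)
qed

lemma Z_semistable:
  assumes "F \<in> Q \<phi>" "\<not> zero_obj C F"
  shows "Z F = of_real (cmod (Z F)) * cis (pi * \<phi>)" "Z F \<noteq> 0"
proof -
  obtain m where "m > 0" "Z F = of_real m * cis (pi * \<phi>)"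
    using pre_stable assms unfolding pre_stability_def by blast
  then show "Z F = of_real (cmod (Z F)) * cis (pi * \<phi>)" "Z F \<noteq> 0"
    by (simp_all add: norm_mult)
qed

lemma Q_obj:
  assumes "F \<in> Q \<phi>"
  shows "F \<in> obj C"
proof -
  have "full_additive_subcategory C (Q \<phi>)"
    using slicing_Q unfolding slicing_def by (elim conjE) (erule spec)
  then show ?thesis
    using assms unfolding full_additive_subcategory_def by (elim conjE) (erule subsetD)
qed

lemma Q_shift: "{Y \<in> obj C. \<exists>X \<in> Q \<phi>. isomorphic C (sho C X) Y} = Q (\<phi> + 1)"
  using slicing_Q unfolding slicing_def by (elim conjE) (erule spec)

lemma Q_sho:
  assumes "F \<in> Q \<phi>"
  shows "sho C F \<in> Q (\<phi> + 1)"
proof -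
  have "sho C F \<in> obj C"
    using Q_obj[OF assms] sho_in by blast
  then show ?thesis
    unfolding Q_shift[symmetric] using assms isomorphic_refl by blast
qed

lemma Q_unsho:
  assumes "F \<in> Q (\<phi> + 1)"
  obtains F' where "F' \<in> Q \<phi>" "isomorphic C (sho C F') F"
  using assms unfolding Q_shift[symmetric] by blast

lemma Q_orth:
  assumes "X \<in> Q \<phi>" "Y \<in> Q \<psi>" "\<phi> > \<psi>"
  shows "orth X Y"
proof -
  have "\<forall>\<phi>\<^sub>1 \<phi>\<^sub>2. \<phi>\<^sub>1 > \<phi>\<^sub>2 \<longrightarrow> (\<forall>X \<in> Q \<phi>\<^sub>1. \<forall>Y \<in> Q \<phi>\<^sub>2. homset C X Y = {null C X Y})"
    using slicing_Q unfolding slicing_def by (elim conjE)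
  then have "homset C X Y = {null C X Y}"
    using assms by blast
  then show ?thesis
    unfolding orth_def using Q_obj assms by simp
qed

lemma ex_hn: "X \<in> obj C \<Longrightarrow> \<exists>L. hn_filtration C Q X L"
proof (cases "zero_obj C X")
  case True
  then have "hn_filtration C Q X []"
    by (simp add: hn_filtration_def filtration_Nil)
  then show ?thesis ..
next
  case False
  moreover assume "X \<in> obj C"
  moreover have "\<forall>E \<in> obj C. \<not> zero_obj C E \<longrightarrow> (\<exists>L. hn_filtration C Q E L)"
    using slicing_Q unfolding slicing_def by (elim conjE)
  ultimately show ?thesis
    by blast
qed

text \<open>The aisle of objects with all phases above \<psi>. Defining it by extensions makes its
  closure properties available before anything is known about uniqueness of HN filtrations;
  \<open>gt_iff\<close> gives the description by phases later.\<close>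

definition gt :: "real \<Rightarrow> 'b set" where
  "gt \<psi> = ext_closure (\<Union>\<phi>\<in>{\<psi><..}. Q \<phi>)"

text \<open>The right orthogonal of the aisle, hence closed under extensions, fibres and retracts
  for formal reasons. \<open>le_iff\<close> identifies it by phases.\<close>

definition le :: "real \<Rightarrow> 'b set" where
  "le \<psi> = {Y \<in> obj C. \<forall>X \<in> gt \<psi>. orth X Y}"

lemma gt_obj: "X \<in> gt \<psi> \<Longrightarrow> X \<in> obj C"
  unfolding gt_def by (rule ext_obj)

lemma gt_zero: "zero_obj C X \<Longrightarrow> X \<in> gt \<psi>"
  unfolding gt_def by (rule ext_closure.zero)

lemma gt_base: "F \<in> Q \<phi> \<Longrightarrow> \<psi> < \<phi> \<Longrightarrow> F \<in> gt \<psi>"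
  unfolding gt_def using Q_obj by (intro ext_closure.base) auto

lemma gt_Tr: "Tr C X Y W \<Longrightarrow> X \<in> gt \<psi> \<Longrightarrow> W \<in> gt \<psi> \<Longrightarrow> Y \<in> gt \<psi>"
  unfolding gt_def by (rule ext_closure.tri)

lemma gt_mono: "X \<in> gt \<psi> \<Longrightarrow> \<psi>' \<le> \<psi> \<Longrightarrow> X \<in> gt \<psi>'"
  unfolding gt_def by (erule ext_mono) force

lemma gt_sho: "X \<in> gt \<psi> \<Longrightarrow> sho C X \<in> gt (\<psi> + 1)"
  unfolding gt_def[of \<psi>]
proof (induction rule: ext_closure.induct)
  case (zero X)
  then show ?case
    using gt_zero zero_obj_sho by blast
next
  case (base X)
  then obtain \<phi> where "X \<in> Q \<phi>" "\<psi> < \<phi>"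
    by auto
  then show ?case
    using gt_base[OF Q_sho] by simp
next
  case (tri X Y W)
  then show ?case
    using gt_Tr[OF Tr_sho] by blast
qed

lemma gt_sho': "X \<in> gt \<psi> \<Longrightarrow> sho C X \<in> gt \<psi>"
  using gt_mono[OF gt_sho] by simp

lemma gt_cone: "Tr C X Y W \<Longrightarrow> X \<in> gt \<psi> \<Longrightarrow> Y \<in> gt \<psi> \<Longrightarrow> W \<in> gt \<psi>"
  using gt_Tr[OF Tr_rot] gt_sho' by blast

lemma le_obj: "X \<in> le \<psi> \<Longrightarrow> X \<in> obj C"
  by (simp add: le_def)

lemma gt_le_orth: "X \<in> gt \<psi> \<Longrightarrow> Y \<in> le \<psi> \<Longrightarrow> orth X Y"
  by (simp add: le_def)

lemma le_zero: "zero_obj C X \<Longrightarrow> X \<in> le \<psi>"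
  unfolding le_def using orth_zero_right gt_obj zero_objD by blast

lemma le_Tr: "Tr C X Y W \<Longrightarrow> X \<in> le \<psi> \<Longrightarrow> W \<in> le \<psi> \<Longrightarrow> Y \<in> le \<psi>"
  unfolding le_def using orth_middle(1) TrD by blast

lemma le_fibre: "Tr C X Y W \<Longrightarrow> Y \<in> le \<psi> \<Longrightarrow> W \<in> le \<psi> \<Longrightarrow> X \<in> le \<psi>"
  unfolding le_def using orth_fibre gt_sho' TrD by blast

lemma le_mono: "X \<in> le \<psi> \<Longrightarrow> \<psi> \<le> \<psi>' \<Longrightarrow> X \<in> le \<psi>'"
  unfolding le_def using gt_mono by blast

lemma le_base:
  assumes "F \<in> Q \<phi>" "\<phi> \<le> \<psi>"
  shows "F \<in> le \<psi>"
proof -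
  have "orth X F" if "X \<in> gt \<psi>" for X
    using that unfolding gt_def
    by (rule ext_orth) (use assms Q_obj Q_orth in force)+
  then show ?thesis
    using Q_obj[OF assms(1)] by (simp add: le_def)
qed

lemma ext_le: "X \<in> ext_closure S \<Longrightarrow> S \<subseteq> le \<psi> \<Longrightarrow> X \<in> le \<psi>"
  by (induction rule: ext_closure.induct) (use le_zero le_Tr in blast)+

lemma ext_gt: "X \<in> ext_closure S \<Longrightarrow> S \<subseteq> gt \<psi> \<Longrightarrow> X \<in> gt \<psi>"
  by (induction rule: ext_closure.induct) (use gt_zero gt_Tr in blast)+

lemma le_sho:
  assumes Y: "Y \<in> le \<psi>"
  shows "sho C Y \<in> le (\<psi> + 1)"
proof -
  have Y': "Y \<in> obj C" "sho C Y \<in> obj C"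
    using le_obj[OF Y] sho_in by auto
  have "orth X (sho C Y)" if "X \<in> gt (\<psi> + 1)" for X
    using that unfolding gt_def
  proof (rule ext_orth)
    fix F assume "F \<in> (\<Union>\<phi>\<in>{\<psi> + 1<..}. Q \<phi>)"
    then obtain \<phi> where "F \<in> Q ((\<phi> - 1) + 1)" "\<phi> > \<psi> + 1"
      by auto
    then obtain F' where F': "F' \<in> Q (\<phi> - 1)" "isomorphic C (sho C F') F" "\<psi> < \<phi> - 1"
      using Q_unsho[of F "\<phi> - 1"] by auto
    then have "orth F' Y"
      using gt_le_orth[OF gt_base Y] by blast
    then have "orth (sho C F') (sho C Y)"
      using orth_sho Q_obj[OF F'(1)] Y'(1) by blast
    then show "orth F (sho C Y)"
      using retract_orth_left isomorphic_retract isomorphic_sym F'(2) by blast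
  qed (rule Y'(2))
  then show ?thesis
    using Y' by (simp add: le_def)
qed

lemma retract_le: "retract X Y \<Longrightarrow> Y \<in> le \<psi> \<Longrightarrow> X \<in> le \<psi>"
  unfolding le_def using retract_orth_right retract_obj by blast

lemma sho_gt_le_orth: "X \<in> gt \<psi> \<Longrightarrow> Y \<in> le \<psi> \<Longrightarrow> orth (sho C X) Y"
  using gt_le_orth gt_sho' by blast

definition trunc :: "real \<Rightarrow> 'b \<Rightarrow> 'b \<Rightarrow> 'b \<Rightarrow> bool" where
  "trunc \<psi> X P R \<longleftrightarrow> Tr C P X R \<and> P \<in> gt \<psi> \<and> R \<in> le \<psi>"

text \<open>The object comparing two truncations lies both in the aisle and in its orthogonal and is
  therefore zero. HN filtrations are chosen arbitrarily, so this is what makes charges of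
  truncations well defined.\<close>

lemma trunc_charge_unique:
  assumes "trunc \<psi> X P R" "trunc \<psi> X P' R'"
  shows "Z P = Z P'"
proof -
  have PR: "Tr C P X R" "P \<in> gt \<psi>" "R \<in> le \<psi>" "Tr C P' X R'" "P' \<in> gt \<psi>" "R' \<in> le \<psi>"
    using assms by (auto simp: trunc_def)
  obtain V where V: "Tr C P P' V" "Tr C V R R'"
    using Tr_lift[OF PR(1,4) gt_le_orth[OF PR(2,6)]] .
  have "V \<in> gt \<psi>" "V \<in> le \<psi>"
    using gt_cone[OF V(1) PR(2,5)] le_fibre[OF V(2) PR(3,6)] by auto
  then have "zero_obj C V"
    using gt_le_orth orth_self by blast
  then show ?thesis
    using Z_Tr[OF V(1)] Z_zero by simp
qed

end

section \<open>Truncations and windowed masses\<close>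

lemma sorted_filter_append:
  "sorted_wrt (>) (map snd L) \<Longrightarrow>
    L = filter (\<lambda>p. \<psi> < snd p) L @ filter (\<lambda>p. \<not> \<psi> < (snd p :: real)) L"
proof (induction L)
  case (Cons p L)
  show ?case
  proof (cases "\<psi> < snd p")
    case True
    then show ?thesis
      using Cons by simp
  next
    case False
    then have "\<forall>q \<in> set (p # L). \<not> \<psi> < snd q"
      using Cons.prems by auto
    then have "filter (\<lambda>p. \<psi> < snd p) (p # L) = []" "filter (\<lambda>p. \<not> \<psi> < snd p) (p # L) = p # L"
      by (simp_all add: filter_empty_conv filter_id_conv)
    then show ?thesis
      by (simp only: append_Nil)
  qed
qed simp

context pre_stable_category
begin

abbreviation hn :: "'b \<Rightarrow> ('b \<times> real) list" where "hn \<equiv> hn_factors C \<sigma>"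

lemma hn_factors_hn: "X \<in> obj C \<Longrightarrow> hn_filtration C Q X (hn X)"
  unfolding hn_factors_def using someI_ex[OF ex_hn] .

lemma hn_mem:
  assumes "X \<in> obj C" "p \<in> set (hn X)"
  shows "fst p \<in> Q (snd p)" "\<not> zero_obj C (fst p)"
  using hn_factors_hn[OF assms(1)] assms(2) unfolding hn_filtration_def by (cases p; fastforce)+

lemma hn_charge:
  assumes "X \<in> obj C" "p \<in> set (hn X)"
  shows "Z (fst p) = of_real (cmod (Z (fst p))) * cis (pi * snd p)" "cmod (Z (fst p)) > 0"
  using Z_semistable[OF hn_mem[OF assms]] by auto

lemma Z_filtration: "filtration C E Gs \<Longrightarrow> Z E = (\<Sum>G\<leftarrow>Gs. Z G)"
proof (induction Gs arbitrary: E rule: rev_induct)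
  case Nil
  then show ?case
    by (simp add: filtration_Nil Z_zero)
next
  case (snoc G Gs)
  then obtain E' where "filtration C E' Gs" "Tr C E' E G"
    by (auto simp: filtration_snoc)
  then show ?case
    using snoc.IH Z_Tr by simp
qed

text \<open>The charge of the truncation of X to phases above \<psi>, read off from the chosen HN
  factors; \<open>trunc_tz\<close> shows that any truncation gives the same value.\<close>

definition tz :: "real \<Rightarrow> 'b \<Rightarrow> complex" where
  "tz \<psi> X = (\<Sum>p\<leftarrow>filter (\<lambda>p. \<psi> < snd p) (hn X). Z (fst p))"

lemma ex_trunc:
  assumes "X \<in> obj C"
  obtains P R where "trunc \<psi> X P R" "Z P = tz \<psi> X"
proof -
  note h = hn_factors_hn[OF assms, unfolded hn_filtration_def]
  define A where "A = filter (\<lambda>p. \<psi> < snd p) (hn X)"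
  define B where "B = filter (\<lambda>p. \<not> \<psi> < snd p) (hn X)"
  have "hn X = A @ B"
    unfolding A_def B_def using h by (intro sorted_filter_append) blast
  then have "filtration C X (map fst A @ map fst B)"
    using h by simp
  then obtain P R where PR: "Tr C P X R" "filtration C P (map fst A)" "R \<in> ext_closure (set (map fst B))"
    using filtration_split by blast
  have "set (map fst A) \<subseteq> gt \<psi>" "set (map fst B) \<subseteq> le \<psi>"
    using gt_base[OF hn_mem(1)[OF assms]] le_base[OF hn_mem(1)[OF assms]]
    unfolding A_def B_def by auto
  then have "P \<in> gt \<psi>" "R \<in> le \<psi>"
    using ext_gt[OF filtration_ext[OF PR(2)]] ext_le[OF PR(3)] by auto
  moreover have "Z P = tz \<psi> X"
    using Z_filtration[OF PR(2)] by (simp add: tz_def A_def comp_def)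
  ultimately show ?thesis
    using that PR(1) by (simp add: trunc_def)
qed

lemma trunc_tz: "trunc \<psi> X P R \<Longrightarrow> Z P = tz \<psi> X"
  using ex_trunc[of X \<psi>] trunc_charge_unique TrD unfolding trunc_def by metis

lemma tz_gt:
  assumes "X \<in> gt \<psi>"
  shows "tz \<psi> X = Z X"
proof -
  obtain K where "zero_obj C K"
    using ex_zero_obj by blast
  then have "trunc \<psi> X X K"
    unfolding trunc_def using Tr_idt gt_obj le_zero assms by blast
  then show ?thesis
    using trunc_tz by simp
qed

lemma tz_le:
  assumes "X \<in> le \<psi>"
  shows "tz \<psi> X = 0"
proof -
  obtain K where K: "zero_obj C K"
    using ex_zero_obj by blast
  then have "trunc \<psi> X K X"
    unfolding trunc_def using Tr_zero_left le_obj gt_zero assms by blast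
  then show ?thesis
    using trunc_tz Z_zero[OF K] by metis
qed

lemma tz_sho:
  assumes "X \<in> obj C"
  shows "tz (\<psi> + 1) (sho C X) = - tz \<psi> X"
proof -
  obtain P R where PR: "trunc \<psi> X P R" "Z P = tz \<psi> X"
    using ex_trunc[OF assms] .
  then have "trunc (\<psi> + 1) (sho C X) (sho C P) (sho C R)"
    unfolding trunc_def using Tr_sho gt_sho le_sho by blast
  from trunc_tz[OF this] show ?thesis
    using PR Z_sho[of P] gt_obj[of P \<psi>] by (simp add: trunc_def)
qed

text \<open>If A lies above \<psi>, the preimage in G of the truncation of B truncates G; if B lies
  below, the truncation of A is already that of G. Without such a condition only an inequality
  survives.\<close>

lemma tz_add:
  assumes "Tr C A G B" "A \<in> gt \<psi> \<or> B \<in> le \<psi>"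
  shows "tz \<psi> G = tz \<psi> A + tz \<psi> B"
  using assms(2)
proof
  assume A: "A \<in> gt \<psi>"
  obtain P R where PR: "trunc \<psi> B P R" "Z P = tz \<psi> B"
    using ex_trunc TrD[OF assms(1)] by blast
  obtain D where D: "Tr C D G R" "Tr C A D P"
    using Tr_cocompose[OF assms(1)] PR(1) unfolding trunc_def by blast
  have "trunc \<psi> G D R"
    using D PR(1) gt_Tr[OF D(2) A] unfolding trunc_def by blast
  then show ?thesis
    using trunc_tz Z_Tr[OF D(2)] PR(2) tz_gt[OF A] by metis
next
  assume B: "B \<in> le \<psi>"
  obtain P R where PR: "trunc \<psi> A P R" "Z P = tz \<psi> A"
    using ex_trunc TrD[OF assms(1)] by blast
  obtain D where D: "Tr C P G D" "Tr C R D B"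
    using Tr_compose[of P A R G B] assms(1) PR(1) unfolding trunc_def by blast
  have "trunc \<psi> G P D"
    using D PR(1) le_Tr[OF D(2) _ B] unfolding trunc_def by blast
  then show ?thesis
    using trunc_tz PR(2) tz_le[OF B] by (metis add.right_neutral)
qed

text \<open>The rotation moves the heart of phases in the half-open interval from \<theta>,
  excluded, to \<theta> + 1, included, into the closed upper half-plane. \<open>window_eq\<close>
  expands this into the sum over HN factors.\<close>

definition window :: "real \<Rightarrow> 'b \<Rightarrow> real" where
  "window \<theta> X = Im (cis (- pi * \<theta>) * (tz \<theta> X - tz (\<theta> + 1) X))"

lemma hn_term:
  assumes "X \<in> obj C" "p \<in> set (hn X)"
  shows "Im (cis (- pi * \<theta>) * Z (fst p)) = cmod (Z (fst p)) * sin (pi * (snd p - \<theta>))"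
proof -
  have "cis (- pi * \<theta>) * Z (fst p) = of_real (cmod (Z (fst p))) * cis (pi * (snd p - \<theta>))"
    by (subst hn_charge(1)[OF assms]) (simp add: cis_mult algebra_simps)
  then show ?thesis
    by simp
qed

lemma window_eq:
  assumes "X \<in> obj C"
  shows "window \<theta> X = (\<Sum>p\<leftarrow>hn X. if \<theta> < snd p \<and> snd p \<le> \<theta> + 1
    then cmod (Z (fst p)) * sin (pi * (snd p - \<theta>)) else 0)"
proof -
  have "Im (cis (- pi * \<theta>) * ((\<Sum>p\<leftarrow>filter (\<lambda>p. \<theta> < snd p) L. Z (fst p)) -
      (\<Sum>p\<leftarrow>filter (\<lambda>p. \<theta> + 1 < snd p) L. Z (fst p)))) =
    (\<Sum>p\<leftarrow>L. if \<theta> < snd p \<and> snd p \<le> \<theta> + 1 then cmod (Z (fst p)) * sin (pi * (snd p - \<theta>)) else 0)"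
    if "set L \<subseteq> set (hn X)" for L
    using that
  proof (induction L)
    case (Cons p L)
    then have "Im (cis (- pi * \<theta>) * Z (fst p)) = cmod (Z (fst p)) * sin (pi * (snd p - \<theta>))"
      using hn_term[OF assms] by auto
    then show ?case
      using Cons by (auto simp: algebra_simps)
  qed simp
  then show ?thesis
    unfolding window_def tz_def by blast
qed

lemma sin_window_nonneg:
  assumes "\<theta> < \<phi>" "\<phi> \<le> \<theta> + 1"
  shows "0 \<le> sin (pi * (\<phi> - \<theta>))"
  using assms by (intro sin_ge_zero) (auto simp: mult_le_cancel_left1)

lemma window_nonneg:
  assumes "X \<in> obj C"
  shows "0 \<le> window \<theta> X"
  unfolding window_eq[OF assms]
  by (rule sum_list_nonneg) (use sin_window_nonneg in \<open>auto intro!: mult_nonneg_nonneg\<close>)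

lemma mass_eq: "mass C \<sigma> X = (\<Sum>p\<leftarrow>hn X. cmod (Z (fst p)))"
  unfolding mass_def by (simp add: case_prod_beta')

lemma window_le_mass:
  assumes "X \<in> obj C"
  shows "window \<theta> X \<le> mass C \<sigma> X"
  unfolding window_eq[OF assms] mass_eq
proof (rule sum_list_mono)
  fix p assume "p \<in> set (hn X)"
  have "cmod (Z (fst p)) * sin (pi * (snd p - \<theta>)) \<le> cmod (Z (fst p)) * 1"
    by (intro mult_left_mono) auto
  then show "(if \<theta> < snd p \<and> snd p \<le> \<theta> + 1 then cmod (Z (fst p)) * sin (pi * (snd p - \<theta>)) else 0)
    \<le> cmod (Z (fst p))"
    by simp
qed

lemma heart_window:
  assumes "J \<in> gt \<theta>" "J \<in> le (\<theta> + 1)"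
  shows "window \<theta> J = Im (cis (- pi * \<theta>) * Z J)"
  unfolding window_def using tz_gt[OF assms(1)] tz_le[OF assms(2)] by simp

lemma heart_nonneg:
  assumes "J \<in> gt \<theta>" "J \<in> le (\<theta> + 1)"
  shows "0 \<le> Im (cis (- pi * \<theta>) * Z J)"
  using heart_window[OF assms] window_nonneg[OF gt_obj[OF assms(1)]] by metis

text \<open>
  The charge of the part of G above \<theta> differs from the sum over A and B by the charge of the image
  of the connecting map in the heart. Splitting off the parts of B below \<theta> and of A above \<theta> reduces
  this to the case where A lies below and B above \<theta>.
\<close>

lemma tz_subadditive:
  assumes "Tr C A G B"
  shows "Im (cis (- pi * \<theta>) * tz \<theta> G) \<le> Im (cis (- pi * \<theta>) * tz \<theta> A) + Im (cis (- pi * \<theta>) * tz \<theta> B)"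
proof -
  let ?y = "\<lambda>z. Im (cis (- pi * \<theta>) * z)"
  obtain P R where B: "trunc \<theta> B P R" "Z P = tz \<theta> B"
    using ex_trunc TrD[OF assms] by blast
  obtain G' where G': "Tr C G' G R" "Tr C A G' P"
    using Tr_cocompose[OF assms] B(1) unfolding trunc_def by blast
  have tG: "tz \<theta> G = tz \<theta> G'"
    using tz_add[OF G'(1)] B(1) tz_le[of R \<theta>] unfolding trunc_def by simp
  obtain P' R' where A: "trunc \<theta> A P' R'" "Z P' = tz \<theta> A"
    using ex_trunc TrD[OF assms] by blast
  obtain J' where J': "Tr C P' G' J'" "Tr C R' J' P"
    using Tr_compose[OF _ G'(2)] A(1) unfolding trunc_def by blast
  have tG': "tz \<theta> G' = tz \<theta> A + tz \<theta> J'"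
    using tz_add[OF J'(1)] A tz_gt[of P' \<theta>] unfolding trunc_def by simp
  obtain V U where J: "trunc \<theta> J' V U" "Z V = tz \<theta> J'"
    using ex_trunc TrD[OF J'(2)] by blast
  \<comment> \<open>\<open>D\<close> is an extension of V[1] by \<open>P\<close> and also of R'[1]
    by \<open>U\<close>. The first places it above \<theta>, the second at most at \<theta> + 1, so
    it is in the heart, and its charge is the difference of those of \<open>P\<close> and
    \<open>V\<close>.\<close>
  obtain D where D: "Tr C P D (sho C V)" "Tr C R' U D"
    using Tr_quotient[OF J'(2)] J(1) unfolding trunc_def by blast
  have V: "V \<in> gt \<theta>" "U \<in> le \<theta>" and P: "P \<in> gt \<theta>" and R': "R' \<in> le \<theta>"
    using J(1) B(1) A(1) unfolding trunc_def by auto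
  have "D \<in> gt \<theta>"
    using gt_Tr[OF D(1) P gt_sho'[OF V(1)]] .
  moreover have "D \<in> le (\<theta> + 1)"
    using le_Tr[OF Tr_rot[OF D(2)]] le_sho[OF R'] le_mono[OF V(2)] by simp
  ultimately have "0 \<le> ?y (Z D)"
    by (rule heart_nonneg)
  moreover have "Z D = Z P - Z V"
    using Z_Tr[OF D(1)] Z_sho[OF gt_obj[OF V(1)]] by simp
  ultimately have "?y (Z V) \<le> ?y (Z P)"
    by (simp add: algebra_simps)
  then show ?thesis
    using tG tG' J(2) B(2) by (simp add: algebra_simps)
qed

lemma cis_shift: "cis (- pi * (\<theta> + 1)) = - cis (- pi * \<theta>)"
proof -
  have "- pi * (\<theta> + 1) = - pi * \<theta> + - pi"
    by (simp add: algebra_simps)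
  then have "cis (- pi * (\<theta> + 1)) = cis (- pi * \<theta>) * cis (- pi)"
    by (simp only: cis_mult)
  also have "cis (- pi) = - 1"
    by (simp add: complex_eq_iff)
  finally show ?thesis
    by simp
qed

text \<open>Rotating by \<theta> + 1 instead of \<theta> changes the sign, which turns the
  difference in \<open>window\<close> into a sum of two terms of the shape treated in
  \<open>tz_subadditive\<close>. This is why a difference can be subadditive.\<close>

lemma window_eq_sum:
  "window \<theta> X = Im (cis (- pi * \<theta>) * tz \<theta> X) + Im (cis (- pi * (\<theta> + 1)) * tz (\<theta> + 1) X)"
  unfolding window_def cis_shift by (simp add: algebra_simps)

lemma window_subadditive:
  assumes "Tr C A G B"
  shows "window \<theta> G \<le> window \<theta> A + window \<theta> B"
  unfolding window_eq_sum
  using tz_subadditive[OF assms, of \<theta>] tz_subadditive[OF assms, of "\<theta> + 1"] by linarith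

lemma window_sho:
  assumes "X \<in> obj C"
  shows "window (\<theta> + 1) (sho C X) = window \<theta> X"
  unfolding window_def cis_shift tz_sho[OF assms] by (simp add: algebra_simps)

text \<open>
  Truncation is functorial, so the part of X with phases in the window is a retract of that of Y,
  and the complement is again an object of the heart.
\<close>

lemma window_retract:
  assumes "retract X Y"
  shows "window \<theta> X \<le> window \<theta> Y"
proof -
  have XY: "X \<in> obj C" "Y \<in> obj C"
    using retract_obj[OF assms] by auto
  obtain P R where X: "trunc \<theta> X P R"
    using ex_trunc[OF XY(1)] by metis
  obtain P' R' where Y: "trunc \<theta> Y P' R'"
    using ex_trunc[OF XY(2)] by metis
  have PP: "retract P P'"
    using retract_sub[of P X R P' Y R'] X Y assms gt_le_orth sho_gt_le_orth unfolding trunc_def by blast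
  have PP': "P \<in> obj C" "P' \<in> obj C"
    using retract_obj[OF PP] by auto
  obtain S W where S: "trunc (\<theta> + 1) P S W"
    using ex_trunc[OF PP'(1)] by metis
  obtain S' W' where S': "trunc (\<theta> + 1) P' S' W'"
    using ex_trunc[OF PP'(2)] by metis
  have WW: "retract W W'"
    using retract_quotient[of S P W S' P' W'] S S' PP gt_le_orth sho_gt_le_orth
    unfolding trunc_def by blast
  obtain D where D: "Tr C W W' D" "retract D W'"
    using retract_complement[OF WW] .
  \<comment> \<open>Truncating first at \<theta> and then at \<theta> + 1 leaves the cohomology
    object \<open>W\<close> of the heart; the part \<open>R\<close> below \<theta> does not affect
    the second truncation.\<close>
  have w: "window \<theta> X = Im (cis (- pi * \<theta>) * Z W)"
    if "trunc \<theta> X P R" "trunc (\<theta> + 1) P S W" for X P R S W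
  proof -
    have t: "Tr C P X R" "P \<in> gt \<theta>" "R \<in> le \<theta>" "Tr C S P W" "S \<in> gt (\<theta> + 1)"
      using that unfolding trunc_def by auto
    have "tz (\<theta> + 1) X = tz (\<theta> + 1) P"
      using tz_add[OF t(1), of "\<theta> + 1"] tz_le[of R "\<theta> + 1"] le_mono[OF t(3), of "\<theta> + 1"] by simp
    then have "tz (\<theta> + 1) X = Z S"
      using trunc_tz[OF that(2)] by simp
    moreover have "tz \<theta> X = Z S + Z W"
      using trunc_tz[OF that(1)] Z_Tr[OF t(4)] by simp
    ultimately have "tz \<theta> X - tz (\<theta> + 1) X = Z W"
      by simp
    then show ?thesis
      by (simp add: window_def)
  qed
  have W': "W' \<in> gt \<theta>" "W' \<in> le (\<theta> + 1)"
    using S' Y gt_cone[of S' P' W' \<theta>] gt_mono[of S' "\<theta> + 1" \<theta>] unfolding trunc_def by auto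
  have "W \<in> gt \<theta>"
    using S X gt_cone[of S P W \<theta>] gt_mono[of S "\<theta> + 1" \<theta>] unfolding trunc_def by auto
  then have "D \<in> gt \<theta>"
    using gt_cone[OF D(1)] W' by blast
  then have "0 \<le> Im (cis (- pi * \<theta>) * Z D)"
    using heart_nonneg retract_le[OF D(2) W'(2)] by blast
  then show ?thesis
    using w[OF X S] w[OF Y S'] Z_Tr[OF D(1)] by (simp add: algebra_simps)
qed

section \<open>Extremal phases, mass and averaged phase\<close>

abbreviation pplus :: "'b \<Rightarrow> real" where "pplus \<equiv> phase_plus C \<sigma>"

abbreviation pminus :: "'b \<Rightarrow> real" where "pminus \<equiv> phase_minus C \<sigma>"

lemma hn_nonempty:
  assumes "X \<in> obj C" "\<not> zero_obj C X"
  shows "hn X \<noteq> []"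
proof
  assume "hn X = []"
  then have "filtration C X []"
    using hn_factors_hn[OF assms(1)] unfolding hn_filtration_def by simp
  then show False
    using assms(2) by (simp add: filtration_Nil)
qed

lemma hn_sorted: "X \<in> obj C \<Longrightarrow> sorted_wrt (>) (map snd (hn X))"
  using hn_factors_hn unfolding hn_filtration_def by blast

lemma hn_phase_bounds:
  assumes "X \<in> obj C" "p \<in> set (hn X)"
  shows "pminus X \<le> snd p" "snd p \<le> pplus X"
proof -
  have ne: "hn X \<noteq> []"
    using assms(2) by auto
  obtain i where i: "i < length (hn X)" "p = hn X ! i"
    using assms(2) by (metis in_set_conv_nth)
  have s: "snd (hn X ! j) < snd (hn X ! k)" if "k < j" "j < length (hn X)" for j k
    using sorted_wrt_nth_less[OF hn_sorted[OF assms(1)], of k j] that by simp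
  show "snd p \<le> pplus X"
    unfolding phase_plus_def i(2) hd_conv_nth[OF ne] using s[of 0 i] i(1) by (cases i) auto
  have "i = length (hn X) - 1 \<or> i < length (hn X) - 1"
    using i(1) by linarith
  then show "pminus X \<le> snd p"
    unfolding phase_minus_def i(2) last_conv_nth[OF ne]
    using s[of i "length (hn X) - 1"] i(1) ne by force
qed

lemma pminus_le_pplus:
  assumes "X \<in> obj C" "\<not> zero_obj C X"
  shows "pminus X \<le> pplus X"
  using hn_phase_bounds[OF assms(1) hd_in_set[OF hn_nonempty[OF assms]]] by linarith

text \<open>For the hard direction, truncate at the lowest phase: an object of the aisle keeps its
  whole charge, while \<open>tz\<close> omits exactly the last HN factor, whose charge is
  nonzero.\<close>

lemma gt_iff:
  assumes "X \<in> obj C" "\<not> zero_obj C X"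
  shows "X \<in> gt \<psi> \<longleftrightarrow> \<psi> < pminus X"
proof
  assume *: "\<psi> < pminus X"
  have "set (map fst (hn X)) \<subseteq> gt \<psi>"
    using gt_base[OF hn_mem(1)[OF assms(1)]] hn_phase_bounds[OF assms(1)] * by fastforce
  moreover have "filtration C X (map fst (hn X))"
    using hn_factors_hn[OF assms(1)] unfolding hn_filtration_def by blast
  ultimately show "X \<in> gt \<psi>"
    using ext_gt[OF filtration_ext] by blast
next
  assume X: "X \<in> gt \<psi>"
  show "\<psi> < pminus X"
  proof (rule ccontr)
    assume "\<not> \<psi> < pminus X"
    then have "X \<in> gt (pminus X)"
      using gt_mono[OF X] by simp
    then have *: "tz (pminus X) X = Z X"
      by (rule tz_gt)
    obtain L p where L: "hn X = L @ [p]"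
      using hn_nonempty[OF assms] by (metis rev_exhaust)
    then have p: "pminus X = snd p"
      by (simp add: phase_minus_def)
    have "\<forall>q \<in> set L. snd p < snd q"
      using hn_sorted[OF assms(1)] L by (auto simp: sorted_wrt_append)
    then have "filter (\<lambda>q. snd p < snd q) (hn X) = L"
      by (simp add: L filter_id_conv)
    then have "tz (pminus X) X = (\<Sum>q\<leftarrow>L. Z (fst q))"
      by (simp add: tz_def p)
    moreover have "Z X = (\<Sum>q\<leftarrow>L. Z (fst q)) + Z (fst p)"
      using Z_filtration[of X "map fst (hn X)"] hn_factors_hn[OF assms(1)]
      unfolding hn_filtration_def by (simp add: L comp_def)
    moreover have "Z (fst p) \<noteq> 0"
      using hn_charge(2)[OF assms(1), of p] L by auto
    ultimately show False
      using * by simp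
  qed
qed

lemma le_iff:
  assumes "X \<in> obj C" "\<not> zero_obj C X"
  shows "X \<in> le \<psi> \<longleftrightarrow> pplus X \<le> \<psi>"
proof
  assume *: "pplus X \<le> \<psi>"
  have "set (map fst (hn X)) \<subseteq> le \<psi>"
    using le_base[OF hn_mem(1)[OF assms(1)]] hn_phase_bounds[OF assms(1)] * by fastforce
  moreover have "filtration C X (map fst (hn X))"
    using hn_factors_hn[OF assms(1)] unfolding hn_filtration_def by blast
  ultimately show "X \<in> le \<psi>"
    using ext_le[OF filtration_ext] by blast
next
  assume X: "X \<in> le \<psi>"
  show "pplus X \<le> \<psi>"
  proof (rule ccontr)
    assume n: "\<not> pplus X \<le> \<psi>"
    obtain p L where L: "hn X = p # L"
      using hn_nonempty[OF assms] by (metis neq_Nil_conv)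
    \<comment> \<open>The larger of \<psi> and the second phase: exactly the first HN factor lies
      above it, so the truncation has nonzero charge although X lies below.\<close>
    define \<psi>' where "\<psi>' = (if L = [] then \<psi> else max \<psi> (snd (hd L)))"
    have p: "pplus X = snd p"
      by (simp add: phase_plus_def L)
    have s: "\<forall>q \<in> set L. snd q < snd p" "sorted_wrt (>) (map snd L)"
      using hn_sorted[OF assms(1)] L by auto
    have "snd q \<le> \<psi>'" if "q \<in> set L" for q
    proof (cases L)
      case (Cons a L')
      then show ?thesis
        using s(2) that by (fastforce simp: \<psi>'_def)
    qed (use that in simp)
    moreover have "\<psi>' < snd p"
      using n p s(1) hd_in_set[of L] by (auto simp: \<psi>'_def)
    ultimately have "filter (\<lambda>q. \<psi>' < snd q) (hn X) = [p]"
      by (auto simp: L filter_empty_conv not_less)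
    then have "tz \<psi>' X = Z (fst p)"
      by (simp add: tz_def)
    moreover have "X \<in> le \<psi>'"
      using le_mono[OF X] by (simp add: \<psi>'_def)
    moreover have "Z (fst p) \<noteq> 0"
      using hn_charge(2)[OF assms(1), of p] L by auto
    ultimately show False
      using tz_le by simp
  qed
qed

lemma mass_pos:
  assumes "X \<in> obj C" "\<not> zero_obj C X"
  shows "0 < mass C \<sigma> X"
proof -
  obtain p L where L: "hn X = p # L"
    using hn_nonempty[OF assms] by (metis neq_Nil_conv)
  have "0 \<le> (\<Sum>q\<leftarrow>L. cmod (Z (fst q)))"
    by (rule sum_list_nonneg) auto
  then show ?thesis
    using hn_charge(2)[OF assms(1), of p] L by (simp add: mass_eq add_pos_nonneg)
qed

lemma phase_eq: "phase C \<sigma> X = (\<Sum>p\<leftarrow>hn X. snd p * cmod (Z (fst p))) / mass C \<sigma> X"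
  unfolding phase_def by (simp add: case_prod_beta')

lemma phase_bounds:
  assumes "X \<in> obj C" "\<not> zero_obj C X"
  shows "pminus X \<le> phase C \<sigma> X" "phase C \<sigma> X \<le> pplus X"
proof -
  have "pminus X * mass C \<sigma> X \<le> (\<Sum>p\<leftarrow>hn X. snd p * cmod (Z (fst p)))"
    unfolding mass_eq sum_list_const_mult[symmetric]
    by (rule sum_list_mono) (use hn_phase_bounds[OF assms(1)] in \<open>auto intro: mult_right_mono\<close>)
  then show "pminus X \<le> phase C \<sigma> X"
    unfolding phase_eq using mass_pos[OF assms] by (simp add: pos_le_divide_eq)
  have "(\<Sum>p\<leftarrow>hn X. snd p * cmod (Z (fst p))) \<le> pplus X * mass C \<sigma> X"
    unfolding mass_eq sum_list_const_mult[symmetric]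
    by (rule sum_list_mono) (use hn_phase_bounds[OF assms(1)] in \<open>auto intro: mult_right_mono\<close>)
  then show "phase C \<sigma> X \<le> pplus X"
    unfolding phase_eq using mass_pos[OF assms] by (simp add: pos_divide_le_eq)
qed

lemma sin_near_half:
  assumes "\<bar>x - 1 / 2\<bar> < 1 / 4"
  shows "1 / 2 \<le> sin (pi * x)"
proof -
  have "pi / 6 \<le> pi * x" "pi * x \<le> pi - pi / 6"
  proof -
    have "1 / 6 \<le> x" "x \<le> 5 / 6"
      using assms by (auto simp: abs_if split: if_splits)
    then have "pi * (1 / 6) \<le> pi * x" "pi * x \<le> pi * (5 / 6)"
      by (auto intro!: mult_left_mono)
    then show "pi / 6 \<le> pi * x" "pi * x \<le> pi - pi / 6"
      by auto
  qed
  then show ?thesis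
  proof (cases "pi * x \<le> pi / 2")
    case True
    then show ?thesis
      using sin_monotone_2pi_le[of "pi / 6" "pi * x"] \<open>pi / 6 \<le> pi * x\<close> pi_gt_zero
      by (simp add: sin_30)
  next
    case False
    then have "sin (pi / 6) \<le> sin (pi - pi * x)"
      using \<open>pi * x \<le> pi - pi / 6\<close> pi_gt_zero by (intro sin_monotone_2pi_le) auto
    then show ?thesis
      by (simp add: sin_30)
  qed
qed

text \<open>The window is centred at the averaged phase. A spread below 1/4 puts every HN factor
  within 1/4 of the centre, where \<open>sin_near_half\<close> bounds the sine below by sin(pi/6) =
  1/2; and X lies in the heart, so its window is an imaginary part of its rotated charge.\<close>

lemma window_lower:
  assumes "X \<in> obj C" "\<not> zero_obj C X" "pplus X - pminus X < 1 / 4"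
  shows "mass C \<sigma> X / 2 \<le> window (phase C \<sigma> X - 1 / 2) X"
    and "window (phase C \<sigma> X - 1 / 2) X \<le> cmod (Z X)"
proof -
  let ?\<theta> = "phase C \<sigma> X - 1 / 2"
  have near: "\<bar>snd p - phase C \<sigma> X\<bar> < 1 / 4" if "p \<in> set (hn X)" for p
    using hn_phase_bounds[OF assms(1) that] phase_bounds[OF assms(1,2)] assms(3) by linarith
  have "mass C \<sigma> X / 2 = (\<Sum>p\<leftarrow>hn X. cmod (Z (fst p)) * (1 / 2))"
    unfolding mass_eq sum_list_mult_const by simp
  also have "\<dots> \<le> window ?\<theta> X"
    unfolding window_eq[OF assms(1)]
  proof (rule sum_list_mono)
    fix p assume p: "p \<in> set (hn X)"
    have "1 / 2 \<le> sin (pi * (snd p - ?\<theta>))"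
      using near[OF p] by (intro sin_near_half) auto
    then have "cmod (Z (fst p)) * (1 / 2) \<le> cmod (Z (fst p)) * sin (pi * (snd p - ?\<theta>))"
      by (intro mult_left_mono) auto
    then show "cmod (Z (fst p)) * (1 / 2) \<le> (if ?\<theta> < snd p \<and> snd p \<le> ?\<theta> + 1
        then cmod (Z (fst p)) * sin (pi * (snd p - ?\<theta>)) else 0)"
      using near[OF p] by (auto simp: abs_if split: if_splits)
  qed
  finally show "mass C \<sigma> X / 2 \<le> window ?\<theta> X" .
  have "X \<in> gt ?\<theta>" "X \<in> le (?\<theta> + 1)"
    unfolding gt_iff[OF assms(1,2)] le_iff[OF assms(1,2)]
    using phase_bounds[OF assms(1,2)] assms(3) by auto
  then have "window ?\<theta> X = Im (cis (- pi * ?\<theta>) * Z X)"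
    by (rule heart_window)
  also have "\<dots> \<le> cmod (cis (- pi * ?\<theta>) * Z X)"
    using abs_Im_le_cmod abs_le_D1 by blast
  finally show "window ?\<theta> X \<le> cmod (Z X)"
    by (simp add: norm_mult)
qed

lemma charge_le_mass:
  assumes "X \<in> obj C"
  shows "cmod (Z X) \<le> mass C \<sigma> X"
proof -
  have "Z X = (\<Sum>p\<leftarrow>hn X. Z (fst p))"
    using Z_filtration[of X "map fst (hn X)"] hn_factors_hn[OF assms]
    unfolding hn_filtration_def by (simp add: comp_def)
  moreover have "cmod (\<Sum>p\<leftarrow>L. Z (fst p)) \<le> (\<Sum>p\<leftarrow>L. cmod (Z (fst p)))" for L :: "('b \<times> real) list"
    by (induction L) (auto intro: norm_triangle_le)
  ultimately show ?thesis
    by (simp add: mass_eq)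
qed

lemma window_zero:
  assumes "X \<in> obj C" "\<not> zero_obj C X" "pplus X \<le> \<theta> \<or> \<theta> + 1 < pminus X"
  shows "window \<theta> X = 0"
proof -
  have "(if \<theta> < snd p \<and> snd p \<le> \<theta> + 1 then cmod (Z (fst p)) * sin (pi * (snd p - \<theta>)) else 0) = 0"
    if "p \<in> set (hn X)" for p
    using hn_phase_bounds[OF assms(1) that] assms(3) by auto
  then have "(\<Sum>p\<leftarrow>hn X. if \<theta> < snd p \<and> snd p \<le> \<theta> + 1
      then cmod (Z (fst p)) * sin (pi * (snd p - \<theta>)) else 0) = (\<Sum>p\<leftarrow>hn X. 0)"
    by (intro arg_cong[of _ _ sum_list] map_cong) auto
  then show ?thesis
    unfolding window_eq[OF assms(1)] by simp
qed

text \<open>The phase intervals of the pieces are disjoint and decreasing, as they would be for a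
  coarsening of the HN filtration. A limit HN filtration has this property for all large
  times.\<close>

definition tower :: "'b list \<Rightarrow> bool" where
  "tower Gs \<longleftrightarrow> (\<forall>G \<in> set Gs. G \<in> obj C \<and> \<not> zero_obj C G) \<and>
    sorted_wrt (\<lambda>F G. pplus G < pminus F) Gs"

lemma towerI:
  assumes "\<And>G. G \<in> set Gs \<Longrightarrow> G \<in> obj C \<and> \<not> zero_obj C G"
    "\<And>i. Suc i < length Gs \<Longrightarrow> pplus (Gs ! Suc i) < pminus (Gs ! i)"
  shows "tower Gs"
proof -
  \<comment> \<open>The second conjunct makes the relation transitive, so that consecutive
    comparisons suffice.\<close>
  let ?R = "\<lambda>F G. pplus G < pminus F \<and> pminus G \<le> pplus G"
  have "transp ?R"
    by (intro transpI) auto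
  moreover have "\<forall>i. Suc i < length Gs \<longrightarrow> ?R (Gs ! i) (Gs ! Suc i)"
    using assms pminus_le_pplus nth_mem by blast
  ultimately have "sorted_wrt ?R Gs"
    by (simp add: sorted_wrt_iff_nth_Suc_transp)
  then have "sorted_wrt (\<lambda>F G. pplus G < pminus F) Gs"
    by (rule sorted_wrt_mono_rel[rotated]) simp
  then show ?thesis
    using assms(1) by (simp add: tower_def)
qed

text \<open>For every \<psi>, either the last piece lies below \<psi> or all earlier ones lie above
  it, so \<open>tz_add\<close> applies at each step.\<close>

lemma tower_tz:
  "filtration C E Gs \<Longrightarrow> tower Gs \<Longrightarrow> tz \<psi> E = (\<Sum>G\<leftarrow>Gs. tz \<psi> G)"
proof (induction Gs arbitrary: E rule: rev_induct)
  case Nil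
  then show ?case
    using tz_le[OF le_zero] by (simp add: filtration_Nil)
next
  case (snoc G Gs)
  then obtain E' where E': "filtration C E' Gs" "Tr C E' E G"
    by (auto simp: filtration_snoc)
  have t: "tower Gs" "G \<in> obj C" "\<not> zero_obj C G" "\<And>F. F \<in> set Gs \<Longrightarrow> F \<in> obj C \<and> \<not> zero_obj C F \<and> pplus G < pminus F"
    using snoc.prems(2) unfolding tower_def by (auto simp: sorted_wrt_append)
  have "E' \<in> gt \<psi> \<or> G \<in> le \<psi>"
  proof (cases "pplus G \<le> \<psi>")
    case True
    then show ?thesis
      using le_iff t(2,3) by blast
  next
    case False
    then have "set Gs \<subseteq> gt \<psi>"
      using gt_iff t(4) by (meson less_trans not_le subsetI)
    then show ?thesis
      using ext_gt filtration_ext[OF E'(1)] by blast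
  qed
  then show ?case
    using tz_add[OF E'(2)] snoc.IH[OF E'(1) t(1)] by simp
qed

text \<open>An equality, where a general filtration gives only \<open>filtration_window\<close>.
  Since windows are nonnegative, it bounds the window of each piece by that of the filtered
  object.\<close>

lemma tower_window:
  assumes "filtration C E Gs" "tower Gs"
  shows "window \<theta> E = (\<Sum>G\<leftarrow>Gs. window \<theta> G)"
proof -
  have "(\<Sum>G\<leftarrow>L. window \<theta> G) = Im (cis (- pi * \<theta>) * ((\<Sum>G\<leftarrow>L. tz \<theta> G) - (\<Sum>G\<leftarrow>L. tz (\<theta> + 1) G)))" for L
    by (induction L) (simp_all add: window_def algebra_simps)
  then show ?thesis
    unfolding window_def tower_tz[OF assms] by simp
qed

lemma filtration_window:
  "filtration C E Gs \<Longrightarrow> window \<theta> E \<le> (\<Sum>G\<leftarrow>Gs. window \<theta> G)"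
proof (induction Gs arbitrary: E rule: rev_induct)
  case Nil
  then have "tz \<psi> E = 0" for \<psi>
    using tz_le le_zero by (simp add: filtration_Nil)
  then show ?case
    by (simp add: window_def)
next
  case (snoc G Gs)
  then obtain E' where E': "filtration C E' Gs" "Tr C E' E G"
    by (auto simp: filtration_snoc)
  then show ?case
    using window_subadditive[OF E'(2), of \<theta>] snoc.IH[OF E'(1)] by simp
qed

end

section \<open>Phases and masses along a path\<close>

context pre_stable_category
begin

text \<open>Closure under retracts is not visible from the extension closure. The part
  \<open>R\<close> of X below \<psi> receives only null arrows from X, because Y is orthogonal to
  it, and is therefore zero.\<close>

lemma retract_gt:
  assumes "retract X Y" "Y \<in> gt \<psi>"
  shows "X \<in> gt \<psi>"
proof -
  obtain P R where PR: "trunc \<psi> X P R"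
    using ex_trunc retract_obj[OF assms(1)] by metis
  then have t: "Tr C P X R" "P \<in> gt \<psi>" "R \<in> le \<psi>"
    unfolding trunc_def by auto
  have "orth X R"
    using retract_orth_left[OF assms(1) gt_le_orth[OF assms(2) t(3)]] .
  then have "zero_obj C R"
    using zero_of_null_quotient[OF t(1) _ sho_gt_le_orth[OF t(2,3)]] by blast
  then show ?thesis
    using gt_Tr[OF t(1,2)] gt_zero by blast
qed

lemma pplus_sho_le:
  assumes "X \<in> obj C" "\<not> zero_obj C X"
  shows "pplus (sho C X) \<le> pplus X + 1" "pminus X + 1 \<le> pminus (sho C X)"
proof -
  have s: "sho C X \<in> obj C" "\<not> zero_obj C (sho C X)"
    using assms sho_in zero_obj_sho_iff by auto
  show "pplus (sho C X) \<le> pplus X + 1"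
    using le_sho[of X "pplus X"] le_iff[OF assms] le_iff[OF s] by simp
  \<comment> \<open>The aisle is a strict condition on the lowest phase, so the bound is obtained
    for all smaller \<psi> and then by density.\<close>
  have "\<psi> + 1 < pminus (sho C X)" if "\<psi> < pminus X" for \<psi>
    using gt_sho[of X \<psi>] gt_iff[OF assms] gt_iff[OF s] that by simp
  then show "pminus X + 1 \<le> pminus (sho C X)"
    using dense_le[of "pminus X" "pminus (sho C X) - 1"] by force
qed

lemma retract_phases:
  assumes "retract X Y" "\<not> zero_obj C X"
  shows "pplus X \<le> pplus Y" "pminus Y \<le> pminus X"
proof -
  have XY: "X \<in> obj C" "Y \<in> obj C" "\<not> zero_obj C Y"
    using retract_obj[OF assms(1)] retract_zero[OF assms(1)] assms(2) by auto
  show "pplus X \<le> pplus Y"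
    using retract_le[OF assms(1), of "pplus Y"] le_iff[OF XY(2,3)] le_iff[OF XY(1) assms(2)] by simp
  have "\<psi> < pminus X" if "\<psi> < pminus Y" for \<psi>
    using retract_gt[OF assms(1), of \<psi>] gt_iff[OF XY(2,3)] gt_iff[OF XY(1) assms(2)] that by simp
  then show "pminus Y \<le> pminus X"
    using dense_le[of "pminus Y" "pminus X"] by force
qed

lemma Tr_phases:
  assumes "Tr C A G B" "\<not> zero_obj C G"
    "\<not> zero_obj C A \<Longrightarrow> pplus A \<le> u \<and> l \<le> pminus A"
    "\<not> zero_obj C B \<Longrightarrow> pplus B \<le> u \<and> l \<le> pminus B"
  shows "pplus G \<le> u" "l \<le> pminus G"
proof -
  have o: "A \<in> obj C" "B \<in> obj C" "G \<in> obj C"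
    using TrD[OF assms(1)] by auto
  have "A \<in> le u" "B \<in> le u"
    using o assms(3,4) le_iff le_zero by blast+
  then show "pplus G \<le> u"
    using le_Tr[OF assms(1)] le_iff[OF o(3) assms(2)] by blast
  have "\<psi> < pminus G" if "\<psi> < l" for \<psi>
  proof -
    have "A \<in> gt \<psi>" "B \<in> gt \<psi>"
      using o assms(3,4) gt_iff gt_zero that by (meson less_le_trans)+
    then show ?thesis
      using gt_Tr[OF assms(1)] gt_iff[OF o(3) assms(2)] by blast
  qed
  then show "l \<le> pminus G"
    using dense_le[of l "pminus G"] by force
qed

lemma sum_list_zero: "(\<And>x. x \<in> set L \<Longrightarrow> f x = 0) \<Longrightarrow> (\<Sum>x\<leftarrow>L. f x) = (0 :: complex)"
  by (induction L) auto

text \<open>Otherwise some level below the phases of A bounds all phases of E and of the other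
  pieces. Truncating there annihilates everything except A, whose nonzero charge contradicts
  additivity.\<close>

lemma tower_first:
  assumes "filtration C E (A # Gs)" "tower (A # Gs)" "Z A \<noteq> 0" "\<not> zero_obj C E"
  shows "pminus A \<le> pplus E"
proof (rule ccontr)
  assume n: "\<not> pminus A \<le> pplus E"
  define S where "S = insert (pplus E) (pplus ` set Gs)"
  have S: "finite S" "S \<noteq> {}"
    by (simp_all add: S_def)
  have "\<forall>x \<in> S. x < pminus A"
    using n assms(2) by (auto simp: S_def tower_def)
  then have m: "Max S < pminus A"
    using S by simp
  have "E \<in> obj C"
    using filtration_obj[OF assms(1)] by blast
  then have "E \<in> le (Max S)"
    using le_iff assms(4) S(1) by (simp add: S_def)
  then have "tz (Max S) E = 0"
    by (rule tz_le)
  moreover have "A \<in> gt (Max S)"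
    using m gt_iff assms(2) unfolding tower_def by simp
  then have "tz (Max S) A = Z A"
    by (rule tz_gt)
  moreover have "tz (Max S) G = 0" if "G \<in> set Gs" for G
  proof -
    have "G \<in> le (Max S)"
      using le_iff[of G "Max S"] assms(2) that S(1) by (simp add: tower_def S_def)
    then show ?thesis
      by (rule tz_le)
  qed
  then have "(\<Sum>G\<leftarrow>Gs. tz (Max S) G) = 0"
    by (rule sum_list_zero)
  ultimately show False
    using tower_tz[OF assms(1,2), of "Max S"] assms(3) by simp
qed

text \<open>The dual argument at the top phase of B: E and the earlier pieces keep their full charge
  and B loses its own.\<close>

lemma tower_last:
  assumes "filtration C E (Gs @ [B])" "tower (Gs @ [B])" "Z B \<noteq> 0" "\<not> zero_obj C E"
  shows "pminus E \<le> pplus B"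
proof (rule ccontr)
  assume n: "\<not> pminus E \<le> pplus B"
  have B: "B \<in> obj C" "\<not> zero_obj C B"
    using assms(2) by (auto simp: tower_def)
  have "E \<in> obj C"
    using filtration_obj[OF assms(1)] by blast
  then have "E \<in> gt (pplus B)"
    using gt_iff assms(4) n by simp
  then have "tz (pplus B) E = Z E"
    by (rule tz_gt)
  moreover have "tz (pplus B) B = 0"
    using tz_le le_iff[OF B] by simp
  moreover have "tz (pplus B) G = Z G" if "G \<in> set Gs" for G
  proof -
    have "G \<in> gt (pplus B)"
      using gt_iff[of G] assms(2) that by (auto simp: tower_def sorted_wrt_append)
    then show ?thesis
      by (rule tz_gt)
  qed
  then have "(\<Sum>G\<leftarrow>Gs. tz (pplus B) G) = (\<Sum>G\<leftarrow>Gs. Z G)"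
    by (intro arg_cong[of _ _ sum_list] map_cong) auto
  ultimately show False
    using tower_tz[OF assms(1,2), of "pplus B"] Z_filtration[OF assms(1)] assms(3) by simp
qed

end

lemma filterlim_at_top_add_bounded_below:
  fixes f g :: "real \<Rightarrow> real"
  assumes "filterlim f at_top F" "eventually (\<lambda>t. K \<le> g t) F"
  shows "filterlim (\<lambda>t. f t + g t) at_top F"
  unfolding filterlim_at_top
proof
  fix c
  have "eventually (\<lambda>t. c - K \<le> f t) F"
    using assms(1) unfolding filterlim_at_top by blast
  then show "eventually (\<lambda>t. c \<le> f t + g t) F"
    using assms(2) by eventually_elim simp
qed

lemma continuous_sign:
  fixes f :: "real \<Rightarrow> real"
  assumes "continuous_on {b..} f" "0 < c" "\<And>t. b \<le> t \<Longrightarrow> c \<le> \<bar>f t\<bar>"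
  shows "(\<forall>t\<ge>b. c \<le> f t) \<or> (\<forall>t\<ge>b. f t \<le> - c)"
proof (rule ccontr)
  assume "\<not> ?thesis"
  then obtain x y where xy: "b \<le> x" "b \<le> y" "f x < c" "- c < f y"
    by force
  then have fxy: "f x \<le> - c" "c \<le> f y"
    using assms(3)[of x] assms(3)[of y] by linarith+
  have "connected (f ` {b..})"
    by (rule connected_continuous_image[OF assms(1) connected_Ici])
  moreover have "f x \<in> f ` {b..}" "f y \<in> f ` {b..}"
    using xy by auto
  ultimately have "0 \<in> f ` {b..}"
    by (rule connectedD_interval) (use fxy assms(2) in auto)
  then obtain z where "b \<le> z" "f z = 0"
    by auto
  then show False
    using assms(2) assms(3)[of z] by simp
qed

section \<open>Limit semistable objects and their phase differences\<close>

locale quasi_convergent_path = triangulated_category +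
  fixes \<Lambda> :: "'l monoid" and v :: "('b \<Rightarrow>\<^sub>0 int) set \<Rightarrow> 'l" and a :: real
    and \<sigma> :: "real \<Rightarrow> 'b charge_slicing"
  assumes qc: "quasi_convergent C \<Lambda> v a \<sigma>"
begin

lemma openin_stab: "openin (stab_topology C \<Lambda> v) = stab_open C \<Lambda> v"
  unfolding stab_topology_def by (rule topology_inverse'[OF istopology_stab_open])

lemma topspace_stab: "topspace (stab_topology C \<Lambda> v) = Stab C \<Lambda> v"
proof -
  have "stab_open C \<Lambda> v (Stab C \<Lambda> v)"
    unfolding stab_open_def using zero_less_one by blast
  then show ?thesis
    unfolding topspace_def openin_stab stab_open_def by blast
qed

lemma path_continuous: "continuous_map (top_of_set {a..}) (stab_topology C \<Lambda> v) \<sigma>"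
  using qc unfolding quasi_convergent_def by blast

lemma path_Stab:
  assumes "a \<le> t"
  shows "\<sigma> t \<in> Stab C \<Lambda> v"
  using continuous_map_image_subset_topspace[OF path_continuous] assms
  unfolding topspace_stab by auto

lemma stable:
  assumes "a \<le> t"
  shows "pre_stable_category C (\<sigma> t)"
  using path_Stab[OF assms] triangulated_category_axioms
  unfolding pre_stable_category_def pre_stable_category_axioms_def Stab_def by blast

abbreviation lss :: "'b \<Rightarrow> bool" where "lss \<equiv> limit_semistable C \<sigma>"
abbreviation pplus :: "real \<Rightarrow> 'b \<Rightarrow> real" where "pplus t \<equiv> phase_plus C (\<sigma> t)"
abbreviation pminus :: "real \<Rightarrow> 'b \<Rightarrow> real" where "pminus t \<equiv> phase_minus C (\<sigma> t)"
abbreviation ph :: "real \<Rightarrow> 'b \<Rightarrow> real" where "ph t \<equiv> phase C (\<sigma> t)"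
abbreviation ms :: "real \<Rightarrow> 'b \<Rightarrow> real" where "ms t \<equiv> mass C (\<sigma> t)"
abbreviation Z :: "real \<Rightarrow> 'b \<Rightarrow> complex" where "Z t \<equiv> charge C (\<sigma> t)"
abbreviation window :: "real \<Rightarrow> real \<Rightarrow> 'b \<Rightarrow> real" where
  "window t \<equiv> pre_stable_category.window C (\<sigma> t)"

lemma lssD: "lss E \<Longrightarrow> E \<in> obj C" "lss E \<Longrightarrow> \<not> zero_obj C E"
  "lss E \<Longrightarrow> ((\<lambda>t. pplus t E - pminus t E) \<longlongrightarrow> 0) at_top"
  unfolding limit_semistable_def by blast+

lemma ev_ge: "eventually (\<lambda>t. a \<le> t) at_top"
  by (rule eventually_ge_at_top)

text \<open>The generalized metric contains the variation of the top phase as one of its terms. The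
  averaged phase is not among them, so the continuity argument is carried out with
  \<open>pplus\<close>.\<close>

lemma continuous_pplus:
  assumes X: "X \<in> obj C" "\<not> zero_obj C X"
  shows "continuous_on {a..} (\<lambda>t. pplus t X)"
proof -
  have "continuous_map (stab_topology C \<Lambda> v) euclideanreal (\<lambda>\<tau>. phase_plus C \<tau> X)"
    unfolding continuous_map_def
  proof (intro conjI allI impI)
    fix W :: "real set" assume "openin euclideanreal W"
    then have W: "open W"
      by simp
    show "openin (stab_topology C \<Lambda> v) {\<tau> \<in> topspace (stab_topology C \<Lambda> v). phase_plus C \<tau> X \<in> W}"
      unfolding openin_stab topspace_stab stab_open_def
    proof (intro conjI ballI)
      fix \<tau> assume "\<tau> \<in> {\<tau> \<in> Stab C \<Lambda> v. phase_plus C \<tau> X \<in> W}"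
      then obtain e where e: "e > 0" "\<And>y. dist y (phase_plus C \<tau> X) < e \<Longrightarrow> y \<in> W"
        using W unfolding open_dist by blast
      have "phase_plus C \<tau>' X \<in> W" if "stab_dist C \<tau> \<tau>' < ennreal e" for \<tau>'
      proof -
        let ?M = "{\<bar>phase_plus C \<tau> X - phase_plus C \<tau>' X\<bar>, \<bar>phase_minus C \<tau> X - phase_minus C \<tau>' X\<bar>,
            \<bar>ln (mass C \<tau> X / mass C \<tau>' X)\<bar>}"
        have "ennreal \<bar>phase_plus C \<tau> X - phase_plus C \<tau>' X\<bar> \<le> ennreal (Max ?M)"
          by (intro ennreal_leI Max_ge) auto
        also have "\<dots> \<le> stab_dist C \<tau> \<tau>'"
          unfolding stab_dist_def using X by (intro SUP_upper2[of X]) auto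
        finally have "\<bar>phase_plus C \<tau> X - phase_plus C \<tau>' X\<bar> < e"
          using that e(1) by (metis abs_ge_zero ennreal_less_iff le_less_trans)
        then show ?thesis
          using e(2)[of "phase_plus C \<tau>' X"] by (simp add: dist_real_def abs_minus_commute)
      qed
      then show "\<exists>\<epsilon>>0. \<forall>\<tau>'\<in>Stab C \<Lambda> v. stab_dist C \<tau> \<tau>' < \<epsilon> \<longrightarrow> \<tau>' \<in> {\<tau> \<in> Stab C \<Lambda> v. phase_plus C \<tau> X \<in> W}"
        using e(1) by (intro exI[of _ "ennreal e"]) auto
    qed auto
  qed auto
  from continuous_map_compose[OF path_continuous this] show ?thesis
    by (simp add: o_def)
qed

lemma ph_bounds:
  assumes "a \<le> t" "X \<in> obj C" "\<not> zero_obj C X"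
  shows "pminus t X \<le> ph t X" "ph t X \<le> pplus t X" "0 < ms t X" "cmod (Z t X) \<le> ms t X"
  using pre_stable_category.phase_bounds[OF stable[OF assms(1)] assms(2,3)]
    pre_stable_category.mass_pos[OF stable[OF assms(1)] assms(2,3)]
    pre_stable_category.charge_le_mass[OF stable[OF assms(1)] assms(2)] by auto

lemma lss_gap:
  assumes "lss X" "0 < e"
  shows "eventually (\<lambda>t. pplus t X - pminus t X < e) at_top"
  using order_tendstoD(2)[OF lssD(3)[OF assms(1)] assms(2)] .

text \<open>The phase spread is eventually below 1/4, so \<open>window_lower\<close> applies;
  positivity of the mass makes the charge nonzero.\<close>

lemma lss_charge:
  assumes "lss X"
  shows "eventually (\<lambda>t. ms t X / 2 \<le> cmod (Z t X)) at_top"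
    "eventually (\<lambda>t. ms t X / 2 \<le> window t (ph t X - 1 / 2) X) at_top"
    "eventually (\<lambda>t. Z t X \<noteq> 0) at_top"
proof -
  have g: "eventually (\<lambda>t. pplus t X - pminus t X < 1 / 4) at_top"
    by (rule lss_gap[OF assms]) simp
  show 1: "eventually (\<lambda>t. ms t X / 2 \<le> window t (ph t X - 1 / 2) X) at_top"
    using g ev_ge
  proof eventually_elim
    case (elim t)
    then show ?case
      using pre_stable_category.window_lower(1)[OF stable] lssD(1,2)[OF assms] by blast
  qed
  show 2: "eventually (\<lambda>t. ms t X / 2 \<le> cmod (Z t X)) at_top"
    using g ev_ge 1
  proof eventually_elim
    case (elim t)
    then show ?case
      using pre_stable_category.window_lower(2)[OF stable] lssD(1,2)[OF assms] by (meson order_trans)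
  qed
  show "eventually (\<lambda>t. Z t X \<noteq> 0) at_top"
    using 2 ev_ge
  proof eventually_elim
    case (elim t)
    then show ?case
      using ph_bounds(3)[OF elim(2) lssD(1,2)[OF assms]] by auto
  qed
qed

lemma lss_sho:
  assumes "lss X"
  shows "lss (sho C X)" "((\<lambda>t. ph t (sho C X) - ph t X) \<longlongrightarrow> 1) at_top"
proof -
  note X = lssD(1,2)[OF assms]
  have s: "sho C X \<in> obj C" "\<not> zero_obj C (sho C X)"
    using X sho_in zero_obj_sho_iff by auto
  have b: "pplus t (sho C X) \<le> pplus t X + 1" "pminus t X + 1 \<le> pminus t (sho C X)" if "a \<le> t" for t
    using pre_stable_category.pplus_sho_le[OF stable[OF that] X] by auto
  have "((\<lambda>t. pplus t (sho C X) - pminus t (sho C X)) \<longlongrightarrow> 0) at_top"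
  proof (rule tendsto_sandwich[OF _ _ tendsto_const lssD(3)[OF assms]])
    show "eventually (\<lambda>t. 0 \<le> pplus t (sho C X) - pminus t (sho C X)) at_top"
      using ev_ge by eventually_elim (use ph_bounds[OF _ s] in force)
    show "eventually (\<lambda>t. pplus t (sho C X) - pminus t (sho C X) \<le> pplus t X - pminus t X) at_top"
      using ev_ge by eventually_elim (use b in force)
  qed
  then show "lss (sho C X)"
    using s unfolding limit_semistable_def by blast
  have "((\<lambda>t. (ph t (sho C X) - ph t X) - 1) \<longlongrightarrow> 0) at_top"
  proof (rule Lim_null_comparison[OF _ lssD(3)[OF assms]])
    show "eventually (\<lambda>t. norm ((ph t (sho C X) - ph t X) - 1) \<le> pplus t X - pminus t X) at_top"
      using ev_ge
    proof eventually_elim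
      case (elim t)
      then show ?case
        using ph_bounds(1,2)[OF elim s] ph_bounds(1,2)[OF elim X] b[OF elim] by (auto simp: abs_le_iff)
    qed
  qed
  then show "((\<lambda>t. ph t (sho C X) - ph t X) \<longlongrightarrow> 1) at_top"
    by (simp add: LIM_zero_iff)
qed

lemma lss_funpow_sho:
  assumes "lss X"
  shows "lss ((sho C ^^ n) X) \<and> ((\<lambda>t. ph t ((sho C ^^ n) X) - ph t X) \<longlongrightarrow> real n) at_top"
proof (induction n)
  case (Suc n)
  then have l: "lss ((sho C ^^ n) X)" and *: "((\<lambda>t. ph t ((sho C ^^ n) X) - ph t X) \<longlongrightarrow> real n) at_top"
    by auto
  from tendsto_add[OF lss_sho(2)[OF l] *] lss_sho(1)[OF l] show ?case
    by (simp add: add.commute)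
qed (use assms in simp)

text \<open>A positive lower limit leaves a constant gap c between consecutive averaged phases;
  spreads below c/2 then separate the phase intervals.\<close>

lemma limit_hn_tower:
  assumes "limit_hn_filtration C \<sigma> G Gs"
  shows "filtration C G Gs" "\<And>F. F \<in> set Gs \<Longrightarrow> lss F"
    "eventually (\<lambda>t. pre_stable_category.tower C (\<sigma> t) Gs) at_top"
    "Suc i < length Gs \<Longrightarrow> \<exists>c>0. eventually (\<lambda>t. c < ph t (Gs ! i) - ph t (Gs ! Suc i)) at_top"
proof -
  show f: "filtration C G Gs" and l: "\<And>F. F \<in> set Gs \<Longrightarrow> lss F"
    using assms unfolding limit_hn_filtration_def by auto
  have gap: "\<exists>c>0. eventually (\<lambda>t. c < ph t (Gs ! i) - ph t (Gs ! Suc i)) at_top"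
    if "Suc i < length Gs" for i
  proof -
    have "0 < Liminf at_top (\<lambda>t. ereal (ph t (Gs ! i) - ph t (Gs ! Suc i)))"
      using assms that unfolding limit_hn_filtration_def by blast
    then obtain c where c: "0 < ereal c" "ereal c < Liminf at_top (\<lambda>t. ereal (ph t (Gs ! i) - ph t (Gs ! Suc i)))"
      using ereal_dense2 by blast
    then have "eventually (\<lambda>t. ereal c < ereal (ph t (Gs ! i) - ph t (Gs ! Suc i))) at_top"
      by (intro less_LiminfD)
    then show ?thesis
      using c(1) by (intro exI[of _ c]) simp
  qed
  then show "Suc i < length Gs \<Longrightarrow> \<exists>c>0. eventually (\<lambda>t. c < ph t (Gs ! i) - ph t (Gs ! Suc i)) at_top"
    by blast
  have "eventually (\<lambda>t. pplus t (Gs ! Suc i) < pminus t (Gs ! i)) at_top" if i: "Suc i < length Gs" for i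
  proof -
    obtain c where c: "c > 0" "eventually (\<lambda>t. c < ph t (Gs ! i) - ph t (Gs ! Suc i)) at_top"
      using gap[OF i] by blast
    have li: "lss (Gs ! i)" "lss (Gs ! Suc i)"
      using l i by auto
    have c2: "0 < c / 2"
      using c(1) by simp
    show ?thesis
      using c(2) lss_gap[OF li(1) c2] lss_gap[OF li(2) c2] ev_ge
    proof eventually_elim
      case (elim t)
      then show ?case
        using ph_bounds(1,2)[OF _ lssD(1,2)[OF li(1)], of t] ph_bounds(1,2)[OF _ lssD(1,2)[OF li(2)], of t] c(1)
        by auto
    qed
  qed
  then have "\<forall>i \<in> {i. Suc i < length Gs}. eventually (\<lambda>t. pplus t (Gs ! Suc i) < pminus t (Gs ! i)) at_top"
    by blast
  moreover have "finite {i. Suc i < length Gs}"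
    by (rule finite_subset[of _ "{..<length Gs}"]) auto
  ultimately have "eventually (\<lambda>t. \<forall>i \<in> {i. Suc i < length Gs}. pplus t (Gs ! Suc i) < pminus t (Gs ! i)) at_top"
    by (intro eventually_ball_finite)
  then show "eventually (\<lambda>t. pre_stable_category.tower C (\<sigma> t) Gs) at_top"
    using ev_ge
  proof eventually_elim
    case (elim t)
    show ?case
      by (rule pre_stable_category.towerI[OF stable[OF elim(2)]]) (use elim(1) l lssD in auto)
  qed
qed

lemma ex_limit_hn: "X \<in> obj C \<Longrightarrow> \<exists>Gs. limit_hn_filtration C \<sigma> X Gs"
  using qc unfolding quasi_convergent_def by blast

text \<open>The test object \<open>G\<close> is the sum of E and F[1]. A single limit HN factor
  squeezes both phases into its shrinking phase interval. With two or more, the phases of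
  \<open>G\<close> stay spread out; since E and F[1] have shrinking spreads, they must be apart from
  each other. The shift on F comes from \<open>Tr_zero_map\<close>.\<close>

lemma phase_gap_sho:
  assumes E: "lss E" and F: "lss F"
  shows "((\<lambda>t. ph t E - ph t (sho C F)) \<longlongrightarrow> 0) at_top \<or>
    (\<exists>c>0. eventually (\<lambda>t. c \<le> \<bar>pplus t E - pplus t (sho C F)\<bar>) at_top)"
proof -
  let ?F = "sho C F"
  note F' = lss_sho(1)[OF F]
  note oE = lssD(1,2)[OF E] and oF = lssD(1,2)[OF F']
  obtain G where G: "Tr C E G ?F" "retract E G" "retract ?F G"
    using Tr_zero_map[OF lssD(1)[OF F] lssD(1)[OF E]] .
  have oG: "G \<in> obj C" "\<not> zero_obj C G"
    using retract_obj[OF G(2)] retract_zero[OF G(2)] oE by auto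
  obtain Gs where "limit_hn_filtration C \<sigma> G Gs"
    using ex_limit_hn[OF oG(1)] ..
  note Gs = limit_hn_tower[OF this]
  have "Gs \<noteq> []"
    using Gs(1) oG(2) filtration_Nil by auto
  then consider A where "Gs = [A]" | A B L where "Gs = A # B # L"
    by (metis list.exhaust)
  then show ?thesis
  proof cases
    case 1
    then obtain E0 where E0: "zero_obj C E0" "Tr C E0 G A"
      using Gs(1) filtration_snoc[of G "[]" A] by (auto simp: filtration_Nil)
    have A: "lss A"
      using Gs(2) 1 by simp
    have "((\<lambda>t. ph t E - ph t ?F) \<longlongrightarrow> 0) at_top"
    proof (rule Lim_null_comparison[OF _ lssD(3)[OF A]])
      show "eventually (\<lambda>t. norm (ph t E - ph t ?F) \<le> pplus t A - pminus t A) at_top"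
        using ev_ge
      proof eventually_elim
        case (elim t)
        interpret S: pre_stable_category C "\<sigma> t"
          by (rule stable[OF elim])
        have "pplus t G \<le> pplus t A" "pminus t A \<le> pminus t G"
          using S.Tr_phases[OF E0(2) oG(2), of "pplus t A" "pminus t A"] E0(1) by auto
        then show ?case
          using S.retract_phases[OF G(2) oE(2)] S.retract_phases[OF G(3) oF(2)]
            ph_bounds(1,2)[OF elim oE] ph_bounds(1,2)[OF elim oF] by (simp add: abs_le_iff)
      qed
    qed
    then show ?thesis ..
  next
    case 2
    define M where "M = last (B # L)"
    define Gs' where "Gs' = A # butlast (B # L)"
    have Gs': "Gs = Gs' @ [M]"
      unfolding M_def Gs'_def 2 by simp
    have "M \<in> set Gs"
      unfolding Gs' by simp
    then have lA: "lss A" and lB: "lss B" and lM: "lss M"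
      using Gs(2) 2 by auto
    obtain c where c: "c > 0" "eventually (\<lambda>t. c < ph t A - ph t B) at_top"
      using Gs(4)[of 0] 2 by auto
    \<comment> \<open>The spreads of \<open>A\<close>, \<open>B\<close>, E and F[1], each below c/8,
      together cost less than c/2 of the gap c, so c/4 is left with room to spare.\<close>
    have c8: "0 < c / 8"
      using c(1) by simp
    have "eventually (\<lambda>t. c / 4 \<le> \<bar>pplus t E - pplus t ?F\<bar>) at_top"
      using c(2) Gs(3) lss_charge(3)[OF lA] lss_charge(3)[OF lM] ev_ge
        lss_gap[OF lA c8] lss_gap[OF lB c8] lss_gap[OF E c8] lss_gap[OF F' c8]
    proof eventually_elim
      case (elim t)
      interpret S: pre_stable_category C "\<sigma> t"
        by (rule stable[OF elim(5)])
      have 1: "pminus t A \<le> pplus t G"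
        using S.tower_first[of G A "B # L"] Gs(1) elim(2,3) oG(2) 2 by simp
      have 2: "pminus t G \<le> pplus t M"
        using S.tower_last[of G Gs' M] Gs(1) elim(2,4) oG(2) Gs' by simp
      have 3: "pplus t M \<le> pplus t B"
      proof (cases "L = []")
        case False
        then have "M \<in> set L"
          by (simp add: M_def)
        then have "pplus t M < pminus t B"
          using elim(2) \<open>Gs = A # B # L\<close> by (simp add: S.tower_def)
        then show ?thesis
          using S.pminus_le_pplus[OF lssD(1,2)[OF lB]] by simp
      qed (simp add: M_def)
      have 4: "pplus t G \<le> max (pplus t E) (pplus t ?F)" "min (pminus t E) (pminus t ?F) \<le> pminus t G"
        using S.Tr_phases[OF G(1) oG(2), of "max (pplus t E) (pplus t ?F)" "min (pminus t E) (pminus t ?F)"]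
        by auto
      show ?case
        using 1 2 3 4 elim(1,6-9) ph_bounds(1,2)[OF elim(5) lssD(1,2)[OF lA]]
          ph_bounds(1,2)[OF elim(5) lssD(1,2)[OF lB]]
        unfolding max_def min_def abs_if by (auto split: if_splits)
    qed
    then show ?thesis
      using c(1) by (intro disjI2 exI[of _ "c / 4"]) simp
  qed
qed

text \<open>
  Whenever the phases of E and F[1] coincide along the path, their direct sum is close to being
  semistable, which forces it to have a single limit HN factor. Hence by continuity the phase
  difference of two limit semistable objects cannot oscillate across an integer.
\<close>

lemma phase_trichotomy_sho:
  assumes E: "lss E" and F: "lss F"
  shows "((\<lambda>t. ph t E - ph t (sho C F)) \<longlongrightarrow> 0) at_top \<or>
    eventually (\<lambda>t. 0 < ph t E - ph t (sho C F)) at_top \<or>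
    eventually (\<lambda>t. ph t E - ph t (sho C F) < 0) at_top"
  using phase_gap_sho[OF E F]
proof
  let ?F = "sho C F"
  let ?f = "\<lambda>t. pplus t E - pplus t ?F"
  note F' = lss_sho(1)[OF F]
  note oE = lssD(1,2)[OF E] and oF = lssD(1,2)[OF F']
  assume "\<exists>c>0. eventually (\<lambda>t. c \<le> \<bar>pplus t E - pplus t ?F\<bar>) at_top"
  then obtain c b where c: "c > 0" "\<And>t. b \<le> t \<Longrightarrow> c \<le> \<bar>?f t\<bar>"
    unfolding eventually_at_top_linorder by blast
  define b' where "b' = max a b"
  have "continuous_on {a..} ?f"
    by (intro continuous_on_diff continuous_pplus oE oF)
  then have "continuous_on {b'..} ?f"
    by (rule continuous_on_subset) (simp add: b'_def)
  then have s: "(\<forall>t\<ge>b'. c \<le> ?f t) \<or> (\<forall>t\<ge>b'. ?f t \<le> - c)"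
    using continuous_sign[of b' ?f c] c by (simp add: b'_def)
  have e: "eventually (\<lambda>t. b' \<le> t) at_top"
    by (rule eventually_ge_at_top)
  from s have "eventually (\<lambda>t. 0 < ph t E - ph t ?F) at_top \<or> eventually (\<lambda>t. ph t E - ph t ?F < 0) at_top"
  proof
    assume s: "\<forall>t\<ge>b'. c \<le> ?f t"
    have "eventually (\<lambda>t. 0 < ph t E - ph t ?F) at_top"
      using e ev_ge lss_gap[OF E c(1)]
    proof eventually_elim
      case (elim t)
      then have "c \<le> ?f t"
        using s by blast
      then show ?case
        using elim(3) ph_bounds(1,2)[OF elim(2) oE] ph_bounds(1,2)[OF elim(2) oF] by linarith
    qed
    then show ?thesis ..
  next
    assume s: "\<forall>t\<ge>b'. ?f t \<le> - c"
    have "eventually (\<lambda>t. ph t E - ph t ?F < 0) at_top"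
      using e ev_ge lss_gap[OF F' c(1)]
    proof eventually_elim
      case (elim t)
      then have "?f t \<le> - c"
        using s by blast
      then show ?case
        using elim(3) ph_bounds(1,2)[OF elim(2) oE] ph_bounds(1,2)[OF elim(2) oF] by linarith
    qed
    then show ?thesis ..
  qed
  then show ?thesis
    by blast
qed blast

text \<open>For each integer k the difference eventually stays above k - 1 or eventually stays below
  k + 1. If one alternative holds for all k, the difference diverges; otherwise it is bounded on
  both sides.\<close>

lemma phase_trichotomy:
  assumes E: "lss E" and F: "lss F"
  shows "filterlim (\<lambda>t. ph t E - ph t F) at_top at_top \<or>
    filterlim (\<lambda>t. ph t F - ph t E) at_top at_top \<or>
    (\<exists>K. eventually (\<lambda>t. \<bar>ph t E - ph t F\<bar> \<le> K) at_top)"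
proof -
  let ?d = "\<lambda>t. ph t E - ph t F"
  have int: "eventually (\<lambda>t. real_of_int k - 1 < ?d t) at_top \<or> eventually (\<lambda>t. ?d t < real_of_int k + 1) at_top"
    for k :: int
  proof -
    \<comment> \<open>\<open>m\<close> and \<open>n\<close> shift E and F so that n + 1 - m = k with
      both natural; the additional 1 is the shift already present in
      \<open>phase_trichotomy_sho\<close>.\<close>
    define m where "m = nat (1 - k)"
    define n where "n = nat k - (if k \<ge> 1 then 1 else 0)"
    have mn: "real n + 1 - real m = real_of_int k"
      by (auto simp: m_def n_def)
    define E' where "E' = (sho C ^^ m) E"
    define F' where "F' = (sho C ^^ n) F"
    have E': "lss E'" "((\<lambda>t. ph t E' - ph t E) \<longlongrightarrow> real m) at_top"
      and F': "lss F'" "((\<lambda>t. ph t F' - ph t F) \<longlongrightarrow> real n) at_top"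
      using lss_funpow_sho[OF E, of m] lss_funpow_sho[OF F, of n] by (auto simp: E'_def F'_def)
    let ?r = "\<lambda>t. (ph t (sho C F') - ph t F') + (ph t F' - ph t F) - (ph t E' - ph t E)"
    have r: "(?r \<longlongrightarrow> real_of_int k) at_top"
      using tendsto_diff[OF tendsto_add[OF lss_sho(2)[OF F'(1)] F'(2)] E'(2)] mn by (simp add: algebra_simps)
    have ru: "eventually (\<lambda>t. ?r t < real_of_int k + 1) at_top" "eventually (\<lambda>t. real_of_int k - 1 < ?r t) at_top"
      using order_tendstoD[OF r] by auto
    from phase_trichotomy_sho[OF E'(1) F'(1)]
    consider "((\<lambda>t. ph t E' - ph t (sho C F')) \<longlongrightarrow> 0) at_top"
      | "eventually (\<lambda>t. 0 < ph t E' - ph t (sho C F')) at_top"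
      | "eventually (\<lambda>t. ph t E' - ph t (sho C F') < 0) at_top"
      by blast
    then show ?thesis
    proof cases
      case 1
      from tendsto_add[OF 1 r] have "(?d \<longlongrightarrow> real_of_int k) at_top"
        by simp
      then show ?thesis
        using order_tendstoD(1)[of ?d "real_of_int k" at_top "real_of_int k - 1"] by simp
    next
      case 2
      then have "eventually (\<lambda>t. real_of_int k - 1 < ?d t) at_top"
        using ru(2) by eventually_elim linarith
      then show ?thesis ..
    next
      case 3
      then have "eventually (\<lambda>t. ?d t < real_of_int k + 1) at_top"
        using ru(1) by eventually_elim linarith
      then show ?thesis ..
    qed
  qed
  show ?thesis
  proof (cases "\<forall>k::int. eventually (\<lambda>t. real_of_int k - 1 < ?d t) at_top")
    case True
    have "eventually (\<lambda>t. c \<le> ?d t) at_top" for c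
      using True[rule_format, of "\<lceil>c\<rceil> + 1"] by eventually_elim linarith
    then show ?thesis
      by (simp add: filterlim_at_top)
  next
    case False
    then obtain k where k: "eventually (\<lambda>t. ?d t < real_of_int k + 1) at_top"
      using int by blast
    show ?thesis
    proof (cases "\<forall>k::int. eventually (\<lambda>t. ?d t < real_of_int k + 1) at_top")
      case True
      have "eventually (\<lambda>t. c \<le> ph t F - ph t E) at_top" for c
        using True[rule_format, of "\<lfloor>- c\<rfloor> - 1"] by eventually_elim linarith
      then show ?thesis
        by (simp add: filterlim_at_top)
    next
      case False
      then obtain k' where k': "eventually (\<lambda>t. real_of_int k' - 1 < ?d t) at_top"
        using int by blast
      from k k' have "eventually (\<lambda>t. \<bar>?d t\<bar> \<le> \<bar>real_of_int k + 1\<bar> + \<bar>real_of_int k' - 1\<bar>) at_top"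
        by eventually_elim (simp add: abs_if split: if_splits)
      then show ?thesis
        by blast
    qed
  qed
qed

text \<open>A positive form of \<open>equiv_i\<close> that is visibly symmetric and transitive; the
  two agree on limit semistable objects by \<open>phase_trichotomy\<close>.\<close>

definition bounded_phase :: "'b \<Rightarrow> 'b \<Rightarrow> bool" where
  "bounded_phase E F \<longleftrightarrow> (\<exists>K. eventually (\<lambda>t. \<bar>ph t E - ph t F\<bar> \<le> K) at_top)"

lemma bounded_phase_sym: "bounded_phase E F \<Longrightarrow> bounded_phase F E"
  unfolding bounded_phase_def by (simp add: abs_minus_commute)

lemma bounded_phase_trans:
  assumes "bounded_phase E F" "bounded_phase F G"
  shows "bounded_phase E G"
proof -
  obtain K L where "eventually (\<lambda>t. \<bar>ph t E - ph t F\<bar> \<le> K) at_top" "eventually (\<lambda>t. \<bar>ph t F - ph t G\<bar> \<le> L) at_top"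
    using assms unfolding bounded_phase_def by blast
  then have "eventually (\<lambda>t. \<bar>ph t E - ph t G\<bar> \<le> K + L) at_top"
    by eventually_elim linarith
  then show ?thesis
    unfolding bounded_phase_def by blast
qed

lemma bounded_phase_not_prec_i: "bounded_phase E F \<Longrightarrow> \<not> prec_i C \<sigma> F E"
proof
  assume "bounded_phase E F" "prec_i C \<sigma> F E"
  then obtain K where "eventually (\<lambda>t. \<bar>ph t E - ph t F\<bar> \<le> K) at_top" "eventually (\<lambda>t. K + 1 \<le> ph t E - ph t F) at_top"
    unfolding bounded_phase_def prec_i_def filterlim_at_top by blast
  then have "eventually (\<lambda>t::real. False) at_top"
    by eventually_elim linarith
  then show False
    by simp
qed

lemma prec_i_asym: "prec_i C \<sigma> F E \<Longrightarrow> \<not> prec_i C \<sigma> E F"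
proof
  assume "prec_i C \<sigma> F E" "prec_i C \<sigma> E F"
  then have "eventually (\<lambda>t. 1 \<le> ph t E - ph t F) at_top" "eventually (\<lambda>t. 1 \<le> ph t F - ph t E) at_top"
    unfolding prec_i_def filterlim_at_top by blast+
  then have "eventually (\<lambda>t::real. False) at_top"
    by eventually_elim linarith
  then show False
    by simp
qed

lemma equiv_i_iff: "lss E \<Longrightarrow> lss F \<Longrightarrow> equiv_i C \<sigma> E F \<longleftrightarrow> bounded_phase E F"
  unfolding equiv_i_def preceq_i_def
  using phase_trichotomy[of E F] bounded_phase_not_prec_i bounded_phase_sym
  unfolding bounded_phase_def prec_i_def by blast

section \<open>Masses and the preorder\<close>

definition mass_ratio :: "'b \<Rightarrow> 'b \<Rightarrow> real \<Rightarrow> real" where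
  "mass_ratio E F t = ln (ms t E / ms t F)"

lemma mass_ratio_eq:
  assumes "lss E" "lss F" "a \<le> t"
  shows "mass_ratio E F t = ln (ms t E) - ln (ms t F)"
  unfolding mass_ratio_def using ph_bounds(3)[OF assms(3) lssD(1,2)[OF assms(1)]]
    ph_bounds(3)[OF assms(3) lssD(1,2)[OF assms(2)]] by (simp add: ln_div)

lemma lim_prec_iff:
  assumes "lss E" "lss F"
  shows "lim_prec C \<sigma> F E \<longleftrightarrow> filterlim (\<lambda>t. ph t E - ph t F) at_top at_top \<or>
    (bounded_phase E F \<and> filterlim (mass_ratio E F) at_top at_top)"
  unfolding lim_prec_def prec_i_def equiv_i_iff[OF assms] mass_ratio_def ..

text \<open>Condition (ii) gives a limit \<open>l\<close> of the log-charge differences compressed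
  into the unit disc. If \<open>l\<close> is interior the differences converge. If it is on the
  circle they are unbounded; as their imaginary parts stay bounded, the real parts diverge with the
  sign of Re l.\<close>

lemma mass_trichotomy:
  assumes E: "lss E" and F: "lss F" and b: "bounded_phase E F"
  shows "filterlim (mass_ratio E F) at_top at_top \<or> filterlim (mass_ratio F E) at_top at_top \<or>
    (\<exists>x y. ((\<lambda>t. ph t E - ph t F) \<longlongrightarrow> x) at_top \<and> (mass_ratio E F \<longlongrightarrow> y) at_top)"
proof -
  define f where "f t = log_charge_diff C (\<sigma> t) E F" for t
  define u where "u t = f t / (1 + cmod (f t))" for t
  obtain l where l: "(u \<longlongrightarrow> l) at_top"
    using qc E F unfolding quasi_convergent_def u_def f_def by blast
  have f: "Im (f t) = pi * (ph t E - ph t F)" "a \<le> t \<Longrightarrow> Re (f t) = mass_ratio E F t" for t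
    using mass_ratio_eq[OF E F] by (simp_all add: f_def log_charge_diff_def log_charge_def algebra_simps)
  have pos: "0 < 1 + cmod (f t)" for t
    by (simp add: add_pos_nonneg)
  have ue: "u t = f t / of_real (1 + cmod (f t))" for t
    unfolding u_def by simp
  have nu: "cmod (u t) = cmod (f t) / (1 + cmod (f t))" for t
    unfolding ue norm_divide norm_of_real using pos[of t] by simp
  \<comment> \<open>The compression f / (1 + |f|) onto the open disc has the inverse u / (1 - |u|),
    which is continuous away from the unit circle.\<close>
  have nu1: "cmod (u t) < 1" and fu: "f t = u t / of_real (1 - cmod (u t))" for t
  proof -
    show "cmod (u t) < 1"
      unfolding nu using pos[of t] by (simp add: pos_divide_less_eq)
    have "1 - cmod (u t) = 1 / (1 + cmod (f t))"
      unfolding nu using pos[of t] by (simp add: field_simps)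
    moreover have "complex_of_real (1 + cmod (f t)) \<noteq> 0"
      using pos[of t] by (metis less_irrefl of_real_eq_0_iff)
    ultimately show "f t = u t / of_real (1 - cmod (u t))"
      unfolding ue by (simp only:) (simp add: field_simps)
  qed
  have nl: "((\<lambda>t. cmod (u t)) \<longlongrightarrow> cmod l) at_top"
    using l by (rule tendsto_norm)
  have l1: "cmod l \<le> 1"
    using tendsto_upperbound[OF nl, of 1] nu1 by (simp add: less_imp_le)
  show ?thesis
  proof (cases "cmod l = 1")
    case False
    then have "((\<lambda>t. u t / of_real (1 - cmod (u t))) \<longlongrightarrow> l / of_real (1 - cmod l)) at_top"
      by (intro tendsto_intros l) auto
    then have "(f \<longlongrightarrow> l / of_real (1 - cmod l)) at_top"
      using ext[of f, OF fu] by simp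
    from tendsto_Im[OF this] tendsto_Re[OF this]
    have "((\<lambda>t. Im (f t)) \<longlongrightarrow> Im (l / of_real (1 - cmod l))) at_top"
      and r: "((\<lambda>t. Re (f t)) \<longlongrightarrow> Re (l / of_real (1 - cmod l))) at_top" .
    then have "((\<lambda>t. (pi * (ph t E - ph t F)) / pi) \<longlongrightarrow> Im (l / of_real (1 - cmod l)) / pi) at_top"
      unfolding f(1) by (intro tendsto_divide tendsto_const) auto
    then have "((\<lambda>t. ph t E - ph t F) \<longlongrightarrow> Im (l / of_real (1 - cmod l)) / pi) at_top"
      by simp
    moreover have "(mass_ratio E F \<longlongrightarrow> Re (l / of_real (1 - cmod l))) at_top"
    proof (rule Lim_transform_eventually[OF r])
      show "eventually (\<lambda>t. Re (f t) = mass_ratio E F t) at_top"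
        using ev_ge by eventually_elim (rule f(2))
    qed
    ultimately show ?thesis
      by blast
  next
    case True
    have inf: "filterlim (\<lambda>t. cmod (f t)) at_top at_top"
      unfolding filterlim_at_top
    proof
      fix c :: real
      define c' where "c' = max c 0"
      have "c' / (1 + c') < 1"
        by (simp add: c'_def pos_divide_less_eq add_pos_nonneg)
      then have "eventually (\<lambda>t. c' / (1 + c') < cmod (u t)) at_top"
        using order_tendstoD(1)[OF nl] True by simp
      then show "eventually (\<lambda>t. c \<le> cmod (f t)) at_top"
      proof eventually_elim
        case (elim t)
        have "0 < 1 + c'"
          by (simp add: c'_def add_pos_nonneg)
        then have "c' < cmod (f t)"
          using elim pos[of t] unfolding nu by (simp add: field_simps)
        then show ?case
          by (simp add: c'_def)
      qed
    qed
    obtain K where K: "eventually (\<lambda>t. \<bar>ph t E - ph t F\<bar> \<le> K) at_top"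
      using b unfolding bounded_phase_def by blast
    then have K': "eventually (\<lambda>t. \<bar>Im (f t)\<bar> \<le> pi * K) at_top"
      by eventually_elim (simp add: f(1) abs_mult)
    have re: "eventually (\<lambda>t. cmod (f t) - pi * K \<le> \<bar>Re (f t)\<bar>) at_top"
      using K'
    proof eventually_elim
      case (elim t)
      then show ?case
        using cmod_le[of "f t"] by linarith
    qed
    have "filterlim (\<lambda>t. cmod (f t) + (- (pi * K))) at_top at_top"
      by (rule filterlim_at_top_add_bounded_below[OF inf]) (rule always_eventually, rule allI, rule order_refl)
    then have rinf: "filterlim (\<lambda>t. \<bar>Re (f t)\<bar>) at_top at_top"
      by (rule filterlim_at_top_mono) (use re in simp)
    \<comment> \<open>A bounded imaginary part divided by a diverging modulus tends to 0, so
      \<open>l\<close> is real and equals 1 or -1.\<close>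
    have "((\<lambda>t. Im (u t)) \<longlongrightarrow> 0) at_top"
    proof (rule Lim_null_comparison)
      show "eventually (\<lambda>t. norm (Im (u t)) \<le> (pi * K) / (1 + cmod (f t))) at_top"
        using K'
      proof eventually_elim
        case (elim t)
        have "Im (u t) = Im (f t) / (1 + cmod (f t))"
          unfolding ue by (rule Im_divide_of_real)
        then show ?case
          using elim pos[of t] by (simp add: divide_right_mono)
      qed
      have "filterlim (\<lambda>t. cmod (f t) + 1) at_top at_top"
        by (rule filterlim_at_top_add_bounded_below[OF inf]) (rule always_eventually, rule allI, rule order_refl)
      then show "((\<lambda>t. (pi * K) / (1 + cmod (f t))) \<longlongrightarrow> 0) at_top"
        by (intro tendsto_divide_0[OF tendsto_const] filterlim_at_top_imp_at_infinity) (simp add: add.commute)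
    qed
    moreover have "((\<lambda>t. Im (u t)) \<longlongrightarrow> Im l) at_top"
      using l by (rule tendsto_Im)
    ultimately have "Im l = 0"
      using tendsto_unique trivial_limit_at_top_linorder by blast
    then have "\<bar>Re l\<bar> = 1"
      using True by (simp add: cmod_def)
    then consider "0 < Re l" | "Re l < 0"
      by linarith
    then show ?thesis
    proof cases
      case 1
      have "eventually (\<lambda>t. 0 < Re (u t)) at_top"
        using order_tendstoD(1)[OF tendsto_Re[OF l] 1] .
      then have "eventually (\<lambda>t. \<bar>Re (f t)\<bar> = mass_ratio E F t) at_top"
        using ev_ge
      proof eventually_elim
        case (elim t)
        have "Re (u t) = Re (f t) / (1 + cmod (f t))"
          unfolding ue by (rule Re_divide_of_real)
        then show ?case
          using elim pos[of t] f(2)[OF elim(2)] by (simp add: zero_less_divide_iff)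
      qed
      then have "filterlim (mass_ratio E F) at_top at_top"
        using rinf filterlim_cong[OF refl refl, of "\<lambda>t. \<bar>Re (f t)\<bar>" "mass_ratio E F" at_top at_top] by blast
      then show ?thesis ..
    next
      case 2
      have "eventually (\<lambda>t. Re (u t) < 0) at_top"
        using order_tendstoD(2)[OF tendsto_Re[OF l] 2] .
      then have "eventually (\<lambda>t. \<bar>Re (f t)\<bar> = mass_ratio F E t) at_top"
        using ev_ge
      proof eventually_elim
        case (elim t)
        have "Re (u t) = Re (f t) / (1 + cmod (f t))"
          unfolding ue by (rule Re_divide_of_real)
        then show ?case
          using elim pos[of t] f(2)[OF elim(2)] mass_ratio_eq[OF E F elim(2)] mass_ratio_eq[OF F E elim(2)]
          by (simp add: divide_less_0_iff)
      qed
      then have "filterlim (mass_ratio F E) at_top at_top"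
        using rinf filterlim_cong[OF refl refl, of "\<lambda>t. \<bar>Re (f t)\<bar>" "mass_ratio F E" at_top at_top] by blast
      then show ?thesis
        by blast
    qed
  qed
qed

lemma ratio_at_top_mono:
  assumes "filterlim f at_top at_top" "filterlim g at_top at_top \<or> (\<exists>K. eventually (\<lambda>t. K \<le> g t) at_top)"
  shows "filterlim (\<lambda>t. f t + g t :: real) at_top (at_top :: real filter)"
proof -
  have "\<exists>K. eventually (\<lambda>t. K \<le> g t) at_top"
    using assms(2) unfolding filterlim_at_top by blast
  then show ?thesis
    using filterlim_at_top_add_bounded_below[OF assms(1)] by blast
qed

lemma lim_prec_asym:
  assumes "lss E" "lss F" "lim_prec C \<sigma> F E"
  shows "\<not> lim_prec C \<sigma> E F"
proof
  assume "lim_prec C \<sigma> E F"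
  then consider "prec_i C \<sigma> F E" "prec_i C \<sigma> E F" | "bounded_phase E F" "prec_i C \<sigma> F E \<or> prec_i C \<sigma> E F"
    | "filterlim (mass_ratio E F) at_top at_top" "filterlim (mass_ratio F E) at_top at_top"
    using assms lim_prec_iff bounded_phase_sym unfolding prec_i_def by blast
  then show False
  proof cases
    case 1
    then show ?thesis
      using prec_i_asym by blast
  next
    case 2
    then show ?thesis
      using bounded_phase_not_prec_i bounded_phase_sym by blast
  next
    case 3
    then have "eventually (\<lambda>t. 1 \<le> mass_ratio E F t) at_top" "eventually (\<lambda>t. 1 \<le> mass_ratio F E t) at_top"
      unfolding filterlim_at_top by blast+
    then have "eventually (\<lambda>t::real. False) at_top"
      using ev_ge by eventually_elim (use mass_ratio_eq assms in force)
    then show ?thesis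
      by simp
  qed
qed

lemma lim_preceq_cases:
  assumes "lss F" "lss B" "lim_preceq C \<sigma> F B"
  shows "filterlim (\<lambda>t. ph t B - ph t F) at_top at_top \<or> (bounded_phase B F \<and>
    (filterlim (mass_ratio B F) at_top at_top \<or>
      (\<exists>x y. ((\<lambda>t. ph t B - ph t F) \<longlongrightarrow> x) at_top \<and> (mass_ratio B F \<longlongrightarrow> y) at_top)))"
  using assms(3) phase_trichotomy[OF assms(2,1)] mass_trichotomy[OF assms(2,1)] lim_prec_iff[OF assms(1,2)]
    bounded_phase_sym[of B F]
  unfolding lim_preceq_def bounded_phase_def by blast

text \<open>Phase differences and logarithmic mass ratios are additive along F, B, E. At whichever
  level the divergence occurs, the other summand diverges as well or is bounded below, so it cannot
  cancel it.\<close>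

lemma lim_preceq_prec_trans:
  assumes "lss F" "lss B" "lss E" "lim_preceq C \<sigma> F B" "lim_prec C \<sigma> B E"
  shows "lim_prec C \<sigma> F E"
proof -
  have d: "(\<lambda>t. ph t E - ph t F) = (\<lambda>t. (ph t E - ph t B) + (ph t B - ph t F))"
    by auto
  \<comment> \<open>\<open>ratio_at_top_mono\<close> expects the divergent summand first, hence the
    two orders of the same sum.\<close>
  have d': "(\<lambda>t. ph t E - ph t F) = (\<lambda>t. (ph t B - ph t F) + (ph t E - ph t B))"
    by auto
  have low: "\<exists>K. eventually (\<lambda>t. K \<le> ph t X - ph t Y) at_top" if b: "bounded_phase X Y" for X Y
  proof -
    obtain K where "eventually (\<lambda>t. \<bar>ph t X - ph t Y\<bar> \<le> K) at_top"
      using b unfolding bounded_phase_def by blast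
    then have "eventually (\<lambda>t. - K \<le> ph t X - ph t Y) at_top"
      by eventually_elim linarith
    then show ?thesis
      by blast
  qed
  have FB: "filterlim (\<lambda>t. ph t B - ph t F) at_top at_top \<or> (bounded_phase B F \<and>
      (filterlim (mass_ratio B F) at_top at_top \<or> (\<exists>K. eventually (\<lambda>t. K \<le> mass_ratio B F t) at_top)))"
  proof -
    have "\<exists>K. eventually (\<lambda>t. K \<le> mass_ratio B F t) at_top" if y: "(mass_ratio B F \<longlongrightarrow> y) at_top" for y
      using order_tendstoD(1)[OF y, of "y - 1"] by (intro exI[of _ "y - 1"]) (auto elim: eventually_mono)
    then show ?thesis
      using lim_preceq_cases[OF assms(1,2,4)] by blast
  qed
  have r: "filterlim (mass_ratio E F) at_top at_top"
    if "filterlim (mass_ratio E B) at_top at_top"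
      "filterlim (mass_ratio B F) at_top at_top \<or> (\<exists>K. eventually (\<lambda>t. K \<le> mass_ratio B F t) at_top)"
  proof -
    have "eventually (\<lambda>t. mass_ratio E B t + mass_ratio B F t = mass_ratio E F t) at_top"
      using ev_ge by eventually_elim (simp add: mass_ratio_eq assms)
    then show ?thesis
      using ratio_at_top_mono[OF that]
        filterlim_cong[OF refl refl, of "\<lambda>t. mass_ratio E B t + mass_ratio B F t" "mass_ratio E F" at_top at_top]
      by blast
  qed
  have "filterlim (\<lambda>t. ph t E - ph t F) at_top at_top \<or>
    (bounded_phase E F \<and> filterlim (mass_ratio E F) at_top at_top)"
    using assms(5)[unfolded lim_prec_iff[OF assms(3,2)]]
  proof
    assume "filterlim (\<lambda>t. ph t E - ph t B) at_top at_top"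
    then have "filterlim (\<lambda>t. ph t E - ph t F) at_top at_top"
      unfolding d by (rule ratio_at_top_mono) (use FB low in blast)
    then show ?thesis ..
  next
    assume EB: "bounded_phase E B \<and> filterlim (mass_ratio E B) at_top at_top"
    from FB show ?thesis
    proof
      assume "filterlim (\<lambda>t. ph t B - ph t F) at_top at_top"
      then have "filterlim (\<lambda>t. ph t E - ph t F) at_top at_top"
        unfolding d' by (rule ratio_at_top_mono) (use EB low in blast)
      then show ?thesis ..
    next
      assume "bounded_phase B F \<and>
        (filterlim (mass_ratio B F) at_top at_top \<or> (\<exists>K. eventually (\<lambda>t. K \<le> mass_ratio B F t) at_top))"
      then show ?thesis
        using EB r bounded_phase_trans by blast
    qed
  qed
  then show ?thesis
    using lim_prec_iff[OF assms(3,1)] by blast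
qed

lemma lim_preceq_trans:
  assumes "lss F" "lss B" "lss E" "lim_preceq C \<sigma> F B" "lim_preceq C \<sigma> B E"
  shows "lim_preceq C \<sigma> F E"
  using lim_preceq_prec_trans[of B E F] assms unfolding lim_preceq_def by blast

text \<open>In the window centred at the phase of F, the object G has at least half the mass of F,
  by \<open>tower_window\<close>. If every B preceded F, each would have left the window because its
  phase falls behind, or would have negligible mass, and the right-hand side would be too small. The
  offset \<open>k\<close> accommodates shifts.\<close>

lemma limit_hn_window_bound:
  assumes G: "limit_hn_filtration C \<sigma> G Fs" and F: "F \<in> set Fs" and Bs: "\<And>B. B \<in> set Bs \<Longrightarrow> lss B"
    and w: "eventually (\<lambda>t. \<forall>\<theta>. window t \<theta> G \<le> (\<Sum>B\<leftarrow>Bs. window t (\<theta> + k) B)) at_top"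
  shows "\<exists>B \<in> set Bs. lim_preceq C \<sigma> F B"
proof (rule ccontr)
  assume "\<not> ?thesis"
  then have prec: "lim_prec C \<sigma> B F" if "B \<in> set Bs" for B
    using that unfolding lim_preceq_def by blast
  note Fs = limit_hn_tower[OF G]
  have lF: "lss F"
    using Fs(2) F by blast
  \<comment> \<open>Terms of size at most ms F / n sum to less than a quarter of the mass of F,
    safely below the half that is required; the 1 keeps \<open>n\<close> positive when
    \<open>Bs\<close> is empty.\<close>
  define n where "n = 4 * (real (length Bs) + 1)"
  have n: "n > 0"
    by (simp add: n_def add_pos_nonneg)
  have small: "eventually (\<lambda>t. window t (ph t F - 1 / 2 + k) B \<le> ms t F / n) at_top" if B: "B \<in> set Bs" for B
  proof -
    note lB = Bs[OF B]
    from prec[OF B, unfolded lim_prec_iff[OF lF lB]] show ?thesis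
    proof
      assume "filterlim (\<lambda>t. ph t F - ph t B) at_top at_top"
      \<comment> \<open>With spread below 1 this puts the top phase of B at most at ph F - 1 + k,
        below the start ph F - 1/2 + k of the window.\<close>
      then have "eventually (\<lambda>t. 2 - k \<le> ph t F - ph t B) at_top"
        unfolding filterlim_at_top by blast
      moreover have "eventually (\<lambda>t. pplus t B - pminus t B < 1) at_top"
        using lss_gap[OF lB] by simp
      ultimately show ?thesis
        using ev_ge
      proof eventually_elim
        case (elim t)
        then have "pplus t B \<le> ph t F - 1 / 2 + k"
          using ph_bounds(1,2)[OF elim(3) lssD(1,2)[OF lB]] by linarith
        then have "window t (ph t F - 1 / 2 + k) B = 0"
          using pre_stable_category.window_zero[OF stable[OF elim(3)] lssD(1,2)[OF lB]] by blast
        then show ?case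
          using n ph_bounds(3)[OF elim(3) lssD(1,2)[OF lF]] by simp
      qed
    next
      assume "bounded_phase F B \<and> filterlim (mass_ratio F B) at_top at_top"
      then have "eventually (\<lambda>t. ln n \<le> mass_ratio F B t) at_top"
        unfolding filterlim_at_top by blast
      then show ?thesis
        using ev_ge
      proof eventually_elim
        case (elim t)
        have pos: "0 < ms t F" "0 < ms t B"
          using ph_bounds(3)[OF elim(2)] lssD(1,2) lF lB by blast+
        then have "n \<le> ms t F / ms t B"
          using elim(1) n unfolding mass_ratio_def by (subst (asm) ln_le_cancel_iff) auto
        then have "ms t B \<le> ms t F / n"
          using pos n by (simp add: field_simps)
        then show ?case
          using pre_stable_category.window_le_mass[OF stable[OF elim(2)] lssD(1)[OF lB],
              of "ph t F - 1 / 2 + k"] by simp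
      qed
    qed
  qed
  have "eventually (\<lambda>t. \<forall>B \<in> set Bs. window t (ph t F - 1 / 2 + k) B \<le> ms t F / n) at_top"
    by (intro eventually_ball_finite ballI small) auto
  then have "eventually (\<lambda>t::real. False) at_top"
    using w lss_charge(2)[OF lF] Fs(3) ev_ge
  proof eventually_elim
    case (elim t)
    interpret S: pre_stable_category C "\<sigma> t"
      by (rule stable[OF elim(5)])
    let ?\<theta> = "ph t F - 1 / 2"
    have pos: "0 < ms t F"
      using ph_bounds(3)[OF elim(5) lssD(1,2)[OF lF]] .
    have nonneg: "0 \<le> S.window ?\<theta> A" if "A \<in> set Fs" for A
      using S.window_nonneg lssD(1) Fs(2) that by blast
    have "S.window ?\<theta> F \<le> (\<Sum>A\<leftarrow>Fs. S.window ?\<theta> A)"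
      using nonneg F by (intro member_le_sum_list) auto
    also have "\<dots> = S.window ?\<theta> G"
      using S.tower_window[OF Fs(1) elim(4)] by simp
    also have "\<dots> \<le> (\<Sum>B\<leftarrow>Bs. S.window (?\<theta> + k) B)"
      using elim(2) by blast
    also have "\<dots> \<le> (\<Sum>B\<leftarrow>Bs. ms t F / n)"
      using elim(1) by (intro sum_list_mono) auto
    also have "\<dots> = real (length Bs) * (ms t F / n)"
      by (simp add: sum_list_triv)
    also have "\<dots> < ms t F / 2"
      using pos n by (simp add: n_def field_simps add_pos_nonneg)
    finally show ?case
      using elim(3) by simp
  qed
  then show False
    by simp
qed

section \<open>Thickness of the subcategories cut out by limit HN factors\<close>

definition down_closed :: "('b \<Rightarrow> bool) \<Rightarrow> bool" where
  "down_closed P \<longleftrightarrow> (\<forall>F B. lss F \<longrightarrow> lss B \<longrightarrow> lim_preceq C \<sigma> F B \<longrightarrow> P B \<longrightarrow> P F)"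

lemma down_closed_preceq: "lss E \<Longrightarrow> down_closed (\<lambda>A. lim_preceq C \<sigma> A E)"
  unfolding down_closed_def using lim_preceq_trans by blast

lemma down_closed_prec: "lss E \<Longrightarrow> down_closed (\<lambda>A. lim_prec C \<sigma> A E)"
  unfolding down_closed_def using lim_preceq_prec_trans by blast

lemma owf_obj: "X \<in> objs_with_factors C \<sigma> P \<Longrightarrow> X \<in> obj C"
  unfolding objs_with_factors_def by blast

lemma owf_factors:
  assumes "X \<in> objs_with_factors C \<sigma> P"
  obtains Gs where "limit_hn_filtration C \<sigma> X Gs" "\<And>A. A \<in> set Gs \<Longrightarrow> P A" "\<And>A. A \<in> set Gs \<Longrightarrow> lss A"
  using assms limit_hn_tower(2) unfolding objs_with_factors_def by blast

lemma limit_hn_window: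
  assumes "limit_hn_filtration C \<sigma> X Gs" "a \<le> t"
  shows "window t \<theta> X \<le> (\<Sum>G\<leftarrow>Gs. window t \<theta> G)"
  using pre_stable_category.filtration_window[OF stable[OF assms(2)] limit_hn_tower(1)[OF assms(1)]] .

text \<open>The common criterion behind closure under shifts, extensions and retracts: each of these
  bounds the windows of X by windows of limit HN factors satisfying \<open>P\<close>, up to a
  constant offset.\<close>

lemma owf_window:
  assumes P: "down_closed P" and X: "X \<in> obj C" and Bs: "\<And>B. B \<in> set Bs \<Longrightarrow> P B" "\<And>B. B \<in> set Bs \<Longrightarrow> lss B"
    and w: "\<And>t \<theta>. a \<le> t \<Longrightarrow> window t \<theta> X \<le> (\<Sum>B\<leftarrow>Bs. window t (\<theta> + k) B)"
  shows "X \<in> objs_with_factors C \<sigma> P"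
proof -
  obtain Fs where Fs: "limit_hn_filtration C \<sigma> X Fs"
    using ex_limit_hn[OF X] ..
  have w': "eventually (\<lambda>t. \<forall>\<theta>. window t \<theta> X \<le> (\<Sum>B\<leftarrow>Bs. window t (\<theta> + k) B)) at_top"
    by (rule eventually_mono[OF ev_ge]) (use w in blast)
  have "P F" if "F \<in> set Fs" for F
    using limit_hn_window_bound[OF Fs that Bs(2) w'] Bs P limit_hn_tower(2)[OF Fs that]
    unfolding down_closed_def by blast
  then show ?thesis
    unfolding objs_with_factors_def using X Fs by blast
qed

lemma owf_zero: "zero_obj C X \<Longrightarrow> X \<in> objs_with_factors C \<sigma> P"
  unfolding objs_with_factors_def using zero_objD
  by (auto intro!: exI[of _ "[]"] simp: limit_hn_filtration_def filtration_Nil)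

lemma filtration_single:
  assumes "X \<in> obj C"
  shows "filtration C X [X]"
proof -
  obtain K where "zero_obj C K"
    using ex_zero_obj by blast
  then have "filtration C K []" "Tr C K X X"
    using Tr_zero_left assms by (auto simp: filtration_Nil)
  then show ?thesis
    using filtration_snoc[of X "[]" X] by auto
qed

lemma owf_lss: "lss X \<Longrightarrow> P X \<Longrightarrow> X \<in> objs_with_factors C \<sigma> P"
  unfolding objs_with_factors_def using lssD(1) filtration_single
  by (auto intro!: exI[of _ "[X]"] simp: limit_hn_filtration_def)

lemma owf_sho:
  assumes P: "down_closed P" and X: "X \<in> obj C"
  shows "sho C X \<in> objs_with_factors C \<sigma> P \<longleftrightarrow> X \<in> objs_with_factors C \<sigma> P"
proof
  assume "X \<in> objs_with_factors C \<sigma> P"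
  then obtain Bs where Bs: "limit_hn_filtration C \<sigma> X Bs" "\<And>A. A \<in> set Bs \<Longrightarrow> P A" "\<And>A. A \<in> set Bs \<Longrightarrow> lss A"
    using owf_factors by metis
  show "sho C X \<in> objs_with_factors C \<sigma> P"
  proof (rule owf_window[OF P sho_in[OF X] Bs(2,3)])
    fix t \<theta> assume t: "a \<le> t"
    show "window t \<theta> (sho C X) \<le> (\<Sum>B\<leftarrow>Bs. window t (\<theta> + - 1) B)"
      using pre_stable_category.window_sho[OF stable[OF t] X, of "\<theta> - 1"] limit_hn_window[OF Bs(1) t, of "\<theta> - 1"]
      by simp
  qed
next
  assume "sho C X \<in> objs_with_factors C \<sigma> P"
  then obtain Bs where Bs: "limit_hn_filtration C \<sigma> (sho C X) Bs" "\<And>A. A \<in> set Bs \<Longrightarrow> P A" "\<And>A. A \<in> set Bs \<Longrightarrow> lss A"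
    using owf_factors by metis
  show "X \<in> objs_with_factors C \<sigma> P"
  proof (rule owf_window[OF P X Bs(2,3)])
    fix t \<theta> assume t: "a \<le> t"
    show "window t \<theta> X \<le> (\<Sum>B\<leftarrow>Bs. window t (\<theta> + 1) B)"
      using pre_stable_category.window_sho[OF stable[OF t] X, of \<theta>] limit_hn_window[OF Bs(1) t, of "\<theta> + 1"]
      by simp
  qed
qed

lemma owf_Tr:
  assumes P: "down_closed P" and T: "Tr C X Y W"
    and X: "X \<in> objs_with_factors C \<sigma> P" and W: "W \<in> objs_with_factors C \<sigma> P"
  shows "Y \<in> objs_with_factors C \<sigma> P"
proof -
  obtain Bs where Bs: "limit_hn_filtration C \<sigma> X Bs" "\<And>A. A \<in> set Bs \<Longrightarrow> P A" "\<And>A. A \<in> set Bs \<Longrightarrow> lss A"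
    using owf_factors[OF X] by metis
  obtain Bs' where Bs': "limit_hn_filtration C \<sigma> W Bs'" "\<And>A. A \<in> set Bs' \<Longrightarrow> P A" "\<And>A. A \<in> set Bs' \<Longrightarrow> lss A"
    using owf_factors[OF W] by metis
  have Y: "Y \<in> obj C"
    using TrD[OF T] by blast
  show ?thesis
  proof (rule owf_window[OF P Y, of "Bs @ Bs'" 0])
    fix t \<theta> assume t: "a \<le> t"
    show "window t \<theta> Y \<le> (\<Sum>B\<leftarrow>Bs @ Bs'. window t (\<theta> + 0) B)"
      using pre_stable_category.window_subadditive[OF stable[OF t] T, of \<theta>]
        limit_hn_window[OF Bs(1) t, of \<theta>] limit_hn_window[OF Bs'(1) t, of \<theta>] by simp
  qed (use Bs Bs' in auto)
qed

lemma owf_retract: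
  assumes P: "down_closed P" and R: "retract X Y" and Y: "Y \<in> objs_with_factors C \<sigma> P"
  shows "X \<in> objs_with_factors C \<sigma> P"
proof -
  obtain Bs where Bs: "limit_hn_filtration C \<sigma> Y Bs" "\<And>A. A \<in> set Bs \<Longrightarrow> P A" "\<And>A. A \<in> set Bs \<Longrightarrow> lss A"
    using owf_factors[OF Y] by metis
  have X: "X \<in> obj C"
    using retract_obj[OF R] by blast
  show ?thesis
  proof (rule owf_window[OF P X Bs(2,3)])
    fix t \<theta> assume t: "a \<le> t"
    show "window t \<theta> X \<le> (\<Sum>B\<leftarrow>Bs. window t (\<theta> + 0) B)"
      using pre_stable_category.window_retract[OF stable[OF t] R, of \<theta>] limit_hn_window[OF Bs(1) t, of \<theta>]
      by simp
  qed
qed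

end

section \<open>Verdier quotients\<close>

text \<open>\<open>S\<close> and \<open>N\<close> will be the objects below and strictly below E.
  Closure of \<open>N\<close> under retracts enters where invertibility or vanishing in the quotient
  has to be read off from a cone.\<close>

locale thick_pair = triangulated_category +
  fixes S N :: "'b set"
  assumes S_zero: "zero_obj C X \<Longrightarrow> X \<in> S"
    and S_sho: "X \<in> obj C \<Longrightarrow> sho C X \<in> S \<longleftrightarrow> X \<in> S"
    and S_Tr: "Tr C X Y W \<Longrightarrow> X \<in> S \<Longrightarrow> W \<in> S \<Longrightarrow> Y \<in> S"
    and N_zero: "zero_obj C X \<Longrightarrow> X \<in> N"
    and N_sho: "X \<in> obj C \<Longrightarrow> sho C X \<in> N \<longleftrightarrow> X \<in> N"
    and N_Tr: "Tr C X Y W \<Longrightarrow> X \<in> N \<Longrightarrow> W \<in> N \<Longrightarrow> Y \<in> N"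
    and N_retract: "retract X Y \<Longrightarrow> Y \<in> N \<Longrightarrow> X \<in> N"
    and N_S: "N \<subseteq> S"
    and S_obj: "S \<subseteq> obj C"
begin

lemma N_cone: "Tr C X Y W \<Longrightarrow> X \<in> N \<Longrightarrow> Y \<in> N \<Longrightarrow> W \<in> N"
  using N_Tr[OF Tr_rot] N_sho TrD by blast

lemma N_fibre: "Tr C X Y W \<Longrightarrow> Y \<in> N \<Longrightarrow> W \<in> N \<Longrightarrow> X \<in> N"
  using N_Tr[OF Tr_rot[OF Tr_rot]] N_sho TrD by blast

lemma S_fibre: "Tr C X Y W \<Longrightarrow> Y \<in> S \<Longrightarrow> W \<in> S \<Longrightarrow> X \<in> S"
  using S_Tr[OF Tr_rot[OF Tr_rot]] S_sho TrD by blast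

definition qis :: "'b \<Rightarrow> 'b \<Rightarrow> 'c \<Rightarrow> bool" where
  "qis X Y s \<longleftrightarrow> s \<in> homset C X Y \<and> X \<in> S \<and> Y \<in> S \<and> (\<exists>W \<in> N. \<exists>g h. dt C X Y W s g h)"

lemma qisD: "qis X Y s \<Longrightarrow> s \<in> homset C X Y" "qis X Y s \<Longrightarrow> X \<in> S" "qis X Y s \<Longrightarrow> Y \<in> S"
  by (auto simp: qis_def)

text \<open>The octahedron for the identity followed by \<open>s\<close> links any two cones of
  \<open>s\<close> by a triangle with a zero object, so membership in \<open>N\<close> does not
  depend on the cone.\<close>

lemma qis_cone:
  assumes "qis X Y s" "dt C X Y W s g h"
  shows "W \<in> N"
proof -
  obtain W' g' h' where W': "W' \<in> N" "dt C X Y W' s g' h'"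
    using assms(1) unfolding qis_def by blast
  obtain K where K: "zero_obj C K"
    using ex_zero_obj by blast
  have X: "X \<in> obj C" and i: "idt C X \<in> homset C X X"
    using dtD[OF assms(2)] idt_in by auto
  have "s \<cdot> idt C X = s"
    using cmp_idt dtD[OF assms(2)] by blast
  then obtain b b' where "dt C K W W' b b' (sha C (null C X K) \<cdot> h')"
    using octahedron[OF dt_idt[OF X K] W'(2), of W g h] assms(2) by metis
  then have "Tr C K W W'"
    unfolding Tr_def by blast
  then show ?thesis
    using N_Tr N_zero[OF K] W'(1) by blast
qed

lemma qisI: "dt C X Y W s g h \<Longrightarrow> X \<in> S \<Longrightarrow> Y \<in> S \<Longrightarrow> W \<in> N \<Longrightarrow> qis X Y s"
  unfolding qis_def using dtD(1) by blast

lemma qis_idt: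
  assumes "X \<in> S"
  shows "qis X X (idt C X)"
proof -
  obtain K where K: "zero_obj C K"
    using ex_zero_obj by blast
  have "X \<in> obj C"
    using assms S_obj by blast
  then show ?thesis
    using qisI[OF dt_idt[OF _ K]] assms N_zero[OF K] by blast
qed

text \<open>One octahedron contains the whole two-out-of-three property: the three cones form a
  triangle, and \<open>N\<close> is closed under completing triangles.\<close>

lemma qis_triangle:
  assumes "f \<in> homset C X Y" "g \<in> homset C Y W"
  obtains A B D where "Tr C A D B" "qis X Y f \<Longrightarrow> A \<in> N" "qis Y W g \<Longrightarrow> B \<in> N" "qis X W (g \<cdot> f) \<Longrightarrow> D \<in> N"
    "A \<in> N \<Longrightarrow> X \<in> S \<Longrightarrow> Y \<in> S \<Longrightarrow> qis X Y f" "B \<in> N \<Longrightarrow> Y \<in> S \<Longrightarrow> W \<in> S \<Longrightarrow> qis Y W g"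
    "D \<in> N \<Longrightarrow> X \<in> S \<Longrightarrow> W \<in> S \<Longrightarrow> qis X W (g \<cdot> f)"
proof -
  obtain A i i' where 1: "dt C X Y A f i i'"
    using dt_complete[OF assms(1)] .
  obtain B j j' where 2: "dt C Y W B g j j'"
    using dt_complete[OF assms(2)] .
  obtain D l l' where 3: "dt C X W D (g \<cdot> f) l l'"
    using dt_complete[OF cmp_in[OF assms]] .
  obtain b b' where "dt C A D B b b' (sha C i \<cdot> j')"
    using octahedron[OF 1 2 3] .
  then have "Tr C A D B"
    unfolding Tr_def by blast
  then show ?thesis
    using that[of A D B] qis_cone[OF _ 1] qis_cone[OF _ 2] qis_cone[OF _ 3] qisI[OF 1] qisI[OF 2] qisI[OF 3]
    by blast
qed

lemma qis_cmp:
  assumes "qis X Y f" "qis Y W g"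
  shows "qis X W (g \<cdot> f)"
  using qis_triangle[OF qisD(1)[OF assms(1)] qisD(1)[OF assms(2)]] assms N_Tr qisD(2,3) by metis

lemma qis_cancel_left:
  assumes "qis X W (g \<cdot> f)" "qis Y W g" "f \<in> homset C X Y"
  shows "qis X Y f"
  using qis_triangle[OF assms(3) qisD(1)[OF assms(2)]] assms N_fibre qisD(2,3) by metis

text \<open>Instead of a pullback, take the fibre \<open>U\<close> of V -> W -> M, where M is the
  cone of \<open>p\<close>. Then \<open>m\<close> has cone M, and x m vanishes in M, so it factors
  through \<open>p\<close>.\<close>

lemma ore:
  assumes p: "qis P W p" and x: "x \<in> homset C V W" and V: "V \<in> S"
  obtains U m \<alpha> where "qis U V m" "\<alpha> \<in> homset C U P" "x \<cdot> m = p \<cdot> \<alpha>"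
proof -
  obtain M g h where d: "dt C P W M p g h"
    using dt_complete[OF qisD(1)[OF p]] .
  have M: "M \<in> N"
    using qis_cone[OF p d] .
  have gx: "g \<cdot> x \<in> homset C V M"
    using cmp_in[OF x dtD(2)[OF d]] .
  obtain Y y y' where e: "dt C V M Y (g \<cdot> x) y y'"
    using dt_complete[OF gx] .
  obtain U where U: "U \<in> obj C" "isomorphic C (sho C U) Y"
    using sho_ess_surj dtD(6)[OF e] by blast
  obtain m c where m: "dt C U V M m (g \<cdot> x) c"
    using dt_back[OF e U] .
  have "Tr C U V M"
    using m unfolding Tr_def by blast
  then have "U \<in> S"
    using S_fibre V M N_S by blast
  then have q: "qis U V m"
    using qisI[OF m] V M by blast
  have xm: "x \<cdot> m \<in> homset C U W"
    using cmp_in[OF dtD(1)[OF m] x] .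
  have "g \<cdot> (x \<cdot> m) = null C U M"
    using cmp_assoc[OF dtD(1)[OF m] x dtD(2)[OF d]] dt_cmp_null[OF m] by simp
  then obtain \<alpha> where "\<alpha> \<in> homset C U P" "p \<cdot> \<alpha> = x \<cdot> m"
    using factor_fibre[OF d xm] by blast
  then show ?thesis
    using that q by metis
qed

lemma qis_sho:
  assumes "qis X Y s"
  shows "qis (sho C X) (sho C Y) (sha C s)"
proof -
  obtain W g h where W: "W \<in> N" "dt C X Y W s g h"
    using assms unfolding qis_def by blast
  have "dt C (sho C X) (sho C Y) (sho C W) (neg (sha C s)) (neg (sha C g)) (neg (sha C h))"
    using dt_sho[OF W(2)] .
  from dt_neg_neg[OF this]
  have "dt C (sho C X) (sho C Y) (sho C W) (sha C s) (sha C g) (neg (sha C h))"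
    using neg_neg sha_in dtD(1,2)[OF W(2)] by metis
  moreover have "sho C X \<in> S" "sho C Y \<in> S" "sho C W \<in> N"
    using S_sho N_sho dtD(4-6)[OF W(2)] qisD(2,3)[OF assms] W(1) by blast+
  ultimately show ?thesis
    using qisI by blast
qed

text \<open>The cone of z \<beta> maps to the cone \<open>K\<close> of \<open>z\<close>, and
  \<open>K\<close> maps to the cone of g z; what the second arrow kills comes from the first. This
  exhibits K[1] as a retract of the cone of an arrow between objects of \<open>N\<close>.\<close>

lemma two_of_six:
  assumes z: "z \<in> homset C W V" and \<beta>: "\<beta> \<in> homset C U W" and g: "g \<in> homset C V X"
    and z\<beta>: "qis U V (z \<cdot> \<beta>)" and gz: "qis W X (g \<cdot> z)"
  shows "qis W V z"
proof -
  obtain K j \<delta> where K: "dt C W V K z j \<delta>"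
    using dt_complete[OF z] .
  note k = dtD[OF K]
  obtain M1 c1 d1 where M1: "dt C U V M1 (z \<cdot> \<beta>) c1 d1"
    using dt_complete[OF qisD(1)[OF z\<beta>]] .
  obtain M2 c2 \<epsilon> where M2: "dt C W X M2 (g \<cdot> z) c2 \<epsilon>"
    using dt_complete[OF qisD(1)[OF gz]] .
  have MN: "M1 \<in> N" "M2 \<in> N"
    using qis_cone[OF z\<beta> M1] qis_cone[OF gz M2] .
  note m1 = dtD[OF M1] and m2 = dtD[OF M2]
  have "j \<cdot> (z \<cdot> \<beta>) = null C U K"
    using cmp_assoc[OF \<beta> z k(2)] dt_cmp_null[OF K] cmp_null_left[OF \<beta> k(6)] by simp
  then obtain b1 where b1: "b1 \<in> homset C M1 K" "b1 \<cdot> c1 = j"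
    using factor_cone[OF M1 k(2)] by blast
  have "sha C (g \<cdot> z) \<cdot> \<delta> = sha C g \<cdot> (sha C z \<cdot> \<delta>)"
    using sha_cmp[OF z g] cmp_assoc[OF k(3) sha_in[OF z] sha_in[OF g]] by simp
  also have "\<dots> = null C K (sho C X)"
    using dt_cmp_null3[OF K] cmp_null_right[OF sha_in[OF g] k(6)] by simp
  finally obtain \<gamma> where \<gamma>: "\<gamma> \<in> homset C K M2" "\<epsilon> \<cdot> \<gamma> = \<delta>"
    using factor_shift[OF M2 k(3)] by blast
  obtain T \<tau> h where T: "dt C M1 K T b1 \<tau> h"
    using dt_complete[OF b1(1)] .
  note t = dtD[OF T]
  obtain Y0 y0 y0' where Y0: "dt C K M2 Y0 \<gamma> y0 y0'"
    using dt_complete[OF \<gamma>(1)] .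
  obtain L where L: "L \<in> obj C" "isomorphic C (sho C L) Y0"
    using sho_ess_surj dtD(6)[OF Y0] by blast
  \<comment> \<open>\<open>e0\<close> is weakly universal among arrows killed by
    \<open>\<gamma>\<close>. It is killed by \<open>\<delta>\<close> too, so it comes through
    \<open>j\<close> and hence through \<open>b1\<close>; therefore \<open>\<tau>\<close> kills it
    and factors through \<open>\<gamma>\<close>.\<close>
  obtain e0 c where e0: "dt C L K M2 e0 \<gamma> c"
    using dt_back[OF Y0 L] .
  note l = dtD[OF e0]
  have "\<delta> \<cdot> e0 = \<epsilon> \<cdot> (\<gamma> \<cdot> e0)"
    using cmp_assoc[OF l(1) \<gamma>(1) m2(3)] \<gamma>(2) by simp
  also have "\<dots> = null C L (sho C W)"
    using dt_cmp_null[OF e0] cmp_null_right[OF m2(3) l(4)] by simp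
  finally obtain \<rho> where \<rho>: "\<rho> \<in> homset C L V" "j \<cdot> \<rho> = e0"
    using factor_fibre[OF dt_rot[OF K] l(1)] by blast
  have c\<rho>: "c1 \<cdot> \<rho> \<in> homset C L M1"
    using cmp_in[OF \<rho>(1) m1(2)] .
  have "\<tau> \<cdot> e0 = (\<tau> \<cdot> b1) \<cdot> (c1 \<cdot> \<rho>)"
    using cmp_assoc[OF \<rho>(1) m1(2) b1(1)] b1(2) \<rho>(2) cmp_assoc[OF c\<rho> b1(1) t(2)] by simp
  also have "\<dots> = null C L T"
    using dt_cmp_null[OF T] cmp_null_left[OF c\<rho> t(6)] by simp
  finally obtain \<tau>' where \<tau>': "\<tau>' \<in> homset C M2 T" "\<tau>' \<cdot> \<gamma> = \<tau>"
    using factor_cone[OF e0 t(2)] by blast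
  \<comment> \<open>The arrow M2 -> M1[1] whose cone lies in \<open>N\<close> and will contain K[1]
    as a retract.\<close>
  define \<kappa> where "\<kappa> = h \<cdot> \<tau>'"
  have \<kappa>: "\<kappa> \<in> homset C M2 (sho C M1)"
    unfolding \<kappa>_def using cmp_in[OF \<tau>'(1) t(3)] .
  obtain Y y y' where Y: "dt C M2 (sho C M1) Y \<kappa> y y'"
    using dt_complete[OF \<kappa>] .
  note yD = dtD[OF Y]
  have iM: "idt C (sho C M1) \<in> homset C (sho C M1) (sho C M1)"
    using idt_in yD by blast
  have "idt C (sho C M1) \<cdot> \<kappa> = h \<cdot> \<tau>'"
    using cmp_idt[OF \<kappa>] \<kappa>_def by simp
  then obtain d where d: "d \<in> homset C Y (sho C K)" "d \<cdot> y = neg (sha C b1) \<cdot> idt C (sho C M1)"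
    "sha C \<tau>' \<cdot> y' = neg (sha C \<tau>) \<cdot> d"
    using dt_morphism[OF Y dt_rot[OF dt_rot[OF T]] \<tau>'(1) iM] by blast
  have sb: "neg (sha C b1) \<in> homset C (sho C M1) (sho C K)" and s\<tau>: "neg (sha C \<tau>) \<in> homset C (sho C K) (sho C T)"
    and s\<gamma>: "sha C \<gamma> \<in> homset C (sho C K) (sho C M2)"
    using neg_in sha_in b1(1) t(2) \<gamma>(1) by blast+
  have dy: "d \<cdot> y = neg (sha C b1)"
    using d(2) cmp_idt[OF sb] by simp
  have "\<kappa> \<cdot> \<gamma> = h \<cdot> \<tau>"
    unfolding \<kappa>_def using cmp_assoc[OF \<gamma>(1) \<tau>'(1) t(3)] \<tau>'(2) by simp
  then have \<kappa>\<gamma>: "\<kappa> \<cdot> \<gamma> = null C K (sho C M1)"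
    using dt_cmp_null2[OF T] by simp
  have oK: "K \<in> obj C" "sho C K \<in> obj C" "sho C M1 \<in> obj C"
    using k(6) sho_in m1(6) by auto
  have "sha C \<kappa> \<cdot> sha C \<gamma> = null C (sho C K) (sho C (sho C M1))"
    using sha_cmp[OF \<gamma>(1) \<kappa>] \<kappa>\<gamma> sha_null[OF oK(1,3)] by simp
  then have "sha C \<kappa> \<cdot> neg (sha C \<gamma>) = null C (sho C K) (sho C (sho C M1))"
    using cmp_scal[OF s\<gamma> sha_in[OF \<kappa>], of "-1"] neg_null[OF oK(2) sho_in[OF oK(3)]] by simp
  then obtain x where x: "x \<in> homset C (sho C K) Y" "y' \<cdot> x = neg (sha C \<gamma>)"
    using factor_shift[OF Y neg_in[OF s\<gamma>]] by blast
  have iK: "idt C (sho C K) \<in> homset C (sho C K) (sho C K)" and dx: "d \<cdot> x \<in> homset C (sho C K) (sho C K)"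
    using idt_in oK cmp_in[OF x(1) d(1)] by auto
  have "neg (sha C \<tau>) \<cdot> (d \<cdot> x) = (sha C \<tau>' \<cdot> y') \<cdot> x"
    using cmp_assoc[OF x(1) d(1) s\<tau>] d(3) by simp
  also have "\<dots> = sha C \<tau>' \<cdot> neg (sha C \<gamma>)"
    using cmp_assoc[OF x(1) yD(3) sha_in[OF \<tau>'(1)]] x(2) by simp
  also have "\<dots> = neg (sha C \<tau>)"
    using cmp_scal[OF s\<gamma> sha_in[OF \<tau>'(1)], of "-1"] sha_cmp[OF \<gamma>(1) \<tau>'(1)] \<tau>'(2) by simp
  finally have "neg (sha C \<tau>) \<cdot> (d \<cdot> x \<boxplus> neg (idt C (sho C K))) = null C (sho C K) (sho C T)"
    using cmp_diff_right[OF dx iK s\<tau>] cmp_idt[OF s\<tau>] padd_uminus[OF s\<tau>] by simp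
  \<comment> \<open>The axioms do not control the composite \<open>d \<cdot> x\<close>. Its defect
    from the identity is killed by the shifted \<open>\<tau>\<close>, hence factors through
    \<open>d \<cdot> y\<close>, and replacing \<open>x\<close> by its difference with
    \<open>y \<cdot> r\<close> removes it.\<close>
  then obtain r where r: "r \<in> homset C (sho C K) (sho C M1)"
    "neg (sha C b1) \<cdot> r = d \<cdot> x \<boxplus> neg (idt C (sho C K))"
    using factor_fibre[OF dt_sho[OF T] padd_in[OF dx neg_in[OF iK]]] by blast
  have yr: "y \<cdot> r \<in> homset C (sho C K) Y" and dyr: "d \<cdot> (y \<cdot> r) \<in> homset C (sho C K) (sho C K)"
    using cmp_in[OF r(1) yD(2)] cmp_in[OF cmp_in[OF r(1) yD(2)] d(1)] by auto
  have e: "d \<cdot> (y \<cdot> r) = d \<cdot> x \<boxplus> neg (idt C (sho C K))"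
    using cmp_assoc[OF r(1) yD(2) d(1)] dy r(2) by simp
  have "d \<cdot> (x \<boxplus> neg (y \<cdot> r)) = d \<cdot> x \<boxplus> neg (d \<cdot> (y \<cdot> r))"
    by (rule cmp_diff_right[OF x(1) yr d(1)])
  also have "\<dots> = d \<cdot> x \<boxplus> (neg (d \<cdot> x) \<boxplus> idt C (sho C K))"
    unfolding e using scal_padd[OF dx neg_in[OF iK], of "-1"] neg_neg[OF iK] by simp
  also have "\<dots> = (d \<cdot> x \<boxplus> neg (d \<cdot> x)) \<boxplus> idt C (sho C K)"
    using padd_assoc[OF dx neg_in[OF dx] iK] by simp
  also have "\<dots> = idt C (sho C K)"
    using padd_uminus[OF dx] padd_comm[OF null_in[OF oK(2,2)] iK] padd_null[OF iK] by simp
  finally have "retract (sho C K) Y"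
    unfolding retract_def using d(1) padd_in[OF x(1) neg_in[OF yr]] by blast
  moreover have "Tr C M2 (sho C M1) Y"
    using Y unfolding Tr_def by blast
  then have "Y \<in> N"
    using N_cone MN N_sho m1(6) by blast
  ultimately have "K \<in> N"
    using N_retract N_sho oK by blast
  then show ?thesis
    using qisI[OF K] qisD[OF z\<beta>] qisD[OF gz] by blast
qed

section \<open>Roofs and localized arrows\<close>

abbreviation D :: "('a, 'b, 'c) tcat" where "D \<equiv> full_subcategory C S"

lemma D_simps [simp]: "obj D = S" "src D = src C" "trg D = trg C" "idt D = idt C" "cmp D = cmp C"
  "padd D = padd C" "null D = null C" "scal D = scal C" "sho D = sho C" "sha D = sha C"
  using S_obj by (auto simp: full_subcategory_def)

lemma D_arr: "f \<in> arr D \<longleftrightarrow> f \<in> homset C (src C f) (trg C f) \<and> src C f \<in> S \<and> trg C f \<in> S"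
  by (simp add: full_subcategory_def homset_iff)

lemma D_homset: "f \<in> homset D X Y \<longleftrightarrow> f \<in> homset C X Y \<and> X \<in> S \<and> Y \<in> S"
  unfolding homset_iff D_arr D_simps by metis

lemma D_tri: "(f, g, h) \<in> tri D \<longleftrightarrow> (f, g, h) \<in> tri C \<and> src C f \<in> S \<and> trg C f \<in> S \<and> trg C g \<in> S"
proof -
  have "trg C h \<in> S" if "(f, g, h) \<in> tri C" "src C f \<in> S"
  proof -
    have "trg C h = sho C (src C f)"
      using dtD(3)[OF dtI[OF that(1)]] by (simp add: homset_iff)
    moreover have "src C f \<in> obj C"
      using dtD(4)[OF dtI[OF that(1)]] .
    ultimately show ?thesis
      using S_sho that(2) by simp
  qed
  then show ?thesis
    by (auto simp: full_subcategory_def)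
qed

lemma cone_in_iff: "cone_in D N s \<longleftrightarrow> qis (src C s) (trg C s) s"
proof
  assume "cone_in D N s"
  then obtain g h where *: "s \<in> arr D" "(s, g, h) \<in> tri C" "trg C g \<in> N"
    unfolding cone_in_def D_tri D_simps by blast
  then show "qis (src C s) (trg C s) s"
    using qisI[OF dtI[OF *(2)]] unfolding D_arr by blast
next
  assume q: "qis (src C s) (trg C s) s"
  then obtain W g h where W: "W \<in> N" "dt C (src C s) (trg C s) W s g h"
    unfolding qis_def by blast
  have "trg C g = W"
    using dtD(2)[OF W(2)] by (simp add: homset_iff)
  then have "(s, g, h) \<in> tri D" "trg D g \<in> N"
    using W qisD(2,3)[OF q] dtD(7)[OF W(2)] N_S by (auto simp: D_tri)
  then show "cone_in D N s"
    unfolding cone_in_def using qisD[OF q] D_arr by blast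
qed

lemma qis_cone_in: "qis X Y s \<Longrightarrow> cone_in D N s"
  unfolding cone_in_iff using qisD(1)[of X Y s] by (simp add: homset_iff)

lemma cone_in_qis: "cone_in D N s \<Longrightarrow> s \<in> homset C X Y \<Longrightarrow> qis X Y s"
  unfolding cone_in_iff by (simp add: homset_iff)

lemma roofs_iff: "(s, f) \<in> roofs D N X Y \<longleftrightarrow> (\<exists>W. qis W X s \<and> f \<in> homset C W Y \<and> Y \<in> S)"
proof
  assume "(s, f) \<in> roofs D N X Y"
  then have "cone_in D N s" "trg C s = X" "f \<in> homset D (src C s) Y"
    by (auto simp: roofs_def)
  then show "\<exists>W. qis W X s \<and> f \<in> homset C W Y \<and> Y \<in> S"
    unfolding cone_in_iff D_homset by auto
next
  assume "\<exists>W. qis W X s \<and> f \<in> homset C W Y \<and> Y \<in> S"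
  then obtain W where W: "qis W X s" "f \<in> homset C W Y" "Y \<in> S"
    by blast
  then have "src C s = W" "trg C s = X"
    using qisD(1)[OF W(1)] by (auto simp: homset_iff)
  then show "(s, f) \<in> roofs D N X Y"
    using W qis_cone_in[OF W(1)] qisD(2)[OF W(1)] by (simp add: roofs_def D_homset)
qed

lemma roof_eq_iff:
  assumes "s \<in> homset C W X" "f \<in> homset C W Y" "s' \<in> homset C W' X" "f' \<in> homset C W' Y"
    "W \<in> S" "W' \<in> S" "X \<in> S"
  shows "roof_eq D N (s, f) (s', f') \<longleftrightarrow> (\<exists>V u u'. u \<in> homset C V W \<and> u' \<in> homset C V W' \<and>
    s \<cdot> u = s' \<cdot> u' \<and> f \<cdot> u = f' \<cdot> u' \<and> qis V X (s \<cdot> u))"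
proof
  have e: "src C s = W" "src C s' = W'"
    using assms by (auto simp: homset_iff)
  assume "roof_eq D N (s, f) (s', f')"
  then obtain u u' where u: "u \<in> arr D" "u' \<in> arr D" "src C u = src C u'" "trg C u = W" "trg C u' = W'"
    "s \<cdot> u = s' \<cdot> u'" "f \<cdot> u = f' \<cdot> u'" "cone_in D N (s \<cdot> u)"
    unfolding roof_eq_def prod.case D_simps e by blast
  have "u \<in> homset C (src C u) W" "u' \<in> homset C (src C u) W'"
    using u by (auto simp: D_arr)
  then show "\<exists>V u u'. u \<in> homset C V W \<and> u' \<in> homset C V W' \<and>
    s \<cdot> u = s' \<cdot> u' \<and> f \<cdot> u = f' \<cdot> u' \<and> qis V X (s \<cdot> u)"
    using u(6,7) cone_in_qis[OF u(8) cmp_in[OF _ assms(1)]] by blast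
next
  have e: "src C s = W" "src C s' = W'"
    using assms by (auto simp: homset_iff)
  assume "\<exists>V u u'. u \<in> homset C V W \<and> u' \<in> homset C V W' \<and>
    s \<cdot> u = s' \<cdot> u' \<and> f \<cdot> u = f' \<cdot> u' \<and> qis V X (s \<cdot> u)"
  then obtain V u u' where u: "u \<in> homset C V W" "u' \<in> homset C V W'"
    "s \<cdot> u = s' \<cdot> u'" "f \<cdot> u = f' \<cdot> u'" "qis V X (s \<cdot> u)"
    by blast
  have "u \<in> arr D" "u' \<in> arr D" "src C u = V" "src C u' = V" "trg C u = W" "trg C u' = W'"
    using u(1,2) assms(5,6) qisD(2)[OF u(5)] by (auto simp: D_arr homset_iff)
  then show "roof_eq D N (s, f) (s', f')"
    unfolding roof_eq_def prod.case D_simps e using u(3,4) qis_cone_in[OF u(5)] by metis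
qed

text \<open>The class of roofs belonging to \<open>localize D N f\<close>: those (s, b) for which b
  = f s holds after precomposition with an arrow having its cone in \<open>N\<close>. In this form
  equality of localized arrows becomes equality of explicit sets.\<close>

definition localized :: "'b \<Rightarrow> 'b \<Rightarrow> 'c \<Rightarrow> ('c \<times> 'c) set" where
  "localized X Y f = {(s, b). \<exists>W. qis W X s \<and> b \<in> homset C W Y \<and> (\<exists>P p. qis P W p \<and> b \<cdot> p = f \<cdot> (s \<cdot> p))}"

lemma roof_eq_arrow:
  assumes "qis W X s" "b \<in> homset C W Y" "f \<in> homset C X Y"
  shows "roof_eq D N (s, b) (idt C X, f) \<longleftrightarrow> (\<exists>P p. qis P W p \<and> b \<cdot> p = f \<cdot> (s \<cdot> p))"
proof -
  note q = qisD[OF assms(1)]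
  have X: "idt C X \<in> homset C X X"
    using idt_in q(3) S_obj by blast
  have "roof_eq D N (s, b) (idt C X, f) \<longleftrightarrow> (\<exists>V u u'. u \<in> homset C V W \<and> u' \<in> homset C V X \<and>
    s \<cdot> u = idt C X \<cdot> u' \<and> b \<cdot> u = f \<cdot> u' \<and> qis V X (s \<cdot> u))"
    by (rule roof_eq_iff[OF q(1) assms(2) X assms(3) q(2,3,3)])
  also have "\<dots> \<longleftrightarrow> (\<exists>P p. qis P W p \<and> b \<cdot> p = f \<cdot> (s \<cdot> p))"
  proof
    assume "\<exists>V u u'. u \<in> homset C V W \<and> u' \<in> homset C V X \<and>
      s \<cdot> u = idt C X \<cdot> u' \<and> b \<cdot> u = f \<cdot> u' \<and> qis V X (s \<cdot> u)"
    then obtain V u u' where u: "u \<in> homset C V W" "u' \<in> homset C V X"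
      "s \<cdot> u = idt C X \<cdot> u'" "b \<cdot> u = f \<cdot> u'" "qis V X (s \<cdot> u)"
      by blast
    then have "qis V W u" "b \<cdot> u = f \<cdot> (s \<cdot> u)"
      using qis_cancel_left[OF u(5) assms(1) u(1)] cmp_idt[OF u(2)] by auto
    then show "\<exists>P p. qis P W p \<and> b \<cdot> p = f \<cdot> (s \<cdot> p)"
      by blast
  next
    assume "\<exists>P p. qis P W p \<and> b \<cdot> p = f \<cdot> (s \<cdot> p)"
    then obtain P p where p: "qis P W p" "b \<cdot> p = f \<cdot> (s \<cdot> p)"
      by blast
    have sp: "qis P X (s \<cdot> p)"
      using qis_cmp[OF p(1) assms(1)] .
    then have "s \<cdot> p = idt C X \<cdot> (s \<cdot> p)"
      using cmp_idt[OF qisD(1)[OF sp]] by simp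
    then show "\<exists>V u u'. u \<in> homset C V W \<and> u' \<in> homset C V X \<and>
      s \<cdot> u = idt C X \<cdot> u' \<and> b \<cdot> u = f \<cdot> u' \<and> qis V X (s \<cdot> u)"
      using p(2) sp qisD(1)[OF sp] qisD(1)[OF p(1)] by blast
  qed
  finally show ?thesis .
qed

lemma localize_eq:
  assumes "f \<in> homset C X Y" "X \<in> S" "Y \<in> S"
  shows "localize D N f = (X, Y, localized X Y f)"
proof -
  have "src C f = X" "trg C f = Y"
    using assms(1) by (auto simp: homset_iff)
  moreover have "(s, b) \<in> roofs D N X Y \<and> roof_eq D N (s, b) (idt C X, f) \<longleftrightarrow> (s, b) \<in> localized X Y f" for s b
    unfolding localized_def mem_Collect_eq prod.case roofs_iff
    using roof_eq_arrow[of _ X s b Y, OF _ _ assms(1)] assms(3) by meson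
  then have "{r' \<in> roofs D N X Y. roof_eq D N r' (idt C X, f)} = localized X Y f"
    by auto
  ultimately show ?thesis
    unfolding localize_def fraction_of_def by simp
qed

abbreviation V :: "('a, 'b, ('b, 'c) fraction) tcat" where "V \<equiv> verdier_category D N"

lemma V_simps: "obj V = S" "src V (X, Y, A) = X" "trg V (X, Y, A) = Y" "sho V = sho C"
  "idt V X = localize D N (idt C X)" "null V X Y = localize D N (null C X Y)"
  by (simp_all add: verdier_category_def)

lemma localized_roof:
  assumes "f \<in> homset C X Y" "X \<in> S" "Y \<in> S"
  shows "(idt C X, f) \<in> roofs D N X Y" "(idt C X, f) \<in> localized X Y f"
proof -
  show "(idt C X, f) \<in> roofs D N X Y"
    unfolding roofs_iff using qis_idt assms by blast
  have "f \<cdot> idt C X = f \<cdot> (idt C X \<cdot> idt C X)"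
    using cmp_idt[OF idt_in, of X] assms S_obj by auto
  then show "(idt C X, f) \<in> localized X Y f"
    unfolding localized_def using qis_idt[OF assms(2)] assms(1) by blast
qed

lemma localize_arr:
  assumes "f \<in> homset C X Y" "X \<in> S" "Y \<in> S"
  shows "localize D N f \<in> homset V X Y"
proof -
  have "src C f = X" "trg C f = Y"
    using assms(1) by (auto simp: homset_iff)
  then have "localize D N f = fraction_of D N X Y (idt C X, f)"
    unfolding localize_def by simp
  then have "localize D N f \<in> arr V"
    unfolding verdier_category_def using localized_roof(1)[OF assms] assms by auto
  then show ?thesis
    unfolding homset_iff by (simp add: localize_eq[OF assms] V_simps)
qed

text \<open>The composite in the quotient collects roofs from all representatives, so the point is
  that any choice of representatives and Ore square yields a roof of the form described by
  \<open>localized\<close>.\<close>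

lemma localize_cmp:
  assumes f: "f \<in> homset C X Y" and g: "g \<in> homset C Y W" and S: "X \<in> S" "Y \<in> S" "W \<in> S"
  shows "localize D N g \<cdot>\<^bsub>V\<^esub> localize D N f = localize D N (g \<cdot> f)"
proof -
  have gf: "g \<cdot> f \<in> homset C X W"
    using cmp_in[OF f g] .
  have o: "X \<in> obj C" "Y \<in> obj C"
    using S S_obj by auto
  let ?L = "{r \<in> roofs D N X W. \<exists>(s, f') \<in> localized X Y f. \<exists>(t, g') \<in> localized Y W g. \<exists>u w.
          cone_in D N u \<and> w \<in> arr D \<and> src C w = src C u \<and> trg C u = src C s \<and> trg C w = src C t \<and>
          f' \<cdot> u = t \<cdot> w \<and> roof_eq D N r (s \<cdot> u, g' \<cdot> w)}"
  have "?L = localized X W (g \<cdot> f)"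
  proof (intro equalityI subsetI)
    fix r assume "r \<in> localized X W (g \<cdot> f)"
    then obtain a b M P p where r: "r = (a, b)" "qis M X a" "b \<in> homset C M W" "qis P M p"
      "b \<cdot> p = (g \<cdot> f) \<cdot> (a \<cdot> p)"
      unfolding localized_def by blast
    have e: "src C (idt C X) = X" "trg C (idt C X) = X" "src C (idt C Y) = Y" "src C f = X" "trg C f = Y"
      using f idt_in[OF o(1)] idt_in[OF o(2)] by (auto simp: homset_iff)
    have 1: "idt C X \<cdot> idt C X = idt C X" "f \<cdot> idt C X = idt C Y \<cdot> f"
      using cmp_idt[OF idt_in[OF o(1)]] cmp_idt[OF f] by auto
    have "roof_eq D N r (idt C X \<cdot> idt C X, g \<cdot> f)"
      unfolding 1 r(1) using roof_eq_arrow[OF r(2,3) gf] r(4,5) by blast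
    moreover have "f \<in> arr D"
      using f S e by (simp add: D_arr)
    moreover have "r \<in> roofs D N X W"
      unfolding r(1) roofs_iff using r(2,3) S(3) by blast
    ultimately have "r \<in> roofs D N X W" and c: "cone_in D N (idt C X) \<and> f \<in> arr D \<and>
        src C f = src C (idt C X) \<and> trg C (idt C X) = src C (idt C X) \<and> trg C f = src C (idt C Y) \<and>
        f \<cdot> idt C X = idt C Y \<cdot> f \<and> roof_eq D N r (idt C X \<cdot> idt C X, g \<cdot> f)"
      using e 1 qis_cone_in[OF qis_idt[OF S(1)]] by simp_all
    then show "r \<in> ?L"
    proof (intro CollectI conjI bexI[OF _ localized_roof(2)[OF f S(1,2)]])
      show "case (idt C X, f) of (s, f') \<Rightarrow> \<exists>(t, g') \<in> localized Y W g. \<exists>u w.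
          cone_in D N u \<and> w \<in> arr D \<and> src C w = src C u \<and> trg C u = src C s \<and> trg C w = src C t \<and>
          f' \<cdot> u = t \<cdot> w \<and> roof_eq D N r (s \<cdot> u, g' \<cdot> w)"
        unfolding prod.case
      proof (intro bexI[OF _ localized_roof(2)[OF g S(2,3)]])
        show "case (idt C Y, g) of (t, g') \<Rightarrow> \<exists>u w. cone_in D N u \<and> w \<in> arr D \<and> src C w = src C u \<and>
            trg C u = src C (idt C X) \<and> trg C w = src C t \<and> f \<cdot> u = t \<cdot> w \<and>
            roof_eq D N r (idt C X \<cdot> u, g' \<cdot> w)"
          unfolding prod.case by (intro exI[of _ "idt C X"] exI[of _ f]) (rule c)
      qed
    qed
  next
    fix r assume "r \<in> ?L"
    then obtain a b s f' t g' u w where r: "r = (a, b)" "(a, b) \<in> roofs D N X W"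
      "(s, f') \<in> localized X Y f" "(t, g') \<in> localized Y W g"
      "cone_in D N u" "w \<in> arr D" "src C w = src C u" "trg C u = src C s" "trg C w = src C t"
      "f' \<cdot> u = t \<cdot> w" "roof_eq D N (a, b) (s \<cdot> u, g' \<cdot> w)"
      by (cases r) auto
    obtain M where M: "qis M X a" "b \<in> homset C M W"
      using r(2) unfolding roofs_iff by blast
    obtain A P p where A: "qis A X s" "f' \<in> homset C A Y" "qis P A p" "f' \<cdot> p = f \<cdot> (s \<cdot> p)"
      using r(3) unfolding localized_def by blast
    obtain B R q where B: "qis B Y t" "g' \<in> homset C B W" "qis R B q" "g' \<cdot> q = g \<cdot> (t \<cdot> q)"
      using r(4) unfolding localized_def by blast
    have e: "src C s = A" "src C t = B"
      using qisD(1)[OF A(1)] qisD(1)[OF B(1)] by (auto simp: homset_iff)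
    define E where "E = src C u"
    have u: "qis E A u"
      using r(5,8) e unfolding cone_in_iff E_def by simp
    have w: "w \<in> homset C E B"
      using r(6,7,9) e unfolding D_arr E_def by simp
    have su: "s \<cdot> u \<in> homset C E X" and gw: "g' \<cdot> w \<in> homset C E W"
      using cmp_in[OF qisD(1)[OF u] qisD(1)[OF A(1)]] cmp_in[OF w B(2)] by auto
    obtain Q0 m n where mn: "m \<in> homset C Q0 M" "n \<in> homset C Q0 E" "a \<cdot> m = (s \<cdot> u) \<cdot> n"
      "b \<cdot> m = (g' \<cdot> w) \<cdot> n" "qis Q0 X (a \<cdot> m)"
      using r(11) unfolding roof_eq_iff[OF qisD(1)[OF M(1)] M(2) su gw qisD(2)[OF M(1)] qisD(2)[OF u] S(1)]
      by blast
    have m: "qis Q0 M m"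
      using qis_cancel_left[OF mn(5) M(1) mn(1)] .
    note uD = qisD(1)[OF u] and sD = qisD(1)[OF A(1)] and tD = qisD(1)[OF B(1)] and pD = qisD(1)[OF A(3)]
      and qD = qisD(1)[OF B(3)]
    have un: "u \<cdot> n \<in> homset C Q0 A" and wn: "w \<cdot> n \<in> homset C Q0 B"
      using cmp_in[OF mn(2) uD] cmp_in[OF mn(2) w] by auto
    \<comment> \<open>Two Ore squares, along \<open>p\<close> and along \<open>q\<close>, produce a
      common domain on which the identities relating \<open>f'\<close> to \<open>f\<close> and
      \<open>g'\<close> to \<open>g\<close> can both be applied.\<close>
    obtain Q1 m1 \<alpha> where m1: "qis Q1 Q0 m1" "\<alpha> \<in> homset C Q1 P" "(u \<cdot> n) \<cdot> m1 = p \<cdot> \<alpha>"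
      using ore[OF A(3) un qisD(2)[OF m]] .
    have m1D: "m1 \<in> homset C Q1 Q0"
      using qisD(1)[OF m1(1)] .
    have wnm: "(w \<cdot> n) \<cdot> m1 \<in> homset C Q1 B"
      using cmp_in[OF m1D wn] .
    obtain Q2 m2 \<beta> where m2: "qis Q2 Q1 m2" "\<beta> \<in> homset C Q2 R" "((w \<cdot> n) \<cdot> m1) \<cdot> m2 = q \<cdot> \<beta>"
      using ore[OF B(3) wnm qisD(2)[OF m1(1)]] .
    have m2D: "m2 \<in> homset C Q2 Q1"
      using qisD(1)[OF m2(1)] .
    define k where "k = m1 \<cdot> m2"
    have k: "k \<in> homset C Q2 Q0" "qis Q2 Q0 k"
      unfolding k_def using cmp_in[OF m2D m1D] qis_cmp[OF m2(1) m1(1)] by auto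
    have nk: "n \<cdot> k \<in> homset C Q2 E"
      using cmp_in[OF k(1) mn(2)] .
    have unk: "u \<cdot> (n \<cdot> k) = p \<cdot> (\<alpha> \<cdot> m2)"
      unfolding k_def using cmp_assoc[OF m2D m1D mn(2)] cmp_assoc[OF cmp_in[OF m2D m1D] mn(2) uD]
        cmp_assoc[OF m2D m1D un] cmp_assoc[OF m2D m1(2) pD] m1(3) by simp
    have wnk: "w \<cdot> (n \<cdot> k) = q \<cdot> \<beta>"
      unfolding k_def using cmp_assoc[OF cmp_in[OF m2D m1D] mn(2) w] cmp_assoc[OF m2D m1D wn] m2(3) by simp
    have \<alpha>m: "\<alpha> \<cdot> m2 \<in> homset C Q2 P"
      using cmp_in[OF m2D m1(2)] .
    have tq: "t \<cdot> q \<in> homset C R Y" and sp: "s \<cdot> p \<in> homset C P X"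
      using cmp_in[OF qD tD] cmp_in[OF pD sD] by auto
    have "b \<cdot> (m \<cdot> k) = ((g' \<cdot> w) \<cdot> n) \<cdot> k"
      using cmp_assoc[OF k(1) mn(1) M(2)] mn(4) by simp
    also have "\<dots> = g' \<cdot> (w \<cdot> (n \<cdot> k))"
      using cmp_assoc[OF k(1) mn(2) gw] cmp_assoc[OF nk w B(2)] by simp
    also have "\<dots> = (g \<cdot> (t \<cdot> q)) \<cdot> \<beta>"
      unfolding wnk using cmp_assoc[OF m2(2) qD B(2)] B(4) by simp
    also have "\<dots> = g \<cdot> (t \<cdot> (w \<cdot> (n \<cdot> k)))"
      unfolding wnk using cmp_assoc[OF m2(2) tq g] cmp_assoc[OF m2(2) qD tD] by simp
    also have "t \<cdot> (w \<cdot> (n \<cdot> k)) = f' \<cdot> (u \<cdot> (n \<cdot> k))"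
      using cmp_assoc[OF nk w tD] cmp_assoc[OF nk uD A(2)] r(10) by simp
    also have "\<dots> = (f \<cdot> (s \<cdot> p)) \<cdot> (\<alpha> \<cdot> m2)"
      unfolding unk using cmp_assoc[OF \<alpha>m pD A(2)] A(4) by simp
    also have "\<dots> = f \<cdot> (s \<cdot> (u \<cdot> (n \<cdot> k)))"
      unfolding unk using cmp_assoc[OF \<alpha>m sp f] cmp_assoc[OF \<alpha>m pD sD] by simp
    also have "s \<cdot> (u \<cdot> (n \<cdot> k)) = a \<cdot> (m \<cdot> k)"
      using cmp_assoc[OF nk uD sD] cmp_assoc[OF k(1) mn(2) su] mn(3) cmp_assoc[OF k(1) mn(1) qisD(1)[OF M(1)]]
      by simp
    finally have "b \<cdot> (m \<cdot> k) = (g \<cdot> f) \<cdot> (a \<cdot> (m \<cdot> k))"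
      using cmp_assoc[OF cmp_in[OF cmp_in[OF k(1) mn(1)] qisD(1)[OF M(1)]] f g] by simp
    then show "r \<in> localized X W (g \<cdot> f)"
      unfolding localized_def r(1) using M qis_cmp[OF k(2) m] by blast
  qed
  then show ?thesis
    unfolding localize_eq[OF f S(1,2)] localize_eq[OF g S(2,3)] localize_eq[OF gf S(1,3)]
    by (simp add: verdier_category_def)
qed

lemma localize_sha:
  assumes f: "f \<in> homset C X Y" and S: "X \<in> S" "Y \<in> S"
  shows "sha V (localize D N f) = localize D N (sha C f)"
proof -
  have o: "X \<in> obj C" "Y \<in> obj C" and sS: "sho C X \<in> S" "sho C Y \<in> S"
    using S S_obj S_sho by auto
  have sf: "sha C f \<in> homset C (sho C X) (sho C Y)"
    using sha_in[OF f] .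
  let ?L = "{r \<in> roofs D N (sho C X) (sho C Y). \<exists>(s, f') \<in> localized X Y f. roof_eq D N r (sha C s, sha C f')}"
  have "?L = localized (sho C X) (sho C Y) (sha C f)"
  proof (intro equalityI subsetI)
    fix r assume "r \<in> localized (sho C X) (sho C Y) (sha C f)"
    then obtain a b M P p where r: "r = (a, b)" "qis M (sho C X) a" "b \<in> homset C M (sho C Y)" "qis P M p"
      "b \<cdot> p = sha C f \<cdot> (a \<cdot> p)"
      unfolding localized_def by blast
    have "roof_eq D N r (sha C (idt C X), sha C f)"
      unfolding sha_idt[OF o(1)] r(1) using roof_eq_arrow[OF r(2,3) sf] r(4,5) by blast
    moreover have "r \<in> roofs D N (sho C X) (sho C Y)"
      unfolding r(1) roofs_iff using r(2,3) sS(2) by blast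
    ultimately show "r \<in> ?L"
      using localized_roof(2)[OF f S] by blast
  next
    fix r assume "r \<in> ?L"
    then obtain a b s f' where r: "r = (a, b)" "(a, b) \<in> roofs D N (sho C X) (sho C Y)"
      "(s, f') \<in> localized X Y f" "roof_eq D N (a, b) (sha C s, sha C f')"
      by (cases r) auto
    obtain M where M: "qis M (sho C X) a" "b \<in> homset C M (sho C Y)"
      using r(2) unfolding roofs_iff by blast
    obtain A P p where A: "qis A X s" "f' \<in> homset C A Y" "qis P A p" "f' \<cdot> p = f \<cdot> (s \<cdot> p)"
      using r(3) unfolding localized_def by blast
    note sD = qisD(1)[OF A(1)] and pD = qisD(1)[OF A(3)]
    have As: "sho C A \<in> S"
      using qisD(2)[OF qis_sho[OF A(1)]] .
    obtain Q0 m n where mn: "m \<in> homset C Q0 M" "n \<in> homset C Q0 (sho C A)" "a \<cdot> m = sha C s \<cdot> n"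
      "b \<cdot> m = sha C f' \<cdot> n" "qis Q0 (sho C X) (a \<cdot> m)"
      using r(4) unfolding roof_eq_iff[OF qisD(1)[OF M(1)] M(2) sha_in[OF sD] sha_in[OF A(2)] qisD(2)[OF M(1)] As sS(1)]
      by blast
    have m: "qis Q0 M m"
      using qis_cancel_left[OF mn(5) M(1) mn(1)] .
    obtain Q1 k \<alpha> where k: "qis Q1 Q0 k" "\<alpha> \<in> homset C Q1 (sho C P)" "n \<cdot> k = sha C p \<cdot> \<alpha>"
      using ore[OF qis_sho[OF A(3)] mn(2) qisD(2)[OF m]] .
    note kD = qisD(1)[OF k(1)]
    have "b \<cdot> (m \<cdot> k) = sha C f' \<cdot> (n \<cdot> k)"
      using cmp_assoc[OF kD mn(1) M(2)] mn(4) cmp_assoc[OF kD mn(2) sha_in[OF A(2)]] by simp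
    also have "\<dots> = sha C (f \<cdot> (s \<cdot> p)) \<cdot> \<alpha>"
      unfolding k(3) using cmp_assoc[OF k(2) sha_in[OF pD] sha_in[OF A(2)]] sha_cmp[OF pD A(2)] A(4) by simp
    also have "\<dots> = sha C f \<cdot> (sha C s \<cdot> (sha C p \<cdot> \<alpha>))"
      using sha_cmp[OF cmp_in[OF pD sD] f] sha_cmp[OF pD sD]
        cmp_assoc[OF k(2) sha_in[OF cmp_in[OF pD sD]] sha_in[OF f]]
        cmp_assoc[OF k(2) sha_in[OF pD] sha_in[OF sD]] by simp
    also have "sha C s \<cdot> (sha C p \<cdot> \<alpha>) = a \<cdot> (m \<cdot> k)"
      using k(3) cmp_assoc[OF kD mn(2) sha_in[OF sD]] mn(3) cmp_assoc[OF kD mn(1) qisD(1)[OF M(1)]] by simp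
    finally show "r \<in> localized (sho C X) (sho C Y) (sha C f)"
      unfolding localized_def r(1) using M qis_cmp[OF k(1) m] by blast
  qed
  then show ?thesis
    unfolding localize_eq[OF f S] localize_eq[OF sf sS] by (simp add: verdier_category_def)
qed

section \<open>Triangles, relators and isomorphisms of the quotient\<close>

abbreviation VQ :: "('a, 'b, ('b, 'c) fraction) tcat" where "VQ \<equiv> verdier_quotient D N"

lemma VQ_simps: "obj VQ = S" "src VQ = src V" "trg VQ = trg V" "homset VQ = homset V"
  "is_isom VQ = is_isom V" "isomorphic VQ = isomorphic V" "zero_obj VQ = zero_obj V"
  by (auto simp: verdier_quotient_def homset_def is_isom_def isomorphic_def zero_obj_def V_simps fun_eq_iff)

lemma V_arr: "F \<in> arr V \<Longrightarrow> src V F \<in> S \<and> trg V F \<in> S"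
  by (auto simp: verdier_category_def fraction_of_def)

lemma localize_isom:
  assumes f: "f \<in> homset C X Y" and g: "g \<in> homset C Y X" and S: "X \<in> S" "Y \<in> S"
    and "localize D N (g \<cdot> f) = localize D N (idt C X)" "localize D N (f \<cdot> g) = localize D N (idt C Y)"
  shows "is_isom V (localize D N f)"
proof -
  have "src V (localize D N f) = X" "trg V (localize D N f) = Y" "localize D N f \<in> arr V"
    using localize_arr[OF f S] by (auto simp: homset_iff)
  moreover have "localize D N g \<in> homset V Y X"
    using localize_arr[OF g S(2,1)] .
  ultimately show ?thesis
    unfolding is_isom_def V_simps
    using localize_cmp[OF f g S(1,2,1)] localize_cmp[OF g f S(2,1,2)] assms(5,6) by metis
qed

lemma localize_idt_isom:
  assumes "X \<in> S"
  shows "is_isom V (localize D N (idt C X))"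
proof -
  have i: "idt C X \<in> homset C X X"
    using assms S_obj idt_in by blast
  have "idt C X \<cdot> idt C X = idt C X"
    using cmp_idt[OF i] by blast
  then show ?thesis
    using localize_isom[OF i i assms assms] by simp
qed

text \<open>Exhibits distinguished triangles of the quotient whose arrows are localized from C
  although the triple itself need not be distinguished in C; it is used with identities and with a
  comparison to a zero object.\<close>

lemma localize_triangle:
  assumes d: "dt C X Y W f g h" and S: "X \<in> S" "Y \<in> S" "W \<in> S" "X' \<in> S" "Y' \<in> S" "W' \<in> S"
    and f': "f' \<in> homset C X' Y'" and g': "g' \<in> homset C Y' W'" and h': "h' \<in> homset C W' (sho C X')"
    and x: "x \<in> homset C X X'" and y: "y \<in> homset C Y Y'" and w: "w \<in> homset C W W'"
    and iso: "is_isom V (localize D N x)" "is_isom V (localize D N y)" "is_isom V (localize D N w)"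
    and comm: "y \<cdot> f = f' \<cdot> x" "w \<cdot> g = g' \<cdot> y" "sha C x \<cdot> h = h' \<cdot> w"
  shows "(localize D N f', localize D N g', localize D N h') \<in> tri VQ"
proof -
  note D = dtD[OF d]
  have sX: "sho C X \<in> S" "sho C X' \<in> S"
    using S_sho S S_obj by blast+
  note lf = localize_arr[OF D(1) S(1,2)] and lg = localize_arr[OF D(2) S(2,3)] and lh = localize_arr[OF D(3) S(3) sX(1)]
  note lf' = localize_arr[OF f' S(4,5)] and lg' = localize_arr[OF g' S(5,6)] and lh' = localize_arr[OF h' S(6) sX(2)]
  note lx = localize_arr[OF x S(1,4)] and ly = localize_arr[OF y S(2,5)] and lw = localize_arr[OF w S(3,6)]
  have "candidate_triangle V (localize D N f', localize D N g', localize D N h')"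
    using lf' lg' lh' by (auto simp: candidate_triangle_def homset_iff V_simps(4))
  moreover have "(f, g, h) \<in> tri D"
  proof -
    have "src C f = X" "trg C f = Y" "trg C g = W"
      using D by (auto simp: homset_iff)
    then show ?thesis
      unfolding D_tri using D(7) S by simp
  qed
  moreover have "triangle_isom V (localize D N f, localize D N g, localize D N h)
      (localize D N f', localize D N g', localize D N h')"
    unfolding triangle_isom_def prod.case
  proof (intro bexI conjI)
    show "is_isom V (localize D N x)" "is_isom V (localize D N y)" "is_isom V (localize D N w)"
      by (fact iso)+
    show "localize D N y \<cdot>\<^bsub>V\<^esub> localize D N f = localize D N f' \<cdot>\<^bsub>V\<^esub> localize D N x"
      using localize_cmp[OF D(1) y S(1,2,5)] localize_cmp[OF x f' S(1,4,5)] comm(1) by simp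
    show "localize D N w \<cdot>\<^bsub>V\<^esub> localize D N g = localize D N g' \<cdot>\<^bsub>V\<^esub> localize D N y"
      using localize_cmp[OF D(2) w S(2,3,6)] localize_cmp[OF y g' S(2,5,6)] comm(2) by simp
    show "sha V (localize D N x) \<cdot>\<^bsub>V\<^esub> localize D N h = localize D N h' \<cdot>\<^bsub>V\<^esub> localize D N w"
      using localize_cmp[OF D(3) sha_in[OF x] S(3) sX] localize_cmp[OF w h' S(3,6) sX(2)]
        comm(3) localize_sha[OF x S(1,4)] by simp
    show "localize D N x \<in> homset V (src V (localize D N f)) (src V (localize D N f'))"
      "localize D N y \<in> homset V (src V (localize D N g)) (src V (localize D N g'))"
      "localize D N w \<in> homset V (src V (localize D N h)) (src V (localize D N h'))"
      using lx ly lw lf lg lh lf' lg' lh' by (simp_all add: homset_iff)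
  qed
  ultimately show ?thesis
    unfolding verdier_quotient_def by auto
qed

lemma VQ_relator:
  assumes "(localize D N f, localize D N g, localize D N h) \<in> tri VQ"
    "f \<in> homset C X Y" "g \<in> homset C Y W" "X \<in> S" "Y \<in> S" "W \<in> S"
  shows "frag_of Y - frag_of X - frag_of W \<in> K0_relators VQ"
proof -
  have "src VQ (localize D N f) = X" "trg VQ (localize D N f) = Y" "trg VQ (localize D N g) = W"
    using localize_arr[OF assms(2,4,5)] localize_arr[OF assms(3,5,6)] by (auto simp: homset_iff VQ_simps)
  then show ?thesis
    unfolding K0_relators_def using assms(1) by blast
qed

lemma VQ_relator_Tr:
  assumes "Tr C X Y W" "X \<in> S" "Y \<in> S" "W \<in> S"
  shows "frag_of Y - frag_of X - frag_of W \<in> K0_relators VQ"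
proof -
  obtain f g h where d: "dt C X Y W f g h"
    using assms(1) unfolding Tr_def by blast
  note D = dtD[OF d]
  have i: "idt C X \<in> homset C X X" "idt C Y \<in> homset C Y Y" "idt C W \<in> homset C W W"
    using idt_in D by blast+
  have "(localize D N f, localize D N g, localize D N h) \<in> tri VQ"
  proof (rule localize_triangle[OF d assms(2-4) assms(2-4) D(1-3) i])
    show "idt C Y \<cdot> f = f \<cdot> idt C X" "idt C W \<cdot> g = g \<cdot> idt C Y" "sha C (idt C X) \<cdot> h = h \<cdot> idt C W"
      using cmp_idt[OF D(1)] cmp_idt[OF D(2)] cmp_idt[OF D(3)] sha_idt[OF D(4)] by simp_all
  qed (use localize_idt_isom assms in blast)+
  then show ?thesis
    using VQ_relator D(1,2) assms(2-4) by blast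
qed

text \<open>Every roof at A has its apex W in \<open>N\<close>. Precomposing with the arrow from a
  zero object to W, whose cone is W, makes any two arrows out of W agree.\<close>

lemma localize_null_idt:
  assumes "A \<in> N"
  shows "localize D N (null C A A) = localize D N (idt C A)"
proof -
  have A: "A \<in> S" "A \<in> obj C"
    using assms N_S S_obj by blast+
  have n: "null C A A \<in> homset C A A" and i: "idt C A \<in> homset C A A"
    using A(2) null_in idt_in by auto
  obtain K where K: "zero_obj C K"
    using ex_zero_obj by blast
  have K': "K \<in> obj C"
    using zero_objD[OF K] .
  have "\<exists>P p. qis P W p \<and> b \<cdot> p = f \<cdot> (s \<cdot> p)"
    if q: "qis W A s" and b: "b \<in> homset C W A" and f: "f \<in> homset C A A" for W s b f
  proof -
    obtain M g h where M: "dt C W A M s g h" "M \<in> N"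
      using q unfolding qis_def by blast
    then have "Tr C W A M"
      unfolding Tr_def by blast
    then have W: "W \<in> N" "W \<in> obj C" "W \<in> S"
      using N_fibre assms M(2) N_S S_obj by blast+
    have "qis K W (null C K W)"
      using qisI[OF dt_zero_left[OF W(2) K] S_zero[OF K] W(3,1)] .
    moreover have "s \<cdot> null C K W = null C K A" "b \<cdot> null C K W = null C K A" "f \<cdot> null C K A = null C K A"
      using cmp_null_right[OF qisD(1)[OF q] K'] cmp_null_right[OF b K'] cmp_null_right[OF f K'] by auto
    ultimately show ?thesis
      by (intro exI[of _ K] exI[of _ "null C K W"]) simp
  qed
  then have "localized A A (null C A A) = localized A A (idt C A)"
    unfolding localized_def using n i by blast
  then show ?thesis
    using localize_eq[OF n A(1,1)] localize_eq[OF i A(1,1)] by simp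
qed

text \<open>In the quotient A is isomorphic to a zero object, so A = A -> A, with a null second
  arrow, is part of a distinguished triangle. Its relator is minus the generator of A and kills the
  class of A.\<close>

lemma VQ_relator_N:
  assumes A: "A \<in> N"
  shows "frag_of A - frag_of A - frag_of A \<in> K0_relators VQ"
proof -
  have A': "A \<in> S" "A \<in> obj C"
    using A N_S S_obj by blast+
  have sA: "sho C A \<in> obj C"
    using sho_in A'(2) by blast
  obtain K where K: "zero_obj C K"
    using ex_zero_obj by blast
  have K': "K \<in> obj C" "K \<in> S" "K \<in> N"
    using zero_objD[OF K] S_zero[OF K] N_zero[OF K] by auto
  have n: "null C A K \<in> homset C A K" "null C K A \<in> homset C K A" "null C A A \<in> homset C A A"
    "null C A (sho C A) \<in> homset C A (sho C A)" "null C K (sho C A) \<in> homset C K (sho C A)"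
    using null_in A'(2) K'(1) sA by auto
  have i: "idt C A \<in> homset C A A"
    using idt_in A'(2) by blast
  have "is_isom V (localize D N (null C K A))"
  proof (rule localize_isom[OF n(2,1) K'(2) A'(1)])
    show "localize D N (null C A K \<cdot> null C K A) = localize D N (idt C K)"
      using cmp_null_right[OF n(1) K'(1)] localize_null_idt[OF K'(3)] by simp
    show "localize D N (null C K A \<cdot> null C A K) = localize D N (idt C A)"
      using cmp_null_right[OF n(2) A'(2)] localize_null_idt[OF A] by simp
  qed
  then have "(localize D N (idt C A), localize D N (null C A A), localize D N (null C A (sho C A))) \<in> tri VQ"
  proof (rule localize_triangle[OF dt_idt[OF A'(2) K] A'(1,1) K'(2) A'(1,1,1) i n(3,4) i i n(2)
        localize_idt_isom[OF A'(1)] localize_idt_isom[OF A'(1)]])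
    show "idt C A \<cdot> idt C A = idt C A \<cdot> idt C A" ..
    show "null C K A \<cdot> null C A K = null C A A \<cdot> idt C A"
      using cmp_null_right[OF n(2) A'(2)] cmp_idt[OF n(3)] by simp
    show "sha C (idt C A) \<cdot> null C K (sho C A) = null C A (sho C A) \<cdot> null C K A"
      using sha_idt[OF A'(2)] cmp_idt[OF n(5)] cmp_null_right[OF n(4) K'(1)] by simp
  qed
  then show ?thesis
    using VQ_relator i n(3) A'(1) by blast
qed

text \<open>Compares an arbitrary roof of the class with a fixed representative; both comparison
  arrows have their cones in \<open>N\<close> by cancellation.\<close>

lemma fraction_roof:
  assumes "(s0, f0) \<in> roofs D N X Y" "(s, f) \<in> snd (snd (fraction_of D N X Y (s0, f0)))"
  obtains W W0 P i i0 where "qis W X s" "f \<in> homset C W Y" "qis W0 X s0" "f0 \<in> homset C W0 Y"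
    "qis P W i" "qis P W0 i0" "s \<cdot> i = s0 \<cdot> i0" "f \<cdot> i = f0 \<cdot> i0"
proof -
  have r: "(s, f) \<in> roofs D N X Y" "roof_eq D N (s, f) (s0, f0)"
    using assms(2) unfolding fraction_of_def by auto
  obtain W W0 where W: "qis W X s" "f \<in> homset C W Y" "qis W0 X s0" "f0 \<in> homset C W0 Y"
    using r(1) assms(1) unfolding roofs_iff by blast
  obtain P i i0 where i: "i \<in> homset C P W" "i0 \<in> homset C P W0" "s \<cdot> i = s0 \<cdot> i0" "f \<cdot> i = f0 \<cdot> i0"
    "qis P X (s \<cdot> i)"
    using r(2) unfolding roof_eq_iff[OF qisD(1)[OF W(1)] W(2) qisD(1)[OF W(3)] W(4) qisD(2)[OF W(1)]
        qisD(2)[OF W(3)] qisD(3)[OF W(1)]] by blast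
  have "qis P W i" "qis P W0 i0"
    using qis_cancel_left[OF i(5) W(1) i(1)] qis_cancel_left[OF i(5)[unfolded i(3)] W(3) i(2)] by auto
  then show ?thesis
    using that W i(3,4) by blast
qed

lemma cmp_eq_idt_roof:
  assumes "F \<in> homset V X Y" "G \<in> homset V Y X" "G \<cdot>\<^bsub>V\<^esub> F = idt V X"
  obtains s f t g P A B q z where "(s, f) \<in> snd (snd F)" "(t, g) \<in> snd (snd G)"
    "q \<in> homset C P A" "z \<in> homset C P B" "qis A X s" "f \<in> homset C A Y" "qis B Y t" "g \<in> homset C B X"
    "f \<cdot> q = t \<cdot> z" "qis P X (s \<cdot> q)" "s \<cdot> q = g \<cdot> z"
proof -
  have FG: "F = (X, Y, snd (snd F))" "G = (Y, X, snd (snd G))"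
    using assms(1,2) by (cases F; cases G; auto simp: homset_iff V_simps)+
  have XY: "X \<in> S" "Y \<in> S" "X \<in> obj C"
    using V_arr[of F] assms(1) S_obj by (auto simp: homset_iff)
  have i: "idt C X \<in> homset C X X"
    using idt_in XY(3) .
  have sub: "snd (snd F) \<subseteq> roofs D N X Y" "snd (snd G) \<subseteq> roofs D N Y X"
    using assms(1,2) by (auto simp: homset_iff verdier_category_def fraction_of_def)
  have "(idt C X, idt C X) \<in> snd (snd (G \<cdot>\<^bsub>V\<^esub> F))"
    using localized_roof(2)[OF i XY(1,1)] assms(3) localize_eq[OF i XY(1,1)] by (simp add: V_simps)
  moreover have "snd (snd ((Y, X, B) \<cdot>\<^bsub>V\<^esub> (X, Y, A))) = {r \<in> roofs D N X X. \<exists>(s, f) \<in> A. \<exists>(t, g) \<in> B. \<exists>u w.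
          cone_in D N u \<and> w \<in> arr D \<and> src C w = src C u \<and> trg C u = src C s \<and> trg C w = src C t \<and>
          f \<cdot> u = t \<cdot> w \<and> roof_eq D N r (s \<cdot> u, g \<cdot> w)}" for A B
    by (simp add: verdier_category_def)
  ultimately obtain s f t g u w where r: "(s, f) \<in> snd (snd F)" "(t, g) \<in> snd (snd G)"
    "cone_in D N u" "w \<in> arr D" "src C w = src C u" "trg C u = src C s" "trg C w = src C t"
    "f \<cdot> u = t \<cdot> w" "roof_eq D N (idt C X, idt C X) (s \<cdot> u, g \<cdot> w)"
    using FG by (smt (verit) case_prodE mem_Collect_eq)
  obtain A where A: "qis A X s" "f \<in> homset C A Y"
    using r(1) sub(1) roofs_iff by blast
  obtain B where B: "qis B Y t" "g \<in> homset C B X"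
    using r(2) sub(2) roofs_iff by blast
  have e: "src C s = A" "src C t = B"
    using qisD(1)[OF A(1)] qisD(1)[OF B(1)] by (auto simp: homset_iff)
  define E where "E = src C u"
  have u: "qis E A u"
    using r(3,6) e unfolding cone_in_iff E_def by simp
  have w: "w \<in> homset C E B"
    using r(4,5,7) e unfolding D_arr E_def by simp
  have su: "s \<cdot> u \<in> homset C E X" and gw: "g \<cdot> w \<in> homset C E X"
    using cmp_in[OF qisD(1)[OF u] qisD(1)[OF A(1)]] cmp_in[OF w B(2)] by auto
  obtain P p p' where p: "p \<in> homset C P X" "p' \<in> homset C P E" "idt C X \<cdot> p = (s \<cdot> u) \<cdot> p'"
    "idt C X \<cdot> p = (g \<cdot> w) \<cdot> p'" "qis P X (idt C X \<cdot> p)"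
    using r(9) unfolding roof_eq_iff[OF i i su gw XY(1) qisD(2)[OF u] XY(1)] by blast
  have "u \<cdot> p' \<in> homset C P A" "w \<cdot> p' \<in> homset C P B"
    using cmp_in[OF p(2)] qisD(1)[OF u] w by auto
  moreover have "f \<cdot> (u \<cdot> p') = t \<cdot> (w \<cdot> p')"
    using cmp_assoc[OF p(2) qisD(1)[OF u] A(2)] cmp_assoc[OF p(2) w qisD(1)[OF B(1)]] r(8) by simp
  moreover have "s \<cdot> (u \<cdot> p') = idt C X \<cdot> p" "g \<cdot> (w \<cdot> p') = idt C X \<cdot> p"
    using cmp_assoc[OF p(2) qisD(1)[OF u] qisD(1)[OF A(1)]] cmp_assoc[OF p(2) w B(2)] p(3,4) by simp_all
  ultimately show ?thesis
    using that[OF r(1,2)] A B p(5) by metis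
qed

text \<open>
  An isomorphism in the quotient is represented by a roof whose second leg, after replacing the apex,
  has a left and a right partner with which it composes to arrows with cone in N.
\<close>

lemma isomorphic_roof:
  assumes "isomorphic VQ X Y"
  obtains W M M' where "Tr C W X M" "Tr C W Y M'" "W \<in> S" "M \<in> N" "M' \<in> N"
proof -
  obtain F where F: "F \<in> homset V X Y" "is_isom V F"
    using assms unfolding isomorphic_def VQ_simps by blast
  have e: "src V F = X" "trg V F = Y"
    using F(1) unfolding homset_iff by blast+
  obtain G where G: "G \<in> homset V Y X" "G \<cdot>\<^bsub>V\<^esub> F = idt V X" "F \<cdot>\<^bsub>V\<^esub> G = idt V Y"
    using F(2) unfolding is_isom_def e by blast
  obtain s0 f0 where F0: "(s0, f0) \<in> roofs D N X Y" "F = fraction_of D N X Y (s0, f0)"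
    using F(1) unfolding homset_iff by (auto simp: verdier_category_def fraction_of_def)
  obtain s f t g P A B q z where 1: "(s, f) \<in> snd (snd F)" "(t, g) \<in> snd (snd G)"
    "q \<in> homset C P A" "z \<in> homset C P B" "qis A X s" "f \<in> homset C A Y" "qis B Y t" "g \<in> homset C B X"
    "f \<cdot> q = t \<cdot> z" "qis P X (s \<cdot> q)" "s \<cdot> q = g \<cdot> z"
    using cmp_eq_idt_roof[OF F(1) G(1,2)] .
  obtain t' g' s' f' P' B' A' r' h where 2: "(t', g') \<in> snd (snd G)" "(s', f') \<in> snd (snd F)"
    "r' \<in> homset C P' B'" "h \<in> homset C P' A'" "qis B' Y t'" "g' \<in> homset C B' X" "qis A' X s'" "f' \<in> homset C A' Y"
    "g' \<cdot> r' = s' \<cdot> h" "qis P' Y (t' \<cdot> r')" "t' \<cdot> r' = f' \<cdot> h"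
    using cmp_eq_idt_roof[OF G(1) F(1) G(3)] .
  obtain A1 W0 R i i0 where 3: "qis A1 X s" "f \<in> homset C A1 Y" "qis W0 X s0" "f0 \<in> homset C W0 Y"
    "qis R A1 i" "qis R W0 i0" "s \<cdot> i = s0 \<cdot> i0" "f \<cdot> i = f0 \<cdot> i0"
    using fraction_roof[OF F0(1)] 1(1) unfolding F0(2) by metis
  obtain A2 W1 R' i' i0' where 4: "qis A2 X s'" "f' \<in> homset C A2 Y" "qis W1 X s0" "f0 \<in> homset C W1 Y"
    "qis R' A2 i'" "qis R' W1 i0'" "s' \<cdot> i' = s0 \<cdot> i0'" "f' \<cdot> i' = f0 \<cdot> i0'"
    using fraction_roof[OF F0(1)] 2(2) unfolding F0(2) by metis
  have eq: "A1 = A" "A2 = A'" "W1 = W0"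
    using 3(2,4) 4(2,4) 1(6) 2(8) by (auto simp: homset_iff)
  have fh: "qis P' Y (f' \<cdot> h)"
    using 2(10,11) by simp
  have i': "qis R' A' i'" "i' \<in> homset C R' A'" and i0': "i0' \<in> homset C R' W0"
    using 4(5,6) qisD(1) eq by auto
  obtain U m \<alpha> where 5: "qis U P' m" "\<alpha> \<in> homset C U R'" "h \<cdot> m = i' \<cdot> \<alpha>"
    using ore[OF i'(1) 2(4) qisD(2)[OF fh]] .
  \<comment> \<open>The right partner of the fixed second leg \<open>f0\<close>, extracted from F G
    = id: the composite \<open>f0 \<cdot> H\<close> has its cone in \<open>N\<close>.\<close>
  define H where "H = i0' \<cdot> \<alpha>"
  have H: "H \<in> homset C U W0"
    unfolding H_def using cmp_in[OF 5(2) i0'] .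
  have "f0 \<cdot> H = (f' \<cdot> h) \<cdot> m"
    unfolding H_def using cmp_assoc[OF 5(2) i0' 3(4)] 4(8) cmp_assoc[OF 5(2) i'(2) 2(8)] 5(3)
      cmp_assoc[OF qisD(1)[OF 5(1)] 2(4,8)] by simp
  then have fH: "qis U Y (f0 \<cdot> H)"
    using qis_cmp[OF 5(1) fh] by simp
  have i: "qis R A i" "i \<in> homset C R A" and i0: "i0 \<in> homset C R W0"
    using 3(5,6) qisD(1) eq by auto
  have q: "qis P A q"
    using qis_cancel_left[OF 1(10,5,3)] .
  obtain U1 m1 \<alpha>1 where 6: "qis U1 P m1" "\<alpha>1 \<in> homset C U1 R" "q \<cdot> m1 = i \<cdot> \<alpha>1"
    using ore[OF i(1) 1(3) qisD(2)[OF q]] .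
  note m1 = qisD(1)[OF 6(1)]
  have "qis U1 R \<alpha>1"
    using qis_cancel_left[OF _ i(1) 6(2)] qis_cmp[OF 6(1) q] 6(3) by simp
  then have x: "qis U1 W0 (i0 \<cdot> \<alpha>1)"
    using qis_cmp 3(6) by blast
  define z1 where "z1 = z \<cdot> m1"
  have z1: "z1 \<in> homset C U1 B"
    unfolding z1_def using cmp_in[OF m1 1(4)] .
  have fx: "f0 \<cdot> (i0 \<cdot> \<alpha>1) = t \<cdot> z1"
    unfolding z1_def using cmp_assoc[OF 6(2) i0 3(4)] 3(8) cmp_assoc[OF 6(2) i(2) 1(6)] 6(3)
      cmp_assoc[OF m1 1(3,6)] 1(9) cmp_assoc[OF m1 1(4) qisD(1)[OF 1(7)]] by simp
  have gz: "qis U1 X (g \<cdot> z1)"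
    unfolding z1_def using cmp_assoc[OF m1 1(4,8)] 1(11) qis_cmp[OF 6(1) 1(10)] by simp
  obtain U2 m2 \<beta> where 7: "qis U2 U m2" "\<beta> \<in> homset C U2 U1" "H \<cdot> m2 = (i0 \<cdot> \<alpha>1) \<cdot> \<beta>"
    using ore[OF x H qisD(2)[OF fH]] .
  have "(f0 \<cdot> H) \<cdot> m2 = t \<cdot> (z1 \<cdot> \<beta>)"
    using cmp_assoc[OF qisD(1)[OF 7(1)] H 3(4)] 7(3) cmp_assoc[OF 7(2) qisD(1)[OF x] 3(4)] fx
      cmp_assoc[OF 7(2) z1 qisD(1)[OF 1(7)]] by simp
  then have "qis U2 Y (t \<cdot> (z1 \<cdot> \<beta>))"
    using qis_cmp[OF 7(1) fH] by simp
  then have "qis U2 B (z1 \<cdot> \<beta>)"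
    using qis_cancel_left[OF _ 1(7) cmp_in[OF 7(2) z1]] by blast
  \<comment> \<open>\<open>z1\<close> has a left partner \<open>g\<close> from G F = id and, through
    \<open>H\<close>, a right partner \<open>\<beta>\<close>. So \<open>two_of_six\<close> applies,
    and the new second leg \<open>f0 \<cdot> (i0 \<cdot> \<alpha>1)\<close>, which equals
    \<open>t \<cdot> z1\<close>, has its cone in \<open>N\<close>.\<close>
  then have "qis U1 B z1"
    using two_of_six[OF z1 7(2) 1(8) _ gz] by blast
  then have "qis U1 Y (t \<cdot> z1)"
    using qis_cmp 1(7) by blast
  moreover have "qis U1 X (s0 \<cdot> (i0 \<cdot> \<alpha>1))"
    using qis_cmp[OF x 3(3)] .
  ultimately show ?thesis
    using that unfolding qis_def Tr_def by blast
qed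

text \<open>Triangles of the quotient are by definition isomorphic to images of triangles in
  \<open>S\<close>; only the resulting isomorphisms of objects matter for the Grothendieck
  group.\<close>

lemma VQ_relator_cases:
  assumes "r \<in> K0_relators VQ"
  obtains X Y W X0 Y0 W0 where "r = frag_of Y - frag_of X - frag_of W" "X \<in> S" "Y \<in> S" "W \<in> S"
    "Tr C X0 Y0 W0" "X0 \<in> S" "Y0 \<in> S" "W0 \<in> S"
    "isomorphic VQ X0 X" "isomorphic VQ Y0 Y" "isomorphic VQ W0 W"
proof -
  obtain f g h where r: "(f, g, h) \<in> tri VQ" "r = frag_of (trg V f) - frag_of (src V f) - frag_of (trg V g)"
    using assms unfolding K0_relators_def VQ_simps by blast
  have c: "candidate_triangle V (f, g, h)"
    using r(1) unfolding verdier_quotient_def by auto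
  obtain f0 g0 h0 where t: "(f0, g0, h0) \<in> tri D"
    "triangle_isom V (localize D N f0, localize D N g0, localize D N h0) (f, g, h)"
    using r(1) unfolding verdier_quotient_def by auto
  have d: "dt C (src C f0) (trg C f0) (trg C g0) f0 g0 h0"
    and S0: "src C f0 \<in> S" "trg C f0 \<in> S" "trg C g0 \<in> S"
    using t(1) dtI unfolding D_tri by blast+
  note dD = dtD[OF d]
  have e: "src V g = trg V f" "src V h = trg V g" and a: "f \<in> arr V" "g \<in> arr V"
    using c unfolding candidate_triangle_def by auto
  have sX: "sho C (src C f0) \<in> S"
    using S0 S_sho S_obj by blast
  have e0: "src V (localize D N f0) = src C f0" "src V (localize D N g0) = trg C f0" "src V (localize D N h0) = trg C g0"
    using localize_arr[OF dD(1) S0(1,2)] localize_arr[OF dD(2) S0(2,3)] localize_arr[OF dD(3) S0(3) sX]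
    by (auto simp: homset_iff)
  have "isomorphic VQ (src C f0) (src V f)" "isomorphic VQ (trg C f0) (trg V f)" "isomorphic VQ (trg C g0) (trg V g)"
    using t(2) unfolding triangle_isom_def prod.case e0 e VQ_simps isomorphic_def by blast+
  moreover have "Tr C (src C f0) (trg C f0) (trg C g0)"
    using d unfolding Tr_def by blast
  ultimately show ?thesis
    using that[OF r(2)] S0 V_arr[OF a(1)] V_arr[OF a(2)] by blast
qed

end

section \<open>Lattices\<close>

lemma tensor_relators_carrier:
  assumes "comm_group G"
  shows "tensor_relators G \<subseteq> carrier (free_Abelian_group (carrier G \<times> UNIV))"
proof -
  interpret comm_group G by fact
  show ?thesis
    unfolding tensor_relators_def by (auto simp: keys_frag_of dest!: subsetD[OF keys_diff])
qed

lemma tensor_comm_group: "comm_group G \<Longrightarrow> comm_group (tensor G)"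
  unfolding tensor_def by (rule presented_group_comm[OF tensor_relators_carrier])

lemma pure_tensor_hom:
  assumes "comm_group G"
  shows "(\<lambda>x. pure_tensor G x r) \<in> hom G (tensor G)"
proof (rule homI)
  interpret comm_group G by fact
  note R = tensor_relators_carrier[OF assms]
  fix x assume x: "x \<in> carrier G"
  then show "pure_tensor G x r \<in> carrier (tensor G)"
    unfolding pure_tensor_def tensor_def by (intro hom_in_carrier[OF presented_class_hom[OF R]]) simp
  fix y assume y: "y \<in> carrier G"
  have "frag_of (x \<otimes>\<^bsub>G\<^esub> y, r) - frag_of (x, r) - frag_of (y, r) \<in> tensor_relators G"
    unfolding tensor_relators_def using x y by blast
  then show "pure_tensor G (x \<otimes>\<^bsub>G\<^esub> y) r = pure_tensor G x r \<otimes>\<^bsub>tensor G\<^esub> pure_tensor G y r"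
    unfolding pure_tensor_def tensor_def using x y by (intro presented_class_relator_add[OF R]) auto
qed

lemma pure_tensor_one:
  assumes "comm_group G"
  shows "pure_tensor G \<one>\<^bsub>G\<^esub> r = \<one>\<^bsub>tensor G\<^esub>"
proof -
  interpret G: comm_group G by fact
  interpret T: comm_group "tensor G :: ('a \<times> 'b \<Rightarrow>\<^sub>0 int) set monoid"
    by (rule tensor_comm_group[OF assms])
  show ?thesis
    using hom_one[OF pure_tensor_hom[OF assms] G.is_group T.is_group] .
qed

text \<open>Polymorphic because two instances occur: the rationals, as target of coordinate
  functionals on the tensor product, and the complex numbers, where it coincides with
  \<open>complex_group\<close>.\<close>

definition additive_group :: "'a::ab_group_add monoid" where
  "additive_group = \<lparr>carrier = UNIV, mult = (+), one = 0\<rparr>"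

lemma additive_group_simps [simp]:
  "carrier additive_group = UNIV" "x \<otimes>\<^bsub>additive_group\<^esub> y = x + y" "\<one>\<^bsub>additive_group\<^esub> = 0"
  by (simp_all add: additive_group_def)

lemma additive_group_comm: "comm_group (additive_group :: 'a::ab_group_add monoid)"
proof (rule comm_groupI)
  fix x :: 'a
  show "\<exists>y \<in> carrier additive_group. y \<otimes>\<^bsub>additive_group\<^esub> x = \<one>\<^bsub>additive_group\<^esub>"
    by (intro bexI[of _ "- x"]) simp_all
qed (simp_all add: ac_simps)

lemma additive_group_inv [simp]: "inv\<^bsub>additive_group\<^esub> x = - (x :: 'a::ab_group_add)"
  by (rule group.inv_equality[OF comm_group.axioms(2)[OF additive_group_comm]]) simp_all

lemma complex_group_eq: "complex_group = additive_group"
  by (simp add: complex_group_def additive_group_def)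

text \<open>
  A coordinate of the free group, extended rationally, detects elements of the tensor product.
\<close>

lemma pure_tensor_eq_one:
  assumes "free_of_finite_rank G" "x \<in> carrier G" "pure_tensor G x (1 :: rat) = \<one>\<^bsub>tensor G\<^esub>"
  shows "x = \<one>\<^bsub>G\<^esub>"
proof -
  have G: "comm_group G"
    using assms(1) by (simp add: free_of_finite_rank_def)
  interpret G: comm_group G by fact
  obtain n :: nat and \<iota> where \<iota>: "\<iota> \<in> iso G (free_Abelian_group {..<n})"
    using assms(1) unfolding free_of_finite_rank_def is_iso_def by blast
  have \<iota>h: "\<iota> \<in> hom G (free_Abelian_group {..<n})" and \<iota>i: "inj_on \<iota> (carrier G)"
    using \<iota> unfolding iso_def bij_betw_def by auto
  have add: "\<iota> (a \<otimes>\<^bsub>G\<^esub> b) = \<iota> a + \<iota> b" if "a \<in> carrier G" "b \<in> carrier G" for a b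
    using hom_mult[OF \<iota>h that] by simp
  note R = tensor_relators_carrier[OF G]
  have "Poly_Mapping.lookup (\<iota> x) i = 0" for i
  proof -
    obtain h where h: "h \<in> hom (free_Abelian_group (carrier G \<times> UNIV)) (additive_group :: rat monoid)"
      "\<And>p. p \<in> carrier G \<times> UNIV \<Longrightarrow> h (frag_of p) = snd p * of_int (Poly_Mapping.lookup (\<iota> (fst p)) i)"
      using comm_group.free_Abelian_group_universal[OF additive_group_comm,
          of "\<lambda>p. snd p * of_int (Poly_Mapping.lookup (\<iota> (fst p)) i)" "carrier G \<times> UNIV"] by auto
    have hd: "h (frag_of p - frag_of q - frag_of r) = h (frag_of p) - h (frag_of q) - h (frag_of r)"
      if "p \<in> carrier G \<times> UNIV" "q \<in> carrier G \<times> UNIV" "r \<in> carrier G \<times> UNIV" for p q r :: "'a \<times> rat"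
    proof -
      have k: "Poly_Mapping.keys (frag_of p - frag_of q) \<subseteq> carrier G \<times> UNIV"
        using that keys_diff[of "frag_of p" "frag_of q"] by auto
      have k': "Poly_Mapping.keys (frag_of p - frag_of q - frag_of r) \<subseteq> carrier G \<times> UNIV"
        using that k keys_diff[of "frag_of p - frag_of q" "frag_of r"] by auto
      have "h ((frag_of p - frag_of q) + frag_of q) = h (frag_of p - frag_of q) + h (frag_of q)"
        using hom_mult[OF h(1), of "frag_of p - frag_of q" "frag_of q"] k that by simp
      moreover have "h ((frag_of p - frag_of q - frag_of r) + frag_of r) = h (frag_of p - frag_of q - frag_of r) + h (frag_of r)"
        using hom_mult[OF h(1), of "frag_of p - frag_of q - frag_of r" "frag_of r"] k' that by simp
      ultimately show ?thesis
        by simp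
    qed
    have "h r = \<one>\<^bsub>additive_group\<^esub>" if "r \<in> tensor_relators G" for r
      using that unfolding tensor_relators_def
    proof (elim UnE CollectE exE conjE)
      fix a b q assume ab: "a \<in> carrier G" "b \<in> carrier G" "r = frag_of (a \<otimes>\<^bsub>G\<^esub> b, q) - frag_of (a, q) - frag_of (b, q)"
      show ?thesis
        unfolding ab(3) using ab(1,2) by (subst hd) (simp_all add: h(2) add Poly_Mapping.lookup_add algebra_simps)
    next
      fix a q s assume a: "r = frag_of (a, q + s) - frag_of (a, q) - frag_of (a, s)" "a \<in> carrier G"
      show ?thesis
        unfolding a(1) using a(2) by (subst hd) (simp_all add: h(2) algebra_simps)
    qed
    then obtain k where k: "k \<in> hom (tensor G) (additive_group :: rat monoid)"
      "\<And>u. Poly_Mapping.keys u \<subseteq> carrier G \<times> UNIV \<Longrightarrow>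
        k (presented_class (carrier G \<times> UNIV) (tensor_relators G) u) = h u"
      using presented_group_universal[OF R h(1) additive_group_comm] unfolding tensor_def by metis
    have "k (pure_tensor G x 1) = of_int (Poly_Mapping.lookup (\<iota> x) i)"
      unfolding pure_tensor_def using k(2)[of "frag_of (x, 1)"] h(2)[of "(x, 1)"] assms(2) by simp
    moreover have "k (pure_tensor G x 1) = 0"
      unfolding assms(3)
      using hom_one[OF k(1) comm_group.axioms(2)[OF tensor_comm_group[OF G]] comm_group.axioms(2)[OF additive_group_comm]]
      by simp
    ultimately show ?thesis
      by simp
  qed
  then have "\<iota> x = 0"
    by (simp add: poly_mapping_eqI)
  moreover have "\<iota> \<one>\<^bsub>G\<^esub> = 0"
    using hom_one[OF \<iota>h G.is_group group_free_Abelian_group] by simp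
  ultimately show ?thesis
    using \<iota>i assms(2) by (metis G.one_closed inj_onD)
qed

lemma hom_finprod:
  assumes "comm_group G" "comm_group H" "h \<in> hom G H" "f \<in> A \<rightarrow> carrier G"
  shows "h (finprod G f A) = finprod H (\<lambda>x. h (f x)) A"
proof -
  interpret G: comm_group G by fact
  interpret H: comm_group H by fact
  show ?thesis
    using assms(4)
  proof (induction A rule: infinite_finite_induct)
    case (insert x A)
    then have "(\<lambda>x. h (f x)) \<in> A \<rightarrow> carrier H" "f \<in> A \<rightarrow> carrier G" "f x \<in> carrier G"
      using hom_in_carrier[OF assms(3)] by auto
    then show ?case
      using insert hom_mult[OF assms(3)] hom_in_carrier[OF assms(3)] by simp
  qed (use hom_one[OF assms(3) G.is_group H.is_group] in simp_all)
qed

lemma finprod_additive_group: "finprod additive_group f A = (\<Sum>x\<in>A. f x)"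
proof -
  interpret comm_group additive_group
    by (rule additive_group_comm)
  show ?thesis
    by (induction A rule: infinite_finite_induct) simp_all
qed

lemma int_pow_additive_group: "x [^]\<^bsub>additive_group\<^esub> (k :: int) = of_int k * (x :: 'a::ring_1)"
proof -
  interpret comm_group "additive_group :: 'a monoid"
    by (rule additive_group_comm)
  have nat: "x [^]\<^bsub>additive_group\<^esub> (n :: nat) = of_nat n * x" for n
    by (induction n) (simp_all add: algebra_simps)
  show ?thesis
  proof (cases k)
    case (nonneg n)
    then show ?thesis
      using nat by (simp add: int_pow_int)
  next
    case (neg n)
    then show ?thesis
      using nat[of "Suc n"] int_pow_neg_int[of x "Suc n"] by (simp del: of_nat_Suc)
  qed
qed

lemma torsion_subgroup:
  fixes G (structure)
  assumes "comm_group G"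
  shows "subgroup (torsion G) G"
proof
  interpret comm_group G by fact
  show "torsion G \<subseteq> carrier G" "\<one> \<in> torsion G"
    by (auto simp: torsion_def intro: exI[of _ 1])
  fix x assume "x \<in> torsion G"
  then obtain m :: nat where m: "x \<in> carrier G" "m > 0" "x [^] m = \<one>"
    unfolding torsion_def by blast
  then show "inv x \<in> torsion G"
    unfolding torsion_def by (auto simp: nat_pow_inv intro!: exI[of _ m])
  fix y assume "y \<in> torsion G"
  then obtain n :: nat where n: "y \<in> carrier G" "n > 0" "y [^] n = \<one>"
    unfolding torsion_def by blast
  have "(x \<otimes> y) [^] (m * n) = (x [^] m) [^] n \<otimes> (y [^] n) [^] m"
    using m(1) n(1) by (simp add: nat_pow_distrib nat_pow_pow mult.commute)
  then have "(x \<otimes> y) [^] (m * n) = \<one>"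
    using m n by simp
  then show "x \<otimes> y \<in> torsion G"
    unfolding torsion_def using m n by (auto intro!: exI[of _ "m * n"])
qed

locale torsion_free_quotient = comm_group G for G :: "'a monoid" (structure) +
  fixes M N :: "'a set"
  assumes M: "subgroup M G" and N: "subgroup N G" and NM: "N \<subseteq> M"
begin

abbreviation "GM \<equiv> G\<lparr>carrier := M\<rparr>"

definition cl :: "'a \<Rightarrow> 'a set set" where
  "cl x = torsion (GM Mod N) #>\<^bsub>GM Mod N\<^esub> (N #> x)"

lemma GM: "comm_group GM" "N \<lhd> GM" "comm_group (GM Mod N)" "comm_group (torsion_free_part (GM Mod N))"
proof -
  show 1: "comm_group GM"
    by (rule group.group_comm_groupI[OF subgroup_imp_group[OF M]])
      (use subgroup.subset[OF M] m_comm in auto)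
  have "subgroup N GM"
    using subgroup_incl[OF N M NM] .
  then show "N \<lhd> GM" and 2: "comm_group (GM Mod N)"
    using comm_group.subgroup_imp_normal[OF 1] comm_group.abelian_FactGroup[OF 1] by auto
  show "comm_group (torsion_free_part (GM Mod N))"
    unfolding torsion_free_part_def
    using comm_group.abelian_FactGroup[OF 2 torsion_subgroup[OF 2]] .
qed

lemma coset_GM: "N #>\<^bsub>GM\<^esub> x = N #> x"
  by (simp add: r_coset_def)

lemma cl_hom: "cl \<in> hom GM (torsion_free_part (GM Mod N))"
proof -
  have "(\<lambda>x. N #>\<^bsub>GM\<^esub> x) \<in> hom GM (GM Mod N)"
    using normal.r_coset_hom_Mod[OF GM(2)] .
  moreover have "(\<lambda>U. torsion (GM Mod N) #>\<^bsub>GM Mod N\<^esub> U) \<in> hom (GM Mod N) (torsion_free_part (GM Mod N))"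
    unfolding torsion_free_part_def
    using normal.r_coset_hom_Mod[OF comm_group.subgroup_imp_normal[OF GM(3) torsion_subgroup[OF GM(3)]]] .
  ultimately have "(\<lambda>U. torsion (GM Mod N) #>\<^bsub>GM Mod N\<^esub> U) \<circ> (\<lambda>x. N #>\<^bsub>GM\<^esub> x) \<in> hom GM (torsion_free_part (GM Mod N))"
    by (rule Group.hom_compose)
  moreover have "(\<lambda>U. torsion (GM Mod N) #>\<^bsub>GM Mod N\<^esub> U) \<circ> (\<lambda>x. N #>\<^bsub>GM\<^esub> x) = cl"
    by (simp add: fun_eq_iff cl_def coset_GM)
  ultimately show ?thesis
    by simp
qed

lemma cl_closed: "x \<in> M \<Longrightarrow> cl x \<in> carrier (torsion_free_part (GM Mod N))"
  using hom_in_carrier[OF cl_hom] by simp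

lemma cl_mult: "x \<in> M \<Longrightarrow> y \<in> M \<Longrightarrow> cl (x \<otimes> y) = cl x \<otimes>\<^bsub>torsion_free_part (GM Mod N)\<^esub> cl y"
  using hom_mult[OF cl_hom] by simp

lemma cl_surj:
  assumes "U \<in> carrier (torsion_free_part (GM Mod N))"
  obtains x where "x \<in> M" "U = cl x"
  using assms that unfolding torsion_free_part_def carrier_FactGroup cl_def by (auto simp: coset_GM)

lemma coset_pow:
  assumes "x \<in> M"
  shows "(N #> x) [^]\<^bsub>GM Mod N\<^esub> (n :: nat) = N #> (x [^] n)"
proof (induction n)
  case 0
  have "N #> \<one> = N"
    using coset_mult_one subgroup.subset[OF N] by blast
  then show ?case
    by simp
next
  case (Suc n)
  have "x [^] n \<in> M"
    by (induction n) (simp_all add: assms subgroup.one_closed[OF M] subgroup.m_closed[OF M])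
  then show ?case
    using Suc normal.rcos_sum[OF GM(2), of "x [^] n" x] assms by (simp add: coset_GM set_mult_def)
qed

text \<open>Dividing out torsion after dividing by N identifies x with the unit exactly when a
  positive power lies in N. This is the form in which the relation between X and Y enters
  later.\<close>

lemma cl_eq_one:
  assumes "x \<in> M"
  shows "cl x = \<one>\<^bsub>torsion_free_part (GM Mod N)\<^esub> \<longleftrightarrow> (\<exists>n::nat. n > 0 \<and> x [^] n \<in> N)"
proof -
  interpret Q: comm_group "GM Mod N"
    by (rule GM(3))
  have c: "N #> x \<in> carrier (GM Mod N)"
    unfolding carrier_FactGroup using assms coset_GM by auto
  have xG: "x [^] n \<in> carrier G" for n :: nat
    using assms subgroup.subset[OF M] by auto
  have "cl x = \<one>\<^bsub>torsion_free_part (GM Mod N)\<^esub> \<longleftrightarrow> N #> x \<in> torsion (GM Mod N)"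
    unfolding cl_def torsion_free_part_def one_FactGroup
    using Q.coset_join1[OF _ c torsion_subgroup[OF GM(3)]] Q.coset_join2[OF c torsion_subgroup[OF GM(3)]] by blast
  also have "\<dots> \<longleftrightarrow> (\<exists>n::nat. n > 0 \<and> N #> (x [^] n) = N)"
    unfolding torsion_def using c by (simp add: coset_pow[OF assms])
  also have "\<dots> \<longleftrightarrow> (\<exists>n::nat. n > 0 \<and> x [^] n \<in> N)"
    using coset_join1[OF _ xG N] coset_join2[OF xG N] by blast
  finally show ?thesis .
qed

end

section \<open>The Grothendieck group of the quotient\<close>

context thick_pair
begin

lemma VQ_relators_carrier: "K0_relators VQ \<subseteq> carrier (free_Abelian_group (obj VQ))"
proof
  fix r assume "r \<in> K0_relators VQ"
  then obtain X Y W where r: "r = frag_of Y - frag_of X - frag_of W" "X \<in> S" "Y \<in> S" "W \<in> S"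
    by (rule VQ_relator_cases)
  then show "r \<in> carrier (free_Abelian_group (obj VQ))"
    unfolding r(1) VQ_simps using keys_diff[of "frag_of Y - frag_of X" "frag_of W"]
      keys_diff[of "frag_of Y" "frag_of X"] by auto
qed

abbreviation "qcl \<equiv> K0_class VQ"

lemma VQ_K0_comm: "comm_group (K0 VQ)"
  unfolding K0_def by (rule presented_group_comm[OF VQ_relators_carrier])

lemma qcl_in: "X \<in> S \<Longrightarrow> qcl X \<in> carrier (K0 VQ)"
  using hom_in_carrier[OF presented_class_hom[OF VQ_relators_carrier]]
  unfolding K0_def K0_class_def VQ_simps by simp

lemma qcl_Tr:
  assumes "Tr C X Y W" "X \<in> S" "Y \<in> S" "W \<in> S"
  shows "qcl Y = qcl X \<otimes>\<^bsub>K0 VQ\<^esub> qcl W"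
  by (rule K0_class_relator[OF VQ_relators_carrier]) (use VQ_relator_Tr[OF assms] assms VQ_simps(1) in auto)

lemma qcl_N:
  assumes "A \<in> N"
  shows "qcl A = \<one>\<^bsub>K0 VQ\<^esub>"
proof -
  interpret K: comm_group "K0 VQ"
    by (rule VQ_K0_comm)
  have A: "A \<in> S"
    using assms N_S by blast
  have "qcl A = qcl A \<otimes>\<^bsub>K0 VQ\<^esub> qcl A"
    by (rule K0_class_relator[OF VQ_relators_carrier]) (use VQ_relator_N[OF assms] A VQ_simps(1) in auto)
  then show ?thesis
    by (rule K.l_cancel_one'[OF qcl_in[OF A] qcl_in[OF A], THEN iffD1])
qed

text \<open>Both legs of the roof from \<open>isomorphic_roof\<close> change \<open>g\<close> only
  by values on \<open>N\<close>, which are trivial.\<close>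

lemma additive_isomorphic:
  assumes H: "comm_group H" and c: "\<And>X. X \<in> S \<Longrightarrow> g X \<in> carrier H"
    and add: "\<And>X Y W. Tr C X Y W \<Longrightarrow> X \<in> S \<Longrightarrow> Y \<in> S \<Longrightarrow> W \<in> S \<Longrightarrow> g Y = g X \<otimes>\<^bsub>H\<^esub> g W"
    and N: "\<And>A. A \<in> N \<Longrightarrow> g A = \<one>\<^bsub>H\<^esub>"
    and iso: "isomorphic VQ X Y" and S: "X \<in> S" "Y \<in> S"
  shows "g X = g Y"
proof -
  interpret comm_group H by fact
  obtain W M M' where W: "Tr C W X M" "Tr C W Y M'" "W \<in> S" "M \<in> N" "M' \<in> N"
    using isomorphic_roof[OF iso] .
  then have "M \<in> S" "M' \<in> S"
    using N_S by auto
  then have "g X = g W" "g Y = g W"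
    using add[OF W(1)] add[OF W(2)] W N S c[OF W(3)] by simp_all
  then show ?thesis
    by simp
qed

lemma qcl_isomorphic: "isomorphic VQ X Y \<Longrightarrow> X \<in> S \<Longrightarrow> Y \<in> S \<Longrightarrow> qcl X = qcl Y"
  using additive_isomorphic[of "K0 VQ" qcl, OF VQ_K0_comm qcl_in qcl_Tr qcl_N] .

text \<open>Every class is the class of an object, so homomorphisms out of this group are
  determined, and may be compared, on objects.\<close>

lemma qcl_surj:
  assumes "x \<in> carrier (K0 VQ)"
  obtains X where "X \<in> S" "x = qcl X"
proof -
  interpret K: comm_group "K0 VQ"
    by (rule VQ_K0_comm)
  obtain K where K: "zero_obj C K"
    using ex_zero_obj by blast
  have K': "K \<in> S" "qcl K = \<one>\<^bsub>K0 VQ\<^esub>"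
    using S_zero[OF K] qcl_N[OF N_zero[OF K]] by auto
  have hom: "presented_class S (K0_relators VQ) \<in> hom (free_Abelian_group S) (K0 VQ)"
    using presented_class_hom[OF VQ_relators_carrier] by (simp add: K0_def VQ_simps)
  obtain \<xi> where \<xi>: "Poly_Mapping.keys \<xi> \<subseteq> S" "x = presented_class S (K0_relators VQ) \<xi>"
    using presented_group_elem[OF VQ_relators_carrier] assms unfolding K0_def VQ_simps by metis
  have "\<exists>X \<in> S. presented_class S (K0_relators VQ) \<xi> = qcl X"
  proof (rule free_Abelian_group_induct[OF \<xi>(1)])
    have "presented_class S (K0_relators VQ) 0 = \<one>\<^bsub>K0 VQ\<^esub>"
      using hom_one[OF hom group_free_Abelian_group K.is_group] by simp
    then show "\<exists>X \<in> S. presented_class S (K0_relators VQ) 0 = qcl X"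
      using K' by force
  next
    fix \<xi> \<zeta>
    assume 2: "Poly_Mapping.keys \<xi> \<subseteq> S" "Poly_Mapping.keys \<zeta> \<subseteq> S"
      "\<exists>X \<in> S. presented_class S (K0_relators VQ) \<xi> = qcl X"
      "\<exists>X \<in> S. presented_class S (K0_relators VQ) \<zeta> = qcl X"
    then obtain X Y where XY: "X \<in> S" "presented_class S (K0_relators VQ) \<xi> = qcl X"
      "Y \<in> S" "presented_class S (K0_relators VQ) \<zeta> = qcl Y"
      by blast
    have o: "X \<in> obj C" "Y \<in> obj C" "sho C Y \<in> S"
      using XY S_obj S_sho by blast+
    \<comment> \<open>\<open>G\<close> is the sum of X and Y[1], whose class is the difference of
      the classes of X and Y.\<close>
    obtain G where G: "Tr C X G (sho C Y)"
      using Tr_zero_map[OF o(2,1)] .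
    have GS: "G \<in> S"
      using S_Tr[OF G XY(1) o(3)] .
    have "qcl K = qcl Y \<otimes>\<^bsub>K0 VQ\<^esub> qcl (sho C Y)"
      using qcl_Tr[OF Tr_rot[OF Tr_idt[OF o(2) K]] XY(3) K'(1) o(3)] .
    then have inv: "qcl (sho C Y) = inv\<^bsub>K0 VQ\<^esub> qcl Y"
      using K'(2) K.inv_equality[of "qcl (sho C Y)" "qcl Y"] qcl_in[OF XY(3)] qcl_in[OF o(3)]
        K.m_comm[of "qcl Y" "qcl (sho C Y)"] by simp
    have k: "Poly_Mapping.keys (\<xi> - \<zeta>) \<subseteq> S"
      using 2 keys_diff[of \<xi> \<zeta>] by blast
    have "presented_class S (K0_relators VQ) ((\<xi> - \<zeta>) + \<zeta>) =
        presented_class S (K0_relators VQ) (\<xi> - \<zeta>) \<otimes>\<^bsub>K0 VQ\<^esub> presented_class S (K0_relators VQ) \<zeta>"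
      using hom_mult[OF hom, of "\<xi> - \<zeta>" \<zeta>] k 2 by (simp del: diff_add_cancel)
    then have "presented_class S (K0_relators VQ) (\<xi> - \<zeta>) \<otimes>\<^bsub>K0 VQ\<^esub> qcl Y = qcl X"
      using XY by simp
    moreover have "presented_class S (K0_relators VQ) (\<xi> - \<zeta>) \<in> carrier (K0 VQ)"
      using hom_in_carrier[OF hom] k by simp
    ultimately have "presented_class S (K0_relators VQ) (\<xi> - \<zeta>) = qcl X \<otimes>\<^bsub>K0 VQ\<^esub> inv\<^bsub>K0 VQ\<^esub> qcl Y"
      using K.inv_solve_right[OF _ qcl_in[OF XY(1)] qcl_in[OF XY(3)]] by simp
    also have "\<dots> = qcl G"
      using qcl_Tr[OF G XY(1) GS o(3)] inv by simp
    finally show "\<exists>X \<in> S. presented_class S (K0_relators VQ) (\<xi> - \<zeta>) = qcl X"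
      using GS by blast
  next
    fix X assume "X \<in> S"
    then show "\<exists>Y \<in> S. presented_class S (K0_relators VQ) (frag_of X) = qcl Y"
      unfolding K0_class_def VQ_simps by blast
  qed
  then show ?thesis
    using that \<xi>(2) by blast
qed

text \<open>A relator of the quotient has terms isomorphic to those of a genuine triangle in
  \<open>S\<close>, where \<open>g\<close> is additive; \<open>additive_isomorphic\<close> transfers
  this to the relator.\<close>

lemma VQ_K0_universal:
  assumes H: "comm_group H" and c: "\<And>X. X \<in> S \<Longrightarrow> g X \<in> carrier H"
    and add: "\<And>X Y W. Tr C X Y W \<Longrightarrow> X \<in> S \<Longrightarrow> Y \<in> S \<Longrightarrow> W \<in> S \<Longrightarrow> g Y = g X \<otimes>\<^bsub>H\<^esub> g W"
    and N: "\<And>A. A \<in> N \<Longrightarrow> g A = \<one>\<^bsub>H\<^esub>"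
  obtains k where "k \<in> hom (K0 VQ) H" "\<And>X. X \<in> S \<Longrightarrow> k (qcl X) = g X"
proof -
  interpret H: comm_group H by fact
  obtain h where h: "h \<in> hom (free_Abelian_group S) H" "\<And>X. X \<in> S \<Longrightarrow> h (frag_of X) = g X"
    using H.free_Abelian_group_universal[of g S] c by blast
  have "h r = \<one>\<^bsub>H\<^esub>" if rr: "r \<in> K0_relators VQ" for r
  proof -
    obtain X Y W X0 Y0 W0 where r: "r = frag_of Y - frag_of X - frag_of W" "X \<in> S" "Y \<in> S" "W \<in> S"
      "Tr C X0 Y0 W0" "X0 \<in> S" "Y0 \<in> S" "W0 \<in> S"
      "isomorphic VQ X0 X" "isomorphic VQ Y0 Y" "isomorphic VQ W0 W"
      using VQ_relator_cases[OF rr] .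
    have "g Y = g X \<otimes>\<^bsub>H\<^esub> g W"
      using additive_isomorphic[of H g, OF H c add N r(9) r(6,2)] additive_isomorphic[of H g, OF H c add N r(10) r(7,3)]
        additive_isomorphic[of H g, OF H c add N r(11) r(8,4)] add[OF r(5-8)] by simp
    moreover have "r \<in> carrier (free_Abelian_group S)"
      using VQ_relators_carrier rr unfolding VQ_simps by blast
    then have "h (r + (frag_of X + frag_of W)) = h r \<otimes>\<^bsub>H\<^esub> h (frag_of X + frag_of W)"
      "h (frag_of X + frag_of W) = g X \<otimes>\<^bsub>H\<^esub> g W" "h r \<in> carrier H"
      using hom_mult[OF h(1), of r "frag_of X + frag_of W"] hom_mult[OF h(1), of "frag_of X" "frag_of W"]
        keys_add[of "frag_of X :: 'b \<Rightarrow>\<^sub>0 int" "frag_of W"] r(2,4) h(2) hom_in_carrier[OF h(1)] by auto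
    moreover have "r + (frag_of X + frag_of W) = frag_of Y"
      unfolding r(1) by simp
    ultimately show ?thesis
      using h(2)[OF r(3)] H.m_closed[OF c[OF r(2)] c[OF r(4)]] H.r_cancel_one'[of "g X \<otimes>\<^bsub>H\<^esub> g W" "h r"]
      by simp
  qed
  then obtain k where "k \<in> hom (K0 VQ) H"
    "\<And>x. Poly_Mapping.keys x \<subseteq> S \<Longrightarrow> k (presented_class S (K0_relators VQ) x) = h x"
    using presented_group_universal[OF VQ_relators_carrier _ H] h(1) unfolding K0_def VQ_simps by metis
  then show ?thesis
    using that h(2) unfolding K0_class_def VQ_simps by simp
qed

lemma VQ_zero_obj:
  assumes "zero_obj VQ X"
  shows "X \<in> N"
proof -
  have X: "X \<in> S" "X \<in> obj C" and "idt V X = null V X X"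
    using assms S_obj unfolding VQ_simps zero_obj_def V_simps by auto
  have i: "idt C X \<in> homset C X X" and n: "null C X X \<in> homset C X X"
    using idt_in null_in X by auto
  have "localized X X (idt C X) = localized X X (null C X X)"
    using \<open>idt V X = null V X X\<close> localize_eq[OF i X(1,1)] localize_eq[OF n X(1,1)] unfolding V_simps by simp
  then have "(idt C X, idt C X) \<in> localized X X (null C X X)"
    using localized_roof(2)[OF i X(1,1)] by simp
  then obtain P p where p: "qis P X p" "idt C X \<cdot> p = null C X X \<cdot> (idt C X \<cdot> p)"
    unfolding localized_def using i by (auto simp: homset_iff)
  then have "p = null C P X"
    using cmp_idt[OF qisD(1)[OF p(1)]] cmp_null_left[OF qisD(1)[OF p(1)] X(2)] by simp
  obtain M g h where M: "M \<in> N" "dt C P X M p g h"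
    using p(1) unfolding qis_def by blast
  \<comment> \<open>Vanishing of the identity makes the denominator \<open>p\<close> a null arrow;
    then the identity of X factors through the cone of \<open>p\<close>, so X is a retract of an
    object of \<open>N\<close>.\<close>
  have "idt C X \<cdot> p = null C P X"
    using cmp_idt[OF qisD(1)[OF p(1)]] \<open>p = _\<close> by simp
  then obtain w where "w \<in> homset C M X" "w \<cdot> g = idt C X"
    using factor_cone[OF M(2) i] by blast
  then have "retract X M"
    unfolding retract_def using dtD(2)[OF M(2)] by blast
  then show ?thesis
    using N_retract M(1) by blast
qed

lemma VQ_isomorphic_refl:
  assumes "X \<in> S"
  shows "isomorphic VQ X X"
proof -
  have "idt C X \<in> homset C X X"
    using idt_in assms S_obj by blast
  then show ?thesis
    unfolding VQ_simps isomorphic_def using localize_idt_isom[OF assms] localize_arr assms by blast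
qed

end

lemma equivalence_representatives:
  assumes "finite A" "\<And>x. x \<in> A \<Longrightarrow> R x x" "\<And>x y. R x y \<Longrightarrow> R y x" "\<And>x y z. R x y \<Longrightarrow> R y z \<Longrightarrow> R x z"
  shows "\<exists>B \<subseteq> A. (\<forall>x \<in> A. \<exists>y \<in> B. R x y) \<and> (\<forall>x \<in> B. \<forall>y \<in> B. x \<noteq> y \<longrightarrow> \<not> R x y)"
  using assms(1,2)
proof (induction A)
  case (insert x A)
  then obtain B where B: "B \<subseteq> A" "\<forall>x \<in> A. \<exists>y \<in> B. R x y" "\<forall>x \<in> B. \<forall>y \<in> B. x \<noteq> y \<longrightarrow> \<not> R x y"
    by auto
  show ?case
  proof (cases "\<exists>y \<in> B. R x y")
    case True
    then have "B \<subseteq> insert x A" "\<forall>z \<in> insert x A. \<exists>y \<in> B. R z y"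
      using B(1,2) by blast+
    then show ?thesis
      using B(3) by blast
  next
    case False
    have "R x x"
      using insert.prems by blast
    then have "\<forall>z \<in> insert x A. \<exists>y \<in> insert x B. R z y"
      using B(2) by blast
    moreover have "\<not> R z y" if "z \<in> insert x B" "y \<in> insert x B" "z \<noteq> y" for z y
      using that False B(3) assms(3)[of z y] by blast
    moreover have "insert x B \<subseteq> insert x A"
      using B(1) by blast
    ultimately show ?thesis
      by (intro exI[of _ "insert x B"]) blast
  qed
qed simp

lemma (in comm_group) finprod_in_subgroup:
  assumes "subgroup H G" "f \<in> A \<rightarrow> H"
  shows "finprod G f A \<in> H"
  using assms(2)
proof (induction A rule: infinite_finite_induct)
  case (insert x A)
  then have "f \<in> A \<rightarrow> carrier G" "f x \<in> carrier G"
    using subgroup.subset[OF assms(1)] by auto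
  then show ?case
    using insert subgroup.m_closed[OF assms(1)] by auto
qed (use subgroup.one_closed[OF assms(1)] in simp_all)

lemma sum_count_list:
  fixes f :: "'x \<Rightarrow> complex"
  assumes "finite A" "set L \<subseteq> A"
  shows "(\<Sum>x\<in>A. of_int (int (count_list L x)) * f x) = (\<Sum>x\<leftarrow>L. f x)"
  using assms(2)
proof (induction L)
  case (Cons y L)
  have "(\<Sum>x\<in>A. of_int (int (count_list (y # L) x)) * f x) =
      (\<Sum>x\<in>A. of_int (int (count_list L x)) * f x + (if x = y then f y else 0))"
    by (intro sum.cong) (auto simp: algebra_simps)
  also have "\<dots> = (\<Sum>x\<leftarrow>L. f x) + f y"
    using Cons assms(1) by (simp add: sum.distrib)
  finally show ?case
    by simp
qed simp

section \<open>Relations among classes of limit semistable objects\<close>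

locale numerical_path = quasi_convergent_path +
  assumes rank: "free_of_finite_rank \<Lambda>"
    and v_epi: "v \<in> epi (K0 C) \<Lambda>"
    and num: "numerical C \<Lambda> v \<sigma>"
begin

sublocale L: comm_group \<Lambda>
  using rank by (simp add: free_of_finite_rank_def)

abbreviation cls :: "'b \<Rightarrow> 'd" where "cls X \<equiv> v (K0_class C X)"

lemma v_hom: "v \<in> hom (K0 C) \<Lambda>"
  using v_epi by (simp add: epi_def)

lemma cls_in: "X \<in> obj C \<Longrightarrow> cls X \<in> carrier \<Lambda>"
  using hom_in_carrier[OF v_hom K0_class_in] .

lemma cls_Tr:
  assumes "Tr C X Y W"
  shows "cls Y = cls X \<otimes>\<^bsub>\<Lambda>\<^esub> cls W"
  using hom_mult[OF v_hom K0_class_in K0_class_in] TrD[OF assms] unfolding K0_class_Tr[OF assms] by blast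

lemma cls_zero:
  assumes "zero_obj C X"
  shows "cls X = \<one>\<^bsub>\<Lambda>\<^esub>"
proof -
  have X: "X \<in> obj C"
    using zero_objD[OF assms] .
  show ?thesis
    using cls_Tr[OF Tr_idt[OF X assms]] by (rule L.l_cancel_one'[OF cls_in[OF X] cls_in[OF X], THEN iffD1])
qed

lemma cls_sho:
  assumes X: "X \<in> obj C"
  shows "cls (sho C X) = inv\<^bsub>\<Lambda>\<^esub> cls X"
proof -
  obtain K where K: "zero_obj C K"
    using ex_zero_obj by blast
  have "cls K = cls X \<otimes>\<^bsub>\<Lambda>\<^esub> cls (sho C X)"
    using cls_Tr[OF Tr_rot[OF Tr_idt[OF X K]]] .
  then have "cls (sho C X) \<otimes>\<^bsub>\<Lambda>\<^esub> cls X = \<one>\<^bsub>\<Lambda>\<^esub>"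
    using cls_zero[OF K] L.m_comm[OF cls_in[OF X] cls_in[OF sho_in[OF X]]] by simp
  then show ?thesis
    using L.inv_equality[OF _ cls_in[OF X] cls_in[OF sho_in[OF X]]] by simp
qed

text \<open>Factors are counted with multiplicity over an ambient finite set \<open>A\<close>, so
  that the expansions of two objects can be combined in a single product.\<close>

lemma cls_filtration:
  assumes A: "finite A" "A \<subseteq> obj C"
  shows "filtration C X Gs \<Longrightarrow> set Gs \<subseteq> A \<Longrightarrow>
    cls X = finprod \<Lambda> (\<lambda>B. cls B [^]\<^bsub>\<Lambda>\<^esub> int (count_list Gs B)) A"
proof (induction Gs arbitrary: X rule: rev_induct)
  case Nil
  then have "cls X = \<one>\<^bsub>\<Lambda>\<^esub>"
    using cls_zero by (simp add: filtration_Nil)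
  moreover have "finprod \<Lambda> (\<lambda>B. cls B [^]\<^bsub>\<Lambda>\<^esub> int (count_list [] B)) A = finprod \<Lambda> (\<lambda>B. \<one>\<^bsub>\<Lambda>\<^esub>) A"
    using A cls_in by (intro L.finprod_cong) auto
  ultimately show ?case
    by simp
next
  case (snoc G Gs)
  then obtain E where E: "filtration C E Gs" "Tr C E X G"
    by (auto simp: filtration_snoc)
  have G: "G \<in> A"
    using snoc.prems by auto
  have c: "cls B \<in> carrier \<Lambda>" if "B \<in> A" for B
    using cls_in A(2) that by blast
  have "finprod \<Lambda> (\<lambda>B. cls B [^]\<^bsub>\<Lambda>\<^esub> int (count_list (Gs @ [G]) B)) A =
    finprod \<Lambda> (\<lambda>B. cls B [^]\<^bsub>\<Lambda>\<^esub> int (count_list Gs B) \<otimes>\<^bsub>\<Lambda>\<^esub> (if B = G then cls B else \<one>\<^bsub>\<Lambda>\<^esub>)) A"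
  proof (rule L.finprod_cong'[OF refl])
    fix B assume B: "B \<in> A"
    have "cls B [^]\<^bsub>\<Lambda>\<^esub> (int (count_list Gs B) + 1) = cls B [^]\<^bsub>\<Lambda>\<^esub> int (count_list Gs B) \<otimes>\<^bsub>\<Lambda>\<^esub> cls B"
      using c[OF B] by (simp add: L.int_pow_mult)
    then show "cls B [^]\<^bsub>\<Lambda>\<^esub> int (count_list (Gs @ [G]) B) =
        cls B [^]\<^bsub>\<Lambda>\<^esub> int (count_list Gs B) \<otimes>\<^bsub>\<Lambda>\<^esub> (if B = G then cls B else \<one>\<^bsub>\<Lambda>\<^esub>)"
      using c[OF B] by (auto simp: add.commute)
  qed (use c in auto)
  also have "\<dots> = finprod \<Lambda> (\<lambda>B. cls B [^]\<^bsub>\<Lambda>\<^esub> int (count_list Gs B)) A \<otimes>\<^bsub>\<Lambda>\<^esub>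
      finprod \<Lambda> (\<lambda>B. if B = G then cls B else \<one>\<^bsub>\<Lambda>\<^esub>) A"
    using c by (intro L.finprod_multf) auto
  also have "finprod \<Lambda> (\<lambda>B. if B = G then cls B else \<one>\<^bsub>\<Lambda>\<^esub>) A = cls G"
    using L.finprod_singleton_swap[OF G A(1), of cls] c by auto
  also have "finprod \<Lambda> (\<lambda>B. cls B [^]\<^bsub>\<Lambda>\<^esub> int (count_list Gs B)) A = cls E"
    using snoc.IH[OF E(1)] snoc.prems(2) by simp
  finally show ?case
    using cls_Tr[OF E(2)] by simp
qed

lemma charge_factors:
  assumes "a \<le> t"
  obtains z where "z \<in> hom \<Lambda> (additive_group :: complex monoid)" "\<And>X. X \<in> obj C \<Longrightarrow> Z t X = z (cls X)"
proof -
  have "factors_through (K0 C) \<Lambda> v (fst (\<sigma> t))"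
    using path_Stab[OF assms] unfolding Stab_def by blast
  then obtain z where "z \<in> hom \<Lambda> complex_group" "\<forall>x \<in> carrier (K0 C). fst (\<sigma> t) x = z (v x)"
    unfolding factors_through_def by blast
  then show ?thesis
    using that K0_class_in unfolding charge_def complex_group_eq by blast
qed

lemma class_subgroup_subgroup: "T \<subseteq> obj C \<Longrightarrow> subgroup (class_subgroup C \<Lambda> v T) \<Lambda>"
  unfolding class_subgroup_def using cls_in by (intro L.generate_is_subgroup) auto

lemma class_subgroup_incl: "X \<in> T \<Longrightarrow> cls X \<in> class_subgroup C \<Lambda> v T"
  unfolding class_subgroup_def by (intro generate.incl) auto

text \<open>This is where the numerical condition enters.\<close>

lemma numerical_relation:
  assumes A: "finite A" "\<And>B. B \<in> A \<Longrightarrow> lss B"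
    and rel: "finprod \<Lambda> (\<lambda>B. cls B [^]\<^bsub>\<Lambda>\<^esub> (c B :: int)) A = \<one>\<^bsub>\<Lambda>\<^esub>"
  shows "finprod \<Lambda> (\<lambda>B. cls B [^]\<^bsub>\<Lambda>\<^esub> c B) {B \<in> A. bounded_phase B E} = \<one>\<^bsub>\<Lambda>\<^esub>"
proof (cases "\<exists>B \<in> A. bounded_phase B E")
  case False
  then have "{B \<in> A. bounded_phase B E} = {}"
    by blast
  then show ?thesis
    by (simp only: L.finprod_empty)
next
  case True
  then obtain B0 where B0: "B0 \<in> A" "bounded_phase B0 E"
    by blast
  have self: "bounded_phase B B" for B
    unfolding bounded_phase_def by (intro exI[of _ 0]) simp
  have "\<exists>R \<subseteq> A. (\<forall>B \<in> A. \<exists>r \<in> R. bounded_phase B r) \<and>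
      (\<forall>r \<in> R. \<forall>r' \<in> R. r \<noteq> r' \<longrightarrow> \<not> bounded_phase r r')"
    by (rule equivalence_representatives[OF A(1)])
      (rule self, erule bounded_phase_sym, erule (1) bounded_phase_trans)
  then obtain R where R0: "R \<subseteq> A" "\<forall>B \<in> A. \<exists>r \<in> R. bounded_phase B r"
    "\<forall>r \<in> R. \<forall>r' \<in> R. r \<noteq> r' \<longrightarrow> \<not> bounded_phase r r'"
    by (elim exE conjE) rule
  note R = R0(1) bspec[OF R0(2)] R0(3)[rule_format]
  \<comment> \<open>The condition \<open>numerical\<close> is formulated for finite sequences, hence
    the enumeration of the representatives.\<close>
  obtain e where e: "bij_betw e {0..<card R} R"
    using ex_bij_betw_nat_finite finite_subset[OF R(1) A(1)] by blast
  define n where "n = card R"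
  have eR: "e i \<in> R" if "i < n" for i
    using bij_betwE[OF e] that by (simp add: n_def)
  have e_surj: thesis if "r \<in> R" "\<And>i. i < n \<Longrightarrow> e i = r \<Longrightarrow> thesis" for r thesis
  proof -
    have "r \<in> e ` {0..<card R}"
      using bij_betw_imp_surj_on[OF e] that(1) by simp
    then show ?thesis
      using that(2) by (auto simp: n_def)
  qed
  have ne: "\<not> bounded_phase (e i) (e j)" if "i < n" "j < n" "i \<noteq> j" for i j
  proof -
    have "e i \<noteq> e j"
      using inj_on_eq_iff[OF bij_betw_imp_inj_on[OF e], of i j] that by (simp add: n_def)
    then show ?thesis
      by (rule R(3)[OF eR[OF that(1)] eR[OF that(2)]])
  qed
  define f where "f B = cls B [^]\<^bsub>\<Lambda>\<^esub> c B" for B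
  have ff: "f = (\<lambda>B. cls B [^]\<^bsub>\<Lambda>\<^esub> c B)"
    by (rule ext) (rule f_def)
  define D where "D i = {B \<in> A. bounded_phase B (e i)}" for i
  have f: "f B \<in> carrier \<Lambda>" if "B \<in> A" for B
    unfolding f_def using cls_in[OF lssD(1)[OF A(2)[OF that]]] by simp
  define x where "x i = finprod \<Lambda> f (D i)" for i
  define H where "H i = class_subgroup C \<Lambda> v (objs_equiv_i C \<sigma> (e i))" for i
  have H: "subgroup (H i) \<Lambda>" for i
    unfolding H_def objs_equiv_i_def by (rule class_subgroup_subgroup) (use owf_obj in blast)
  have xH: "x i \<in> H i" if i: "i < n" for i
    unfolding x_def
  proof (rule L.finprod_in_subgroup[OF H])
    show "f \<in> D i \<rightarrow> H i"
    proof
      fix B assume B: "B \<in> D i"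
      have l: "lss B" "lss (e i)"
        using A(2) B eR[OF i] R(1) by (auto simp: D_def)
      then have "B \<in> objs_equiv_i C \<sigma> (e i)"
        unfolding objs_equiv_i_def using B equiv_i_iff[OF l] by (intro owf_lss) (auto simp: D_def)
      then have "cls B \<in> H i"
        unfolding H_def by (rule class_subgroup_incl)
      then show "f B \<in> H i"
        unfolding f_def by (rule L.subgroup_int_pow_closed[OF H])
    qed
  qed
  have xc: "x i \<in> carrier \<Lambda>" if "i < n" for i
    using xH[OF that] subgroup.subset[OF H] by blast
  have "(\<Union>i\<in>{..<n}. D i) = A"
  proof
    show "A \<subseteq> (\<Union>i\<in>{..<n}. D i)"
    proof
      fix B assume B: "B \<in> A"
      then obtain r where r: "r \<in> R" "bounded_phase B r"
        using R(2) by blast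
      obtain i where "i < n" "e i = r"
        using e_surj[OF r(1)] .
      then show "B \<in> (\<Union>i\<in>{..<n}. D i)"
        using B r by (auto simp: D_def)
    qed
  qed (auto simp: D_def)
  moreover have "finprod \<Lambda> f (\<Union>i\<in>{..<n}. D i) = finprod \<Lambda> x {..<n}"
    unfolding x_def
  proof (rule L.finprod_UN_disjoint)
    show "pairwise (\<lambda>i j. disjnt (D i) (D j)) {..<n}"
    proof (rule pairwiseI)
      fix i j assume ij: "i \<in> {..<n}" "j \<in> {..<n}" "i \<noteq> j"
      have "\<not> (bounded_phase B (e i) \<and> bounded_phase B (e j))" for B
        using ne[of i j] ij bounded_phase_sym bounded_phase_trans by blast
      then show "disjnt (D i) (D j)"
        unfolding disjnt_def D_def by blast
    qed
  qed (use A(1) f in \<open>auto simp: D_def\<close>)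
  ultimately have x1: "finprod \<Lambda> x {..<n} = \<one>\<^bsub>\<Lambda>\<^esub>"
    using rel unfolding ff by simp
  let ?T = "tensor \<Lambda> :: ('d \<times> rat \<Rightarrow>\<^sub>0 int) set monoid"
  \<comment> \<open>Independence is stated for rational spans, so the partial products are carried
    into the tensor product with the rationals.\<close>
  define u where "u i = pure_tensor \<Lambda> (x i) (1 :: rat)" for i
  note L = L.comm_group_axioms
  have "finprod ?T u {..<n} = pure_tensor \<Lambda> (finprod \<Lambda> x {..<n}) 1"
    unfolding u_def using hom_finprod[OF L tensor_comm_group[OF L] pure_tensor_hom[OF L], of x "{..<n}" 1] xc by auto
  then have u1: "finprod ?T u {..<n} = \<one>\<^bsub>?T\<^esub>"
    unfolding x1 using pure_tensor_one[OF L] by simp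
  have "independent_over_rat \<Lambda> n H"
    unfolding H_def
  proof (rule num[unfolded numerical_def, rule_format], intro conjI allI impI)
    have l: "lss (e i)" if "i < n" for i
      using A(2) subsetD[OF R(1) eR[OF that]] .
    then show "lss (e i)" if "i < n" for i
      using that .
    fix i j assume "i < n" "j < n" "i \<noteq> j"
    then show "\<not> equiv_i C \<sigma> (e i) (e j)"
      using ne l equiv_i_iff by simp
  qed
  moreover have "u i \<in> rational_span \<Lambda> (H i)" if "i < n" for i
    unfolding rational_span_def u_def using xH[OF that] by (intro generate.incl) blast
  ultimately have "u i = \<one>\<^bsub>?T\<^esub>" if "i < n" for i
    using u1 that unfolding independent_over_rat_def by simp
  \<comment> \<open>Freeness of the lattice makes the passage to the rational tensor product
    injective, so the relation descends again.\<close>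
  then have xi: "x i = \<one>\<^bsub>\<Lambda>\<^esub>" if "i < n" for i
    using pure_tensor_eq_one[OF rank xc[OF that]] that unfolding u_def by blast
  obtain r where r: "r \<in> R" "bounded_phase B0 r"
    using R(2) B0(1) by blast
  obtain i where i: "i < n" "e i = r"
    using e_surj[OF r(1)] .
  \<comment> \<open>E may lie outside \<open>A\<close>; its class is matched with that of some
    \<open>e i\<close> through \<open>B0\<close>.\<close>
  have "bounded_phase B E \<longleftrightarrow> bounded_phase B (e i)" for B
    using B0(2) r(2) i(2) bounded_phase_sym bounded_phase_trans by blast
  then have "{B \<in> A. bounded_phase B E} = D i"
    by (simp add: D_def)
  then show ?thesis
    using xi[OF i(1)] unfolding x_def ff by simp
qed

end

section \<open>The limit charge of a graded piece\<close>

locale graded_piece = numerical_path +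
  fixes E :: 'b and \<sigma>E :: "'b charge_slicing"
  assumes E: "limit_semistable C \<sigma> E"
    and induced: "induced_pre_stability C \<sigma> E \<sigma>E"
begin

abbreviation "S \<equiv> objs_preceq C \<sigma> E"
abbreviation "N \<equiv> objs_prec C \<sigma> E"

sublocale T: thick_pair C S N
proof
  note P = down_closed_preceq[OF E] and P' = down_closed_prec[OF E]
  show "zero_obj C X \<Longrightarrow> X \<in> S" "zero_obj C X \<Longrightarrow> X \<in> N" for X
    unfolding objs_preceq_def objs_prec_def using owf_zero by blast+
  show "X \<in> obj C \<Longrightarrow> sho C X \<in> S \<longleftrightarrow> X \<in> S" "X \<in> obj C \<Longrightarrow> sho C X \<in> N \<longleftrightarrow> X \<in> N" for X
    unfolding objs_preceq_def objs_prec_def using owf_sho[OF P] owf_sho[OF P'] by blast+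
  show "Tr C X Y W \<Longrightarrow> X \<in> S \<Longrightarrow> W \<in> S \<Longrightarrow> Y \<in> S" "Tr C X Y W \<Longrightarrow> X \<in> N \<Longrightarrow> W \<in> N \<Longrightarrow> Y \<in> N" for X Y W
    unfolding objs_preceq_def objs_prec_def using owf_Tr[OF P] owf_Tr[OF P'] by blast+
  show "retract X Y \<Longrightarrow> Y \<in> N \<Longrightarrow> X \<in> N" for X Y
    unfolding objs_prec_def using owf_retract[OF P'] by blast
  show "S \<subseteq> obj C"
    unfolding objs_preceq_def using owf_obj by blast
  show "N \<subseteq> S"
  proof
    fix X assume X: "X \<in> N"
    obtain Gs where Gs: "limit_hn_filtration C \<sigma> X Gs" "\<And>A. A \<in> set Gs \<Longrightarrow> lim_prec C \<sigma> A E" "\<And>A. A \<in> set Gs \<Longrightarrow> lss A"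
      using owf_factors[OF X[unfolded objs_prec_def]] by metis
    have "\<forall>A \<in> set Gs. lim_preceq C \<sigma> A E"
      using Gs(2,3) lim_prec_asym[OF E] unfolding lim_preceq_def by blast
    then show "X \<in> S"
      unfolding objs_preceq_def objs_with_factors_def using Gs(1) owf_obj[OF X[unfolded objs_prec_def]] by blast
  qed
qed

lemma graded_quotient_eq: "graded_quotient C \<sigma> E = T.VQ"
  by (simp add: graded_quotient_def)

abbreviation zE :: "'b \<Rightarrow> complex" where "zE \<equiv> charge T.VQ \<sigma>E"

lemma pre_stability_E: "pre_stability T.VQ \<sigma>E"
  using induced unfolding induced_pre_stability_def graded_quotient_eq by blast

lemma charge_hom: "fst \<sigma>E \<in> hom (K0 T.VQ) additive_group"
  using pre_stability_E unfolding pre_stability_def complex_group_eq by blast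

lemma zE_Tr: "Tr C X Y W \<Longrightarrow> X \<in> S \<Longrightarrow> Y \<in> S \<Longrightarrow> W \<in> S \<Longrightarrow> zE Y = zE X + zE W"
  using hom_mult[OF charge_hom T.qcl_in T.qcl_in, of X W] T.qcl_Tr[of X Y W] unfolding charge_def by simp

lemma zE_N:
  assumes "A \<in> N"
  shows "zE A = 0"
  unfolding charge_def T.qcl_N[OF assms]
  using hom_one[OF charge_hom comm_group.axioms(2)[OF T.VQ_K0_comm] comm_group.axioms(2)[OF additive_group_comm]]
  by simp

lemma zE_limit:
  assumes "lss F" "lim_equiv C \<sigma> F E"
  shows "((\<lambda>t. Z t F / Z t E) \<longlongrightarrow> zE F) at_top"
  using induced assms unfolding induced_pre_stability_def graded_quotient_eq by blast

lemma filtration_S: "filtration C X Gs \<Longrightarrow> set Gs \<subseteq> S \<Longrightarrow> X \<in> S \<and> zE X = (\<Sum>G\<leftarrow>Gs. zE G)"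
proof (induction Gs arbitrary: X rule: rev_induct)
  case Nil
  then show ?case
    using T.S_zero zE_N[OF T.N_zero] by (simp add: filtration_Nil)
next
  case (snoc G Gs)
  then obtain X' where X': "filtration C X' Gs" "Tr C X' X G"
    by (auto simp: filtration_snoc)
  have IH: "X' \<in> S" "zE X' = (\<Sum>G\<leftarrow>Gs. zE G)"
    using snoc.IH[OF X'(1)] snoc.prems(2) by auto
  have G: "G \<in> S"
    using snoc.prems(2) by simp
  then show ?case
    using T.S_Tr[OF X'(2) IH(1) G] zE_Tr[OF X'(2) IH(1) _ G] IH(2) by simp
qed

text \<open>Factors with unbounded phase difference are set to 0 because the quotient of charges
  need not converge for them. This is consistent: among factors below E they belong to
  \<open>N\<close>, where the induced charge vanishes, and \<open>numerical_relation\<close> removes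
  them from relations.\<close>

definition ratio :: "'b \<Rightarrow> real \<Rightarrow> complex" where
  "ratio A t = (if bounded_phase A E then Z t A / Z t E else 0)"

lemma ratio_limit:
  assumes A: "lss A" and AE: "lim_preceq C \<sigma> A E"
  shows "(ratio A \<longlongrightarrow> zE A) at_top"
proof (cases "lim_prec C \<sigma> A E")
  case True
  then have "A \<in> N"
    unfolding objs_prec_def by (rule owf_lss[OF A])
  then have z: "zE A = 0"
    by (rule zE_N)
  show ?thesis
  proof (cases "bounded_phase A E")
    case False
    then have "ratio A = (\<lambda>t. 0)"
      by (simp add: ratio_def fun_eq_iff)
    then show ?thesis
      using z by simp
  next
    case b: True
    have "\<not> filterlim (\<lambda>t. ph t E - ph t A) at_top at_top"
      using bounded_phase_not_prec_i[OF bounded_phase_sym[OF b]] unfolding prec_i_def .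
    then have r: "filterlim (mass_ratio E A) at_top at_top"
      using True lim_prec_iff[OF E A] by blast
    \<comment> \<open>The factor 2 comes from |Z E| being at least half the mass of E, while |Z A|
      is at most the mass of A.\<close>
    have "((\<lambda>t. 2 * exp (- mass_ratio E A t)) \<longlongrightarrow> 2 * 0) at_top"
      by (intro tendsto_mult tendsto_const filterlim_compose[OF exp_at_bot]
          filterlim_uminus_at_bot[THEN iffD2]) (use r in simp)
    then have lim: "((\<lambda>t. 2 * exp (- mass_ratio E A t)) \<longlongrightarrow> 0) at_top"
      by simp
    have "(ratio A \<longlongrightarrow> 0) at_top"
    proof (rule Lim_null_comparison[OF _ lim])
      show "eventually (\<lambda>t. norm (ratio A t) \<le> 2 * exp (- mass_ratio E A t)) at_top"
        using lss_charge(1)[OF E] ev_ge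
      proof eventually_elim
        case (elim t)
        have pos: "0 < ms t E" "0 < ms t A"
          using ph_bounds(3)[OF elim(2)] lssD(1,2) E A by blast+
        have "cmod (Z t A) \<le> ms t A"
          using ph_bounds(4)[OF elim(2) lssD(1,2)[OF A]] .
        then have "cmod (Z t A) / cmod (Z t E) \<le> ms t A / (ms t E / 2)"
          using elim(1) pos by (intro frac_le) auto
        also have "\<dots> = 2 * (ms t A / ms t E)"
          by simp
        also have "ms t A / ms t E = exp (- mass_ratio E A t)"
          using pos unfolding mass_ratio_def by (simp add: exp_minus)
        finally show ?case
          using b by (simp add: ratio_def norm_divide)
      qed
    qed
    then show ?thesis
      using z by simp
  qed
next
  case False
  then have eq: "lim_equiv C \<sigma> A E"
    using AE unfolding lim_equiv_def lim_preceq_def by blast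
  have "bounded_phase A E"
    using phase_trichotomy[OF A E] False AE lim_prec_iff[OF A E] lim_prec_iff[OF E A]
    unfolding lim_preceq_def bounded_phase_def by blast
  then have "ratio A = (\<lambda>t. Z t A / Z t E)"
    by (simp add: ratio_def fun_eq_iff)
  then show ?thesis
    using zE_limit[OF A eq] by simp
qed

lemma S_factors:
  assumes "X \<in> S"
  obtains Gs where "filtration C X Gs" "\<And>A. A \<in> set Gs \<Longrightarrow> lss A" "\<And>A. A \<in> set Gs \<Longrightarrow> lim_preceq C \<sigma> A E"
    "zE X = (\<Sum>G\<leftarrow>Gs. zE G)"
proof -
  obtain Gs where Gs: "limit_hn_filtration C \<sigma> X Gs" "\<And>A. A \<in> set Gs \<Longrightarrow> lim_preceq C \<sigma> A E" "\<And>A. A \<in> set Gs \<Longrightarrow> lss A"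
    using owf_factors[OF assms[unfolded objs_preceq_def]] by metis
  have "A \<in> S" if "A \<in> set Gs" for A
    unfolding objs_preceq_def by (rule owf_lss) (use Gs(2,3)[OF that] in auto)
  then have "zE X = (\<Sum>G\<leftarrow>Gs. zE G)"
    using filtration_S[OF limit_hn_tower(1)[OF Gs(1)]] by blast
  from that[OF limit_hn_tower(1)[OF Gs(1)] Gs(3,2) this] show ?thesis .
qed

lemma charge_vanishes:
  assumes X: "X \<in> S" and Y: "Y \<in> N" and k: "k > 0" and rel: "cls X [^]\<^bsub>\<Lambda>\<^esub> (k :: nat) = cls Y"
  shows "zE X = 0"
proof -
  obtain Gs where Gs: "filtration C X Gs" "\<And>A. A \<in> set Gs \<Longrightarrow> lss A" "\<And>A. A \<in> set Gs \<Longrightarrow> lim_preceq C \<sigma> A E"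
    "zE X = (\<Sum>G\<leftarrow>Gs. zE G)"
    by (rule S_factors[OF X]) (rule that)
  have YS: "Y \<in> S"
    using Y T.N_S by blast
  obtain Hs where Hs: "filtration C Y Hs" "\<And>A. A \<in> set Hs \<Longrightarrow> lss A" "\<And>A. A \<in> set Hs \<Longrightarrow> lim_preceq C \<sigma> A E"
    "zE Y = (\<Sum>G\<leftarrow>Hs. zE G)"
    by (rule S_factors[OF YS]) (rule that)
  define A where "A = set Gs \<union> set Hs"
  have A: "finite A" "\<And>B. B \<in> A \<Longrightarrow> lss B" "\<And>B. B \<in> A \<Longrightarrow> lim_preceq C \<sigma> B E" "A \<subseteq> obj C"
    using Gs(2,3) Hs(2,3) lssD(1) by (auto simp: A_def)
  \<comment> \<open>Multiplicity of B in k times X minus its multiplicity in Y, so that the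
    hypothesis on classes becomes one relation among limit semistable objects.\<close>
  define c where "c B = int k * int (count_list Gs B) - int (count_list Hs B)" for B
  have cl: "cls B \<in> carrier \<Lambda>" if "B \<in> A" for B
    using cls_in A(4) that by blast
  have "finprod \<Lambda> (\<lambda>B. cls B [^]\<^bsub>\<Lambda>\<^esub> c B) A =
    finprod \<Lambda> (\<lambda>B. (cls B [^]\<^bsub>\<Lambda>\<^esub> int (count_list Gs B)) [^]\<^bsub>\<Lambda>\<^esub> int k \<otimes>\<^bsub>\<Lambda>\<^esub>
      (cls B [^]\<^bsub>\<Lambda>\<^esub> int (count_list Hs B)) [^]\<^bsub>\<Lambda>\<^esub> (- 1 :: int)) A"
  proof (rule L.finprod_cong'[OF refl])
    fix B assume B: "B \<in> A"
    have "cls B [^]\<^bsub>\<Lambda>\<^esub> c B = cls B [^]\<^bsub>\<Lambda>\<^esub> (int (count_list Gs B) * int k + int (count_list Hs B) * - 1)"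
      by (simp add: c_def mult.commute)
    also have "\<dots> = (cls B [^]\<^bsub>\<Lambda>\<^esub> int (count_list Gs B)) [^]\<^bsub>\<Lambda>\<^esub> int k \<otimes>\<^bsub>\<Lambda>\<^esub>
      (cls B [^]\<^bsub>\<Lambda>\<^esub> int (count_list Hs B)) [^]\<^bsub>\<Lambda>\<^esub> (- 1 :: int)"
      using cl[OF B] by (simp only: L.int_pow_mult L.int_pow_pow)
    finally show "cls B [^]\<^bsub>\<Lambda>\<^esub> c B = (cls B [^]\<^bsub>\<Lambda>\<^esub> int (count_list Gs B)) [^]\<^bsub>\<Lambda>\<^esub> int k \<otimes>\<^bsub>\<Lambda>\<^esub>
      (cls B [^]\<^bsub>\<Lambda>\<^esub> int (count_list Hs B)) [^]\<^bsub>\<Lambda>\<^esub> (- 1 :: int)" .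
  qed (use cl in auto)
  also have "\<dots> = finprod \<Lambda> (\<lambda>B. (cls B [^]\<^bsub>\<Lambda>\<^esub> int (count_list Gs B)) [^]\<^bsub>\<Lambda>\<^esub> int k) A \<otimes>\<^bsub>\<Lambda>\<^esub>
      finprod \<Lambda> (\<lambda>B. (cls B [^]\<^bsub>\<Lambda>\<^esub> int (count_list Hs B)) [^]\<^bsub>\<Lambda>\<^esub> (- 1 :: int)) A"
    using cl by (intro L.finprod_multf) auto
  also have "\<dots> = cls X [^]\<^bsub>\<Lambda>\<^esub> int k \<otimes>\<^bsub>\<Lambda>\<^esub> cls Y [^]\<^bsub>\<Lambda>\<^esub> (- 1 :: int)"
  proof -
    have p: "finprod \<Lambda> (\<lambda>B. g B [^]\<^bsub>\<Lambda>\<^esub> j) A = finprod \<Lambda> g A [^]\<^bsub>\<Lambda>\<^esub> j" if "g \<in> A \<rightarrow> carrier \<Lambda>" for g and j :: int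
    proof -
      have "(\<lambda>x. x [^]\<^bsub>\<Lambda>\<^esub> j) \<in> hom \<Lambda> \<Lambda>"
        by (rule homI) (simp_all add: L.int_pow_distrib)
      from hom_finprod[OF L.comm_group_axioms L.comm_group_axioms this that] show ?thesis
        by simp
    qed
    have "set Gs \<subseteq> A" "set Hs \<subseteq> A"
      by (auto simp: A_def)
    then show ?thesis
      using cls_filtration[OF A(1,4) Gs(1)] cls_filtration[OF A(1,4) Hs(1)] cl by (subst (1 2) p) auto
  qed
  also have "\<dots> = \<one>\<^bsub>\<Lambda>\<^esub>"
    using rel cls_in X Y T.S_obj T.N_S by (auto simp: L.int_pow_neg int_pow_int subset_iff)
  finally have rel0: "finprod \<Lambda> (\<lambda>B. cls B [^]\<^bsub>\<Lambda>\<^esub> c B) A = \<one>\<^bsub>\<Lambda>\<^esub>" .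
  have rel': "finprod \<Lambda> (\<lambda>B. cls B [^]\<^bsub>\<Lambda>\<^esub> c B) {B \<in> A. bounded_phase B E} = \<one>\<^bsub>\<Lambda>\<^esub>"
    using numerical_relation[OF A(1) _ rel0, of E] A(2) by blast
  \<comment> \<open>The restricted relation gives a vanishing sum of charges before division, so
    this holds for every t from \<open>a\<close> on, even where Z t E = 0.\<close>
  have zero: "(\<Sum>B\<in>A. of_int (c B) * ratio B t) = 0" if t: "a \<le> t" for t
  proof -
    obtain z where z: "z \<in> hom \<Lambda> (additive_group :: complex monoid)" "\<And>X. X \<in> obj C \<Longrightarrow> Z t X = z (cls X)"
      by (rule charge_factors[OF t]) (rule that)
    let ?A = "{B \<in> A. bounded_phase B E}"
    have fc: "(\<lambda>B. cls B [^]\<^bsub>\<Lambda>\<^esub> c B) \<in> ?A \<rightarrow> carrier \<Lambda>"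
      using cl by auto
    have zc: "z (cls B [^]\<^bsub>\<Lambda>\<^esub> c B) = of_int (c B) * Z t B" if "B \<in> A" for B
    proof -
      interpret z: group_hom \<Lambda> "additive_group :: complex monoid" z
        using z(1) L.is_group comm_group.axioms(2)[OF additive_group_comm]
        by (simp add: group_hom_def group_hom_axioms_def)
      have "B \<in> obj C"
        using A(4) that by blast
      then show ?thesis
        using z.hom_int_pow[OF cl[OF that]] z(2) int_pow_additive_group by metis
    qed
    have "0 = z \<one>\<^bsub>\<Lambda>\<^esub>"
      using hom_one[OF z(1) L.is_group comm_group.axioms(2)[OF additive_group_comm]] by simp
    also have "\<dots> = (\<Sum>B\<in>?A. z (cls B [^]\<^bsub>\<Lambda>\<^esub> c B))"
      unfolding rel'[symmetric] using hom_finprod[OF L.comm_group_axioms additive_group_comm z(1) fc]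
      by (simp add: finprod_additive_group)
    also have "\<dots> = (\<Sum>B\<in>?A. of_int (c B) * Z t B)"
      using zc by (intro sum.cong) auto
    finally have "(\<Sum>B\<in>?A. of_int (c B) * Z t B) = 0"
      by simp
    moreover have "(\<Sum>B\<in>A. of_int (c B) * ratio B t) = (\<Sum>B\<in>?A. of_int (c B) * Z t B) / Z t E"
    proof -
      have "(\<Sum>B\<in>A. of_int (c B) * ratio B t) = (\<Sum>B\<in>?A. of_int (c B) * ratio B t)"
        using A(1) by (intro sum.mono_neutral_right) (auto simp: ratio_def)
      also have "\<dots> = (\<Sum>B\<in>?A. of_int (c B) * Z t B / Z t E)"
        by (intro sum.cong) (auto simp: ratio_def)
      finally show ?thesis
        by (simp add: sum_divide_distrib)
    qed
    ultimately show ?thesis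
      by simp
  qed
  have "((\<lambda>t. \<Sum>B\<in>A. of_int (c B) * ratio B t) \<longlongrightarrow> (\<Sum>B\<in>A. of_int (c B) * zE B)) at_top"
    using ratio_limit A(2,3) by (intro tendsto_sum tendsto_mult tendsto_const) auto
  moreover have "((\<lambda>t. \<Sum>B\<in>A. of_int (c B) * ratio B t) \<longlongrightarrow> 0) at_top"
    by (rule tendsto_eventually) (use ev_ge in \<open>eventually_elim\<close>, rule zero)
  ultimately have "(\<Sum>B\<in>A. of_int (c B) * zE B) = 0"
    using tendsto_unique trivial_limit_at_top_linorder by blast
  moreover have "(\<Sum>B\<in>A. of_int (c B) * zE B) =
      of_nat k * (\<Sum>B\<in>A. of_int (int (count_list Gs B)) * zE B) - (\<Sum>B\<in>A. of_int (int (count_list Hs B)) * zE B)"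
    by (simp add: c_def sum_subtractf sum_distrib_left algebra_simps)
  moreover have "set Gs \<subseteq> A" "set Hs \<subseteq> A"
    by (auto simp: A_def)
  ultimately have "of_nat k * zE X - zE Y = 0"
    using sum_count_list[OF A(1)] Gs(4) Hs(4) by simp
  then show ?thesis
    using zE_N[OF Y] k by simp
qed

end

section \<open>The lattice of a graded piece\<close>

text \<open>Shifts realise inverses and cones of null arrows realise products, so for a triangulated
  subcategory the generated subgroup consists of classes of objects.\<close>

lemma (in numerical_path) class_subgroup_elem:
  assumes T: "T \<subseteq> obj C" "\<And>X. zero_obj C X \<Longrightarrow> X \<in> T" "\<And>X. X \<in> T \<Longrightarrow> sho C X \<in> T"
    "\<And>X Y W. Tr C X Y W \<Longrightarrow> X \<in> T \<Longrightarrow> W \<in> T \<Longrightarrow> Y \<in> T"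
    and x: "x \<in> class_subgroup C \<Lambda> v T"
  shows "\<exists>X \<in> T. x = cls X"
  using x unfolding class_subgroup_def
proof (induction rule: generate.induct)
  case one
  obtain K where "zero_obj C K"
    using ex_zero_obj by blast
  then show ?case
    using T(2) cls_zero by force
next
  case (incl h)
  then show ?case
    by blast
next
  case (inv h)
  then obtain X where X: "X \<in> T" "h = cls X"
    by blast
  then have "X \<in> obj C"
    using T(1) by blast
  then show ?case
    using cls_sho T(3)[OF X(1)] X(2) by force
next
  case (eng h1 h2)
  then obtain X Y where XY: "X \<in> T" "h1 = cls X" "Y \<in> T" "h2 = cls Y"
    by blast
  have o: "X \<in> obj C" "Y \<in> obj C" "sho C Y \<in> obj C"
    using XY T(1) sho_in by blast+
  \<comment> \<open>\<open>Tr_zero_map\<close> always shifts one summand; shifting Y twice restores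
    its class, so \<open>G\<close> represents the product.\<close>
  obtain G where G: "Tr C X G (sho C (sho C Y))"
    using Tr_zero_map[OF o(3,1)] .
  have "cls (sho C (sho C Y)) = cls Y"
    unfolding cls_sho[OF o(3)] cls_sho[OF o(2)] using cls_in[OF o(2)] by simp
  then have "cls G = h1 \<otimes>\<^bsub>\<Lambda>\<^esub> h2"
    using cls_Tr[OF G] XY by simp
  moreover have "G \<in> T"
    using T(4)[OF G XY(1) T(3)[OF T(3)[OF XY(3)]]] .
  ultimately show ?case
    by force
qed

context graded_piece
begin

abbreviation "SL \<equiv> class_subgroup C \<Lambda> v S"
abbreviation "NL \<equiv> class_subgroup C \<Lambda> v N"

lemma N_obj: "N \<subseteq> obj C"
  using T.N_S T.S_obj by (rule subset_trans)

sublocale Q: torsion_free_quotient \<Lambda> SL NL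
proof (rule torsion_free_quotient.intro[OF L.comm_group_axioms torsion_free_quotient_axioms.intro])
  show "subgroup SL \<Lambda>" "subgroup NL \<Lambda>"
    using class_subgroup_subgroup T.S_obj N_obj by blast+
  show "NL \<subseteq> SL"
    unfolding class_subgroup_def by (rule L.mono_generate) (use T.N_S in blast)
qed

lemma SL_elem: "x \<in> SL \<Longrightarrow> \<exists>X \<in> S. x = cls X"
  by (rule class_subgroup_elem) (use T.S_obj T.S_zero T.S_sho T.S_Tr in blast)+

lemma NL_elem: "x \<in> NL \<Longrightarrow> \<exists>X \<in> N. x = cls X"
  by (rule class_subgroup_elem) (use N_obj T.N_zero T.N_sho T.N_Tr in blast)+

abbreviation "LE \<equiv> graded_lattice C \<Lambda> v \<sigma> E"
abbreviation "gcl \<equiv> graded_lattice_class C \<Lambda> v \<sigma> E"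
abbreviation "wE \<equiv> graded_lattice_map C \<Lambda> v \<sigma> E"

lemma LE_eq: "LE = torsion_free_part (Q.GM Mod NL)"
  by (simp add: graded_lattice_def graded_class_group_def)

lemma gcl_eq: "gcl X = Q.cl (cls X)"
  by (simp add: graded_lattice_class_def graded_class_group_def Q.cl_def)

lemma LE_comm: "comm_group LE"
  unfolding LE_eq by (rule Q.GM(4))

lemma gcl_in: "X \<in> S \<Longrightarrow> gcl X \<in> carrier LE"
  unfolding gcl_eq LE_eq by (rule Q.cl_closed[OF class_subgroup_incl])

lemma gcl_Tr: "Tr C X Y W \<Longrightarrow> X \<in> S \<Longrightarrow> Y \<in> S \<Longrightarrow> W \<in> S \<Longrightarrow> gcl Y = gcl X \<otimes>\<^bsub>LE\<^esub> gcl W"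
  unfolding gcl_eq LE_eq using Q.cl_mult[OF class_subgroup_incl class_subgroup_incl] cls_Tr[of X Y W] by simp

lemma gcl_eq_one: "X \<in> S \<Longrightarrow> gcl X = \<one>\<^bsub>LE\<^esub> \<longleftrightarrow> (\<exists>n::nat. n > 0 \<and> cls X [^]\<^bsub>\<Lambda>\<^esub> n \<in> NL)"
  unfolding gcl_eq LE_eq by (rule Q.cl_eq_one[OF class_subgroup_incl])

lemma gcl_N:
  assumes "A \<in> N"
  shows "gcl A = \<one>\<^bsub>LE\<^esub>"
proof -
  have A: "A \<in> S" "A \<in> obj C"
    using assms T.N_S N_obj by blast+
  have "cls A [^]\<^bsub>\<Lambda>\<^esub> (1 :: nat) \<in> NL"
    using class_subgroup_incl[OF assms] cls_in[OF A(2)] by simp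
  then show ?thesis
    unfolding gcl_eq_one[OF A(1)] by (intro exI[of _ 1]) simp
qed

text \<open>Shows that the definite description is met: existence by the universal property of the
  Grothendieck group, uniqueness because every class comes from an object.\<close>

lemma graded_map:
  "wE \<in> hom (K0 T.VQ) LE" "X \<in> S \<Longrightarrow> wE (T.qcl X) = gcl X"
proof -
  obtain k where k: "k \<in> hom (K0 T.VQ) LE" "\<And>X. X \<in> S \<Longrightarrow> k (T.qcl X) = gcl X"
    by (rule T.VQ_K0_universal[of LE gcl, OF LE_comm gcl_in gcl_Tr gcl_N]) (assumption+, rule that)
  let ?k = "restrict k (carrier (K0 T.VQ))"
  interpret K: comm_group "K0 T.VQ"
    by (rule T.VQ_K0_comm)
  have 1: "?k \<in> hom (K0 T.VQ) LE"
    using k(1) by (auto simp: hom_def)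
  have 2: "?k (T.qcl X) = gcl X" if "X \<in> S" for X
    using k(2)[OF that] T.qcl_in[OF that] by simp
  have "wE = ?k"
    unfolding graded_lattice_map_def graded_quotient_eq
  proof (rule the_equality)
    show "?k \<in> hom (K0 T.VQ) LE \<inter> extensional (carrier (K0 T.VQ)) \<and> (\<forall>X \<in> obj T.VQ. ?k (T.qcl X) = gcl X)"
      using 1 2 unfolding T.VQ_simps(1) by blast
    fix w assume w: "w \<in> hom (K0 T.VQ) LE \<inter> extensional (carrier (K0 T.VQ)) \<and> (\<forall>X \<in> obj T.VQ. w (T.qcl X) = gcl X)"
    show "w = ?k"
    proof (rule extensionalityI[of _ "carrier (K0 T.VQ)"])
      fix x assume "x \<in> carrier (K0 T.VQ)"
      then obtain X where "X \<in> S" "x = T.qcl X"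
        by (rule T.qcl_surj)
      then show "w x = ?k x"
        using w 2 unfolding T.VQ_simps(1) by simp
    qed (use w in auto)
  qed
  then show "wE \<in> hom (K0 T.VQ) LE" "X \<in> S \<Longrightarrow> wE (T.qcl X) = gcl X"
    using 1 2 by simp_all
qed

text \<open>The sum \<open>G\<close> of X and Y[1] represents the difference. Its class in the
  lattice is trivial, so a multiple is the class of an object of \<open>N\<close>, and
  \<open>charge_vanishes\<close> applies.\<close>

lemma zE_factors:
  assumes "X \<in> S" "Y \<in> S" "gcl X = gcl Y"
  shows "zE X = zE Y"
proof -
  interpret H: comm_group LE
    by (rule LE_comm)
  have o: "X \<in> obj C" "Y \<in> obj C" and sY: "sho C Y \<in> S"
    using assms T.S_obj T.S_sho by blast+
  obtain G where G: "Tr C X G (sho C Y)"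
    using Tr_zero_map[OF o(2,1)] .
  have GS: "G \<in> S"
    using T.S_Tr[OF G assms(1) sY] .
  obtain K where K: "zero_obj C K"
    using ex_zero_obj by blast
  have T0: "Tr C Y K (sho C Y)"
    using Tr_rot[OF Tr_idt[OF o(2) K]] .
  have "gcl G = gcl K"
    using gcl_Tr[OF G assms(1) GS sY] gcl_Tr[OF T0 assms(2) T.S_zero[OF K] sY] assms(3) by simp
  then have "gcl G = \<one>\<^bsub>LE\<^esub>"
    using gcl_N[OF T.N_zero[OF K]] by simp
  then obtain n :: nat where n: "n > 0" "cls G [^]\<^bsub>\<Lambda>\<^esub> n \<in> NL"
    using gcl_eq_one[OF GS] by blast
  then obtain A where "A \<in> N" "cls G [^]\<^bsub>\<Lambda>\<^esub> n = cls A"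
    using NL_elem by blast
  then have "zE G = 0"
    using charge_vanishes[OF GS _ n(1)] by blast
  moreover have "zE G = zE X + zE (sho C Y)"
    using zE_Tr[OF G assms(1) GS sY] .
  moreover have "zE K = zE Y + zE (sho C Y)" "zE K = 0"
    using zE_Tr[OF T0 assms(2) T.S_zero[OF K] sY] zE_N[OF T.N_zero[OF K]] by auto
  ultimately show ?thesis
    by (metis add_right_cancel)
qed

lemma charge_factors_through: "factors_through (K0 T.VQ) LE wE (fst \<sigma>E)"
  unfolding factors_through_def
proof (intro conjI)
  show "wE \<in> hom (K0 T.VQ) LE"
    by (rule graded_map(1))
  \<comment> \<open>The factored charge is evaluated on an arbitrary object representing U;
    \<open>zE_factors\<close> makes the choice immaterial.\<close>
  define z where "z U = zE (SOME X. X \<in> S \<and> gcl X = U)" for U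
  have z: "z (gcl X) = zE X" if X: "X \<in> S" for X
  proof -
    have "(SOME Y. Y \<in> S \<and> gcl Y = gcl X) \<in> S \<and> gcl (SOME Y. Y \<in> S \<and> gcl Y = gcl X) = gcl X"
      using X by (intro someI[of "\<lambda>Y. Y \<in> S \<and> gcl Y = gcl X" X]) simp
    then show ?thesis
      unfolding z_def using zE_factors X by blast
  qed
  have surj: "\<exists>X \<in> S. U = gcl X" if U: "U \<in> carrier LE" for U
  proof -
    obtain x where "x \<in> SL" "U = Q.cl x"
      using Q.cl_surj[OF U[unfolded LE_eq]] .
    then show ?thesis
      using SL_elem gcl_eq by metis
  qed
  have "z \<in> hom LE complex_group"
    unfolding complex_group_eq
  proof (rule homI)
    fix U W assume "U \<in> carrier LE" "W \<in> carrier LE"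
    then obtain X Y where XY: "X \<in> S" "U = gcl X" "Y \<in> S" "W = gcl Y"
      using surj by metis
    have o: "X \<in> obj C" "sho C Y \<in> obj C" "sho C (sho C Y) \<in> S"
      using XY T.S_obj T.S_sho sho_in by blast+
    obtain G where G: "Tr C X G (sho C (sho C Y))"
      using Tr_zero_map[OF o(2,1)] .
    have GS: "G \<in> S"
      using T.S_Tr[OF G XY(1) o(3)] .
    have "cls (sho C (sho C Y)) = cls Y"
      using cls_sho[OF o(2)] cls_sho[of Y] cls_in[of Y] XY(3) T.S_obj by auto
    then have e: "gcl (sho C (sho C Y)) = gcl Y"
      by (simp add: gcl_eq)
    then have "zE (sho C (sho C Y)) = zE Y"
      using zE_factors[OF o(3) XY(3)] by blast
    then have "zE G = zE X + zE Y"
      using zE_Tr[OF G XY(1) GS o(3)] by simp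
    moreover have "gcl G = U \<otimes>\<^bsub>LE\<^esub> W"
      using gcl_Tr[OF G XY(1) GS o(3)] e XY by simp
    ultimately show "z (U \<otimes>\<^bsub>LE\<^esub> W) = z U \<otimes>\<^bsub>additive_group\<^esub> z W"
      using z[OF GS] z[OF XY(1)] z[OF XY(3)] XY by simp
  qed simp
  moreover have "fst \<sigma>E x = z (wE x)" if x: "x \<in> carrier (K0 T.VQ)" for x
  proof -
    obtain X where X: "X \<in> S" "x = T.qcl X"
      using T.qcl_surj[OF x] .
    then show ?thesis
      using z[OF X(1)] graded_map(2)[OF X(1)] by (simp add: charge_def)
  qed
  ultimately show "\<exists>Z' \<in> hom LE complex_group. \<forall>x \<in> carrier (K0 T.VQ). fst \<sigma>E x = Z' (wE x)"
    by blast
qed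

lemma lim_equiv_S:
  assumes "lss F" "lim_equiv C \<sigma> F E"
  shows "F \<in> S"
  unfolding objs_preceq_def
  by (rule owf_lss) (use assms in \<open>auto simp: lim_equiv_def\<close>)

lemma semistable_iff:
  assumes "X \<in> S" "\<not> zero_obj T.VQ X"
  shows "X \<in> snd \<sigma>E \<phi> \<longleftrightarrow> (\<exists>F. lss F \<and> lim_equiv C \<sigma> F E \<and>
    ((\<lambda>t. ph t F - ph t E) \<longlongrightarrow> \<phi>) at_top \<and> isomorphic T.VQ X F)"
  using induced assms unfolding induced_pre_stability_def graded_quotient_eq T.VQ_simps(1) by blast

lemma semistable_S: "X \<in> snd \<sigma>E \<phi> \<Longrightarrow> X \<in> S"
proof -
  assume X: "X \<in> snd \<sigma>E \<phi>"
  have "slicing T.VQ (snd \<sigma>E)"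
    using pre_stability_E unfolding pre_stability_def by (elim conjE)
  then have "full_additive_subcategory T.VQ (snd \<sigma>E \<phi>)"
    unfolding slicing_def by (elim conjE) (erule spec)
  then have "snd \<sigma>E \<phi> \<subseteq> obj T.VQ"
    unfolding full_additive_subcategory_def by (elim conjE)
  then show "X \<in> S"
    using X T.VQ_simps(1) by blast
qed

lemma cmod_limit:
  assumes "lss F" "lim_equiv C \<sigma> F E"
  shows "((\<lambda>t. cmod (Z t F) / cmod (Z t E)) \<longlongrightarrow> cmod (zE F)) at_top"
  using tendsto_norm[OF zE_limit[OF assms]] by (simp add: norm_divide)

text \<open>Equivalence excludes both divergent cases of \<open>mass_trichotomy\<close>, leaving
  convergence. The limit is the phase with which the image of F becomes semistable.\<close>

lemma lim_equiv_phase_limit: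
  assumes F: "lss F" "lim_equiv C \<sigma> F E"
  shows "\<exists>\<phi>. ((\<lambda>t. ph t F - ph t E) \<longlongrightarrow> \<phi>) at_top"
proof -
  have n: "\<not> lim_prec C \<sigma> F E" "\<not> lim_prec C \<sigma> E F"
    using F(2) unfolding lim_equiv_def lim_preceq_def by blast+
  have b: "bounded_phase F E"
    using phase_trichotomy[OF F(1) E] n lim_prec_iff[OF F(1) E] lim_prec_iff[OF E F(1)]
    unfolding bounded_phase_def by blast
  then show ?thesis
    using mass_trichotomy[OF F(1) E b] n lim_prec_iff[OF F(1) E] lim_prec_iff[OF E F(1)] bounded_phase_sym
    by blast
qed

text \<open>Norm and constant stay the same in both directions: the limit of the quotients of moduli
  is the modulus of the induced charge, and isomorphic objects of the quotient have the same
  class.\<close>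

lemma support_iff:
  assumes N: "norm_on_realification LE N'" and c: "c > 0"
  shows "(\<forall>\<phi>. \<forall>X \<in> snd \<sigma>E \<phi>. \<not> zero_obj T.VQ X \<longrightarrow>
      cmod (zE X) \<ge> c * N' (pure_tensor LE (wE (T.qcl X)) 1)) \<longleftrightarrow>
    (\<forall>F. lss F \<and> lim_equiv C \<sigma> F E \<longrightarrow>
      (\<exists>l. ((\<lambda>t. cmod (Z t F) / cmod (Z t E)) \<longlongrightarrow> l) at_top \<and> l \<ge> c * N' (pure_tensor LE (gcl F) 1)))"
    (is "?A \<longleftrightarrow> ?B")
proof
  assume A: ?A
  show ?B
  proof (intro allI impI)
    fix F assume "lss F \<and> lim_equiv C \<sigma> F E"
    then have F: "lss F" "lim_equiv C \<sigma> F E"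
      by auto
    have FS: "F \<in> S"
      using lim_equiv_S[OF F] .
    have "cmod (zE F) \<ge> c * N' (pure_tensor LE (gcl F) 1)"
    \<comment> \<open>The description of semistable objects covers only nonzero images. A zero image
      puts F into \<open>N\<close>, and then both sides of the inequality are 0.\<close>
    proof (cases "zero_obj T.VQ F")
      case True
      then have "F \<in> N"
        by (rule T.VQ_zero_obj)
      moreover have "N' \<one>\<^bsub>tensor LE\<^esub> = 0"
      proof -
        interpret Te: comm_group "tensor LE :: ('d set set \<times> real \<Rightarrow>\<^sub>0 int) set monoid"
          by (rule tensor_comm_group[OF LE_comm])
        show ?thesis
          using N Te.one_closed unfolding norm_on_realification_def by blast
      qed
      ultimately show ?thesis
        using gcl_N zE_N pure_tensor_one[OF LE_comm, of "1 :: real"] by simp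
    next
      case False
      obtain \<phi> where "((\<lambda>t. ph t F - ph t E) \<longlongrightarrow> \<phi>) at_top"
        using lim_equiv_phase_limit[OF F] by blast
      then have "F \<in> snd \<sigma>E \<phi>"
        using semistable_iff[OF FS False] F T.VQ_isomorphic_refl[OF FS] by blast
      then show ?thesis
        using A False graded_map(2)[OF FS] by metis
    qed
    then show "\<exists>l. ((\<lambda>t. cmod (Z t F) / cmod (Z t E)) \<longlongrightarrow> l) at_top \<and> l \<ge> c * N' (pure_tensor LE (gcl F) 1)"
      using cmod_limit[OF F] by blast
  qed
next
  assume B: ?B
  show ?A
  proof (intro allI ballI impI)
    fix \<phi> X assume X: "X \<in> snd \<sigma>E \<phi>" "\<not> zero_obj T.VQ X"
    have XS: "X \<in> S"
      using semistable_S[OF X(1)] .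
    obtain F where F: "lss F" "lim_equiv C \<sigma> F E" "isomorphic T.VQ X F"
      using semistable_iff[OF XS X(2)] X(1) by blast
    have FS: "F \<in> S"
      using lim_equiv_S[OF F(1,2)] .
    have q: "T.qcl X = T.qcl F"
      using T.qcl_isomorphic[OF F(3) XS FS] .
    obtain l where l: "((\<lambda>t. cmod (Z t F) / cmod (Z t E)) \<longlongrightarrow> l) at_top" "l \<ge> c * N' (pure_tensor LE (gcl F) 1)"
      using B F by blast
    have "l = cmod (zE F)"
      using tendsto_unique[OF trivial_limit_at_top_linorder l(1) cmod_limit[OF F(1,2)]] .
    then show "cmod (zE X) \<ge> c * N' (pure_tensor LE (wE (T.qcl X)) 1)"
      using l(2) q graded_map(2)[OF FS] by (simp add: charge_def)
  qed
qed

lemma support_property_iff: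
  "support_property T.VQ LE wE \<sigma>E \<longleftrightarrow> (\<exists>N'. norm_on_realification LE N' \<and>
    (\<exists>\<epsilon>>0. \<forall>F. lss F \<and> lim_equiv C \<sigma> F E \<longrightarrow>
      (\<exists>l. ((\<lambda>t. cmod (Z t F) / cmod (Z t E)) \<longlongrightarrow> l) at_top \<and> l \<ge> \<epsilon> * N' (pure_tensor LE (gcl F) 1))))"
  unfolding support_property_def using support_iff by meson

end

theorem theorem2:
  fixes C :: "('k::field, 'o, 'm) tcat"
    and \<Lambda> :: "'l monoid"
    and v :: "('o \<Rightarrow>\<^sub>0 int) set \<Rightarrow> 'l"
    and a :: real
    and \<sigma> :: "real \<Rightarrow> 'o charge_slicing"
    and \<sigma>E :: "'o \<Rightarrow> 'o charge_slicing"
  assumes "triangulated_category C"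
    and "free_of_finite_rank \<Lambda>"
    and "v \<in> epi (K0 C) \<Lambda>"
    and "quasi_convergent C \<Lambda> v a \<sigma>"
    and "numerical C \<Lambda> v \<sigma>"
    and "\<And>E. limit_semistable C \<sigma> E \<Longrightarrow> induced_pre_stability C \<sigma> E (\<sigma>E E)"
  shows "(\<forall>E. limit_semistable C \<sigma> E \<longrightarrow>
            factors_through (K0 (graded_quotient C \<sigma> E)) (graded_lattice C \<Lambda> v \<sigma> E)
              (graded_lattice_map C \<Lambda> v \<sigma> E) (fst (\<sigma>E E))) \<and>
         (path_support_property C \<Lambda> v \<sigma> \<longleftrightarrow>
            (\<forall>E. limit_semistable C \<sigma> E \<longrightarrow>
               support_property (graded_quotient C \<sigma> E) (graded_lattice C \<Lambda> v \<sigma> E)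
                 (graded_lattice_map C \<Lambda> v \<sigma> E) (\<sigma>E E)))"
proof -
  have g: "graded_piece C \<Lambda> v a \<sigma> E (\<sigma>E E)" if "limit_semistable C \<sigma> E" for E
    using assms that
    by (simp add: graded_piece_def graded_piece_axioms_def numerical_path_def numerical_path_axioms_def
        quasi_convergent_path_def quasi_convergent_path_axioms_def)
  have "factors_through (K0 (graded_quotient C \<sigma> E)) (graded_lattice C \<Lambda> v \<sigma> E)
      (graded_lattice_map C \<Lambda> v \<sigma> E) (fst (\<sigma>E E))" if "limit_semistable C \<sigma> E" for E
    using graded_piece.charge_factors_through[OF g[OF that]]
    unfolding graded_piece.graded_quotient_eq[OF g[OF that]] .
  moreover have "support_property (graded_quotient C \<sigma> E) (graded_lattice C \<Lambda> v \<sigma> E)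
      (graded_lattice_map C \<Lambda> v \<sigma> E) (\<sigma>E E) \<longleftrightarrow>
    (\<exists>N. norm_on_realification (graded_lattice C \<Lambda> v \<sigma> E) N \<and>
         (\<exists>\<epsilon>>0. \<forall>F. limit_semistable C \<sigma> F \<and> lim_equiv C \<sigma> F E \<longrightarrow>
           (\<exists>l. ((\<lambda>t. cmod (charge C (\<sigma> t) F) / cmod (charge C (\<sigma> t) E)) \<longlongrightarrow> l) at_top \<and>
              l \<ge> \<epsilon> * N (pure_tensor (graded_lattice C \<Lambda> v \<sigma> E)
                          (graded_lattice_class C \<Lambda> v \<sigma> E F) 1))))" if "limit_semistable C \<sigma> E" for E
    using graded_piece.support_property_iff[OF g[OF that]]
    unfolding graded_piece.graded_quotient_eq[OF g[OF that]] .
  ultimately show ?thesis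
    unfolding path_support_property_def by simp
qed

end
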